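(* Let $\pi:E\to W$ be a proper dominant map between normal $F$-finite integral schemes of characteristic $p>0$ with $\pi_*\mathcal O_E=\mathcal O_W$. Let $\Delta_E$ be a $\mathbb Q$-divisor on $E$ such that $\mathcal O_E((1-p^e)(K_E+\Delta_E))\cong\pi^*\mathcal L_W$ for some $e>0$ and some line bundle $\mathcal L_W$ on $W$. Suppose that $\phi_E:F^e_*\mathcal O_E((1-p^e)(K_E+\Delta_E))\to K(E)$ is a map corresponding to $\Delta_E$ that satisfies: (i) $\phi_E\big(F^e_*\pi^{-1}\mathcal L_W\big)\subseteq\pi^{-1}(K(W))\subseteq K(E)$; (ii) the map $\phi_W:F^e_*\mathcal L_W\to K(W)$ induced via $\pi_*$ is nonzero. Then there exists a canonically determined $\mathbb Q$-divisor $\Delta_W$ on $W$, namely the divisor corresponding to $\phi_W$, such that $$K_E+\Delta_E\sim_{\mathbb Q}\pi^*(K_W+\Delta_W).$$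
   Context: Schemes are separated and excellent. $\pi^{-1}$ denotes inverse image of sheaves of abelian groups, $\pi^{-1}\mathcal L_W\subseteq\pi^*\mathcal L_W\cong\mathcal O_E((1-p^e)(K_E+\Delta_E))$. Maps and divisors: let $Y$ be normal integral $F$-finite of characteristic $p$, $\mathcal L$ a line bundle, $K(Y)$ the function field (constant sheaf). A nonzero $\phi:F^e_*\mathcal L\to\mathcal O_Y$ corresponds, via $\mathcal Hom(F^e_*\mathcal L,\mathcal O_Y)\cong F^e_*(\mathcal L^{-1}\otimes\mathcal O_Y((1-p^e)K_Y))$, to an effective Weil divisor $D_\phi$; put $\Delta_\phi=\frac1{p^e-1}D_\phi$, so $\mathcal O_Y((1-p^e)(K_Y+\Delta_\phi))\cong\mathcal L$. For a nonzero $\phi:F^e_*\mathcal L\to K(Y)$ choose (locally) an effective Cartier divisor $G_0$ with $\phi(F^e_*\mathcal L((1-p^e)G_0))\subseteq\mathcal O_Y$, let $\Delta'$ be the divisor of the restricted map, and set $\Delta_\phi=\Delta'-G_0$. Conversely a $\mathbb Q$-divisor $\Delta$ with $(p^e-1)(K_Y+\Delta)$ Cartier determines, uniquely up to units of $\Gamma(Y,\mathcal O_Y)$, a map $F^e_*\mathcal O_Y((1-p^e)(K_Y+\Delta))\to K(Y)$ with divisor $\Delta$ (a "map corresponding to $\Delta$"). *)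

theory Defs
  imports "HOL-Algebra.Module" "HOL-Algebra.Ring_Divisibility" "HOL-Algebra.Generated_Rings"
    "HOL-Algebra.Ideal_Product" "HOL-Algebra.IntRing" "HOL-Analysis.Abstract_Topology"
begin

section \<open>Commutative algebra\<close>

definition spectrum :: "'r ring \<Rightarrow> 'r set set" where
  "spectrum R = {P. primeideal P R}"

definition spectrum_topology :: "'r ring \<Rightarrow> 'r set topology" where
  "spectrum_topology R =
     topology (\<lambda>S. \<exists>I \<subseteq> carrier R. S = {P \<in> spectrum R. \<not> I \<subseteq> P})"

text \<open>The fraction \<open>a/b\<close> in the localization of \<open>R\<close> at the prime \<open>P\<close>, as an equivalence class.\<close>

definition fraction :: "'r ring \<Rightarrow> 'r set \<Rightarrow> 'r \<Rightarrow> 'r \<Rightarrow> ('r \<times> 'r) set" where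
  "fraction R P a b = {(c, d). c \<in> carrier R \<and> d \<in> carrier R - P \<and>
     (\<exists>u \<in> carrier R - P. u \<otimes>\<^bsub>R\<^esub> (a \<otimes>\<^bsub>R\<^esub> d) = u \<otimes>\<^bsub>R\<^esub> (c \<otimes>\<^bsub>R\<^esub> b))}"

definition localization :: "'r ring \<Rightarrow> 'r set \<Rightarrow> ('r \<times> 'r) set ring" where
  "localization R P =
     \<lparr>carrier = {fraction R P a b | a b. a \<in> carrier R \<and> b \<in> carrier R - P},
      monoid.mult = (\<lambda>x y. \<Union>(a, b)\<in>x. \<Union>(c, d)\<in>y. fraction R P (a \<otimes>\<^bsub>R\<^esub> c) (b \<otimes>\<^bsub>R\<^esub> d)),
      monoid.one = fraction R P \<one>\<^bsub>R\<^esub> \<one>\<^bsub>R\<^esub>,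
      ring.zero = fraction R P \<zero>\<^bsub>R\<^esub> \<one>\<^bsub>R\<^esub>,
      ring.add = (\<lambda>x y. \<Union>(a, b)\<in>x. \<Union>(c, d)\<in>y.
               fraction R P (a \<otimes>\<^bsub>R\<^esub> d \<oplus>\<^bsub>R\<^esub> c \<otimes>\<^bsub>R\<^esub> b) (b \<otimes>\<^bsub>R\<^esub> d))\<rparr>"

definition prime_chain :: "'r ring \<Rightarrow> 'r set list \<Rightarrow> bool" where
  "prime_chain R Ps \<longleftrightarrow> Ps \<noteq> [] \<and> set Ps \<subseteq> spectrum R \<and> sorted_wrt (\<subset>) Ps"

definition has_krull_dim :: "'r ring \<Rightarrow> nat \<Rightarrow> bool" where
  "has_krull_dim R n \<longleftrightarrow>
     (\<exists>Ps. prime_chain R Ps \<and> length Ps = Suc n) \<and>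
     (\<forall>Ps. prime_chain R Ps \<longrightarrow> length Ps \<le> Suc n)"

definition local_ring :: "'r ring \<Rightarrow> bool" where
  "local_ring R \<longleftrightarrow> cring R \<and> (\<exists>!m. maximalideal m R)"

definition regular_local_ring :: "'r ring \<Rightarrow> bool" where
  "regular_local_ring R \<longleftrightarrow> local_ring R \<and> noetherian_ring R \<and>
     (\<exists>S \<subseteq> carrier R. finite S \<and> maximalideal (Idl\<^bsub>R\<^esub> S) R \<and> has_krull_dim R (card S))"

text \<open>A domain is integrally closed if every fraction \<open>a/b\<close> that is a root of a monic polynomial
  over \<open>R\<close> lies in \<open>R\<close>; the equation is written with denominators cleared.\<close>

definition integrally_closed_domain :: "'r ring \<Rightarrow> bool" where
  "integrally_closed_domain R \<longleftrightarrow> domain R \<and>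
     (\<forall>a \<in> carrier R. \<forall>b \<in> carrier R - {\<zero>\<^bsub>R\<^esub>}. \<forall>n::nat. \<forall>c \<in> {..<n} \<rightarrow> carrier R.
        a [^]\<^bsub>R\<^esub> n \<oplus>\<^bsub>R\<^esub> (\<Oplus>\<^bsub>R\<^esub>i\<in>{..<n}. c i \<otimes>\<^bsub>R\<^esub> (a [^]\<^bsub>R\<^esub> i \<otimes>\<^bsub>R\<^esub> b [^]\<^bsub>R\<^esub> (n - i))) = \<zero>\<^bsub>R\<^esub>
        \<longrightarrow> (\<exists>d \<in> carrier R. a = d \<otimes>\<^bsub>R\<^esub> b))"

definition fin_gen_algebra :: "'a ring \<Rightarrow> ('a \<Rightarrow> 'b) \<Rightarrow> 'b ring \<Rightarrow> bool" where
  "fin_gen_algebra A h B \<longleftrightarrow> h \<in> ring_hom A B \<and>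
     (\<exists>S \<subseteq> carrier B. finite S \<and> generate_ring B (h ` carrier A \<union> S) = carrier B)"

subsection \<open>Tensor products\<close>

definition restrict_scalars :: "('r \<Rightarrow> 'a) \<Rightarrow> 'a ring \<Rightarrow> ('r, 'a) module" where
  "restrict_scalars h A =
     \<lparr>carrier = carrier A, monoid.mult = monoid.mult A, monoid.one = monoid.one A, ring.zero = ring.zero A, ring.add = ring.add A,
      smult = (\<lambda>r a. h r \<otimes>\<^bsub>A\<^esub> a)\<rparr>"

definition point_mass :: "'z \<Rightarrow> 'z \<Rightarrow> int" where
  "point_mass z = (\<lambda>w. if w = z then 1 else 0)"

text \<open>\<open>M \<otimes>\<^sub>R N\<close> is the free abelian group on \<open>M \<times> N\<close> (finitely supported integer valued functions)
  modulo the subgroup \<open>tensor_relations R M N\<close>.\<close>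

definition free_tensors :: "('r, 'm) module \<Rightarrow> ('r, 'n) module \<Rightarrow> ('m \<times> 'n \<Rightarrow> int) set" where
  "free_tensors M N = {f. finite {z. f z \<noteq> 0} \<and> {z. f z \<noteq> 0} \<subseteq> carrier M \<times> carrier N}"

inductive_set tensor_relations ::
    "'r ring \<Rightarrow> ('r, 'm) module \<Rightarrow> ('r, 'n) module \<Rightarrow> ('m \<times> 'n \<Rightarrow> int) set"
  for R M N where
  zero: "(\<lambda>_. 0) \<in> tensor_relations R M N"
| diff: "\<lbrakk>f \<in> tensor_relations R M N; g \<in> tensor_relations R M N\<rbrakk>
         \<Longrightarrow> (\<lambda>z. f z - g z) \<in> tensor_relations R M N"
| add_left: "\<lbrakk>m \<in> carrier M; m' \<in> carrier M; n \<in> carrier N\<rbrakk> \<Longrightarrow>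
    (\<lambda>z. point_mass (m \<oplus>\<^bsub>M\<^esub> m', n) z - point_mass (m, n) z - point_mass (m', n) z)
      \<in> tensor_relations R M N"
| add_right: "\<lbrakk>m \<in> carrier M; n \<in> carrier N; n' \<in> carrier N\<rbrakk> \<Longrightarrow>
    (\<lambda>z. point_mass (m, n \<oplus>\<^bsub>N\<^esub> n') z - point_mass (m, n) z - point_mass (m, n') z)
      \<in> tensor_relations R M N"
| balanced: "\<lbrakk>r \<in> carrier R; m \<in> carrier M; n \<in> carrier N\<rbrakk> \<Longrightarrow>
    (\<lambda>z. point_mass (r \<odot>\<^bsub>M\<^esub> m, n) z - point_mass (m, r \<odot>\<^bsub>N\<^esub> n) z)
      \<in> tensor_relations R M N"

definition tensor_eval ::
    "('c, 'k) ring_scheme \<Rightarrow> ('m \<Rightarrow> 'n \<Rightarrow> 'c) \<Rightarrow> ('m \<times> 'n \<Rightarrow> int) \<Rightarrow> 'c" where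
  "tensor_eval C \<beta> f = (\<Oplus>\<^bsub>C\<^esub>z\<in>{z. f z \<noteq> 0}. [f z] \<cdot>\<^bsub>C\<^esub> \<beta> (fst z) (snd z))"

text \<open>The map \<open>M \<otimes>\<^sub>R N \<rightarrow> C\<close> induced by \<open>\<beta>\<close> is well defined and an isomorphism.\<close>

definition is_tensor_product ::
    "'r ring \<Rightarrow> ('r, 'm) module \<Rightarrow> ('r, 'n) module \<Rightarrow> ('c, 'k) ring_scheme
      \<Rightarrow> ('m \<Rightarrow> 'n \<Rightarrow> 'c) \<Rightarrow> bool" where
  "is_tensor_product R M N C \<beta> \<longleftrightarrow>
     (\<forall>m \<in> carrier M. \<forall>n \<in> carrier N. \<beta> m n \<in> carrier C) \<and>
     tensor_eval C \<beta> ` free_tensors M N = carrier C \<and>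
     (\<forall>f \<in> free_tensors M N. tensor_eval C \<beta> f = \<zero>\<^bsub>C\<^esub> \<longleftrightarrow> f \<in> tensor_relations R M N)"

subsection \<open>Excellent rings\<close>

text \<open>Some notions below quantify over all algebras over a ring or, later, over all schemes over a
  base. As HOL cannot quantify over types inside a formula, these quantifiers range over the rings
  (schemes) whose elements (points and sections) have the types given by an argument of type
  \<open>itself\<close>. For sufficiently large types the usual notion results; for other types it is a
  consequence of the usual notion. So a theorem that assumes such a notion and is polymorphic in
  these types covers the usual one.\<close>

primrec ideal_power :: "'r ring \<Rightarrow> 'r set \<Rightarrow> nat \<Rightarrow> 'r set" where
  "ideal_power R I 0 = carrier R"
| "ideal_power R I (Suc n) = ideal_prod R I (ideal_power R I n)"

text \<open>The inverse limit of the rings \<open>R / I^n\<close>; a class modulo \<open>I^(n+1)\<close> maps to one modulo \<open>I^n\<close>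
  iff the former coset is contained in the latter.\<close>

definition completion :: "'r ring \<Rightarrow> 'r set \<Rightarrow> (nat \<Rightarrow> 'r set) ring" where
  "completion R I = (let Q = (\<lambda>n. R Quot ideal_power R I n) in
     \<lparr>carrier = {x. \<forall>n. x n \<in> carrier (Q n) \<and> x (Suc n) \<subseteq> x n},
      monoid.mult = (\<lambda>x y n. x n \<otimes>\<^bsub>Q n\<^esub> y n),
      monoid.one = (\<lambda>n. \<one>\<^bsub>Q n\<^esub>),
      ring.zero = (\<lambda>n. \<zero>\<^bsub>Q n\<^esub>),
      ring.add = (\<lambda>x y n. x n \<oplus>\<^bsub>Q n\<^esub> y n)\<rparr>)"

definition to_completion :: "'r ring \<Rightarrow> 'r set \<Rightarrow> 'r \<Rightarrow> nat \<Rightarrow> 'r set" where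
  "to_completion R I a = (\<lambda>n. ideal_power R I n +>\<^bsub>R\<^esub> a)"

text \<open>\<open>L\<close> is a finite field extension of the residue field of \<open>B\<close> at the prime \<open>q\<close>, with structure
  map \<open>h : B \<rightarrow> L\<close>.\<close>

definition finite_residue_extension :: "'b ring \<Rightarrow> 'b set \<Rightarrow> ('b \<Rightarrow> 'l) \<Rightarrow> 'l ring \<Rightarrow> bool" where
  "finite_residue_extension B q h L \<longleftrightarrow> field L \<and> h \<in> ring_hom B L \<and> a_kernel B L h = q \<and>
     (\<exists>S \<subseteq> carrier L. finite S \<and> (\<forall>l \<in> carrier L. \<exists>d \<in> carrier B - q. \<exists>c \<in> S \<rightarrow> carrier B.
        h d \<otimes>\<^bsub>L\<^esub> l = (\<Oplus>\<^bsub>L\<^esub>s\<in>S. h (c s) \<otimes>\<^bsub>L\<^esub> s)))"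

text \<open>The completion of a noetherian local ring is always flat, so a noetherian ring is a G-ring iff
  the formal fibres of its local rings are geometrically regular.\<close>

definition G_ring :: "'t itself \<Rightarrow> 'r ring \<Rightarrow> bool" where
  "G_ring _ A \<longleftrightarrow> (\<forall>P \<in> spectrum A. let B = localization A P; m = (THE m. maximalideal m B) in
     \<forall>q \<in> spectrum B. \<forall>(L::'t ring) h. finite_residue_extension B q h L \<longrightarrow>
       (\<forall>(T::'t ring) j k. cring T \<and> j \<in> ring_hom (completion B m) T \<and> k \<in> ring_hom L T \<and>
          is_tensor_product B (restrict_scalars (to_completion B m) (completion B m))
            (restrict_scalars h L) T (\<lambda>c l. j c \<otimes>\<^bsub>T\<^esub> k l) \<longrightarrow>
          (\<forall>Q \<in> spectrum T. regular_local_ring (localization T Q))))"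

definition J2_ring :: "'t itself \<Rightarrow> 'r ring \<Rightarrow> bool" where
  "J2_ring _ A \<longleftrightarrow> (\<forall>(B::'t ring) h. cring B \<and> fin_gen_algebra A h B \<longrightarrow>
     openin (spectrum_topology B) {P \<in> spectrum B. regular_local_ring (localization B P)})"

definition catenary_ring :: "'r ring \<Rightarrow> bool" where
  "catenary_ring R \<longleftrightarrow> (\<forall>P \<in> spectrum R. \<forall>Q \<in> spectrum R. P \<subseteq> Q \<longrightarrow>
     (let C = {Ps. prime_chain R Ps \<and> hd Ps = P \<and> last Ps = Q} in
       (\<exists>n. \<forall>Ps \<in> C. length Ps \<le> n) \<and>
       (\<forall>Ps \<in> C. \<forall>Qs \<in> C.
          (\<forall>Rs \<in> C. \<not> set Ps \<subset> set Rs) \<and> (\<forall>Rs \<in> C. \<not> set Qs \<subset> set Rs)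
          \<longrightarrow> length Ps = length Qs)))"

definition universally_catenary_ring :: "'t itself \<Rightarrow> 'r ring \<Rightarrow> bool" where
  "universally_catenary_ring _ A \<longleftrightarrow>
     (\<forall>(B::'t ring) h. cring B \<and> fin_gen_algebra A h B \<longrightarrow> catenary_ring B)"

definition excellent_ring :: "'t itself \<Rightarrow> 'r ring \<Rightarrow> bool" where
  "excellent_ring T A \<longleftrightarrow> cring A \<and> noetherian_ring A \<and> G_ring T A \<and> J2_ring T A \<and>
     universally_catenary_ring T A"


section \<open>Sheaves and ringed spaces\<close>

definition is_sheaf ::
    "'p topology \<Rightarrow> ('p set \<Rightarrow> 'a set) \<Rightarrow> ('p set \<Rightarrow> 'p set \<Rightarrow> 'a \<Rightarrow> 'a) \<Rightarrow> bool" where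
  "is_sheaf T C \<rho> \<longleftrightarrow>
     (\<forall>U. openin T U \<longrightarrow> (\<forall>s \<in> C U. \<rho> U U s = s)) \<and>
     (\<forall>U V. openin T U \<and> openin T V \<and> V \<subseteq> U \<longrightarrow> \<rho> U V \<in> C U \<rightarrow> C V) \<and>
     (\<forall>U V V'. openin T U \<and> openin T V \<and> openin T V' \<and> V' \<subseteq> V \<and> V \<subseteq> U \<longrightarrow>
        (\<forall>s \<in> C U. \<rho> V V' (\<rho> U V s) = \<rho> U V' s)) \<and>
     (\<forall>\<U> s. (\<forall>U \<in> \<U>. openin T U \<and> s U \<in> C U) \<and>
        (\<forall>U \<in> \<U>. \<forall>V \<in> \<U>. \<rho> U (U \<inter> V) (s U) = \<rho> V (U \<inter> V) (s V)) \<longrightarrow>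
        (\<exists>!t. t \<in> C (\<Union>\<U>) \<and> (\<forall>U \<in> \<U>. \<rho> (\<Union>\<U>) U t = s U)))"

text \<open>Germs at \<open>x\<close> are equivalence classes of pairs (open neighbourhood, section over it).\<close>

definition germ_class ::
    "'p topology \<Rightarrow> ('p set \<Rightarrow> 'a set) \<Rightarrow> ('p set \<Rightarrow> 'p set \<Rightarrow> 'a \<Rightarrow> 'a) \<Rightarrow> 'p \<Rightarrow> 'p set \<Rightarrow> 'a
      \<Rightarrow> ('p set \<times> 'a) set" where
  "germ_class T C \<rho> x U s = {(V, t). openin T V \<and> x \<in> V \<and> t \<in> C V \<and>
     (\<exists>V'. openin T V' \<and> x \<in> V' \<and> V' \<subseteq> U \<inter> V \<and> \<rho> U V' s = \<rho> V V' t)}"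

record ('p, 'r) ringed_space =
  top_of :: "'p topology"
  sec :: "'p set \<Rightarrow> 'r ring"
  rst :: "'p set \<Rightarrow> 'p set \<Rightarrow> 'r \<Rightarrow> 'r"

abbreviation open_in :: "('p, 'r) ringed_space \<Rightarrow> 'p set \<Rightarrow> bool" where
  "open_in X \<equiv> openin (top_of X)"

abbreviation points :: "('p, 'r) ringed_space \<Rightarrow> 'p set" where
  "points X \<equiv> topspace (top_of X)"

definition ringed_space :: "('p, 'r) ringed_space \<Rightarrow> bool" where
  "ringed_space X \<longleftrightarrow>
     is_sheaf (top_of X) (\<lambda>U. carrier (sec X U)) (rst X) \<and>
     (\<forall>U. open_in X U \<longrightarrow> cring (sec X U)) \<and>
     (\<forall>U V. open_in X U \<and> open_in X V \<and> V \<subseteq> U \<longrightarrow> rst X U V \<in> ring_hom (sec X U) (sec X V))"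

definition germ :: "('p, 'r) ringed_space \<Rightarrow> 'p \<Rightarrow> 'p set \<Rightarrow> 'r \<Rightarrow> ('p set \<times> 'r) set" where
  "germ X = germ_class (top_of X) (\<lambda>U. carrier (sec X U)) (rst X)"

definition stalk :: "('p, 'r) ringed_space \<Rightarrow> 'p \<Rightarrow> ('p set \<times> 'r) set ring" where
  "stalk X x =
     \<lparr>carrier = {germ X x U s | U s. open_in X U \<and> x \<in> U \<and> s \<in> carrier (sec X U)},
      monoid.mult = (\<lambda>a b. \<Union>(U, s)\<in>a. \<Union>(V, t)\<in>b. germ X x (U \<inter> V)
                (rst X U (U \<inter> V) s \<otimes>\<^bsub>sec X (U \<inter> V)\<^esub> rst X V (U \<inter> V) t)),
      monoid.one = germ X x (points X) \<one>\<^bsub>sec X (points X)\<^esub>,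
      ring.zero = germ X x (points X) \<zero>\<^bsub>sec X (points X)\<^esub>,
      ring.add = (\<lambda>a b. \<Union>(U, s)\<in>a. \<Union>(V, t)\<in>b. germ X x (U \<inter> V)
                (rst X U (U \<inter> V) s \<oplus>\<^bsub>sec X (U \<inter> V)\<^esub> rst X V (U \<inter> V) t))\<rparr>"

definition locally_ringed_space :: "('p, 'r) ringed_space \<Rightarrow> bool" where
  "locally_ringed_space X \<longleftrightarrow> ringed_space X \<and> (\<forall>x \<in> points X. local_ring (stalk X x))"

definition open_subspace :: "('p, 'r) ringed_space \<Rightarrow> 'p set \<Rightarrow> ('p, 'r) ringed_space" where
  "open_subspace X U = X\<lparr>top_of := subtopology (top_of X) U\<rparr>"

text \<open>A morphism \<open>X \<rightarrow> Y\<close>: \<open>comor f V\<close> is the ring homomorphism from the sections over \<open>V\<close> to those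
  over the preimage of \<open>V\<close>.\<close>

record ('p, 'r, 'q, 's) morphism =
  pt :: "'p \<Rightarrow> 'q"
  comor :: "'q set \<Rightarrow> 's \<Rightarrow> 'r"

definition preim :: "('p, 'r) ringed_space \<Rightarrow> ('p, 'r, 'q, 's) morphism \<Rightarrow> 'q set \<Rightarrow> 'p set" where
  "preim X f V = {x \<in> points X. pt f x \<in> V}"

definition ringed_morphism ::
    "('p, 'r) ringed_space \<Rightarrow> ('q, 's) ringed_space \<Rightarrow> ('p, 'r, 'q, 's) morphism \<Rightarrow> bool" where
  "ringed_morphism X Y f \<longleftrightarrow>
     continuous_map (top_of X) (top_of Y) (pt f) \<and>
     (\<forall>V. open_in Y V \<longrightarrow> comor f V \<in> ring_hom (sec Y V) (sec X (preim X f V))) \<and>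
     (\<forall>V V'. open_in Y V \<and> open_in Y V' \<and> V' \<subseteq> V \<longrightarrow> (\<forall>s \<in> carrier (sec Y V).
        comor f V' (rst Y V V' s) = rst X (preim X f V) (preim X f V') (comor f V s)))"

definition stalk_map ::
    "('p, 'r) ringed_space \<Rightarrow> ('p, 'r, 'q, 's) morphism \<Rightarrow> 'p \<Rightarrow> ('q set \<times> 's) set
      \<Rightarrow> ('p set \<times> 'r) set" where
  "stalk_map X f x a = (\<Union>(V, s)\<in>a. germ X x (preim X f V) (comor f V s))"

definition scheme_morphism ::
    "('p, 'r) ringed_space \<Rightarrow> ('q, 's) ringed_space \<Rightarrow> ('p, 'r, 'q, 's) morphism \<Rightarrow> bool" where
  "scheme_morphism X Y f \<longleftrightarrow> ringed_morphism X Y f \<and>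
     (\<forall>x \<in> points X. \<forall>a \<in> carrier (stalk Y (pt f x)).
        stalk_map X f x a \<in> Units (stalk X x) \<longrightarrow> a \<in> Units (stalk Y (pt f x)))"

definition ringed_isomorphism ::
    "('p, 'r) ringed_space \<Rightarrow> ('q, 's) ringed_space \<Rightarrow> ('p, 'r, 'q, 's) morphism \<Rightarrow> bool" where
  "ringed_isomorphism X Y f \<longleftrightarrow> ringed_morphism X Y f \<and>
     homeomorphic_map (top_of X) (top_of Y) (pt f) \<and>
     (\<forall>V. open_in Y V \<longrightarrow> comor f V \<in> ring_iso (sec Y V) (sec X (preim X f V)))"


section \<open>Schemes\<close>

definition Spec :: "'r ring \<Rightarrow> ('r set, 'r set \<Rightarrow> ('r \<times> 'r) set) ringed_space" where
  "Spec R =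
     \<lparr>top_of = spectrum_topology R,
      sec = (\<lambda>U. \<lparr>
        carrier = {s \<in> (\<Pi>\<^sub>E P\<in>U. carrier (localization R P)).
          \<forall>P \<in> U. \<exists>V. openin (spectrum_topology R) V \<and> P \<in> V \<and> V \<subseteq> U \<and>
            (\<exists>a \<in> carrier R. \<exists>b \<in> carrier R. \<forall>Q \<in> V. b \<notin> Q \<and> s Q = fraction R Q a b)},
        monoid.mult = (\<lambda>s t. \<lambda>P\<in>U. s P \<otimes>\<^bsub>localization R P\<^esub> t P),
        monoid.one = (\<lambda>P\<in>U. \<one>\<^bsub>localization R P\<^esub>),
        ring.zero = (\<lambda>P\<in>U. \<zero>\<^bsub>localization R P\<^esub>),
        ring.add = (\<lambda>s t. \<lambda>P\<in>U. s P \<oplus>\<^bsub>localization R P\<^esub> t P)\<rparr>),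
      rst = (\<lambda>U V s. restrict s V)\<rparr>"

text \<open>Since an affine scheme is the spectrum of its ring of global sections, it is no restriction
  that \<open>R\<close> has the type of the sections.\<close>

definition affine_open :: "('p, 'r) ringed_space \<Rightarrow> 'p set \<Rightarrow> bool" where
  "affine_open X U \<longleftrightarrow> open_in X U \<and>
     (\<exists>(R::'r ring) f. cring R \<and> ringed_isomorphism (open_subspace X U) (Spec R) f)"

definition scheme :: "('p, 'r) ringed_space \<Rightarrow> bool" where
  "scheme X \<longleftrightarrow> locally_ringed_space X \<and> (\<forall>x \<in> points X. \<exists>U. affine_open X U \<and> x \<in> U)"

text \<open>\<open>P\<close> with projections \<open>p\<close>, \<open>q\<close> is the fibre product of \<open>f : X \<rightarrow> S\<close> and \<open>g : Y \<rightarrow> S\<close>: over affine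
  opens it is the spectrum of the tensor product.\<close>

definition fibre_product ::
    "('x, 'a) ringed_space \<Rightarrow> ('x, 'a, 's, 'c) morphism \<Rightarrow>
     ('y, 'b) ringed_space \<Rightarrow> ('y, 'b, 's, 'c) morphism \<Rightarrow> ('s, 'c) ringed_space \<Rightarrow>
     ('q, 'd) ringed_space \<Rightarrow> ('q, 'd, 'x, 'a) morphism \<Rightarrow> ('q, 'd, 'y, 'b) morphism \<Rightarrow> bool" where
  "fibre_product X f Y g S P p q \<longleftrightarrow>
     scheme P \<and> scheme_morphism P X p \<and> scheme_morphism P Y q \<and>
     (\<forall>z \<in> points P. pt f (pt p z) = pt g (pt q z)) \<and>
     (\<forall>V. open_in S V \<longrightarrow> (\<forall>s \<in> carrier (sec S V).
        comor p (preim X f V) (comor f V s) = comor q (preim Y g V) (comor g V s))) \<and>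
     (\<forall>V U U'. affine_open S V \<and> affine_open X U \<and> affine_open Y U' \<and>
        U \<subseteq> preim X f V \<and> U' \<subseteq> preim Y g V \<longrightarrow>
        (let Z = preim P p U \<inter> preim P q U' in
          affine_open P Z \<and>
          is_tensor_product (sec S V)
            (restrict_scalars (\<lambda>s. rst X (preim X f V) U (comor f V s)) (sec X U))
            (restrict_scalars (\<lambda>s. rst Y (preim Y g V) U' (comor g V s)) (sec Y U'))
            (sec P Z)
            (\<lambda>a b. rst P (preim P p U) Z (comor p U a) \<otimes>\<^bsub>sec P Z\<^esub>
                   rst P (preim P q U') Z (comor q U' b))))"

definition closed_immersion ::
    "('p, 'r) ringed_space \<Rightarrow> ('q, 's) ringed_space \<Rightarrow> ('p, 'r, 'q, 's) morphism \<Rightarrow> bool" where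
  "closed_immersion X Y f \<longleftrightarrow> scheme_morphism X Y f \<and>
     embedding_map (top_of X) (top_of Y) (pt f) \<and> closedin (top_of Y) (pt f ` points X) \<and>
     (\<forall>x \<in> points X. stalk_map X f x ` carrier (stalk Y (pt f x)) = carrier (stalk X x))"

definition separated_morphism ::
    "('q \<times> 't) itself \<Rightarrow> ('x, 'a) ringed_space \<Rightarrow> ('s, 'c) ringed_space
      \<Rightarrow> ('x, 'a, 's, 'c) morphism \<Rightarrow> bool" where
  "separated_morphism _ X S f \<longleftrightarrow>
     (\<forall>(P::('q, 't) ringed_space) p q \<delta>.
        fibre_product X f X f S P p q \<and> scheme_morphism X P \<delta> \<and>
        (\<forall>x \<in> points X. pt p (pt \<delta> x) = x \<and> pt q (pt \<delta> x) = x) \<and>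
        (\<forall>U. open_in X U \<longrightarrow> (\<forall>s \<in> carrier (sec X U).
           comor \<delta> (preim P p U) (comor p U s) = s \<and> comor \<delta> (preim P q U) (comor q U s) = s))
        \<longrightarrow> closed_immersion X P \<delta>)"

definition universally_closed_morphism ::
    "('q \<times> 't) itself \<Rightarrow> ('x, 'a) ringed_space \<Rightarrow> ('s, 'c) ringed_space
      \<Rightarrow> ('x, 'a, 's, 'c) morphism \<Rightarrow> bool" where
  "universally_closed_morphism _ X S f \<longleftrightarrow>
     (\<forall>(Y::('q, 't) ringed_space) g (P::('q, 't) ringed_space) p q.
        scheme Y \<and> scheme_morphism Y S g \<and> fibre_product X f Y g S P p q
        \<longrightarrow> closed_map (top_of P) (top_of Y) (pt q))"

definition finite_type_morphism ::
    "('x, 'a) ringed_space \<Rightarrow> ('s, 'c) ringed_space \<Rightarrow> ('x, 'a, 's, 'c) morphism \<Rightarrow> bool" where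
  "finite_type_morphism X S f \<longleftrightarrow>
     (\<forall>V. affine_open S V \<longrightarrow> (\<exists>\<U>. finite \<U> \<and> \<Union>\<U> = preim X f V \<and>
        (\<forall>U \<in> \<U>. affine_open X U \<and>
           fin_gen_algebra (sec S V) (\<lambda>s. rst X (preim X f V) U (comor f V s)) (sec X U))))"

definition proper_morphism ::
    "('q \<times> 't) itself \<Rightarrow> ('x, 'a) ringed_space \<Rightarrow> ('s, 'c) ringed_space
      \<Rightarrow> ('x, 'a, 's, 'c) morphism \<Rightarrow> bool" where
  "proper_morphism T X S f \<longleftrightarrow> scheme_morphism X S f \<and> separated_morphism T X S f \<and>
     finite_type_morphism X S f \<and> universally_closed_morphism T X S f"

definition dominant_morphism ::
    "('x, 'a) ringed_space \<Rightarrow> ('s, 'c) ringed_space \<Rightarrow> ('x, 'a, 's, 'c) morphism \<Rightarrow> bool" where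
  "dominant_morphism X S f \<longleftrightarrow> top_of S closure_of (pt f ` points X) = points S"

definition separated_scheme :: "('q \<times> 't) itself \<Rightarrow> ('x, 'a) ringed_space \<Rightarrow> bool" where
  "separated_scheme T X \<longleftrightarrow> scheme X \<and>
     (\<exists>f. scheme_morphism X (Spec \<Z>) f \<and> separated_morphism T X (Spec \<Z>) f)"

definition excellent_scheme :: "'t itself \<Rightarrow> ('x, 'a) ringed_space \<Rightarrow> bool" where
  "excellent_scheme T X \<longleftrightarrow> scheme X \<and> (\<forall>U. affine_open X U \<longrightarrow> excellent_ring T (sec X U))"

definition integral_scheme :: "('x, 'a) ringed_space \<Rightarrow> bool" where
  "integral_scheme X \<longleftrightarrow> scheme X \<and> points X \<noteq> {} \<and>
     (\<forall>U. open_in X U \<and> U \<noteq> {} \<longrightarrow> domain (sec X U))"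

definition normal_scheme :: "('x, 'a) ringed_space \<Rightarrow> bool" where
  "normal_scheme X \<longleftrightarrow> scheme X \<and> (\<forall>x \<in> points X. integrally_closed_domain (stalk X x))"

definition has_characteristic :: "nat \<Rightarrow> ('x, 'a) ringed_space \<Rightarrow> bool" where
  "has_characteristic p X \<longleftrightarrow> [p] \<cdot>\<^bsub>sec X (points X)\<^esub> \<one>\<^bsub>sec X (points X)\<^esub> = \<zero>\<^bsub>sec X (points X)\<^esub>"

definition F_finite_scheme :: "nat \<Rightarrow> ('x, 'a) ringed_space \<Rightarrow> bool" where
  "F_finite_scheme p X \<longleftrightarrow> (\<forall>U. affine_open X U \<longrightarrow> (let R = sec X U in
     \<exists>B \<subseteq> carrier R. finite B \<and> (\<forall>a \<in> carrier R. \<exists>c \<in> B \<rightarrow> carrier R.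
       a = (\<Oplus>\<^bsub>R\<^esub>b\<in>B. c b [^]\<^bsub>R\<^esub> p \<otimes>\<^bsub>R\<^esub> b))))"

definition normal_F_finite_integral ::
    "('q \<times> 't) itself \<Rightarrow> nat \<Rightarrow> ('x, 'a) ringed_space \<Rightarrow> bool" where
  "normal_F_finite_integral T p X \<longleftrightarrow>
     separated_scheme T X \<and> excellent_scheme TYPE('t) X \<and> integral_scheme X \<and> normal_scheme X \<and>
     has_characteristic p X \<and> F_finite_scheme p X"


section \<open>Sheaves of modules\<close>

record ('p, 'r, 'm) module_sheaf =
  msec :: "'p set \<Rightarrow> ('r, 'm) module"
  mrst :: "'p set \<Rightarrow> 'p set \<Rightarrow> 'm \<Rightarrow> 'm"

definition sheaf_of_modules :: "('p, 'r) ringed_space \<Rightarrow> ('p, 'r, 'm) module_sheaf \<Rightarrow> bool" where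
  "sheaf_of_modules X M \<longleftrightarrow>
     is_sheaf (top_of X) (\<lambda>U. carrier (msec M U)) (mrst M) \<and>
     (\<forall>U. open_in X U \<longrightarrow> module (sec X U) (msec M U)) \<and>
     (\<forall>U V. open_in X U \<and> open_in X V \<and> V \<subseteq> U \<longrightarrow>
        (\<forall>s \<in> carrier (msec M U). \<forall>t \<in> carrier (msec M U).
           mrst M U V (s \<oplus>\<^bsub>msec M U\<^esub> t) = mrst M U V s \<oplus>\<^bsub>msec M V\<^esub> mrst M U V t) \<and>
        (\<forall>r \<in> carrier (sec X U). \<forall>s \<in> carrier (msec M U).
           mrst M U V (r \<odot>\<^bsub>msec M U\<^esub> s) = rst X U V r \<odot>\<^bsub>msec M V\<^esub> mrst M U V s))"

text \<open>Homomorphisms \<open>M|U \<rightarrow> N|U\<close>.\<close>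

definition module_sheaf_hom ::
    "('p, 'r) ringed_space \<Rightarrow> 'p set \<Rightarrow> ('p, 'r, 'm) module_sheaf \<Rightarrow> ('p, 'r, 'n) module_sheaf
      \<Rightarrow> ('p set \<Rightarrow> 'm \<Rightarrow> 'n) \<Rightarrow> bool" where
  "module_sheaf_hom X U M N h \<longleftrightarrow>
     (\<forall>V. open_in X V \<and> V \<subseteq> U \<longrightarrow>
        h V \<in> carrier (msec M V) \<rightarrow> carrier (msec N V) \<and>
        (\<forall>s \<in> carrier (msec M V). \<forall>t \<in> carrier (msec M V).
           h V (s \<oplus>\<^bsub>msec M V\<^esub> t) = h V s \<oplus>\<^bsub>msec N V\<^esub> h V t) \<and>
        (\<forall>r \<in> carrier (sec X V). \<forall>s \<in> carrier (msec M V).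
           h V (r \<odot>\<^bsub>msec M V\<^esub> s) = r \<odot>\<^bsub>msec N V\<^esub> h V s)) \<and>
     (\<forall>V V'. open_in X V \<and> open_in X V' \<and> V \<subseteq> U \<and> V' \<subseteq> V \<longrightarrow>
        (\<forall>s \<in> carrier (msec M V). h V' (mrst M V V' s) = mrst N V V' (h V s)))"

definition module_sheaf_iso ::
    "('p, 'r) ringed_space \<Rightarrow> 'p set \<Rightarrow> ('p, 'r, 'm) module_sheaf \<Rightarrow> ('p, 'r, 'n) module_sheaf
      \<Rightarrow> bool" where
  "module_sheaf_iso X U M N \<longleftrightarrow> (\<exists>h. module_sheaf_hom X U M N h \<and>
     (\<forall>V. open_in X V \<and> V \<subseteq> U \<longrightarrow> bij_betw (h V) (carrier (msec M V)) (carrier (msec N V))))"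

definition structure_module :: "('p, 'r) ringed_space \<Rightarrow> ('p, 'r, 'r) module_sheaf" where
  "structure_module X = \<lparr>msec = (\<lambda>U. restrict_scalars id (sec X U)), mrst = rst X\<rparr>"

definition line_bundle :: "('p, 'r) ringed_space \<Rightarrow> ('p, 'r, 'm) module_sheaf \<Rightarrow> bool" where
  "line_bundle X M \<longleftrightarrow> sheaf_of_modules X M \<and>
     (\<forall>x \<in> points X. \<exists>U. open_in X U \<and> x \<in> U \<and> module_sheaf_iso X U (structure_module X) M)"

definition mgerm ::
    "('p, 'r) ringed_space \<Rightarrow> ('p, 'r, 'm) module_sheaf \<Rightarrow> 'p \<Rightarrow> 'p set \<Rightarrow> 'm
      \<Rightarrow> ('p set \<times> 'm) set" where
  "mgerm X M = germ_class (top_of X) (\<lambda>U. carrier (msec M U)) (mrst M)"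

text \<open>Modules are records extending rings; their fields \<open>mult\<close> and \<open>one\<close> carry no meaning.\<close>

definition mstalk ::
    "('p, 'r) ringed_space \<Rightarrow> ('p, 'r, 'm) module_sheaf \<Rightarrow> 'p
      \<Rightarrow> (('p set \<times> 'r) set, ('p set \<times> 'm) set) module" where
  "mstalk X M x =
     \<lparr>carrier = {mgerm X M x U s | U s. open_in X U \<and> x \<in> U \<and> s \<in> carrier (msec M U)},
      monoid.mult = undefined,
      monoid.one = undefined,
      ring.zero = mgerm X M x (points X) \<zero>\<^bsub>msec M (points X)\<^esub>,
      ring.add = (\<lambda>a b. \<Union>(U, s)\<in>a. \<Union>(V, t)\<in>b. mgerm X M x (U \<inter> V)
               (mrst M U (U \<inter> V) s \<oplus>\<^bsub>msec M (U \<inter> V)\<^esub> mrst M V (U \<inter> V) t)),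
      smult = (\<lambda>a b. \<Union>(U, r)\<in>a. \<Union>(V, s)\<in>b. mgerm X M x (U \<inter> V)
               (rst X U (U \<inter> V) r \<odot>\<^bsub>msec M (U \<inter> V)\<^esub> mrst M V (U \<inter> V) s))\<rparr>"

text \<open>The sheaf \<open>F\<^sup>e\<^sub>* M\<close>: the absolute Frobenius is the identity on points.\<close>

definition frobenius_push ::
    "('p, 'r) ringed_space \<Rightarrow> nat \<Rightarrow> nat \<Rightarrow> ('p, 'r, 'm) module_sheaf
      \<Rightarrow> ('p, 'r, 'm) module_sheaf" where
  "frobenius_push X p e M =
     M\<lparr>msec := (\<lambda>U. (msec M U)
         \<lparr>smult := (\<lambda>r s. (r [^]\<^bsub>sec X U\<^esub> (p ^ e)) \<odot>\<^bsub>msec M U\<^esub> s)\<rparr>)\<rparr>"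

definition direct_image ::
    "('x, 'a) ringed_space \<Rightarrow> ('x, 'a, 's, 'c) morphism \<Rightarrow> ('x, 'a, 'm) module_sheaf
      \<Rightarrow> ('s, 'c, 'm) module_sheaf" where
  "direct_image X f M =
     \<lparr>msec = (\<lambda>V. let MV = msec M (preim X f V) in
        \<lparr>carrier = carrier MV, monoid.mult = monoid.mult MV, monoid.one = monoid.one MV, ring.zero = ring.zero MV, ring.add = ring.add MV,
         smult = (\<lambda>r s. comor f V r \<odot>\<^bsub>MV\<^esub> s)\<rparr>),
      mrst = (\<lambda>V V'. mrst M (preim X f V) (preim X f V'))\<rparr>"

text \<open>The homomorphism \<open>u : L \<rightarrow> f\<^sub>* M\<close> is adjoint to an isomorphism \<open>f\<^sup>* L \<cong> M\<close>. The stalk of \<open>f\<^sup>* L\<close>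
  at \<open>x\<close> is the tensor product of the stalk of \<open>L\<close> at \<open>f x\<close> with the local ring of \<open>X\<close> at \<open>x\<close>.\<close>

definition pullback_iso ::
    "('x, 'a) ringed_space \<Rightarrow> ('s, 'c) ringed_space \<Rightarrow> ('x, 'a, 's, 'c) morphism \<Rightarrow>
     ('s, 'c, 'l) module_sheaf \<Rightarrow> ('x, 'a, 'm) module_sheaf \<Rightarrow> ('s set \<Rightarrow> 'l \<Rightarrow> 'm) \<Rightarrow> bool" where
  "pullback_iso X S f L M u \<longleftrightarrow>
     module_sheaf_hom S (points S) L (direct_image X f M) u \<and>
     (\<forall>x \<in> points X.
        is_tensor_product (stalk S (pt f x)) (mstalk S L (pt f x))
          (restrict_scalars (stalk_map X f x) (stalk X x)) (mstalk X M x)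
          (\<lambda>l a. a \<odot>\<^bsub>mstalk X M x\<^esub> (\<Union>(V, s)\<in>l. mgerm X M x (preim X f V) (u V s))))"

text \<open>Sections over \<open>U\<close> of the inverse image (as a sheaf of abelian groups) of \<open>L\<close>, as a subsheaf of
  \<open>M \<cong> f\<^sup>* L\<close>: the sections that locally come from sections of \<open>L\<close>.\<close>

definition inverse_image_sections ::
    "('x, 'a) ringed_space \<Rightarrow> ('s, 'c) ringed_space \<Rightarrow> ('x, 'a, 's, 'c) morphism \<Rightarrow>
     ('s, 'c, 'l) module_sheaf \<Rightarrow> ('x, 'a, 'm) module_sheaf \<Rightarrow> ('s set \<Rightarrow> 'l \<Rightarrow> 'm) \<Rightarrow>
     'x set \<Rightarrow> 'm set" where
  "inverse_image_sections X S f L M u U =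
     {t \<in> carrier (msec M U). \<forall>x \<in> U. \<exists>V l U'. open_in S V \<and> l \<in> carrier (msec L V) \<and>
        open_in X U' \<and> x \<in> U' \<and> U' \<subseteq> U \<inter> preim X f V \<and>
        mrst M U U' t = mrst M (preim X f V) U' (u V l)}"


section \<open>Function field and divisors\<close>

text \<open>From here on \<open>X\<close> is a normal, locally noetherian integral scheme.\<close>

definition generic_point :: "('p, 'r) ringed_space \<Rightarrow> 'p" where
  "generic_point X = (THE \<eta>. \<eta> \<in> points X \<and> top_of X closure_of {\<eta>} = points X)"

abbreviation fun_field :: "('p, 'r) ringed_space \<Rightarrow> ('p set \<times> 'r) set ring" where
  "fun_field X \<equiv> stalk X (generic_point X)"

abbreviation to_fun_field :: "('p, 'r) ringed_space \<Rightarrow> 'p set \<Rightarrow> 'r \<Rightarrow> ('p set \<times> 'r) set" where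
  "to_fun_field X \<equiv> germ X (generic_point X)"

definition stalk_to_fun_field ::
    "('p, 'r) ringed_space \<Rightarrow> ('p set \<times> 'r) set \<Rightarrow> ('p set \<times> 'r) set" where
  "stalk_to_fun_field X a = (\<Union>(U, s)\<in>a. to_fun_field X U s)"

definition fun_field_pullback ::
    "('x, 'a) ringed_space \<Rightarrow> ('x, 'a, 's, 'c) morphism \<Rightarrow> ('s set \<times> 'c) set
      \<Rightarrow> ('x set \<times> 'a) set" where
  "fun_field_pullback X f = stalk_map X f (generic_point X)"

definition codim_one :: "('p, 'r) ringed_space \<Rightarrow> 'p \<Rightarrow> bool" where
  "codim_one X y \<longleftrightarrow> y \<in> points X \<and> has_krull_dim (stalk X y) 1"

definition uniformizer :: "'r ring \<Rightarrow> 'r \<Rightarrow> bool" where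
  "uniformizer A t \<longleftrightarrow> t \<in> carrier A \<and> maximalideal (PIdl\<^bsub>A\<^esub> t) A"

text \<open>The valuation of the nonzero rational function \<open>f\<close> at the codimension one point \<open>y\<close>, whose local
  ring is a discrete valuation ring.\<close>

definition order_at :: "('p, 'r) ringed_space \<Rightarrow> 'p \<Rightarrow> ('p set \<times> 'r) set \<Rightarrow> int" where
  "order_at X y f = (THE n. \<exists>t v. uniformizer (stalk X y) t \<and> v \<in> Units (stalk X y) \<and>
     f = stalk_to_fun_field X v \<otimes>\<^bsub>fun_field X\<^esub> (stalk_to_fun_field X t [^]\<^bsub>fun_field X\<^esub> n))"

text \<open>A \<open>\<rat>\<close>-divisor is given by its coefficients at the codimension one points (the generic points of
  the prime divisors).\<close>

definition Q_divisor :: "('p, 'r) ringed_space \<Rightarrow> ('p \<Rightarrow> rat) \<Rightarrow> bool" where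
  "Q_divisor X D \<longleftrightarrow> (\<forall>y. D y \<noteq> 0 \<longrightarrow> codim_one X y) \<and>
     (\<forall>x \<in> points X. \<exists>U. open_in X U \<and> x \<in> U \<and> finite {y \<in> U. D y \<noteq> 0})"

definition Weil_divisor :: "('p, 'r) ringed_space \<Rightarrow> ('p \<Rightarrow> rat) \<Rightarrow> bool" where
  "Weil_divisor X D \<longleftrightarrow> Q_divisor X D \<and> (\<forall>y. D y \<in> \<int>)"

definition principal_divisor :: "('p, 'r) ringed_space \<Rightarrow> ('p set \<times> 'r) set \<Rightarrow> 'p \<Rightarrow> rat" where
  "principal_divisor X f y = (if codim_one X y then of_int (order_at X y f) else 0)"

definition nonzero_rational :: "('p, 'r) ringed_space \<Rightarrow> ('p set \<times> 'r) set set" where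
  "nonzero_rational X = carrier (fun_field X) - {\<zero>\<^bsub>fun_field X\<^esub>}"

definition Q_linearly_equivalent ::
    "('p, 'r) ringed_space \<Rightarrow> ('p \<Rightarrow> rat) \<Rightarrow> ('p \<Rightarrow> rat) \<Rightarrow> bool" where
  "Q_linearly_equivalent X D D' \<longleftrightarrow>
     (\<exists>n::nat. n > 0 \<and> Weil_divisor X (\<lambda>y. of_nat n * D y) \<and> Weil_divisor X (\<lambda>y. of_nat n * D' y) \<and>
        (\<exists>f \<in> nonzero_rational X. \<forall>y. of_nat n * D y - of_nat n * D' y = principal_divisor X f y))"

text \<open>\<open>D\<close> is \<open>\<rat>\<close>-Cartier and \<open>D'\<close> is its pullback under the dominant morphism \<open>f\<close>: a multiple \<open>n D\<close> is
  given by local equations, and their pullbacks are local equations of \<open>n D'\<close>.\<close>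

definition Q_Cartier_pullback ::
    "('x, 'a) ringed_space \<Rightarrow> ('s, 'c) ringed_space \<Rightarrow> ('x, 'a, 's, 'c) morphism \<Rightarrow>
     ('s \<Rightarrow> rat) \<Rightarrow> ('x \<Rightarrow> rat) \<Rightarrow> bool" where
  "Q_Cartier_pullback X S f D D' \<longleftrightarrow> Q_divisor S D \<and> Q_divisor X D' \<and>
     (\<exists>n::nat. n > 0 \<and> (\<forall>w \<in> points S. \<exists>U. open_in S U \<and> w \<in> U \<and>
        (\<exists>g \<in> nonzero_rational S.
           (\<forall>y \<in> U. of_nat n * D y = principal_divisor S g y) \<and>
           (\<forall>x \<in> preim X f U.
              of_nat n * D' x = principal_divisor X (fun_field_pullback X f g) x))))"

text \<open>The subsheaf of the constant sheaf \<open>K(X)\<close> with sections \<open>S U\<close> over nonempty \<open>U\<close>. (On an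
  irreducible space the constant sheaf has value \<open>K(X)\<close> on every nonempty open set.)\<close>

definition fun_field_subsheaf ::
    "('p, 'r) ringed_space \<Rightarrow> ('p set \<Rightarrow> ('p set \<times> 'r) set set)
      \<Rightarrow> ('p, 'r, ('p set \<times> 'r) set) module_sheaf" where
  "fun_field_subsheaf X S = (let K = fun_field X in
     \<lparr>msec = (\<lambda>U.
        \<lparr>carrier = (if U = {} then {\<zero>\<^bsub>K\<^esub>} else S U),
         monoid.mult = undefined, monoid.one = undefined, ring.zero = \<zero>\<^bsub>K\<^esub>, ring.add = ring.add K,
         smult = (\<lambda>r f. if U = {} then \<zero>\<^bsub>K\<^esub> else to_fun_field X U r \<otimes>\<^bsub>K\<^esub> f)\<rparr>),
      mrst = (\<lambda>U V f. if V = {} then \<zero>\<^bsub>K\<^esub> else f)\<rparr>)"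

definition constant_sheaf ::
    "('p, 'r) ringed_space \<Rightarrow> ('p, 'r, ('p set \<times> 'r) set) module_sheaf" where
  "constant_sheaf X = fun_field_subsheaf X (\<lambda>_. carrier (fun_field X))"

text \<open>The sheaf \<open>O\<^sub>X(D)\<close>; for a divisor with non-integral coefficients this is \<open>O\<^sub>X\<close> of its round-down.\<close>

definition divisor_sheaf ::
    "('p, 'r) ringed_space \<Rightarrow> ('p \<Rightarrow> rat) \<Rightarrow> ('p, 'r, ('p set \<times> 'r) set) module_sheaf" where
  "divisor_sheaf X D = fun_field_subsheaf X (\<lambda>U. {f \<in> carrier (fun_field X).
     f = \<zero>\<^bsub>fun_field X\<^esub> \<or> (\<forall>y \<in> U. codim_one X y \<longrightarrow> of_int (order_at X y f) + D y \<ge> 0)})"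


section \<open>Frobenius duality and divisors of maps\<close>

text \<open>The sheaf \<open>Hom(F\<^sup>e\<^sub>* O\<^sub>X, O\<^sub>X)\<close> with \<open>O\<^sub>X\<close> acting on the source by ordinary multiplication
  \<open>(r h)(s) = h (r s)\<close>, i.e. with its structure of \<open>F\<^sup>e\<^sub>* O\<^sub>X\<close>-module. A section over \<open>U\<close> is a family of
  maps on the open subsets of \<open>U\<close>, normalised outside its domain.\<close>

definition normalise_family ::
    "('p, 'r) ringed_space \<Rightarrow> 'p set \<Rightarrow> ('p set \<Rightarrow> 'r \<Rightarrow> 'r) \<Rightarrow> 'p set \<Rightarrow> 'r \<Rightarrow> 'r" where
  "normalise_family X U h =
     (\<lambda>V. if open_in X V \<and> V \<subseteq> U then restrict (h V) (carrier (sec X V)) else (\<lambda>_. undefined))"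

definition frobenius_dual ::
    "('p, 'r) ringed_space \<Rightarrow> nat \<Rightarrow> nat \<Rightarrow> ('p, 'r, 'p set \<Rightarrow> 'r \<Rightarrow> 'r) module_sheaf" where
  "frobenius_dual X p e =
     \<lparr>msec = (\<lambda>U.
        \<lparr>carrier = {normalise_family X U h | h.
           module_sheaf_hom X U (frobenius_push X p e (structure_module X)) (structure_module X) h},
         monoid.mult = undefined, monoid.one = undefined,
         ring.zero = normalise_family X U (\<lambda>V s. \<zero>\<^bsub>sec X V\<^esub>),
         ring.add = (\<lambda>h k. normalise_family X U (\<lambda>V s. h V s \<oplus>\<^bsub>sec X V\<^esub> k V s)),
         smult = (\<lambda>r h. normalise_family X U (\<lambda>V s. h V (rst X U V r \<otimes>\<^bsub>sec X V\<^esub> s)))\<rparr>),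
      mrst = (\<lambda>U U' h. normalise_family X U' h)\<rparr>"

text \<open>\<open>K\<close> is a canonical divisor of the normal \<open>F\<close>-finite scheme \<open>X\<close>, in the sense fixed by Frobenius
  duality: \<open>Hom(F\<^sup>e\<^sub>* O\<^sub>X, O\<^sub>X) \<cong> F\<^sup>e\<^sub>* O\<^sub>X((1 - p\<^sup>e) K)\<close> as \<open>F\<^sup>e\<^sub>* O\<^sub>X\<close>-modules for all \<open>e > 0\<close>. This is the
  normalisation \<open>\<omega>\<^sub>X \<cong> F\<^sup>! \<omega>\<^sub>X\<close> of the canonical sheaf \<open>\<omega>\<^sub>X = O\<^sub>X(K)\<close>; it determines the class of \<open>K\<close> up
  to torsion.\<close>

definition canonical_divisor :: "nat \<Rightarrow> ('p, 'r) ringed_space \<Rightarrow> ('p \<Rightarrow> rat) \<Rightarrow> bool" where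
  "canonical_divisor p X K \<longleftrightarrow> Weil_divisor X K \<and>
     (\<forall>e>0. module_sheaf_iso X (points X) (frobenius_dual X p e)
              (divisor_sheaf X (\<lambda>y. (1 - of_nat p ^ e) * K y)))"

text \<open>The map on stalks at \<open>y\<close> of a map \<open>\<phi> : F\<^sup>e\<^sub>* L \<rightarrow> K(X)\<close>.\<close>

definition map_at_stalk ::
    "('p set \<Rightarrow> 'm \<Rightarrow> ('p set \<times> 'r) set) \<Rightarrow> ('p set \<times> 'm) set \<Rightarrow> ('p set \<times> 'r) set" where
  "map_at_stalk \<phi> l = (THE k. \<exists>(V, s) \<in> l. k = \<phi> V s)"

text \<open>\<open>Hom(F\<^sup>e\<^sub>* N, O\<^sub>X\<^sub>,\<^sub>y)\<close> for an \<open>O\<^sub>X\<^sub>,\<^sub>y\<close>-submodule \<open>N\<close> of the stalk of \<open>L\<close> at \<open>y\<close>, where \<open>O\<^sub>X\<^sub>,\<^sub>y\<close> is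
  regarded as a subring of \<open>K(X)\<close>.\<close>

definition frobenius_maps ::
    "('p, 'r) ringed_space \<Rightarrow> nat \<Rightarrow> nat \<Rightarrow> ('p, 'r, 'm) module_sheaf \<Rightarrow> 'p \<Rightarrow> ('p set \<times> 'm) set set
      \<Rightarrow> (('p set \<times> 'm) set \<Rightarrow> ('p set \<times> 'r) set) set" where
  "frobenius_maps X p e L y N = {\<psi>.
     \<psi> \<in> N \<rightarrow> stalk_to_fun_field X ` carrier (stalk X y) \<and>
     (\<forall>l \<in> N. \<forall>l' \<in> N. \<psi> (l \<oplus>\<^bsub>mstalk X L y\<^esub> l') = \<psi> l \<oplus>\<^bsub>fun_field X\<^esub> \<psi> l') \<and>
     (\<forall>a \<in> carrier (stalk X y). \<forall>l \<in> N.
        \<psi> ((a [^]\<^bsub>stalk X y\<^esub> (p ^ e)) \<odot>\<^bsub>mstalk X L y\<^esub> l) = stalk_to_fun_field X a \<otimes>\<^bsub>fun_field X\<^esub> \<psi> l)}"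

text \<open>The coefficient at \<open>y\<close> of the divisor of \<open>\<phi>\<close>, as a section of \<open>Hom(F\<^sup>e\<^sub>* N, O\<^sub>X)\<close>: its order of
  vanishing, i.e. the largest \<open>n\<close> such that \<open>\<phi>\<close> lies in \<open>t\<^sup>n Hom(F\<^sup>e\<^sub>* N, O\<^sub>X\<^sub>,\<^sub>y)\<close>, where \<open>t\<close> is a
  uniformizer in the discrete valuation ring \<open>F\<^sup>e\<^sub>* O\<^sub>X\<^sub>,\<^sub>y\<close>. As isomorphisms of sheaves of modules
  preserve orders of vanishing, this is also the coefficient of the divisor of the section of
  \<open>F\<^sup>e\<^sub>*(N\<^sup>-\<^sup>1((1 - p\<^sup>e) K\<^sub>X))\<close> that corresponds to \<open>\<phi>\<close> under duality.\<close>

definition vanishing_order ::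
    "('p, 'r) ringed_space \<Rightarrow> nat \<Rightarrow> nat \<Rightarrow> ('p, 'r, 'm) module_sheaf \<Rightarrow> 'p \<Rightarrow> ('p set \<times> 'm) set set
      \<Rightarrow> (('p set \<times> 'm) set \<Rightarrow> ('p set \<times> 'r) set) \<Rightarrow> nat \<Rightarrow> bool" where
  "vanishing_order X p e L y N \<phi> n \<longleftrightarrow>
     (let divisible = (\<lambda>k::nat. \<exists>t. uniformizer (stalk X y) t \<and>
            (\<exists>\<psi> \<in> frobenius_maps X p e L y N. \<forall>l \<in> N.
               \<phi> l = \<psi> ((t [^]\<^bsub>stalk X y\<^esub> k) \<odot>\<^bsub>mstalk X L y\<^esub> l)))
      in divisible n \<and> (\<forall>k. divisible k \<longrightarrow> k \<le> n))"

text \<open>\<open>\<Delta>\<close> is the divisor of the nonzero map \<open>\<phi> : F\<^sup>e\<^sub>* L \<rightarrow> K(X)\<close>. Locally, on \<open>U\<close>, the effective Cartier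
  divisor \<open>G\<^sub>0\<close> is \<open>div(g)\<close> for a section \<open>g \<noteq> 0\<close> of \<open>O\<^sub>X\<close>, so \<open>L((1 - p\<^sup>e) G\<^sub>0)\<close> is the subsheaf
  \<open>g\<^bsup>p^e - 1\<^esup> L\<close> of \<open>L\<close>.\<close>

definition map_divisor ::
    "('p, 'r) ringed_space \<Rightarrow> nat \<Rightarrow> nat \<Rightarrow> ('p, 'r, 'm) module_sheaf
      \<Rightarrow> ('p set \<Rightarrow> 'm \<Rightarrow> ('p set \<times> 'r) set) \<Rightarrow> ('p \<Rightarrow> rat) \<Rightarrow> bool" where
  "map_divisor X p e L \<phi> \<Delta> \<longleftrightarrow>
     module_sheaf_hom X (points X) (frobenius_push X p e L) (constant_sheaf X) \<phi> \<and>
     (\<exists>V l. open_in X V \<and> l \<in> carrier (msec L V) \<and> \<phi> V l \<noteq> \<zero>\<^bsub>fun_field X\<^esub>) \<and>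
     Q_divisor X \<Delta> \<and>
     (\<forall>x \<in> points X. \<exists>U g. open_in X U \<and> x \<in> U \<and> g \<in> carrier (sec X U) - {\<zero>\<^bsub>sec X U\<^esub>} \<and>
        (\<forall>V l. open_in X V \<and> V \<noteq> {} \<and> V \<subseteq> U \<and> l \<in> carrier (msec L V) \<longrightarrow>
           \<phi> V ((rst X U V g [^]\<^bsub>sec X V\<^esub> (p ^ e - 1)) \<odot>\<^bsub>msec L V\<^esub> l)
             \<in> to_fun_field X V ` carrier (sec X V)) \<and>
        (\<forall>y \<in> U. codim_one X y \<longrightarrow>
           (\<exists>n. vanishing_order X p e L y
                 ((\<lambda>l. (germ X y U g [^]\<^bsub>stalk X y\<^esub> (p ^ e - 1)) \<odot>\<^bsub>mstalk X L y\<^esub> l)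
                    ` carrier (mstalk X L y))
                 (map_at_stalk \<phi>) n \<and>
              \<Delta> y = of_nat n / (of_nat p ^ e - 1) - of_int (order_at X y (to_fun_field X U g)))))"

text \<open>The map \<open>F\<^sup>e\<^sub>* L \<rightarrow> K(S)\<close> induced on \<open>S\<close> via \<open>f\<^sub>*\<close> by a map \<open>\<phi>\<close> that sends the inverse image of \<open>L\<close>
  into \<open>K(S) \<subseteq> K(X)\<close>.\<close>

definition induced_map ::
    "('x, 'a) ringed_space \<Rightarrow> ('s, 'c) ringed_space \<Rightarrow> ('x, 'a, 's, 'c) morphism \<Rightarrow>
     ('s set \<Rightarrow> 'l \<Rightarrow> 'm) \<Rightarrow> ('x set \<Rightarrow> 'm \<Rightarrow> ('x set \<times> 'a) set) \<Rightarrow>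
     's set \<Rightarrow> 'l \<Rightarrow> ('s set \<times> 'c) set" where
  "induced_map X S f u \<phi> V l =
     inv_into (carrier (fun_field S)) (fun_field_pullback X f) (\<phi> (preim X f V) (u V l))"

end

theory Submission
  imports Defs
begin

text \<open>Duality \<open>Hom(F\<^sup>e\<^sub>* O\<^sub>W, O\<^sub>W) \<cong> O\<^sub>W((1 - p\<^sup>e) K\<^sub>W)\<close>, evaluated at the generic point, identifies the
  nonzero \<open>p\<^sup>e\<close>-linear maps \<open>K(W) \<rightarrow> K(W)\<close> with nonzero rational functions, linearly in the source. A local
  generator \<open>l\<close> of \<open>L\<close> turns \<open>\<phi>\<^sub>W\<close> into such a map, so it gives a rational function \<open>m\<^sub>l\<close>, and another
  generator changes \<open>m\<^sub>l\<close> by the same unit as \<open>l\<close>. \<open>F\<close>-finiteness makes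
  regularity of a map an open condition, and comparing orders at codimension one points shows that \<open>(p\<^sup>e - 1)(K\<^sub>W + \<Delta>\<^sub>W)\<close> is the divisor
  with local equations \<open>m\<^sub>l\<close>.

  On \<open>E\<close> the image \<open>u l\<close> generates \<open>\<pi>\<^sup>* L \<cong> O\<^sub>E((1 - p\<^sup>e)(K\<^sub>E + \<Delta>\<^sub>E))\<close>, so it is a local equation of
  \<open>(p\<^sup>e - 1)(K\<^sub>E + \<Delta>\<^sub>E)\<close>. As \<open>u l\<close> and \<open>\<pi>\<^sup>* m\<^sub>l\<close> change by the same units, their quotient is a rational
  function on \<open>E\<close> that does not depend on \<open>l\<close>; its divisor is the difference of
  \<open>(p\<^sup>e - 1)(K\<^sub>E + \<Delta>\<^sub>E)\<close> and \<open>(p\<^sup>e - 1) \<pi>\<^sup>*(K\<^sub>W + \<Delta>\<^sub>W)\<close>.\<close>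

text \<open>The map \<open>\<phi>\<^sub>W\<close> takes values in K(W), so in general it is no
  section of Hom(F^e_* O_W, O_W) in any trivialisation, and the duality isomorphism cannot be
  applied to it directly. The way out is that every p^e-linear map of K(W) is regular on some
  nonempty open set, where it is such a section, and that restriction in O_W((1 - p^e) K_W) leaves
  rational functions unchanged. Poles of the map then show up as orders of the rational function
  that duality assigns to it. The delicate direction is the one back from orders to maps. An
  inequality of orders at one codimension one point yields a section over a neighbourhood only after
  all other components of the divisor in question have been removed from that neighbourhood. This
  calls for the finiteness of supports and for open sets that separate codimension one points; both
  come from the fact that the local ring at such a point has a single nonzero prime ideal.\<close>

section \<open>Ideals of noetherian rings\<close>

lemma (in cring) ideal_of_closed:
  assumes "I \<subseteq> carrier R" "\<zero> \<in> I"
    and add: "\<And>x y. x \<in> I \<Longrightarrow> y \<in> I \<Longrightarrow> x \<oplus> y \<in> I"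
    and mult: "\<And>r x. r \<in> carrier R \<Longrightarrow> x \<in> I \<Longrightarrow> r \<otimes> x \<in> I"
  shows "ideal I R"
proof (rule idealI[OF ring_axioms])
  show "subgroup I (add_monoid R)"
  proof
    fix x assume x: "x \<in> I"
    have "\<ominus> \<one> \<otimes> x \<in> I" using x by (intro mult) auto
    then have "\<ominus> x \<in> I" using x assms(1) by (simp add: l_minus subset_iff)
    then show "inv\<^bsub>add_monoid R\<^esub> x \<in> I" by (simp add: a_inv_def)
  qed (use assms in auto)
  fix a x assume ax: "a \<in> I" "x \<in> carrier R"
  show "x \<otimes> a \<in> I" using ax mult by blast
  then show "a \<otimes> x \<in> I" using ax assms(1) m_comm[of x a] by auto
qed

text \<open>In a noetherian ring the union of a nonempty chain of ideals is itself a member of the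
  chain, so the bound that Zorn's lemma asks for lies in \<open>S\<close> without any closure
  condition on \<open>S\<close>.\<close>

lemma (in noetherian_ring) maximal_ideal_in:
  assumes "S \<noteq> {}" and "\<And>I. I \<in> S \<Longrightarrow> ideal I R"
  obtains M where "M \<in> S" "\<And>I. I \<in> S \<Longrightarrow> M \<subseteq> I \<Longrightarrow> I = M"
proof -
  have "\<exists>M\<in>S. \<forall>X\<in>S. M \<subseteq> X \<longrightarrow> X = M"
  proof (rule subset_Zorn_nonempty[OF assms(1)])
    fix C assume C: "C \<noteq> {}" "subset.chain S C"
    then have CS: "C \<subseteq> S" and "\<forall>x\<in>C. \<forall>y\<in>C. x \<subseteq> y \<or> y \<subseteq> x"
      unfolding subset_chain_def by auto
    moreover have "C \<subseteq> {I. ideal I R}" using CS assms(2) by auto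
    ultimately have "subset.chain {I. ideal I R} C" unfolding subset_chain_def by simp
    from ideal_chain_is_trivial[OF C(1) this] show "\<Union>C \<in> S" using CS by (rule rev_subsetD)
  qed
  then show ?thesis using that by blast
qed

text \<open>A single repetition is what the integrality and factorisation arguments for valuation
  rings ask for, and a maximal member of the sequence gives it.\<close>

lemma (in noetherian_ring) ascending_chain_stationary:
  fixes I :: "nat \<Rightarrow> 'a set"
  assumes "\<And>n. ideal (I n) R" and "\<And>n. I n \<subseteq> I (Suc n)"
  obtains n where "I (Suc n) = I n"
proof -
  obtain M where M: "M \<in> range I" "\<And>J. J \<in> range I \<Longrightarrow> M \<subseteq> J \<Longrightarrow> J = M"
    using maximal_ideal_in[of "range I"] assms(1) by auto
  then obtain n where "M = I n" by blast
  then have "I (Suc n) = I n" using M(2)[of "I (Suc n)"] assms(2)[of n] by blast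
  then show ?thesis by (rule that)
qed

text \<open>Noetherian induction: an ideal \<open>M\<close> that is maximal among the
  counterexamples is neither prime nor the whole ring, so it contains a product of two elements
  \<open>a\<close> and \<open>b\<close> outside it. A prime above \<open>M\<close> contains one of
  them, hence lies above \<open>M + (a)\<close> or \<open>M + (b)\<close>, and the finite families
  of these two larger ideals together serve \<open>M\<close>. The lemma later bounds the zeros of a
  section in codimension one.\<close>

lemma finitely_many_minimal_primes:
  fixes R (structure)
  assumes "noetherian_ring R" "cring R" "ideal I R"
  shows "\<exists>\<P>. finite \<P> \<and> (\<forall>P\<in>\<P>. primeideal P R \<and> I \<subseteq> P) \<and>
           (\<forall>Q. primeideal Q R \<and> I \<subseteq> Q \<longrightarrow> (\<exists>P\<in>\<P>. P \<subseteq> Q))"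
proof (rule ccontr)
  interpret noetherian_ring R by fact
  interpret cring R by fact
  define good where "good I \<longleftrightarrow> (\<exists>\<P>. finite \<P> \<and> (\<forall>P\<in>\<P>. primeideal P R \<and> I \<subseteq> P) \<and>
           (\<forall>Q. primeideal Q R \<and> I \<subseteq> Q \<longrightarrow> (\<exists>P\<in>\<P>. P \<subseteq> Q)))" for I
  assume "\<not> ?thesis"
  then have "{I. ideal I R \<and> \<not> good I} \<noteq> {}" using assms(3) unfolding good_def by blast
  from maximal_ideal_in[OF this] obtain M where M: "ideal M R" "\<not> good M"
    and max: "\<And>I. ideal I R \<Longrightarrow> \<not> good I \<Longrightarrow> M \<subseteq> I \<Longrightarrow> I = M"
    by (metis (no_types, lifting) mem_Collect_eq)
  have "\<not> primeideal M R"
  proof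
    assume "primeideal M R"
    then have "good M" unfolding good_def by (intro exI[of _ "{M}"]) auto
    then show False using M by blast
  qed
  moreover have "M \<noteq> carrier R"
  proof
    assume "M = carrier R"
    then have "\<not> M \<subseteq> Q" if "primeideal Q R" for Q
      using that primeideal.I_notcarr[OF that] ideal.Icarr[OF primeideal.axioms(1)[OF that]]
      by blast
    then have "good M" unfolding good_def by (intro exI[of _ "{}"]) auto
    then show False using M by blast
  qed
  ultimately obtain a b where ab: "a \<in> carrier R" "b \<in> carrier R" "a \<notin> M" "b \<notin> M" "a \<otimes> b \<in> M"
    using M(1) is_cring by (metis primeidealI)
  have *: "good (M <+>\<^bsub>R\<^esub> PIdl c)" "M \<subseteq> M <+>\<^bsub>R\<^esub> PIdl c" "ideal (M <+>\<^bsub>R\<^esub> PIdl c) R"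
    if c: "c \<in> carrier R" "c \<notin> M" for c
  proof -
    show id: "ideal (M <+>\<^bsub>R\<^esub> PIdl c) R"
      by (rule add_ideals[OF M(1) cgenideal_ideal[OF c(1)]])
    have cc: "c \<in> PIdl c" by (rule cgenideal_self[OF c(1)])
    have z1: "\<zero> \<in> M" using M(1) by (simp add: additive_subgroup.zero_closed ideal.axioms(1))
    have z2: "\<zero> \<in> PIdl c"
      using cgenideal_ideal[OF c(1)] by (simp add: additive_subgroup.zero_closed ideal.axioms(1))
    show sub: "M \<subseteq> M <+>\<^bsub>R\<^esub> PIdl c"
    proof
      fix x assume x: "x \<in> M"
      then have "x = x \<oplus> \<zero>" using ideal.Icarr[OF M(1)] by simp
      then show "x \<in> M <+>\<^bsub>R\<^esub> PIdl c" using x z2 unfolding set_add_def' by blast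
    qed
    have "c = \<zero> \<oplus> c" using c by simp
    then have "c \<in> M <+>\<^bsub>R\<^esub> PIdl c" using z1 cc unfolding set_add_def' by blast
    then show "good (M <+>\<^bsub>R\<^esub> PIdl c)" using max[OF id _ sub] c by blast
  qed
  obtain \<P>a where Pa: "finite \<P>a" "\<forall>P\<in>\<P>a. primeideal P R \<and> M <+>\<^bsub>R\<^esub> PIdl a \<subseteq> P"
    "\<forall>Q. primeideal Q R \<and> M <+>\<^bsub>R\<^esub> PIdl a \<subseteq> Q \<longrightarrow> (\<exists>P\<in>\<P>a. P \<subseteq> Q)"
    using *(1)[OF ab(1,3)] unfolding good_def by (elim exE conjE) (rule that)
  obtain \<P>b where Pb: "finite \<P>b" "\<forall>P\<in>\<P>b. primeideal P R \<and> M <+>\<^bsub>R\<^esub> PIdl b \<subseteq> P"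
    "\<forall>Q. primeideal Q R \<and> M <+>\<^bsub>R\<^esub> PIdl b \<subseteq> Q \<longrightarrow> (\<exists>P\<in>\<P>b. P \<subseteq> Q)"
    using *(1)[OF ab(2,4)] unfolding good_def by (elim exE conjE) (rule that)
  have incl: "M <+>\<^bsub>R\<^esub> PIdl c \<subseteq> Q" if "primeideal Q R" "M \<subseteq> Q" "c \<in> Q" for c Q
  proof -
    have idQ: "ideal Q R" using that(1) by (simp add: primeideal.axioms(1))
    have "PIdl c \<subseteq> Q" using cgenideal_minimal[OF idQ that(3)] .
    then show ?thesis using that(2) idQ unfolding set_add_def'
      by (auto intro!: additive_subgroup.a_closed[OF ideal.axioms(1)[OF idQ]])
  qed
  have "\<exists>P\<in>\<P>a \<union> \<P>b. P \<subseteq> Q" if Q: "primeideal Q R" "M \<subseteq> Q" for Q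
  proof -
    have "a \<in> Q \<or> b \<in> Q" using primeideal.I_prime[OF Q(1) ab(1,2)] ab(5) Q(2) by blast
    then show ?thesis
    proof
      assume "a \<in> Q"
      from Pa(3)[rule_format, OF conjI[OF Q(1) incl[OF Q this]]] show ?thesis by auto
    next
      assume "b \<in> Q"
      from Pb(3)[rule_format, OF conjI[OF Q(1) incl[OF Q this]]] show ?thesis by auto
    qed
  qed
  moreover have "\<forall>P\<in>\<P>a \<union> \<P>b. primeideal P R \<and> M \<subseteq> P"
    using Pa(2) Pb(2) *(2)[OF ab(1,3)] *(2)[OF ab(2,4)] by blast
  ultimately have "good M" unfolding good_def
    using Pa(1) Pb(1) by (intro exI[of _ "\<P>a \<union> \<P>b"]) blast
  then show False using M by blast
qed

section \<open>Rings of fractions\<close>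

text \<open>A description of rings of fractions by a single property: each element of A comes from R
  after multiplication with the image of some \<open>f\<close> that is a unit in A. The instance is
  the map from the sections over an affine open set to a stalk. Injectivity is added where
  numerators have to be compared.\<close>

locale fraction_hom = ring_hom_cring R A h for R (structure) and A (structure) and h +
  assumes fraction: "\<And>a. a \<in> carrier A \<Longrightarrow>
    \<exists>r\<in>carrier R. \<exists>f\<in>carrier R. h f \<in> Units A \<and> h f \<otimes>\<^bsub>A\<^esub> a = h r"
begin

lemma ideal_contract: "ideal J A \<Longrightarrow> ideal {r \<in> carrier R. h r \<in> J} R"
proof -
  assume J: "ideal J A"
  interpret J: ideal J A by fact
  show ?thesis by (rule R.ideal_of_closed) (auto intro: J.I_l_closed)
qed

text \<open>An ideal of A is generated by the images of generators of its contraction, because each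
  of its elements is the inverse of a unit times the image of an element of that
  contraction.\<close>

lemma noetherian_transfer:
  assumes "noetherian_ring R" shows "noetherian_ring A"
proof (rule S.noetherian_ringI)
  fix J assume J: "ideal J A"
  interpret J: ideal J A by fact
  obtain B where B: "B \<subseteq> carrier R" "finite B" "{r \<in> carrier R. h r \<in> J} = Idl\<^bsub>R\<^esub> B"
    using noetherian_ring.finetely_gen[OF assms ideal_contract[OF J]] by auto
  have hB: "h ` B \<subseteq> carrier A" using B(1) by auto
  have idl: "ideal (Idl\<^bsub>A\<^esub> (h ` B)) A" by (rule S.genideal_ideal[OF hB])
  have "h ` B \<subseteq> J" using B R.genideal_self[OF B(1)] by blast
  then have 1: "Idl\<^bsub>A\<^esub> (h ` B) \<subseteq> J" by (rule S.genideal_minimal[OF J])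
  have "Idl\<^bsub>R\<^esub> B \<subseteq> {r \<in> carrier R. h r \<in> Idl\<^bsub>A\<^esub> (h ` B)}"
    by (rule R.genideal_minimal[OF ideal_contract[OF idl]])
      (use B(1) S.genideal_self[OF hB] in auto)
  then have 2: "h r \<in> Idl\<^bsub>A\<^esub> (h ` B)" if "r \<in> carrier R" "h r \<in> J" for r
    using that B(3) by blast
  have "J \<subseteq> Idl\<^bsub>A\<^esub> (h ` B)"
  proof
    fix a assume a: "a \<in> J"
    then have aA: "a \<in> carrier A" by (rule J.Icarr)
    then obtain r f where rf: "r \<in> carrier R" "f \<in> carrier R" "h f \<in> Units A" "h f \<otimes>\<^bsub>A\<^esub> a = h r"
      using fraction by blast
    have "h r \<in> J" using rf a by (metis J.I_l_closed hom_closed)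
    then have "h r \<in> Idl\<^bsub>A\<^esub> (h ` B)" using 2 rf by blast
    moreover have "a = inv\<^bsub>A\<^esub> (h f) \<otimes>\<^bsub>A\<^esub> h r"
      using rf aA by (metis S.Units_inv_closed S.Units_l_inv S.l_one S.m_assoc S.Units_closed)
    ultimately show "a \<in> Idl\<^bsub>A\<^esub> (h ` B)"
      using ideal.I_l_closed[OF idl] rf by simp
  qed
  then show "\<exists>B \<subseteq> carrier A. finite B \<and> J = Idl\<^bsub>A\<^esub> B"
    using 1 hB B(2) by (intro exI[of _ "h ` B"]) auto
qed

text \<open>The extended prime consists of the fractions with numerator in \<open>Q\<close>; its
  contraction is again \<open>Q\<close> since no denominator lies in \<open>Q\<close>. In this way
  primes of the sections over an affine open set are carried to the local ring at a point.\<close>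

lemma prime_extension:
  assumes Q: "primeideal Q R" and disj: "\<And>f. f \<in> Q \<Longrightarrow> h f \<notin> Units A"
    and ker: "\<And>r. r \<in> carrier R \<Longrightarrow> h r = \<zero>\<^bsub>A\<^esub> \<Longrightarrow> r = \<zero>\<^bsub>R\<^esub>"
  obtains Q' where "primeideal Q' A" "{r \<in> carrier R. h r \<in> Q'} = Q"
proof -
  interpret Q: primeideal Q R by fact
  define Q' where "Q' = {a \<in> carrier A. \<exists>r\<in>Q. \<exists>f\<in>carrier R. h f \<in> Units A \<and> h f \<otimes>\<^bsub>A\<^esub> a = h r}"
  \<comment> \<open>Whether the numerator lies in \<open>Q\<close> does not depend on the
    representation: cross-multiplication gives an equation in A, injectivity moves it to R, and the
    denominator \<open>f\<close> is outside \<open>Q\<close> because \<open>h f\<close> is a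
    unit.\<close>
  have key: "r' \<in> Q" if "a \<in> Q'" "r' \<in> carrier R" "f' \<in> carrier R" "h f' \<in> Units A"
    "h f' \<otimes>\<^bsub>A\<^esub> a = h r'" for a r' f'
  proof -
    obtain r f where rf: "r \<in> Q" "f \<in> carrier R" "h f \<in> Units A" "h f \<otimes>\<^bsub>A\<^esub> a = h r"
      and a: "a \<in> carrier A" using \<open>a \<in> Q'\<close> unfolding Q'_def by blast
    have rR: "r \<in> carrier R" using rf by auto
    have "h (f \<otimes>\<^bsub>R\<^esub> r') = h f \<otimes>\<^bsub>A\<^esub> (h f' \<otimes>\<^bsub>A\<^esub> a)" using that rf by simp
    also have "\<dots> = h f' \<otimes>\<^bsub>A\<^esub> h r" using rf that a
      by (metis S.m_lcomm hom_closed)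
    also have "\<dots> = h (f' \<otimes>\<^bsub>R\<^esub> r)" using rR that by simp
    finally have "h (f \<otimes>\<^bsub>R\<^esub> r' \<ominus>\<^bsub>R\<^esub> f' \<otimes>\<^bsub>R\<^esub> r) = \<zero>\<^bsub>A\<^esub>"
      using rR rf that by (simp add: R.minus_eq S.r_neg)
    then have "f \<otimes>\<^bsub>R\<^esub> r' \<ominus>\<^bsub>R\<^esub> f' \<otimes>\<^bsub>R\<^esub> r = \<zero>\<^bsub>R\<^esub>"
      using ker rR rf that by simp
    then have "f \<otimes>\<^bsub>R\<^esub> r' = f' \<otimes>\<^bsub>R\<^esub> r" using rR rf that by simp
    then have "f \<otimes>\<^bsub>R\<^esub> r' \<in> Q" using Q.I_l_closed[OF rf(1) that(3)] by simp
    then show ?thesis using Q.I_prime[OF rf(2) that(2)] disj[of f] rf(3) by blast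
  qed
  have zQ: "\<zero>\<^bsub>R\<^esub> \<in> Q" by simp
  have id: "ideal Q' A"
  proof (rule S.ideal_of_closed)
    show "Q' \<subseteq> carrier A" unfolding Q'_def by blast
    have "h \<one>\<^bsub>R\<^esub> \<in> Units A" "h \<one>\<^bsub>R\<^esub> \<otimes>\<^bsub>A\<^esub> \<zero>\<^bsub>A\<^esub> = h \<zero>\<^bsub>R\<^esub>" by simp_all
    then show "\<zero>\<^bsub>A\<^esub> \<in> Q'" unfolding Q'_def using zQ R.one_closed S.zero_closed by blast
  next
    fix a b assume ab: "a \<in> Q'" "b \<in> Q'"
    from ab(1) obtain r f where rf: "r \<in> Q" "f \<in> carrier R" "h f \<in> Units A" "h f \<otimes>\<^bsub>A\<^esub> a = h r"
      and a: "a \<in> carrier A" unfolding Q'_def by blast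
    from ab(2) obtain s g where sg: "s \<in> Q" "g \<in> carrier R" "h g \<in> Units A" "h g \<otimes>\<^bsub>A\<^esub> b = h s"
      and b: "b \<in> carrier A" unfolding Q'_def by blast
    have c: "r \<in> carrier R" "s \<in> carrier R" using rf sg by auto
    have "h (f \<otimes>\<^bsub>R\<^esub> g) \<otimes>\<^bsub>A\<^esub> (a \<oplus>\<^bsub>A\<^esub> b)
        = h g \<otimes>\<^bsub>A\<^esub> (h f \<otimes>\<^bsub>A\<^esub> a) \<oplus>\<^bsub>A\<^esub> h f \<otimes>\<^bsub>A\<^esub> (h g \<otimes>\<^bsub>A\<^esub> b)"
      using rf(2) sg(2) a b by (simp add: S.r_distr S.m_ac)
    also have "\<dots> = h (g \<otimes>\<^bsub>R\<^esub> r \<oplus>\<^bsub>R\<^esub> f \<otimes>\<^bsub>R\<^esub> s)" using rf sg c by simp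
    finally have "h (f \<otimes>\<^bsub>R\<^esub> g) \<otimes>\<^bsub>A\<^esub> (a \<oplus>\<^bsub>A\<^esub> b) = h (g \<otimes>\<^bsub>R\<^esub> r \<oplus>\<^bsub>R\<^esub> f \<otimes>\<^bsub>R\<^esub> s)" .
    moreover have "g \<otimes>\<^bsub>R\<^esub> r \<oplus>\<^bsub>R\<^esub> f \<otimes>\<^bsub>R\<^esub> s \<in> Q" using rf sg by (simp add: Q.I_l_closed)
    moreover have "h (f \<otimes>\<^bsub>R\<^esub> g) \<in> Units A" using rf sg by simp
    ultimately show "a \<oplus>\<^bsub>A\<^esub> b \<in> Q'" unfolding Q'_def using a b rf(2) sg(2)
      by (metis (mono_tags, lifting) R.m_closed S.a_closed mem_Collect_eq)
  next
    fix c a assume c: "c \<in> carrier A" and "a \<in> Q'"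
    then obtain r f where rf: "r \<in> Q" "f \<in> carrier R" "h f \<in> Units A" "h f \<otimes>\<^bsub>A\<^esub> a = h r"
      and a: "a \<in> carrier A" unfolding Q'_def by blast
    obtain s g where sg: "s \<in> carrier R" "g \<in> carrier R" "h g \<in> Units A" "h g \<otimes>\<^bsub>A\<^esub> c = h s"
      using fraction[OF c] by blast
    have rR: "r \<in> carrier R" using rf by auto
    have "h (g \<otimes>\<^bsub>R\<^esub> f) \<otimes>\<^bsub>A\<^esub> (c \<otimes>\<^bsub>A\<^esub> a) = (h g \<otimes>\<^bsub>A\<^esub> c) \<otimes>\<^bsub>A\<^esub> (h f \<otimes>\<^bsub>A\<^esub> a)"
      using rf(2) sg(2) a c by (simp add: S.m_ac)
    also have "\<dots> = h (s \<otimes>\<^bsub>R\<^esub> r)" using rf sg rR by simp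
    finally have "h (g \<otimes>\<^bsub>R\<^esub> f) \<otimes>\<^bsub>A\<^esub> (c \<otimes>\<^bsub>A\<^esub> a) = h (s \<otimes>\<^bsub>R\<^esub> r)" .
    moreover have "s \<otimes>\<^bsub>R\<^esub> r \<in> Q" using rf sg by (simp add: Q.I_l_closed)
    moreover have "h (g \<otimes>\<^bsub>R\<^esub> f) \<in> Units A" using rf sg by simp
    ultimately show "c \<otimes>\<^bsub>A\<^esub> a \<in> Q'" unfolding Q'_def using a c rf(2) sg(2)
      by (metis (mono_tags, lifting) R.m_closed S.m_closed mem_Collect_eq)
  qed
  have contr: "{r \<in> carrier R. h r \<in> Q'} = Q"
  proof
    show "{r \<in> carrier R. h r \<in> Q'} \<subseteq> Q"
      using key[where f' = "\<one>\<^bsub>R\<^esub>"] by fastforce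
    show "Q \<subseteq> {r \<in> carrier R. h r \<in> Q'}"
    proof
      fix r assume r: "r \<in> Q"
      then have rR: "r \<in> carrier R" by (rule Q.Icarr)
      then have "h \<one>\<^bsub>R\<^esub> \<in> Units A" "h \<one>\<^bsub>R\<^esub> \<otimes>\<^bsub>A\<^esub> h r = h r" by simp_all
      then have "h r \<in> Q'" unfolding Q'_def using r rR R.one_closed hom_closed by blast
      then show "r \<in> {r \<in> carrier R. h r \<in> Q'}" using rR by blast
    qed
  qed
  have "primeideal Q' A"
  proof (rule primeidealI[OF id S.is_cring])
    show "carrier A \<noteq> Q'"
    proof
      assume "carrier A = Q'"
      then have "\<one>\<^bsub>R\<^esub> \<in> {r \<in> carrier R. h r \<in> Q'}" using hom_closed[OF R.one_closed] by simp
      then have "\<one>\<^bsub>R\<^esub> \<in> Q" by (simp only: contr)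
      then show False using Q.one_imp_carrier Q.I_notcarr by simp
    qed
    fix a b assume a: "a \<in> carrier A" and b: "b \<in> carrier A" and ab: "a \<otimes>\<^bsub>A\<^esub> b \<in> Q'"
    obtain r f where rf: "r \<in> carrier R" "f \<in> carrier R" "h f \<in> Units A" "h f \<otimes>\<^bsub>A\<^esub> a = h r"
      using fraction[OF a] by blast
    obtain s g where sg: "s \<in> carrier R" "g \<in> carrier R" "h g \<in> Units A" "h g \<otimes>\<^bsub>A\<^esub> b = h s"
      using fraction[OF b] by blast
    have "h (f \<otimes>\<^bsub>R\<^esub> g) \<otimes>\<^bsub>A\<^esub> (a \<otimes>\<^bsub>A\<^esub> b) = (h f \<otimes>\<^bsub>A\<^esub> a) \<otimes>\<^bsub>A\<^esub> (h g \<otimes>\<^bsub>A\<^esub> b)"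
      using rf(2) sg(2) a b by (simp add: S.m_ac)
    also have "\<dots> = h (r \<otimes>\<^bsub>R\<^esub> s)" using rf sg by simp
    finally have "r \<otimes>\<^bsub>R\<^esub> s \<in> Q" using key[OF ab, of "r \<otimes>\<^bsub>R\<^esub> s" "f \<otimes>\<^bsub>R\<^esub> g"] rf sg by simp
    then have "r \<in> Q \<or> s \<in> Q" using Q.I_prime rf sg by blast
    then show "a \<in> Q' \<or> b \<in> Q'" unfolding Q'_def using rf sg a b by blast
  qed
  then show ?thesis using contr that by blast
qed

end

section \<open>Discrete valuation rings\<close>

lemma (in noetherian_ring) nonunit_in_maximal:
  assumes "cring R" "x \<in> carrier R" "x \<notin> Units R"
  obtains M where "maximalideal M R" "x \<in> M"
proof -
  interpret cring R by fact
  define S where "S = {I. ideal I R \<and> x \<in> I \<and> \<one> \<notin> I}"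
  have "\<one> \<notin> PIdl x"
  proof
    assume "\<one> \<in> PIdl x"
    then obtain y where "y \<in> carrier R" "\<one> = y \<otimes> x" unfolding cgenideal_def by auto
    then have "x \<in> Units R" using assms(2) m_comm[of x y] unfolding Units_def by auto
    then show False using assms(3) by simp
  qed
  then have "PIdl x \<in> S" unfolding S_def
    using cgenideal_ideal[OF assms(2)] cgenideal_self[OF assms(2)] by simp
  then have ne: "S \<noteq> {}" by auto
  obtain M where M: "M \<in> S" and max: "\<And>I. I \<in> S \<Longrightarrow> M \<subseteq> I \<Longrightarrow> I = M"
    by (rule maximal_ideal_in[OF ne]) (auto simp: S_def)
  have "maximalideal M R"
  proof (rule maximalidealI)
    show "ideal M R" using M S_def by simp
    show "carrier R \<noteq> M" using M S_def one_closed by auto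
    fix J assume J: "ideal J R" "M \<subseteq> J" "J \<subseteq> carrier R"
    show "J = M \<or> J = carrier R"
    proof (cases "\<one> \<in> J")
      case True
      then show ?thesis using ideal.one_imp_carrier[OF J(1)] by simp
    next
      case False
      then have "J \<in> S" using J M unfolding S_def by auto
      then show ?thesis using max J(2) by simp
    qed
  qed
  then show ?thesis using that M S_def by simp
qed

text \<open>Normal noetherian local domains of dimension one, which will be the local rings at
  codimension one points. They turn out to be discrete valuation rings: normality makes
  \<open>m\<close> principal, and the chain condition bounds how often a generator of
  \<open>m\<close> divides a given nonzero element.\<close>

locale dim_one_local = domain R + noetherian_ring R for R :: "'a ring" (structure) +
  fixes m
  assumes max_m: "maximalideal m R"
    and max_unique: "\<And>M. maximalideal M R \<Longrightarrow> M = m"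
    and int_closed: "integrally_closed_domain R"
    and dim: "has_krull_dim R 1"
begin

lemma m_carrier: "x \<in> m \<Longrightarrow> x \<in> carrier R"
  using max_m ideal.Icarr maximalideal.axioms(1) by metis

lemma m_ideal: "ideal m R"
  using max_m by (rule maximalideal.axioms(1))

lemma nonunit_iff: "x \<in> carrier R \<Longrightarrow> x \<notin> Units R \<longleftrightarrow> x \<in> m"
proof
  assume x: "x \<in> carrier R" "x \<notin> Units R"
  show "x \<in> m" using nonunit_in_maximal[OF is_cring x] max_unique by metis
next
  assume x: "x \<in> carrier R" "x \<in> m"
  show "x \<notin> Units R"
  proof
    assume "x \<in> Units R"
    then have "inv x \<otimes> x = \<one>" "inv x \<in> carrier R" by simp_all
    then have "\<one> \<in> m" using ideal.I_l_closed[OF m_ideal x(2)] by metis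
    then show False
      using ideal.one_imp_carrier[OF m_ideal] maximalideal.I_notcarr[OF max_m] by simp
  qed
qed

lemma prime_subset_m: "primeideal P R \<Longrightarrow> P \<subseteq> m"
proof
  fix x assume P: "primeideal P R" and x: "x \<in> P"
  interpret P: primeideal P R by fact
  have xR: "x \<in> carrier R" using x by simp
  have "x \<notin> Units R"
  proof
    assume "x \<in> Units R"
    then have "inv x \<otimes> x = \<one>" "inv x \<in> carrier R" by simp_all
    then have "\<one> \<in> P" using P.I_l_closed[OF x] by metis
    then show False using P.one_imp_carrier P.I_notcarr by simp
  qed
  then show "x \<in> m" using nonunit_iff xR by simp
qed

text \<open>Otherwise \<open>{\<zero>}\<close>, \<open>P\<close> and \<open>m\<close> would be a
  chain of three primes in a ring of dimension one.\<close>

lemma nonzero_prime: assumes P: "primeideal P R" "x \<in> P" "x \<noteq> \<zero>" shows "P = m"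
proof (rule ccontr)
  assume ne: "P \<noteq> m"
  have Pm: "P \<subset> m" using prime_subset_m[OF P(1)] ne by auto
  have "\<zero> \<in> P" using P(1)
    by (simp add: additive_subgroup.zero_closed ideal.axioms(1) primeideal.axioms(1))
  then have zP: "{\<zero>} \<subset> P" using P by blast
  have "prime_chain R [{\<zero>}, P, m]" unfolding prime_chain_def spectrum_def
    using zP Pm zeroprimeideal P(1) maximalideal_prime[OF max_m] by auto
  then show False using dim unfolding has_krull_dim_def by fastforce
qed

lemma m_nonzero: obtains a where "a \<in> m" "a \<noteq> \<zero>"
proof -
  obtain Ps where Ps: "prime_chain R Ps" "length Ps = 2"
    using dim unfolding has_krull_dim_def by auto
  then obtain P Q where PQ: "Ps = [P, Q]" by (metis (no_types) One_nat_def Suc_1 length_0_conv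
     length_Suc_conv)
  then have pq: "primeideal P R" "primeideal Q R" "P \<subset> Q" using Ps(1)
    unfolding prime_chain_def spectrum_def by auto
  then obtain a where a: "a \<in> Q" "a \<notin> P" by blast
  have "\<zero> \<in> P" using pq(1)
    by (simp add: additive_subgroup.zero_closed ideal.axioms(1) primeideal.axioms(1))
  then have "a \<noteq> \<zero>" using a by auto
  then show ?thesis using that[of a] a prime_subset_m[OF pq(2)] by auto
qed

text \<open>An associated prime of \<open>R/a\<close> is the colon ideal \<open>(a : b)\<close>, and it must be \<open>m\<close>.\<close>

lemma associated_prime:
  assumes a: "a \<in> m" "a \<noteq> \<zero>"
  obtains b where "b \<in> carrier R" "\<And>y. y \<in> carrier R \<Longrightarrow> b \<noteq> y \<otimes> a"
    "\<And>x. x \<in> m \<Longrightarrow> \<exists>y\<in>carrier R. x \<otimes> b = y \<otimes> a"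
proof -
  have aR: "a \<in> carrier R" using a m_carrier by simp
  define D where "D b = {x \<in> carrier R. \<exists>y\<in>carrier R. x \<otimes> b = y \<otimes> a}" for b
  have D_ideal: "ideal (D b) R" if b: "b \<in> carrier R" for b
  proof (rule ideal_of_closed)
    show "\<zero> \<in> D b" unfolding D_def using b aR by (auto intro!: bexI[of _ \<zero>])
    fix x x' assume "x \<in> D b" "x' \<in> D b"
    then obtain y y' where "x \<in> carrier R" "x' \<in> carrier R" "y \<in> carrier R" "y' \<in> carrier R"
      "x \<otimes> b = y \<otimes> a" "x' \<otimes> b = y' \<otimes> a" unfolding D_def by auto
    then show "x \<oplus> x' \<in> D b" unfolding D_def using b aR
      by (auto intro!: bexI[of _ "y \<oplus> y'"] simp: l_distr)
  next
    fix r x assume "r \<in> carrier R" "x \<in> D b"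
    then obtain y where "r \<in> carrier R" "x \<in> carrier R" "y \<in> carrier R" "x \<otimes> b = y \<otimes> a"
      unfolding D_def by auto
    then show "r \<otimes> x \<in> D b" unfolding D_def using b aR
      by (auto intro!: bexI[of _ "r \<otimes> y"] simp: m_assoc)
  qed (auto simp: D_def)
  \<comment> \<open>Noetherian maximality is applied to the proper ideals among the colon ideals
    \<open>D b = (a : b)\<close>. The one with \<open>b = \<one>\<close> shows that there are any,
    as \<open>a\<close> is not a unit.\<close>
  define S where "S = {D b | b. b \<in> carrier R \<and> \<one> \<notin> D b}"
  have "\<one> \<notin> D \<one>"
  proof
    assume "\<one> \<in> D \<one>"
    then obtain y where "y \<in> carrier R" "\<one> = y \<otimes> a" unfolding D_def by auto
    then have "a \<in> Units R" using aR m_comm[of a y] unfolding Units_def by auto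
    then show False using nonunit_iff[OF aR] a(1) by blast
  qed
  then have ne: "S \<noteq> {}" unfolding S_def by blast
  obtain M where M: "M \<in> S" and max: "\<And>I. I \<in> S \<Longrightarrow> M \<subseteq> I \<Longrightarrow> I = M"
    by (rule maximal_ideal_in[OF ne]) (use D_ideal in \<open>auto simp: S_def\<close>)
  from M obtain b where b: "b \<in> carrier R" "M = D b" "\<one> \<notin> D b" unfolding S_def by auto
  have "primeideal (D b) R"
  proof (rule primeidealI[OF D_ideal[OF b(1)] is_cring])
    show "carrier R \<noteq> D b" using b(3) one_closed by blast
    fix x y assume x: "x \<in> carrier R" and y: "y \<in> carrier R" and xy: "x \<otimes> y \<in> D b"
    show "x \<in> D b \<or> y \<in> D b"
    proof (rule disjCI)
      \<comment> \<open>With \<open>y\<close> outside \<open>(a : b)\<close>, the ideal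
        \<open>(a : y b)\<close> is still proper. It contains \<open>(a : b)\<close>, so by
        maximality the two are equal; \<open>x\<close> lies in the larger one, hence in the
        smaller.\<close>
      assume ny: "y \<notin> D b"
      have "\<one> \<notin> D (y \<otimes> b)" using ny y b(1) unfolding D_def by auto
      then have "D (y \<otimes> b) \<in> S" unfolding S_def using y b(1) by blast
      moreover have "M \<subseteq> D (y \<otimes> b)"
      proof
        fix z assume "z \<in> M"
        then obtain w where w: "z \<in> carrier R" "w \<in> carrier R" "z \<otimes> b = w \<otimes> a"
          unfolding b(2) D_def by auto
        have "z \<otimes> (y \<otimes> b) = y \<otimes> (z \<otimes> b)" using w y b(1) by (simp add: m_lcomm)
        also have "\<dots> = (y \<otimes> w) \<otimes> a" using w y aR by (simp add: m_assoc)
        finally show "z \<in> D (y \<otimes> b)" unfolding D_def using w y by blast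
      qed
      ultimately have "D (y \<otimes> b) = D b" using max b(2) by blast
      moreover have "x \<in> D (y \<otimes> b)" using xy x y b(1) unfolding D_def by (simp add: m_assoc)
      ultimately show "x \<in> D b" by simp
    qed
  qed
  moreover have "a \<in> D b" unfolding D_def using aR b(1) m_comm by blast
  ultimately have "D b = m" using nonzero_prime a by blast
  moreover have "b \<noteq> y \<otimes> a" if "y \<in> carrier R" for y
    using b that unfolding D_def by auto
  ultimately show ?thesis using that b(1) unfolding D_def by blast
qed

text \<open>The coefficients are indexed by \<open>{..<n}\<close> as in
  \<open>integrally_closed_domain\<close>, so that a relation between the generators can be turned
  into an integral equation term by term.\<close>

lemma linear_span_ideal:
  assumes d: "\<And>i. d i \<in> carrier R"
  shows "ideal {x. \<exists>c \<in> {..<n::nat} \<rightarrow> carrier R. x = (\<Oplus>i\<in>{..<n}. c i \<otimes> d i)} R"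
proof (rule ideal_of_closed)
  show "{x. \<exists>c \<in> {..<n} \<rightarrow> carrier R. x = (\<Oplus>i\<in>{..<n}. c i \<otimes> d i)} \<subseteq> carrier R"
    using d by (auto intro!: finsum_closed)
  have "\<zero> = (\<Oplus>i\<in>{..<n}. \<zero> \<otimes> d i)" using d by (simp add: finsum_zero)
  then show "\<zero> \<in> {x. \<exists>c \<in> {..<n} \<rightarrow> carrier R. x = (\<Oplus>i\<in>{..<n}. c i \<otimes> d i)}"
    by (intro CollectI bexI[of _ "\<lambda>_. \<zero>"]) auto
next
  fix x y
  assume "x \<in> {x. \<exists>c \<in> {..<n} \<rightarrow> carrier R. x = (\<Oplus>i\<in>{..<n}. c i \<otimes> d i)}"
    "y \<in> {x. \<exists>c \<in> {..<n} \<rightarrow> carrier R. x = (\<Oplus>i\<in>{..<n}. c i \<otimes> d i)}"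
  then obtain c c' where c: "c \<in> {..<n} \<rightarrow> carrier R" "c' \<in> {..<n} \<rightarrow> carrier R"
    "x = (\<Oplus>i\<in>{..<n}. c i \<otimes> d i)" "y = (\<Oplus>i\<in>{..<n}. c' i \<otimes> d i)" by auto
  have "x \<oplus> y = (\<Oplus>i\<in>{..<n}. c i \<otimes> d i \<oplus> c' i \<otimes> d i)"
    unfolding c(3,4) using c(1,2) d by (intro finsum_addf[symmetric]) auto
  also have "\<dots> = (\<Oplus>i\<in>{..<n}. (c i \<oplus> c' i) \<otimes> d i)"
    using c(1,2) d by (intro finsum_cong') (auto simp: l_distr Pi_iff)
  finally show "x \<oplus> y \<in> {x. \<exists>c \<in> {..<n} \<rightarrow> carrier R. x = (\<Oplus>i\<in>{..<n}. c i \<otimes> d i)}"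
    using c(1,2) by (intro CollectI bexI[of _ "\<lambda>i. c i \<oplus> c' i"]) auto
next
  fix r x
  assume r: "r \<in> carrier R" and "x \<in> {x. \<exists>c \<in> {..<n} \<rightarrow> carrier R. x = (\<Oplus>i\<in>{..<n}. c i \<otimes> d i)}"
  then obtain c where c: "c \<in> {..<n} \<rightarrow> carrier R" "x = (\<Oplus>i\<in>{..<n}. c i \<otimes> d i)" by auto
  have "r \<otimes> x = (\<Oplus>i\<in>{..<n}. r \<otimes> (c i \<otimes> d i))"
    unfolding c(2) using c(1) d r by (intro finsum_rdistr) auto
  also have "\<dots> = (\<Oplus>i\<in>{..<n}. (r \<otimes> c i) \<otimes> d i)"
    using c(1) d r by (intro finsum_cong') (auto simp: m_assoc Pi_iff)
  finally show "r \<otimes> x \<in> {x. \<exists>c \<in> {..<n} \<rightarrow> carrier R. x = (\<Oplus>i\<in>{..<n}. c i \<otimes> d i)}"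
    using c(1) r by (intro CollectI bexI[of _ "\<lambda>i. r \<otimes> c i"]) auto
qed

text \<open>If \<open>(b/a) m \<subseteq> m\<close>, the elements \<open>d n = a (b/a)\<^sup>n\<close> lie in \<open>R\<close>; as the ideals they generate become
  stationary, \<open>b/a\<close> is integral. This replaces the determinant trick.\<close>

lemma colon_witness:
  assumes a: "a \<in> m" "a \<noteq> \<zero>" and b: "b \<in> carrier R" "\<And>y. y \<in> carrier R \<Longrightarrow> b \<noteq> y \<otimes> a"
    and mult: "\<And>x. x \<in> m \<Longrightarrow> \<exists>y\<in>m. x \<otimes> b = y \<otimes> a"
  shows False
proof -
  have aR: "a \<in> carrier R" using a m_carrier by simp
  \<comment> \<open>\<open>step x\<close> is the element \<open>x b / a\<close>, which by assumption
    exists in \<open>m\<close>; iterating it from \<open>a\<close> produces the powers of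
    \<open>b / a\<close>.\<close>
  define step where "step x = (SOME y. y \<in> m \<and> x \<otimes> b = y \<otimes> a)" for x
  have step: "step x \<in> m" "x \<otimes> b = step x \<otimes> a" if "x \<in> m" for x
  proof -
    have "\<exists>y. y \<in> m \<and> x \<otimes> b = y \<otimes> a" using mult[OF that] by blast
    from someI_ex[OF this] show "step x \<in> m" "x \<otimes> b = step x \<otimes> a" unfolding step_def by auto
  qed
  define d where "d n = (step ^^ n) a" for n
  have d_m: "d n \<in> m" for n unfolding d_def by (induction n) (use a step in auto)
  have dR: "d n \<in> carrier R" for n using d_m m_carrier by simp
  have d_pow: "a [^] n \<otimes> d n = a \<otimes> b [^] n" for n
  proof (induction n)
    case 0
    then show ?case using aR by (simp add: d_def)
  next
    case (Suc n)
    have "a [^] Suc n \<otimes> d (Suc n) = a [^] n \<otimes> (d (Suc n) \<otimes> a)"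
      using aR dR by (simp add: m_ac)
    also have "d (Suc n) \<otimes> a = d n \<otimes> b" using step(2)[OF d_m[of n]] by (simp add: d_def)
    also have "a [^] n \<otimes> (d n \<otimes> b) = a \<otimes> b [^] n \<otimes> b"
      using Suc.IH aR dR b(1) by (simp flip: m_assoc)
    finally show ?case using aR b(1) by (simp add: m_assoc)
  qed
  define I where "I n = {x. \<exists>c \<in> {..<n} \<rightarrow> carrier R. x = (\<Oplus>i\<in>{..<n}. c i \<otimes> d i)}" for n
  have B: "I n \<subseteq> I (Suc n)" for n
  proof
    fix x assume "x \<in> I n"
    then obtain c where c: "c \<in> {..<n} \<rightarrow> carrier R" "x = (\<Oplus>i\<in>{..<n}. c i \<otimes> d i)"
      unfolding I_def by auto
    define c' where "c' = c(n := \<zero>)"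
    have c': "c' \<in> {..<Suc n} \<rightarrow> carrier R" using c(1) unfolding c'_def by (auto simp: less_Suc_eq)
    have "(\<Oplus>i\<in>{..<Suc n}. c' i \<otimes> d i) = c' n \<otimes> d n \<oplus> (\<Oplus>i\<in>{..<n}. c' i \<otimes> d i)"
      unfolding lessThan_Suc using c' dR by (intro finsum_insert) (auto simp: Pi_iff)
    also have "(\<Oplus>i\<in>{..<n}. c' i \<otimes> d i) = x" unfolding c(2)
      using c(1) dR by (intro finsum_cong') (auto simp: c'_def)
    also have "c' n \<otimes> d n \<oplus> x = x"
    proof -
      have "x \<in> carrier R" unfolding c(2) using c(1) dR by (intro finsum_closed) auto
      then show ?thesis using dR by (simp add: c'_def)
    qed
    finally have "x = (\<Oplus>i\<in>{..<Suc n}. c' i \<otimes> d i)" ..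
    with c' show "x \<in> I (Suc n)" unfolding I_def by blast
  qed
  have A: "ideal (I n) R" for n unfolding I_def by (rule linear_span_ideal) (rule dR)
  obtain n where n: "I (Suc n) = I n" by (rule ascending_chain_stationary[of I, OF A B])
  have "d n \<in> I (Suc n)"
  proof -
    define c where "c i = (if i = n then \<one> else \<zero>)" for i
    have "(\<Oplus>i\<in>{..<Suc n}. c i \<otimes> d i) = c n \<otimes> d n \<oplus> (\<Oplus>i\<in>{..<n}. c i \<otimes> d i)"
      unfolding lessThan_Suc using dR by (intro finsum_insert) (auto simp: c_def)
    also have "(\<Oplus>i\<in>{..<n}. c i \<otimes> d i) = (\<Oplus>i\<in>{..<n}. \<zero>)"
      using dR by (intro finsum_cong') (auto simp: c_def)
    finally have "d n = (\<Oplus>i\<in>{..<Suc n}. c i \<otimes> d i)" using dR by (simp add: c_def)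
    then show ?thesis unfolding I_def by (intro CollectI bexI[of _ c]) (auto simp: c_def)
  qed
  \<comment> \<open>The repetition expresses \<open>d n\<close> through the earlier
    \<open>d i\<close>. Multiplied by \<open>a [^] n\<close> and divided by \<open>a\<close>, this
    is the monic equation for \<open>b / a\<close> with denominators cleared.\<close>
  then have "d n \<in> I n" by (simp only: n)
  then obtain c where c: "c \<in> {..<n} \<rightarrow> carrier R" "d n = (\<Oplus>i\<in>{..<n}. c i \<otimes> d i)"
    unfolding I_def by auto
  have sumR: "(\<Oplus>i\<in>{..<n}. c i \<otimes> (b [^] i \<otimes> a [^] (n - i))) \<in> carrier R"
    using c(1) aR b(1) by (intro finsum_closed) auto
  have "a \<otimes> b [^] n = (\<Oplus>i\<in>{..<n}. a [^] n \<otimes> (c i \<otimes> d i))"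
    unfolding d_pow[symmetric] unfolding c(2) using c(1) dR aR by (intro finsum_rdistr) auto
  also have "\<dots> = (\<Oplus>i\<in>{..<n}. a \<otimes> (c i \<otimes> (b [^] i \<otimes> a [^] (n - i))))"
  proof (intro finsum_cong')
    fix i assume i: "i \<in> {..<n}"
    have ci: "c i \<in> carrier R" using c(1) i by auto
    have "a [^] n = a [^] (n - i) \<otimes> a [^] i" using i aR by (simp add: nat_pow_mult)
    then have "a [^] n \<otimes> (c i \<otimes> d i) = a [^] (n - i) \<otimes> (c i \<otimes> (a [^] i \<otimes> d i))"
      using ci aR dR by (simp add: m_ac)
    also have "\<dots> = a \<otimes> (c i \<otimes> (b [^] i \<otimes> a [^] (n - i)))"
      unfolding d_pow using ci aR b(1) by (simp add: m_ac)
    finally show "a [^] n \<otimes> (c i \<otimes> d i) = a \<otimes> (c i \<otimes> (b [^] i \<otimes> a [^] (n - i)))" .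
  qed (use c(1) aR b(1) in auto)
  also have "\<dots> = a \<otimes> (\<Oplus>i\<in>{..<n}. c i \<otimes> (b [^] i \<otimes> a [^] (n - i)))"
    using c(1) aR b(1) by (intro finsum_rdistr[symmetric]) auto
  finally have eq: "b [^] n = (\<Oplus>i\<in>{..<n}. c i \<otimes> (b [^] i \<otimes> a [^] (n - i)))"
    using m_lcancel[OF a(2) aR _ sumR] b(1) by simp
  \<comment> \<open>\<open>integrally_closed_domain\<close> wants the equation in the form "sum
    equals zero", hence the change of signs.\<close>
  define c' where "c' i = \<ominus> c i" for i
  have c': "c' \<in> {..<n} \<rightarrow> carrier R" using c(1) unfolding c'_def by auto
  have "(\<Oplus>i\<in>{..<n}. c' i \<otimes> (b [^] i \<otimes> a [^] (n - i)))
      = (\<Oplus>i\<in>{..<n}. (\<ominus> \<one>) \<otimes> (c i \<otimes> (b [^] i \<otimes> a [^] (n - i))))"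
    using c(1) aR b(1) by (intro finsum_cong') (auto simp: c'_def l_minus Pi_iff)
  also have "\<dots> = (\<ominus> \<one>) \<otimes> (\<Oplus>i\<in>{..<n}. c i \<otimes> (b [^] i \<otimes> a [^] (n - i)))"
    using c(1) aR b(1) by (intro finsum_rdistr[symmetric]) auto
  also have "\<dots> = \<ominus> (b [^] n)" unfolding eq[symmetric] using b(1) by (simp add: l_minus)
  finally have "b [^] n \<oplus> (\<Oplus>i\<in>{..<n}. c' i \<otimes> (b [^] i \<otimes> a [^] (n - i))) = \<zero>"
    using b(1) by (simp add: r_neg)
  then obtain y where "y \<in> carrier R" "b = y \<otimes> a"
    using int_closed b(1) aR a(2) c' unfolding integrally_closed_domain_def by blast
  then show False using b(2) by blast
qed

text \<open>By \<open>colon_witness\<close> the fractional ideal \<open>(b/a) m\<close>, which lies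
  in R, is not contained in \<open>m\<close>: some \<open>t\<close> in \<open>m\<close> has
  \<open>t b = v a\<close> with a unit \<open>v\<close>. For \<open>x\<close> in \<open>m\<close>
  with \<open>x b = y a\<close>, cross-multiplying and cancelling \<open>a\<close> gives
  \<open>x v = y t\<close>, so \<open>x\<close> is a multiple of \<open>t\<close>.\<close>

lemma principal_generator:
  obtains t where "t \<in> m" "t \<noteq> \<zero>" "\<And>x. x \<in> m \<Longrightarrow> \<exists>y\<in>carrier R. x = y \<otimes> t"
proof -
  obtain a where a: "a \<in> m" "a \<noteq> \<zero>" by (rule m_nonzero)
  then have aR: "a \<in> carrier R" using m_carrier by simp
  obtain b where b: "b \<in> carrier R" "\<And>y. y \<in> carrier R \<Longrightarrow> b \<noteq> y \<otimes> a"
    and mb: "\<And>x. x \<in> m \<Longrightarrow> \<exists>y\<in>carrier R. x \<otimes> b = y \<otimes> a" using associated_prime[OF a] by blast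
  obtain t where t: "t \<in> m" "\<not> (\<exists>y\<in>m. t \<otimes> b = y \<otimes> a)" using colon_witness[OF a b] by blast
  then have tR: "t \<in> carrier R" using m_carrier by simp
  obtain v where v: "v \<in> carrier R" "t \<otimes> b = v \<otimes> a" using mb[OF t(1)] by blast
  then have vU: "v \<in> Units R" using t(2) nonunit_iff by blast
  have "\<exists>y\<in>carrier R. x = y \<otimes> t" if x: "x \<in> m" for x
  proof -
    have xR: "x \<in> carrier R" using x m_carrier by simp
    obtain y where y: "y \<in> carrier R" "x \<otimes> b = y \<otimes> a" using mb[OF x] by blast
    have "a \<otimes> (x \<otimes> v) = x \<otimes> (v \<otimes> a)" using xR aR v by (simp add: m_ac)
    also have "\<dots> = t \<otimes> (x \<otimes> b)" unfolding v(2)[symmetric] using tR xR b(1) by (simp add: m_lcomm)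
    also have "\<dots> = a \<otimes> (y \<otimes> t)" unfolding y(2) using tR y aR by (simp add: m_ac)
    finally have "x \<otimes> v = y \<otimes> t"
      by (rule m_lcancel[OF a(2) aR, THEN iffD1, rotated 2]) (use xR v y tR in auto)
    then have "x \<otimes> v \<otimes> inv v = y \<otimes> t \<otimes> inv v" by simp
    moreover have "x \<otimes> v \<otimes> inv v = x"
      using xR vU v(1) m_assoc[of x v "inv v"] by simp
    moreover have "y \<otimes> t \<otimes> inv v = (y \<otimes> inv v) \<otimes> t"
      using y(1) tR Units_inv_closed[OF vU] by (simp add: m_ac)
    ultimately show ?thesis using y vU by (intro bexI[of _ "y \<otimes> inv v"]) auto
  qed
  moreover have "t \<noteq> \<zero>"
  proof
    assume "t = \<zero>"
    then have "t \<otimes> b = \<zero> \<otimes> a" using b(1) aR by simp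
    moreover have "\<zero> \<in> m" using m_ideal by (simp add: additive_subgroup.zero_closed ideal.axioms(1))
    ultimately show False using t(2) by blast
  qed
  ultimately show ?thesis using that t(1) by blast
qed

lemma uniformizer_iff:
  "uniformizer R t \<longleftrightarrow> t \<in> m \<and> (\<forall>x\<in>m. \<exists>y\<in>carrier R. x = y \<otimes> t)"
proof
  assume u: "uniformizer R t"
  then have tR: "t \<in> carrier R" and "PIdl t = m" unfolding uniformizer_def using max_unique by auto
  then show "t \<in> m \<and> (\<forall>x\<in>m. \<exists>y\<in>carrier R. x = y \<otimes> t)"
    using cgenideal_self[OF tR] unfolding cgenideal_def by auto
next
  assume t: "t \<in> m \<and> (\<forall>x\<in>m. \<exists>y\<in>carrier R. x = y \<otimes> t)"
  have "PIdl t = m"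
  proof
    show "PIdl t \<subseteq> m" using t by (intro cgenideal_minimal[OF m_ideal]) auto
    show "m \<subseteq> PIdl t" using t unfolding cgenideal_def by blast
  qed
  then show "uniformizer R t" unfolding uniformizer_def using max_m t m_carrier by simp
qed

lemma uniformizer_exists: obtains t where "uniformizer R t" "t \<noteq> \<zero>"
proof -
  obtain t where "t \<in> m" "t \<noteq> \<zero>" "\<And>x. x \<in> m \<Longrightarrow> \<exists>y\<in>carrier R. x = y \<otimes> t"
    by (rule principal_generator) blast
  then show ?thesis using that uniformizer_iff by blast
qed

text \<open>If there were no factorisation, division by \<open>t\<close> could be repeated for ever.
  The successive quotients \<open>d n\<close> generate an ascending chain of principal ideals, and a
  repetition in this chain makes \<open>t\<close> a unit.\<close>

lemma uniformizer_factor: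
  assumes t: "uniformizer R t" "t \<noteq> \<zero>" and x: "x \<in> carrier R" "x \<noteq> \<zero>"
  shows "\<exists>v\<in>Units R. \<exists>n::nat. x = v \<otimes> t [^] n"
proof (rule ccontr)
  assume neg: "\<not> ?thesis"
  have tm: "t \<in> m" and div: "\<And>x. x \<in> m \<Longrightarrow> \<exists>y\<in>carrier R. x = y \<otimes> t"
    using t(1) unfolding uniformizer_iff by auto
  have tR: "t \<in> carrier R" using tm m_carrier by simp
  define step where "step x = (SOME y. y \<in> carrier R \<and> x = y \<otimes> t)" for x
  have step: "step x \<in> carrier R" "x = step x \<otimes> t" if "x \<in> m" for x
  proof -
    have "\<exists>y. y \<in> carrier R \<and> x = y \<otimes> t" using div[OF that] by blast
    from someI_ex[OF this] show "step x \<in> carrier R" "x = step x \<otimes> t" unfolding step_def by auto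
  qed
  define d where "d n = (step ^^ n) x" for n
  have d: "d n \<in> carrier R \<and> x = d n \<otimes> t [^] n" for n
  proof (induction n)
    case 0
    then show ?case using x by (simp add: d_def)
  next
    case (Suc n)
    then have "d n \<in> m" using neg nonunit_iff by blast
    then have s: "d (Suc n) \<in> carrier R" "d n = d (Suc n) \<otimes> t"
      using step[of "d n"] by (simp_all add: d_def)
    have "x = (d (Suc n) \<otimes> t) \<otimes> t [^] n" using Suc.IH s(2) by simp
    then show ?case using s(1) tR by (simp add: m_ac)
  qed
  have dm: "d n \<in> m" for n using d[of n] neg nonunit_iff by blast
  have dS: "d n = d (Suc n) \<otimes> t" for n using step(2)[OF dm[of n]] by (simp add: d_def)
  have d0: "d n \<noteq> \<zero>" for n using d[of n] x tR by auto
  have A: "ideal (PIdl (d n)) R" for n using d cgenideal_ideal by simp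
  have B: "PIdl (d n) \<subseteq> PIdl (d (Suc n))" for n
  proof (rule cgenideal_minimal)
    show "ideal (PIdl (d (Suc n))) R" using d cgenideal_ideal by simp
    show "d n \<in> PIdl (d (Suc n))" using dS[of n] d[of "Suc n"] tR m_comm
      unfolding cgenideal_def by auto
  qed
  obtain n where n: "PIdl (d (Suc n)) = PIdl (d n)"
    by (rule ascending_chain_stationary[of "\<lambda>n. PIdl (d n)", OF A B])
  have "d (Suc n) \<in> PIdl (d n)" unfolding n[symmetric] using d cgenideal_self by simp
  then obtain c where c: "c \<in> carrier R" "d (Suc n) = c \<otimes> d n" unfolding cgenideal_def by auto
  have dR: "d (Suc n) \<in> carrier R" using d by simp
  have "d (Suc n) \<otimes> \<one> = c \<otimes> (d (Suc n) \<otimes> t)" using c dS[of n] dR by simp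
  also have "\<dots> = d (Suc n) \<otimes> (c \<otimes> t)" using c dR tR by (simp add: m_lcomm)
  finally have "\<one> = c \<otimes> t"
    by (rule m_lcancel[OF d0 dR, THEN iffD1, rotated 2]) (use c tR in auto)
  then have "t \<in> Units R" using c tR m_comm[of c t] unfolding Units_def by auto
  then show False using nonunit_iff[OF tR] tm by blast
qed

end

lemma dim_one_localI:
  assumes "local_ring R" "noetherian_ring R" "integrally_closed_domain R" "has_krull_dim R 1"
  shows "dim_one_local R (THE m. maximalideal m R)"
proof -
  obtain M where M: "maximalideal M R" "\<And>M'. maximalideal M' R \<Longrightarrow> M' = M"
    using assms(1) unfolding local_ring_def by auto
  then have "(THE m. maximalideal m R) = M" by (intro the_equality) blast+
  moreover have "domain R" using assms(3) unfolding integrally_closed_domain_def by blast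
  ultimately show ?thesis unfolding dim_one_local_def dim_one_local_axioms_def
    using M assms by blast
qed

section \<open>The Frobenius endomorphism\<close>

lemma (in cring) binomial_expansion:
  assumes x: "x \<in> carrier R" and y: "y \<in> carrier R"
  shows "(x \<oplus> y) [^] (n::nat) = (\<Oplus>k\<in>{..n}. add_pow R (n choose k) (x [^] k \<otimes> y [^] (n - k)))"
proof (induction n)
  case 0
  show ?case using x y by simp
next
  case (Suc n)
  define S where "S = (\<Oplus>k\<in>{..n}. add_pow R (n choose k) (x [^] k \<otimes> y [^] (n - k)))"
  define g where "g k = add_pow R (n choose k) (x [^] k \<otimes> y [^] (Suc n - k))" for k
  define f where "f k = add_pow R (n choose k) (x [^] Suc k \<otimes> y [^] (n - k))" for k
  have SR: "S \<in> carrier R" unfolding S_def using x y by (intro finsum_closed) auto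
  have gR: "g \<in> UNIV \<rightarrow> carrier R" and fR: "f \<in> UNIV \<rightarrow> carrier R"
    unfolding g_def f_def using x y by auto
  have Sx: "x \<otimes> S = (\<Oplus>k\<in>{..n}. f k)"
  proof -
    have "x \<otimes> S = (\<Oplus>k\<in>{..n}. x \<otimes> (add_pow R (n choose k) (x [^] k \<otimes> y [^] (n - k))))"
      unfolding S_def using x y by (intro finsum_rdistr) auto
    also have "\<dots> = (\<Oplus>k\<in>{..n}. f k)"
      using x y fR by (intro finsum_cong') (auto simp: f_def add_pow_rdistr m_ac)
    finally show ?thesis .
  qed
  have Sy: "y \<otimes> S = (\<Oplus>k\<in>{..n}. g k)"
  proof -
    have "y \<otimes> S = (\<Oplus>k\<in>{..n}. y \<otimes> (add_pow R (n choose k) (x [^] k \<otimes> y [^] (n - k))))"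
      unfolding S_def using x y by (intro finsum_rdistr) auto
    also have "\<dots> = (\<Oplus>k\<in>{..n}. g k)"
    proof (intro finsum_cong')
      fix k assume "k \<in> {..n}"
      then have "Suc n - k = Suc (n - k)" by auto
      then show "y \<otimes> (add_pow R (n choose k) (x [^] k \<otimes> y [^] (n - k))) = g k"
        using x y by (simp add: g_def add_pow_rdistr m_ac)
    qed (use gR in auto)
    finally show ?thesis .
  qed
  \<comment> \<open>The binomial coefficient just outside the triangle is zero. It lengthens the sum
    by one term, so that it can be shifted and combined with the other sum by Pascal's rule.\<close>
  have "g (Suc n) = \<zero>" unfolding g_def by (simp add: binomial_eq_0)
  then have "y \<otimes> S = (\<Oplus>k\<in>{..Suc n}. g k)"
    unfolding Sy using gR by (subst finsum_Suc) (auto intro!: finsum_closed simp: Pi_iff)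
  also have "\<dots> = (\<Oplus>k\<in>{..n}. g (Suc k)) \<oplus> g 0"
    using gR by (intro finsum_Suc2) auto
  finally have Sy': "y \<otimes> S = (\<Oplus>k\<in>{..n}. g (Suc k)) \<oplus> g 0" .
  have "(\<Oplus>k\<in>{..Suc n}. add_pow R (Suc n choose k) (x [^] k \<otimes> y [^] (Suc n - k)))
      = (\<Oplus>k\<in>{..n}. add_pow R (Suc n choose Suc k) (x [^] Suc k \<otimes> y [^] (Suc n - Suc k)))
        \<oplus> add_pow R (Suc n choose 0) (x [^] (0::nat) \<otimes> y [^] (Suc n - 0))"
    using x y by (intro finsum_Suc2) auto
  also have "(\<Oplus>k\<in>{..n}. add_pow R (Suc n choose Suc k) (x [^] Suc k \<otimes> y [^] (Suc n - Suc k)))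
      = (\<Oplus>k\<in>{..n}. f k \<oplus> g (Suc k))"
    using x y by (intro finsum_cong') (auto simp: f_def g_def add.nat_pow_mult)
  also have "\<dots> = (\<Oplus>k\<in>{..n}. f k) \<oplus> (\<Oplus>k\<in>{..n}. g (Suc k))"
    using fR gR by (intro finsum_addf) (auto simp: Pi_iff)
  also have "add_pow R (Suc n choose 0) (x [^] (0::nat) \<otimes> y [^] (Suc n - 0)) = g 0"
    unfolding g_def by simp
  also have "(\<Oplus>k\<in>{..n}. f k) \<oplus> (\<Oplus>k\<in>{..n}. g (Suc k)) \<oplus> g 0
      = (\<Oplus>k\<in>{..n}. f k) \<oplus> ((\<Oplus>k\<in>{..n}. g (Suc k)) \<oplus> g 0)"
    using fR gR by (intro a_assoc finsum_closed) (auto simp: Pi_iff)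
  also have "\<dots> = x \<otimes> S \<oplus> y \<otimes> S" unfolding Sx Sy' ..
  also have "\<dots> = (x \<oplus> y) \<otimes> S" using x y SR by (simp add: l_distr)
  also have "\<dots> = (x \<oplus> y) [^] Suc n" using Suc.IH x y SR unfolding S_def[symmetric]
    by (simp add: m_comm)
  finally show ?case ..
qed

text \<open>The binomial coefficients strictly between the two ends are divisible by
  \<open>p\<close>. Additivity of Frobenius is what makes sets such as
  \<open>{c. c^p b \<in> S}\<close> closed under addition in the next lemma.\<close>

lemma (in cring) frobenius_add:
  assumes p: "Factorial_Ring.prime (p::nat)" and char: "add_pow R p \<one> = \<zero>"
    and x: "x \<in> carrier R" and y: "y \<in> carrier R"
  shows "(x \<oplus> y) [^] p = x [^] p \<oplus> y [^] p"
proof -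
  have pz: "add_pow R p z = \<zero>" if z: "z \<in> carrier R" for z
  proof -
    have "add_pow R p z = (add_pow R p \<one>) \<otimes> z" using z by (simp add: add_pow_ldistr)
    then show ?thesis using char z by simp
  qed
  have pz: "add_pow R (p * m) z = \<zero>" if z: "z \<in> carrier R" for m z
    using z pz[of "add_pow R m z"] add.nat_pow_pow[of z p m] by (simp add: mult.commute)
  obtain n where n: "p = Suc n" using p by (metis not0_implies_Suc not_prime_0)
  define f where "f k = add_pow R (p choose k) (x [^] k \<otimes> y [^] (p - k))" for k
  have fR: "f k \<in> carrier R" for k unfolding f_def using x y by simp
  obtain n' where n': "n = Suc n'" using p n by (metis not0_implies_Suc One_nat_def not_prime_1)
  have f0: "f (Suc k) = \<zero>" if "k \<le> n'" for k
  proof -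
    have "p dvd (p choose Suc k)" using p that n n' by (intro dvd_choose_prime) auto
    then obtain m where "p choose Suc k = p * m" by (elim dvdE)
    then show ?thesis unfolding f_def using pz x y by simp
  qed
  have "(x \<oplus> y) [^] p = (\<Oplus>k\<in>{..Suc n}. f k)"
    unfolding binomial_expansion[OF x y] f_def n ..
  also have "\<dots> = f (Suc n) \<oplus> (\<Oplus>k\<in>{..n}. f k)" using fR by (intro finsum_Suc) auto
  also have "(\<Oplus>k\<in>{..n}. f k) = (\<Oplus>k\<in>{..n'}. f (Suc k)) \<oplus> f 0"
    unfolding n' using fR by (intro finsum_Suc2) auto
  also have "(\<Oplus>k\<in>{..n'}. f (Suc k)) = (\<Oplus>k\<in>{..n'}. \<zero>)" using f0 by (intro finsum_cong') auto
  also have "\<dots> = \<zero>" by (simp add: finsum_zero)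
  also have "f (Suc n) = x [^] p" unfolding f_def n[symmetric] using x by simp
  also have "f 0 = y [^] p" unfolding f_def using y by simp
  finally show ?thesis using x y by simp
qed

text \<open>A finite set generating \<open>R\<close> over its subring of \<open>p\<^sup>e\<close>-th powers, expressed without sums.\<close>

definition power_generating :: "'r ring \<Rightarrow> nat \<Rightarrow> 'r set \<Rightarrow> bool" where
  "power_generating R q B \<longleftrightarrow> B \<subseteq> carrier R \<and>
     (\<forall>S \<subseteq> carrier R. B \<subseteq> S \<and> \<zero>\<^bsub>R\<^esub> \<in> S \<and> (\<forall>x\<in>S. \<forall>y\<in>S. x \<oplus>\<^bsub>R\<^esub> y \<in> S) \<and>
        (\<forall>c\<in>carrier R. \<forall>x\<in>S. c [^]\<^bsub>R\<^esub> q \<otimes>\<^bsub>R\<^esub> x \<in> S) \<longrightarrow> S = carrier R)"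

text \<open>Generators over the p-th powers and generators over the p^e-th powers combine: the
  products \<open>b'^p b\<close> generate over the p^(e+1)-th powers. In the closure form of
  \<open>power_generating\<close> this needs no double sums.\<close>

lemma power_generating_iterate:
  fixes R :: "'r ring" (structure)
  assumes R: "cring R" and p: "Factorial_Ring.prime (p::nat)" and char: "add_pow R p \<one> = \<zero>"
    and B: "B \<subseteq> carrier R" "finite B"
    and gen: "\<And>a. a \<in> carrier R \<Longrightarrow> \<exists>c \<in> B \<rightarrow> carrier R. a = (\<Oplus>b\<in>B. c b [^] p \<otimes> b)"
  shows "\<exists>B'. finite B' \<and> power_generating R (p ^ e) B'"
proof -
  interpret cring R by fact
  show ?thesis
  proof (induction e)
    case 0
    have "power_generating R 1 {\<one>}" unfolding power_generating_def
    proof (intro conjI allI impI)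
      fix S assume S: "S \<subseteq> carrier R" "{\<one>} \<subseteq> S \<and> \<zero> \<in> S \<and> (\<forall>x\<in>S. \<forall>y\<in>S. x \<oplus> y \<in> S) \<and>
        (\<forall>c\<in>carrier R. \<forall>x\<in>S. c [^] (1::nat) \<otimes> x \<in> S)"
      have "c \<in> S" if c: "c \<in> carrier R" for c
      proof -
        have "c [^] (1::nat) \<otimes> \<one> \<in> S" using S c by blast
        then show ?thesis using c by simp
      qed
      then show "S = carrier R" using S by blast
    qed simp
    then show ?case by (intro exI[of _ "{\<one>}"]) simp
  next
    case (Suc e)
    then obtain B' where B': "finite B'" "power_generating R (p ^ e) B'" by blast
    have B'R: "B' \<subseteq> carrier R" using B'(2) unfolding power_generating_def by blast
    define B'' where "B'' = (\<lambda>(b', b). b' [^] p \<otimes> b) ` (B' \<times> B)"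
    have "power_generating R (p ^ Suc e) B''" unfolding power_generating_def
    proof (intro conjI allI impI)
      show "B'' \<subseteq> carrier R" unfolding B''_def using B'R B by auto
      fix S assume S: "S \<subseteq> carrier R" and SS: "B'' \<subseteq> S \<and> \<zero> \<in> S \<and>
        (\<forall>x\<in>S. \<forall>y\<in>S. x \<oplus> y \<in> S) \<and> (\<forall>c\<in>carrier R. \<forall>x\<in>S. c [^] (p ^ Suc e) \<otimes> x \<in> S)"
      note SS' = SS[THEN conjunct2, THEN conjunct2]
      have add: "x \<oplus> y \<in> S" if "x \<in> S" "y \<in> S" for x y
        using SS'[THEN conjunct1] that by simp
      have mult: "c [^] (p ^ Suc e) \<otimes> x \<in> S" if "c \<in> carrier R" "x \<in> S" for c x
        using SS'[THEN conjunct2] that by simp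
      have zS: "\<zero> \<in> S" using SS by simp
      have p0: "p \<noteq> 0" using p by (metis not_prime_0)
      have pb: "c [^] p \<otimes> b \<in> S" if b: "b \<in> B" and c: "c \<in> carrier R" for b c
      proof -
        have bR: "b \<in> carrier R" using b B by auto
        \<comment> \<open>For a fixed \<open>b\<close>, the coefficients \<open>c\<close> with
          \<open>c^p b\<close> in \<open>S\<close> satisfy the closure conditions belonging to
          \<open>B'\<close>, so by the induction hypothesis they are all of R.\<close>
        define T where "T = {c \<in> carrier R. c [^] p \<otimes> b \<in> S}"
        have 1: "T \<subseteq> carrier R" unfolding T_def by blast
        have 2: "B' \<subseteq> T" using B'R b SS unfolding T_def B''_def by auto
        have 3: "\<zero> \<in> T" using zS bR p0 unfolding T_def by (simp add: nat_pow_zero)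
        have 4: "x \<oplus> y \<in> T" if "x \<in> T" "y \<in> T" for x y
        proof -
          have xy: "x \<in> carrier R" "y \<in> carrier R" "x [^] p \<otimes> b \<in> S" "y [^] p \<otimes> b \<in> S"
            using that unfolding T_def by auto
          have "(x \<oplus> y) [^] p \<otimes> b = x [^] p \<otimes> b \<oplus> y [^] p \<otimes> b"
            unfolding frobenius_add[OF p char xy(1,2)] using xy bR by (simp add: l_distr)
          then show ?thesis unfolding T_def using xy add by simp
        qed
        have 5: "d [^] (p ^ e) \<otimes> x \<in> T" if d: "d \<in> carrier R" and "x \<in> T" for d x
        proof -
          have x: "x \<in> carrier R" "x [^] p \<otimes> b \<in> S" using \<open>x \<in> T\<close> unfolding T_def by auto
          have "(d [^] (p ^ e) \<otimes> x) [^] p \<otimes> b = d [^] (p ^ Suc e) \<otimes> (x [^] p \<otimes> b)"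
            using d x bR by (simp add: nat_pow_distrib nat_pow_pow m_assoc mult.commute)
          then show ?thesis unfolding T_def using mult[OF d x(2)] d x by simp
        qed
        have "T = carrier R"
          using B'(2)[unfolded power_generating_def, THEN conjunct2, rule_format, of T] 1 2 3 4 5 by simp
        then show ?thesis using c unfolding T_def by blast
      qed
      have "a \<in> S" if a: "a \<in> carrier R" for a
      proof -
        obtain c where c: "c \<in> B \<rightarrow> carrier R" "a = (\<Oplus>b\<in>B. c b [^] p \<otimes> b)" using gen[OF a] by blast
        have "(\<Oplus>b\<in>B0. c b [^] p \<otimes> b) \<in> S" if "finite B0" "B0 \<subseteq> B" for B0
          using that
        proof (induction rule: finite_induct)
          case empty
          then show ?case using zS by simp
        next
          case (insert b F)
          have "(\<Oplus>b\<in>insert b F. c b [^] p \<otimes> b) = c b [^] p \<otimes> b \<oplus> (\<Oplus>b\<in>F. c b [^] p \<otimes> b)"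
            using insert c(1) B(1) by (intro finsum_insert) (auto simp: Pi_iff subset_iff)
          then show ?case using insert add pb[of b "c b"] c(1) by auto
        qed
        then show ?thesis using c(2) B(2) by blast
      qed
      then show "S = carrier R" using S by blast
    qed
    moreover have "finite B''" unfolding B''_def using B' B by blast
    ultimately show ?case by blast
  qed
qed

section \<open>Germs and stalks\<close>

text \<open>The part of \<open>is_sheaf\<close> on which germs depend. Rings of sections, line
  bundles and sheaves of divisors are all instances, so that facts on germs are proved once.\<close>

locale presheaf_on =
  fixes T :: "'p topology" and C :: "'p set \<Rightarrow> 'a set" and \<rho> :: "'p set \<Rightarrow> 'p set \<Rightarrow> 'a \<Rightarrow> 'a"
  assumes rst_self: "openin T U \<Longrightarrow> s \<in> C U \<Longrightarrow> \<rho> U U s = s"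
    and rst_closed: "openin T U \<Longrightarrow> openin T V \<Longrightarrow> V \<subseteq> U \<Longrightarrow> s \<in> C U \<Longrightarrow> \<rho> U V s \<in> C V"
    and rst_trans: "openin T U \<Longrightarrow> openin T V \<Longrightarrow> openin T V' \<Longrightarrow> V' \<subseteq> V \<Longrightarrow> V \<subseteq> U \<Longrightarrow> s \<in> C U \<Longrightarrow>
      \<rho> V V' (\<rho> U V s) = \<rho> U V' s"
begin

abbreviation "grm \<equiv> germ_class T C \<rho>"

lemma germ_self: "openin T U \<Longrightarrow> x \<in> U \<Longrightarrow> s \<in> C U \<Longrightarrow> (U, s) \<in> grm x U s"
  unfolding germ_class_def by auto

lemma germ_eq_iff:
  assumes U: "openin T U" "x \<in> U" "s \<in> C U" and V: "openin T V" "x \<in> V" "t \<in> C V"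
  shows "grm x U s = grm x V t \<longleftrightarrow>
    (\<exists>V'. openin T V' \<and> x \<in> V' \<and> V' \<subseteq> U \<inter> V \<and> \<rho> U V' s = \<rho> V V' t)"
proof
  assume "grm x U s = grm x V t"
  then have "(V, t) \<in> grm x U s" using germ_self[OF V] by simp
  then show "\<exists>V'. openin T V' \<and> x \<in> V' \<and> V' \<subseteq> U \<inter> V \<and> \<rho> U V' s = \<rho> V V' t"
    unfolding germ_class_def by blast
next
  have key: "grm x V t \<subseteq> grm x U s"
    if "openin T U" "s \<in> C U" "openin T V" "t \<in> C V"
      "openin T V'" "x \<in> V'" "V' \<subseteq> U \<inter> V" "\<rho> U V' s = \<rho> V V' t" for U s V t V'
  proof
    fix w assume "w \<in> grm x V t"
    then obtain Z z Z' where w: "w = (Z, z)" "openin T Z" "x \<in> Z" "z \<in> C Z" "openin T Z'" "x \<in> Z'"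
      "Z' \<subseteq> V \<inter> Z" "\<rho> V Z' t = \<rho> Z Z' z" unfolding germ_class_def by blast
    have o: "openin T (V' \<inter> Z')" using that w by blast
    have "\<rho> U (V' \<inter> Z') s = \<rho> V' (V' \<inter> Z') (\<rho> U V' s)"
      using that o by (intro rst_trans[symmetric]) auto
    also have "\<dots> = \<rho> V (V' \<inter> Z') t"
      unfolding that(8) using that o by (intro rst_trans) auto
    also have "\<dots> = \<rho> Z' (V' \<inter> Z') (\<rho> V Z' t)"
      using that w o by (intro rst_trans[symmetric]) auto
    also have "\<dots> = \<rho> Z (V' \<inter> Z') z" unfolding w(8) using w o by (intro rst_trans) auto
    finally have "\<rho> U (V' \<inter> Z') s = \<rho> Z (V' \<inter> Z') z" .
    moreover have "x \<in> V' \<inter> Z'" "V' \<inter> Z' \<subseteq> U \<inter> Z" using that w by auto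
    ultimately have "\<exists>V'. openin T V' \<and> x \<in> V' \<and> V' \<subseteq> U \<inter> Z \<and> \<rho> U V' s = \<rho> Z V' z"
      using o by blast
    then show "w \<in> grm x U s" unfolding germ_class_def w(1) using w(2-4) by blast
  qed
  assume "\<exists>V'. openin T V' \<and> x \<in> V' \<and> V' \<subseteq> U \<inter> V \<and> \<rho> U V' s = \<rho> V V' t"
  then obtain V' where V': "openin T V'" "x \<in> V'" "V' \<subseteq> U \<inter> V" "\<rho> U V' s = \<rho> V V' t" by blast
  then show "grm x U s = grm x V t"
    using key[OF U(1,3) V(1,3) V'] key[OF V(1,3) U(1,3) V'(1,2) _ V'(4)[symmetric]]
    by (auto simp: Int_commute)
qed

lemma germ_mem:
  assumes U: "openin T U" "x \<in> U" "s \<in> C U" and "(V, t) \<in> grm x U s"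
  shows "openin T V" "x \<in> V" "t \<in> C V" "grm x V t = grm x U s"
proof -
  show V: "openin T V" "x \<in> V" "t \<in> C V" using assms(4) unfolding germ_class_def by auto
  have "\<exists>V'. openin T V' \<and> x \<in> V' \<and> V' \<subseteq> U \<inter> V \<and> \<rho> U V' s = \<rho> V V' t"
    using assms(4) unfolding germ_class_def by blast
  then show "grm x V t = grm x U s" using germ_eq_iff[OF U V] by simp
qed

lemma germ_rst:
  assumes "openin T U" "openin T V" "V \<subseteq> U" "x \<in> V" "s \<in> C U"
  shows "grm x V (\<rho> U V s) = grm x U s"
proof (subst germ_eq_iff)
  have "\<rho> V V (\<rho> U V s) = \<rho> U V s" using assms by (intro rst_self) (auto intro: rst_closed)
  then show "\<exists>V'. openin T V' \<and> x \<in> V' \<and> V' \<subseteq> V \<inter> U \<and> \<rho> V V' (\<rho> U V s) = \<rho> U V' s"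
    using assms by (intro exI[of _ V]) auto
qed (use assms in \<open>auto intro: rst_closed\<close>)

text \<open>Operations on stalks are defined as unions over all representatives of a germ. If the
  expression is the same set for every representative, the union collapses to it; well-definedness
  and evaluation thus become one statement.\<close>

lemma UN_germ:
  assumes U: "openin T U" "x \<in> U" "s \<in> C U"
    and "\<And>V t. openin T V \<Longrightarrow> x \<in> V \<Longrightarrow> t \<in> C V \<Longrightarrow> grm x V t = grm x U s \<Longrightarrow> F V t = c"
  shows "(\<Union>(V, t)\<in>grm x U s. F V t) = c"
proof -
  have "F V t = c" if "(V, t) \<in> grm x U s" for V t
    using germ_mem[OF U that] assms(4) by blast
  then have "(case w of (V, t) \<Rightarrow> F V t) = c" if "w \<in> grm x U s" for w
    using that by (cases w) simp
  then show ?thesis using germ_self[OF U] by (intro SUP_eq_const) auto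
qed

end

text \<open>Sum and product of germs and the action of ring germs on module germs share this
  pattern, hence three presheaves and an arbitrary operation \<open>f\<close> that commutes with
  restriction. Other representatives are compared with the given ones on the intersection of two
  neighbourhoods of agreement.\<close>

lemma binary_germ:
  assumes "presheaf_on T C1 \<rho>1" "presheaf_on T C2 \<rho>2" "presheaf_on T C3 \<rho>3"
    and cl: "\<And>U s t. openin T U \<Longrightarrow> s \<in> C1 U \<Longrightarrow> t \<in> C2 U \<Longrightarrow> f U s t \<in> C3 U"
    and compat: "\<And>U V s t. openin T U \<Longrightarrow> openin T V \<Longrightarrow> V \<subseteq> U \<Longrightarrow> s \<in> C1 U \<Longrightarrow> t \<in> C2 U \<Longrightarrow>
      \<rho>3 U V (f U s t) = f V (\<rho>1 U V s) (\<rho>2 U V t)"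
    and U: "openin T U" "x \<in> U" "s \<in> C1 U" "t \<in> C2 U"
  shows "(\<Union>(U', s')\<in>germ_class T C1 \<rho>1 x U s. \<Union>(V', t')\<in>germ_class T C2 \<rho>2 x U t.
      germ_class T C3 \<rho>3 x (U' \<inter> V') (f (U' \<inter> V') (\<rho>1 U' (U' \<inter> V') s') (\<rho>2 V' (U' \<inter> V') t')))
    = germ_class T C3 \<rho>3 x U (f U s t)"
proof -
  interpret A: presheaf_on T C1 \<rho>1 by fact
  interpret B: presheaf_on T C2 \<rho>2 by fact
  interpret D: presheaf_on T C3 \<rho>3 by fact
  have "D.grm x (U' \<inter> V') (f (U' \<inter> V') (\<rho>1 U' (U' \<inter> V') s') (\<rho>2 V' (U' \<inter> V') t')) = D.grm x U (f U s t)"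
    if U': "openin T U'" "x \<in> U'" "s' \<in> C1 U'" "A.grm x U' s' = A.grm x U s"
      and V': "openin T V'" "x \<in> V'" "t' \<in> C2 V'" "B.grm x V' t' = B.grm x U t" for U' s' V' t'
  proof -
    obtain P where P: "openin T P" "x \<in> P" "P \<subseteq> U' \<inter> U" "\<rho>1 U' P s' = \<rho>1 U P s"
      using A.germ_eq_iff[OF U'(1-3) U(1-3)] U'(4) by blast
    obtain Q where Q: "openin T Q" "x \<in> Q" "Q \<subseteq> V' \<inter> U" "\<rho>2 V' Q t' = \<rho>2 U Q t"
      using B.germ_eq_iff[OF V'(1-3) U(1,2,4)] V'(4) by blast
    let ?I = "U' \<inter> V'" and ?W = "P \<inter> Q"
    have o: "openin T ?I" "openin T ?W" using U' V' P Q by auto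
    have s: "\<rho>1 U' ?I s' \<in> C1 ?I" "\<rho>2 V' ?I t' \<in> C2 ?I"
      using U' V' o by (auto intro: A.rst_closed B.rst_closed)
    have "\<rho>3 ?I ?W (f ?I (\<rho>1 U' ?I s') (\<rho>2 V' ?I t')) = f ?W (\<rho>1 ?I ?W (\<rho>1 U' ?I s')) (\<rho>2 ?I ?W (\<rho>2 V' ?I t'))"
      using P Q by (intro compat o s) auto
    also have "\<rho>1 ?I ?W (\<rho>1 U' ?I s') = \<rho>1 U' ?W s'" using o U' P Q by (intro A.rst_trans) auto
    also have "\<dots> = \<rho>1 P ?W (\<rho>1 U' P s')" using o U' P by (intro A.rst_trans[symmetric]) auto
    also have "\<dots> = \<rho>1 U ?W s" unfolding P(4) using o U P by (intro A.rst_trans) auto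
    also have "\<rho>2 ?I ?W (\<rho>2 V' ?I t') = \<rho>2 V' ?W t'" using o V' P Q by (intro B.rst_trans) auto
    also have "\<dots> = \<rho>2 Q ?W (\<rho>2 V' Q t')" using o V' Q by (intro B.rst_trans[symmetric]) auto
    also have "\<dots> = \<rho>2 U ?W t" unfolding Q(4) using o U Q by (intro B.rst_trans) auto
    also have "f ?W (\<rho>1 U ?W s) (\<rho>2 U ?W t) = \<rho>3 U ?W (f U s t)"
      using o U P by (intro compat[symmetric]) auto
    finally have "\<rho>3 ?I ?W (f ?I (\<rho>1 U' ?I s') (\<rho>2 V' ?I t')) = \<rho>3 U ?W (f U s t)" .
    moreover have "x \<in> ?W" "?W \<subseteq> ?I \<inter> U" using P Q by auto
    ultimately have ex: "\<exists>Z. openin T Z \<and> x \<in> Z \<and> Z \<subseteq> ?I \<inter> U \<and>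
      \<rho>3 ?I Z (f ?I (\<rho>1 U' ?I s') (\<rho>2 V' ?I t')) = \<rho>3 U Z (f U s t)"
      using o(2) by (intro exI[of _ ?W]) simp
    have xi: "x \<in> ?I" using U' V' by blast
    show ?thesis
      using D.germ_eq_iff[OF o(1) xi cl[OF o(1) s] U(1,2) cl[OF U(1,3,4)]] ex by simp
  qed
  then show ?thesis
    using U by (intro A.UN_germ B.UN_germ) auto
qed

lemma is_sheaf_presheaf: "is_sheaf T C \<rho> \<Longrightarrow> presheaf_on T C \<rho>"
  unfolding is_sheaf_def by unfold_locales (simp_all add: Pi_iff)

locale ringed_space_loc =
  fixes X :: "('p, 'r) ringed_space"
  assumes ringed: "ringed_space X"
begin

lemma sheaf: "is_sheaf (top_of X) (\<lambda>U. carrier (sec X U)) (rst X)"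
  using ringed unfolding ringed_space_def by blast

sublocale presheaf_on "top_of X" "\<lambda>U. carrier (sec X U)" "rst X"
  by (rule is_sheaf_presheaf[OF sheaf])

lemma sec_cring: "open_in X U \<Longrightarrow> cring (sec X U)"
  using ringed unfolding ringed_space_def by blast

lemma rst_hom: "open_in X U \<Longrightarrow> open_in X V \<Longrightarrow> V \<subseteq> U \<Longrightarrow> rst X U V \<in> ring_hom (sec X U) (sec X V)"
  using ringed unfolding ringed_space_def by blast

lemma rst_hom_cring:
  "open_in X U \<Longrightarrow> open_in X V \<Longrightarrow> V \<subseteq> U \<Longrightarrow> ring_hom_cring (sec X U) (sec X V) (rst X U V)"
  by (simp add: ring_hom_cring_def ring_hom_cring_axioms_def sec_cring rst_hom)

lemma open_points: "open_in X U \<Longrightarrow> U \<subseteq> points X"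
  by (rule openin_subset)

lemma open_all: "open_in X (points X)"
  by (rule openin_topspace)

lemma stalk_carrier_iff:
  "a \<in> carrier (stalk X x) \<longleftrightarrow> (\<exists>U s. open_in X U \<and> x \<in> U \<and> s \<in> carrier (sec X U) \<and> a = germ X x U s)"
  unfolding stalk_def by auto

lemma germ_closed [intro]:
  "open_in X U \<Longrightarrow> x \<in> U \<Longrightarrow> s \<in> carrier (sec X U) \<Longrightarrow> germ X x U s \<in> carrier (stalk X x)"
  unfolding stalk_carrier_iff by blast

lemma germ_restrict:
  assumes "open_in X U" "open_in X V" "V \<subseteq> U" "x \<in> V" "s \<in> carrier (sec X U)"
  shows "germ X x V (rst X U V s) = germ X x U s"
  unfolding germ_def by (rule germ_rst[OF assms])

lemma germ_eqE:
  assumes "germ X x U s = germ X x V t" "open_in X U" "x \<in> U" "s \<in> carrier (sec X U)"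
    "open_in X V" "x \<in> V" "t \<in> carrier (sec X V)"
  obtains V' where "open_in X V'" "x \<in> V'" "V' \<subseteq> U" "V' \<subseteq> V" "rst X U V' s = rst X V V' t"
  using assms germ_eq_iff[of U x s V t] unfolding germ_def by auto

lemma germ_mult:
  assumes "open_in X U" "x \<in> U" "s \<in> carrier (sec X U)" "t \<in> carrier (sec X U)"
  shows "germ X x U s \<otimes>\<^bsub>stalk X x\<^esub> germ X x U t = germ X x U (s \<otimes>\<^bsub>sec X U\<^esub> t)"
proof -
  have "(\<Union>(U', s')\<in>grm x U s. \<Union>(V', t')\<in>grm x U t.
      grm x (U' \<inter> V') (rst X U' (U' \<inter> V') s' \<otimes>\<^bsub>sec X (U' \<inter> V')\<^esub> rst X V' (U' \<inter> V') t'))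
    = grm x U (s \<otimes>\<^bsub>sec X U\<^esub> t)"
  proof (rule binary_germ[OF presheaf_on_axioms presheaf_on_axioms presheaf_on_axioms])
    fix U s t assume "open_in X U" "s \<in> carrier (sec X U)" "t \<in> carrier (sec X U)"
    then show "s \<otimes>\<^bsub>sec X U\<^esub> t \<in> carrier (sec X U)"
      using cring.axioms(1)[OF sec_cring] by (simp add: ring.ring_simprules(5))
  next
    fix U V s t assume "open_in X U" "open_in X V" "V \<subseteq> U" "s \<in> carrier (sec X U)" "t \<in> carrier (sec X U)"
    then show "rst X U V (s \<otimes>\<^bsub>sec X U\<^esub> t) = rst X U V s \<otimes>\<^bsub>sec X V\<^esub> rst X U V t"
      using rst_hom by (simp add: ring_hom_mult)
  qed (use assms in auto)
  then show ?thesis unfolding stalk_def germ_def by simp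
qed

lemma germ_add:
  assumes "open_in X U" "x \<in> U" "s \<in> carrier (sec X U)" "t \<in> carrier (sec X U)"
  shows "germ X x U s \<oplus>\<^bsub>stalk X x\<^esub> germ X x U t = germ X x U (s \<oplus>\<^bsub>sec X U\<^esub> t)"
proof -
  have "(\<Union>(U', s')\<in>grm x U s. \<Union>(V', t')\<in>grm x U t.
      grm x (U' \<inter> V') (rst X U' (U' \<inter> V') s' \<oplus>\<^bsub>sec X (U' \<inter> V')\<^esub> rst X V' (U' \<inter> V') t'))
    = grm x U (s \<oplus>\<^bsub>sec X U\<^esub> t)"
  proof (rule binary_germ[OF presheaf_on_axioms presheaf_on_axioms presheaf_on_axioms])
    fix U s t assume "open_in X U" "s \<in> carrier (sec X U)" "t \<in> carrier (sec X U)"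
    then show "s \<oplus>\<^bsub>sec X U\<^esub> t \<in> carrier (sec X U)"
      using cring.axioms(1)[OF sec_cring] by (simp add: ring.ring_simprules(1))
  next
    fix U V s t assume "open_in X U" "open_in X V" "V \<subseteq> U" "s \<in> carrier (sec X U)" "t \<in> carrier (sec X U)"
    then show "rst X U V (s \<oplus>\<^bsub>sec X U\<^esub> t) = rst X U V s \<oplus>\<^bsub>sec X V\<^esub> rst X U V t"
      using rst_hom by (simp add: ring_hom_add)
  qed (use assms in auto)
  then show ?thesis unfolding stalk_def germ_def by simp
qed

lemma germ_one:
  assumes "open_in X U" "x \<in> U"
  shows "germ X x U \<one>\<^bsub>sec X U\<^esub> = \<one>\<^bsub>stalk X x\<^esub>"
proof -
  have "rst X (points X) U \<one>\<^bsub>sec X (points X)\<^esub> = \<one>\<^bsub>sec X U\<^esub>"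
    by (rule ring_hom_one[OF rst_hom[OF open_all assms(1) open_points[OF assms(1)]]])
  moreover have "\<one>\<^bsub>sec X (points X)\<^esub> \<in> carrier (sec X (points X))"
    using cring.axioms(1)[OF sec_cring[OF open_all]] by (simp add: ring.ring_simprules(6))
  from germ_restrict[OF open_all assms(1) open_points[OF assms(1)] assms(2) this]
  have "germ X x U (rst X (points X) U \<one>\<^bsub>sec X (points X)\<^esub>) = \<one>\<^bsub>stalk X x\<^esub>"
    unfolding stalk_def by simp
  ultimately show ?thesis by simp
qed

lemma germ_zero:
  assumes "open_in X U" "x \<in> U"
  shows "germ X x U \<zero>\<^bsub>sec X U\<^esub> = \<zero>\<^bsub>stalk X x\<^esub>"
proof -
  have "rst X (points X) U \<zero>\<^bsub>sec X (points X)\<^esub> = \<zero>\<^bsub>sec X U\<^esub>"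
    using assms open_all open_points sec_cring rst_hom
    by (intro ring_hom_zero) (auto intro: cring.axioms(1))
  moreover have "\<zero>\<^bsub>sec X (points X)\<^esub> \<in> carrier (sec X (points X))"
    using cring.axioms(1)[OF sec_cring[OF open_all]] by (simp add: ring.ring_simprules(2))
  from germ_restrict[OF open_all assms(1) open_points[OF assms(1)] assms(2) this]
  have "germ X x U (rst X (points X) U \<zero>\<^bsub>sec X (points X)\<^esub>) = \<zero>\<^bsub>stalk X x\<^esub>"
    unfolding stalk_def by simp
  ultimately show ?thesis by simp
qed

lemma common_open2:
  assumes "a \<in> carrier (stalk X x)" "b \<in> carrier (stalk X x)"
  obtains U s t where "open_in X U" "x \<in> U" "s \<in> carrier (sec X U)" "t \<in> carrier (sec X U)"
    "a = germ X x U s" "b = germ X x U t"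
proof -
  obtain U s V t where *: "open_in X U" "x \<in> U" "s \<in> carrier (sec X U)" "a = germ X x U s"
    "open_in X V" "x \<in> V" "t \<in> carrier (sec X V)" "b = germ X x V t"
    using assms unfolding stalk_carrier_iff by blast
  show ?thesis
    by (rule that[of "U \<inter> V" "rst X U (U \<inter> V) s" "rst X V (U \<inter> V) t"])
      (use * in \<open>simp_all add: rst_closed openin_Int germ_restrict\<close>)
qed

lemma germ_Unit:
  assumes "open_in X U" "x \<in> U" "s \<in> Units (sec X U)"
  shows "germ X x U s \<in> Units (stalk X x)"
proof -
  interpret U: cring "sec X U" by (rule sec_cring[OF assms(1)])
  have s: "s \<in> carrier (sec X U)" "inv\<^bsub>sec X U\<^esub> s \<in> carrier (sec X U)" using assms by auto
  have "germ X x U s \<otimes>\<^bsub>stalk X x\<^esub> germ X x U (inv\<^bsub>sec X U\<^esub> s) = \<one>\<^bsub>stalk X x\<^esub>"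
    "germ X x U (inv\<^bsub>sec X U\<^esub> s) \<otimes>\<^bsub>stalk X x\<^esub> germ X x U s = \<one>\<^bsub>stalk X x\<^esub>"
    using assms s by (simp_all add: germ_mult germ_one)
  then show ?thesis unfolding Units_def using s assms by blast
qed

text \<open>The inverse germ has a representative \<open>t\<close>, and the equation
  \<open>s t = 1\<close> between germs already holds on a small neighbourhood.\<close>

lemma Unit_spreads:
  assumes U: "open_in X U" "x \<in> U" "s \<in> carrier (sec X U)" and u: "germ X x U s \<in> Units (stalk X x)"
  obtains V where "open_in X V" "x \<in> V" "V \<subseteq> U" "rst X U V s \<in> Units (sec X V)"
proof -
  obtain b where b: "b \<in> carrier (stalk X x)" "germ X x U s \<otimes>\<^bsub>stalk X x\<^esub> b = \<one>\<^bsub>stalk X x\<^esub>"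
    using u unfolding Units_def by auto
  then obtain V t where V: "open_in X V" "x \<in> V" "t \<in> carrier (sec X V)" "b = germ X x V t"
    unfolding stalk_carrier_iff by blast
  let ?I = "U \<inter> V"
  have o: "open_in X ?I" "x \<in> ?I" using U V by auto
  interpret I: cring "sec X ?I" by (rule sec_cring[OF o(1)])
  have c: "rst X U ?I s \<in> carrier (sec X ?I)" "rst X V ?I t \<in> carrier (sec X ?I)"
    using U V o by (auto intro: rst_closed)
  have "germ X x ?I (rst X U ?I s \<otimes>\<^bsub>sec X ?I\<^esub> rst X V ?I t) = germ X x ?I \<one>\<^bsub>sec X ?I\<^esub>"
    using b V U o c by (simp add: germ_restrict germ_one flip: germ_mult)
  then obtain V' where V': "open_in X V'" "x \<in> V'" "V' \<subseteq> ?I"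
    "rst X ?I V' (rst X U ?I s \<otimes>\<^bsub>sec X ?I\<^esub> rst X V ?I t) = rst X ?I V' \<one>\<^bsub>sec X ?I\<^esub>"
    by (rule germ_eqE) (use o c in auto)
  interpret h: ring_hom_cring "sec X ?I" "sec X V'" "rst X ?I V'"
    by (rule rst_hom_cring[OF o(1) V'(1,3)])
  have "rst X U V' s \<otimes>\<^bsub>sec X V'\<^esub> rst X V V' t = \<one>\<^bsub>sec X V'\<^esub>"
    using V'(4) c U V V' o by (simp add: rst_trans)
  moreover have "rst X U V' s \<in> carrier (sec X V')" "rst X V V' t \<in> carrier (sec X V')"
    using U V V' by (auto intro!: rst_closed)
  ultimately have "rst X U V' s \<in> Units (sec X V')"
    unfolding Units_def using h.S.m_comm[of "rst X V V' t" "rst X U V' s"] by auto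
  then show ?thesis using that V' by blast
qed

end

text \<open>Stalks of modules are governed by restriction and scalars. Both the line bundle and the
  sheaf of a divisor enter the proof through this locale.\<close>

locale module_presheaf = ringed_space_loc X for X :: "('p, 'r) ringed_space" +
  fixes M :: "('p, 'r, 'm) module_sheaf"
  assumes mpresheaf: "presheaf_on (top_of X) (\<lambda>U. carrier (msec M U)) (mrst M)"
    and msec_module: "\<And>U. open_in X U \<Longrightarrow> module (sec X U) (msec M U)"
    and mrst_add: "\<And>U V s t. open_in X U \<Longrightarrow> open_in X V \<Longrightarrow> V \<subseteq> U \<Longrightarrow>
      s \<in> carrier (msec M U) \<Longrightarrow> t \<in> carrier (msec M U) \<Longrightarrow>
      mrst M U V (s \<oplus>\<^bsub>msec M U\<^esub> t) = mrst M U V s \<oplus>\<^bsub>msec M V\<^esub> mrst M U V t"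
    and mrst_smult: "\<And>U V r s. open_in X U \<Longrightarrow> open_in X V \<Longrightarrow> V \<subseteq> U \<Longrightarrow>
      r \<in> carrier (sec X U) \<Longrightarrow> s \<in> carrier (msec M U) \<Longrightarrow>
      mrst M U V (r \<odot>\<^bsub>msec M U\<^esub> s) = rst X U V r \<odot>\<^bsub>msec M V\<^esub> mrst M U V s"
begin

sublocale m: presheaf_on "top_of X" "\<lambda>U. carrier (msec M U)" "mrst M"
  by (rule mpresheaf)

lemma mstalk_carrier_iff:
  "a \<in> carrier (mstalk X M x) \<longleftrightarrow>
    (\<exists>U s. open_in X U \<and> x \<in> U \<and> s \<in> carrier (msec M U) \<and> a = mgerm X M x U s)"
  unfolding mstalk_def by auto

lemma mgerm_closed [intro]:
  "open_in X U \<Longrightarrow> x \<in> U \<Longrightarrow> s \<in> carrier (msec M U) \<Longrightarrow> mgerm X M x U s \<in> carrier (mstalk X M x)"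
  unfolding mstalk_carrier_iff by blast

lemma mgerm_restrict:
  assumes "open_in X U" "open_in X V" "V \<subseteq> U" "x \<in> V" "s \<in> carrier (msec M U)"
  shows "mgerm X M x V (mrst M U V s) = mgerm X M x U s"
  unfolding mgerm_def by (rule m.germ_rst[OF assms])

lemma mgerm_eqE:
  assumes "mgerm X M x U s = mgerm X M x V t" "open_in X U" "x \<in> U" "s \<in> carrier (msec M U)"
    "open_in X V" "x \<in> V" "t \<in> carrier (msec M V)"
  obtains V' where "open_in X V'" "x \<in> V'" "V' \<subseteq> U" "V' \<subseteq> V" "mrst M U V' s = mrst M V V' t"
  using assms m.germ_eq_iff[of U x s V t] unfolding mgerm_def by auto

lemma mgerm_add:
  assumes "open_in X U" "x \<in> U" "s \<in> carrier (msec M U)" "t \<in> carrier (msec M U)"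
  shows "mgerm X M x U s \<oplus>\<^bsub>mstalk X M x\<^esub> mgerm X M x U t = mgerm X M x U (s \<oplus>\<^bsub>msec M U\<^esub> t)"
proof -
  have "(\<Union>(U', s')\<in>m.grm x U s. \<Union>(V', t')\<in>m.grm x U t.
      m.grm x (U' \<inter> V') (mrst M U' (U' \<inter> V') s' \<oplus>\<^bsub>msec M (U' \<inter> V')\<^esub> mrst M V' (U' \<inter> V') t'))
    = m.grm x U (s \<oplus>\<^bsub>msec M U\<^esub> t)"
  proof (rule binary_germ[OF mpresheaf mpresheaf mpresheaf])
    fix U s t assume "open_in X U" "s \<in> carrier (msec M U)" "t \<in> carrier (msec M U)"
    then show "s \<oplus>\<^bsub>msec M U\<^esub> t \<in> carrier (msec M U)"
      using msec_module module.axioms(2) abelian_group.axioms(1) abelian_monoid.a_closed by metis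
  qed (use assms mrst_add in auto)
  then show ?thesis unfolding mstalk_def mgerm_def by simp
qed

lemma mgerm_smult:
  assumes "open_in X U" "x \<in> U" "r \<in> carrier (sec X U)" "s \<in> carrier (msec M U)"
  shows "germ X x U r \<odot>\<^bsub>mstalk X M x\<^esub> mgerm X M x U s = mgerm X M x U (r \<odot>\<^bsub>msec M U\<^esub> s)"
proof -
  have "(\<Union>(U', r')\<in>grm x U r. \<Union>(V', s')\<in>m.grm x U s.
      m.grm x (U' \<inter> V') (rst X U' (U' \<inter> V') r' \<odot>\<^bsub>msec M (U' \<inter> V')\<^esub> mrst M V' (U' \<inter> V') s'))
    = m.grm x U (r \<odot>\<^bsub>msec M U\<^esub> s)"
  proof (rule binary_germ[OF presheaf_on_axioms mpresheaf mpresheaf])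
    fix U r s assume "open_in X U" "r \<in> carrier (sec X U)" "s \<in> carrier (msec M U)"
    then show "r \<odot>\<^bsub>msec M U\<^esub> s \<in> carrier (msec M U)"
      using msec_module module.smult_closed by metis
  qed (use assms mrst_smult in auto)
  then show ?thesis unfolding mstalk_def mgerm_def germ_def by simp
qed

lemma mcommon_open2:
  assumes "a \<in> carrier (mstalk X M x)" "b \<in> carrier (mstalk X M x)"
  obtains U s t where "open_in X U" "x \<in> U" "s \<in> carrier (msec M U)" "t \<in> carrier (msec M U)"
    "a = mgerm X M x U s" "b = mgerm X M x U t"
proof -
  obtain U s V t where *: "open_in X U" "x \<in> U" "s \<in> carrier (msec M U)" "a = mgerm X M x U s"
    "open_in X V" "x \<in> V" "t \<in> carrier (msec M V)" "b = mgerm X M x V t"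
    using assms unfolding mstalk_carrier_iff by blast
  show ?thesis
    by (rule that[of "U \<inter> V" "mrst M U (U \<inter> V) s" "mrst M V (U \<inter> V) t"])
      (use * in \<open>simp_all add: m.rst_closed openin_Int mgerm_restrict\<close>)
qed

lemma mgerm_zero:
  assumes "open_in X U" "x \<in> U"
  shows "mgerm X M x U \<zero>\<^bsub>msec M U\<^esub> = \<zero>\<^bsub>mstalk X M x\<^esub>"
proof -
  interpret P: module "sec X (points X)" "msec M (points X)" by (rule msec_module[OF open_all])
  interpret V: module "sec X U" "msec M U" by (rule msec_module[OF assms(1)])
  have UP: "U \<subseteq> points X" using assms open_points by blast
  \<comment> \<open>Restriction is known to respect sums and scalars; that it maps zero to zero is
    read off by writing zero as a multiple with the scalar zero.\<close>
  have z: "\<zero>\<^bsub>msec M (points X)\<^esub> = \<zero>\<^bsub>sec X (points X)\<^esub> \<odot>\<^bsub>msec M (points X)\<^esub> \<zero>\<^bsub>msec M (points X)\<^esub>"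
    by simp
  have "mrst M (points X) U \<zero>\<^bsub>msec M (points X)\<^esub> =
      rst X (points X) U \<zero>\<^bsub>sec X (points X)\<^esub> \<odot>\<^bsub>msec M U\<^esub> mrst M (points X) U \<zero>\<^bsub>msec M (points X)\<^esub>"
    by (subst z, rule mrst_smult) (use assms open_all UP in auto)
  also have "rst X (points X) U \<zero>\<^bsub>sec X (points X)\<^esub> = \<zero>\<^bsub>sec X U\<^esub>"
    using assms open_all UP rst_hom P.R.ring_axioms V.R.ring_axioms by (intro ring_hom_zero) auto
  also have "\<zero>\<^bsub>sec X U\<^esub> \<odot>\<^bsub>msec M U\<^esub> mrst M (points X) U \<zero>\<^bsub>msec M (points X)\<^esub> = \<zero>\<^bsub>msec M U\<^esub>"
    using m.rst_closed[OF open_all assms(1) UP P.M.zero_closed] by simp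
  finally have "mrst M (points X) U \<zero>\<^bsub>msec M (points X)\<^esub> = \<zero>\<^bsub>msec M U\<^esub>" .
  then show ?thesis
    using mgerm_restrict[OF open_all assms(1) UP assms(2) P.M.zero_closed]
    unfolding mstalk_def by simp
qed

text \<open>\<open>pullback_iso\<close> speaks of stalks through \<open>tensor_eval\<close>, that
  is, through integer multiples and finite sums; their laws are available once the stalk is a
  group.\<close>

lemma mstalk_abelian_group:
  assumes x: "x \<in> points X"
  shows "abelian_group (mstalk X M x)"
proof (rule abelian_groupI)
  fix a b assume "a \<in> carrier (mstalk X M x)" "b \<in> carrier (mstalk X M x)"
  then obtain U s t where U: "open_in X U" "x \<in> U" "s \<in> carrier (msec M U)" "t \<in> carrier (msec M U)"
    "a = mgerm X M x U s" "b = mgerm X M x U t" by (rule mcommon_open2)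
  interpret V: module "sec X U" "msec M U" by (rule msec_module[OF U(1)])
  show "a \<oplus>\<^bsub>mstalk X M x\<^esub> b \<in> carrier (mstalk X M x)"
    unfolding U(5,6) mgerm_add[OF U(1-4)] using U by (intro mgerm_closed) auto
  show "a \<oplus>\<^bsub>mstalk X M x\<^esub> b = b \<oplus>\<^bsub>mstalk X M x\<^esub> a"
    unfolding U(5,6) mgerm_add[OF U(1-4)] mgerm_add[OF U(1,2,4,3)] using U V.M.a_comm by simp
next
  interpret V: module "sec X (points X)" "msec M (points X)" by (rule msec_module[OF open_all])
  show "\<zero>\<^bsub>mstalk X M x\<^esub> \<in> carrier (mstalk X M x)"
    unfolding mgerm_zero[OF open_all x, symmetric] using x by (intro mgerm_closed open_all) auto
next
  fix a b c
  assume "a \<in> carrier (mstalk X M x)" "b \<in> carrier (mstalk X M x)" and c: "c \<in> carrier (mstalk X M x)"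
  then obtain U s t where U: "open_in X U" "x \<in> U" "s \<in> carrier (msec M U)" "t \<in> carrier (msec M U)"
    "a = mgerm X M x U s" "b = mgerm X M x U t" using mcommon_open2 by blast
  obtain V r where V: "open_in X V" "x \<in> V" "r \<in> carrier (msec M V)" "c = mgerm X M x V r"
    using c unfolding mstalk_carrier_iff by blast
  let ?I = "U \<inter> V"
  have o: "open_in X ?I" "x \<in> ?I" using U V by auto
  interpret I: module "sec X ?I" "msec M ?I" by (rule msec_module[OF o(1)])
  have cl: "mrst M U ?I s \<in> carrier (msec M ?I)" "mrst M U ?I t \<in> carrier (msec M ?I)"
    "mrst M V ?I r \<in> carrier (msec M ?I)" using U V o by (auto intro!: m.rst_closed)
  have "a = mgerm X M x ?I (mrst M U ?I s)" "b = mgerm X M x ?I (mrst M U ?I t)"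
    "c = mgerm X M x ?I (mrst M V ?I r)" using U V o by (simp_all add: mgerm_restrict)
  then show "a \<oplus>\<^bsub>mstalk X M x\<^esub> b \<oplus>\<^bsub>mstalk X M x\<^esub> c = a \<oplus>\<^bsub>mstalk X M x\<^esub> (b \<oplus>\<^bsub>mstalk X M x\<^esub> c)"
    using cl o by (simp add: mgerm_add I.M.a_assoc)
next
  fix a assume "a \<in> carrier (mstalk X M x)"
  then obtain U s where U: "open_in X U" "x \<in> U" "s \<in> carrier (msec M U)" "a = mgerm X M x U s"
    unfolding mstalk_carrier_iff by blast
  interpret V: module "sec X U" "msec M U" by (rule msec_module[OF U(1)])
  show "\<zero>\<^bsub>mstalk X M x\<^esub> \<oplus>\<^bsub>mstalk X M x\<^esub> a = a"
    unfolding U(4) mgerm_zero[OF U(1,2), symmetric] using U by (simp add: mgerm_add)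
  have "mgerm X M x U (\<ominus>\<^bsub>msec M U\<^esub> s) \<oplus>\<^bsub>mstalk X M x\<^esub> a = \<zero>\<^bsub>mstalk X M x\<^esub>"
    unfolding U(4) mgerm_zero[OF U(1,2), symmetric] using U by (simp add: mgerm_add V.M.l_neg)
  then show "\<exists>y\<in>carrier (mstalk X M x). y \<oplus>\<^bsub>mstalk X M x\<^esub> a = \<zero>\<^bsub>mstalk X M x\<^esub>"
    using U by blast
qed

end

lemma sheaf_of_modules_presheaf:
  assumes "ringed_space X" "sheaf_of_modules X M" shows "module_presheaf X M"
proof -
  have "ringed_space_loc X" by (rule ringed_space_loc.intro) fact
  then show ?thesis
    using assms(2) unfolding sheaf_of_modules_def module_presheaf_def module_presheaf_axioms_def
    by (simp add: is_sheaf_presheaf)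
qed

section \<open>Affine schemes\<close>

text \<open>\<open>topology\<close> returns the intended open sets for a family that is a topology,
  which has to be shown. For an intersection the two defining sets are multiplied elementwise, which
  works because the points are prime ideals.\<close>

lemma spectrum_topology_iff:
  fixes R (structure)
  assumes "cring R"
  shows "openin (spectrum_topology R) S \<longleftrightarrow> (\<exists>I \<subseteq> carrier R. S = {P \<in> spectrum R. \<not> I \<subseteq> P})"
proof -
  interpret cring R by fact
  define L where "L S \<longleftrightarrow> (\<exists>I \<subseteq> carrier R. S = {P \<in> spectrum R. \<not> I \<subseteq> P})" for S
  have "istopology L" unfolding istopology_def
  proof (intro conjI allI impI)
    fix S T assume "L S" "L T"
    then obtain I J where I: "I \<subseteq> carrier R" "S = {P \<in> spectrum R. \<not> I \<subseteq> P}"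
      and J: "J \<subseteq> carrier R" "T = {P \<in> spectrum R. \<not> J \<subseteq> P}" unfolding L_def by blast
    define K where "K = {i \<otimes> j | i j. i \<in> I \<and> j \<in> J}"
    have K: "K \<subseteq> carrier R" unfolding K_def using I J by auto
    have "\<not> K \<subseteq> P \<longleftrightarrow> \<not> I \<subseteq> P \<and> \<not> J \<subseteq> P" if "P \<in> spectrum R" for P
    proof -
      interpret P: primeideal P R using that unfolding spectrum_def by simp
      show ?thesis
      proof
        assume "\<not> K \<subseteq> P"
        then obtain i j where ij: "i \<in> I" "j \<in> J" "i \<otimes> j \<notin> P" unfolding K_def by blast
        then have "i \<in> carrier R" "j \<in> carrier R" using I J by auto
        then have "i \<notin> P" "j \<notin> P" using ij(3) P.I_l_closed P.I_r_closed by blast+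
        then show "\<not> I \<subseteq> P \<and> \<not> J \<subseteq> P" using ij by blast
      next
        assume "\<not> I \<subseteq> P \<and> \<not> J \<subseteq> P"
        then obtain i j where ij: "i \<in> I" "j \<in> J" "i \<notin> P" "j \<notin> P" by blast
        then have "i \<in> carrier R" "j \<in> carrier R" using I J by auto
        then have "i \<otimes> j \<notin> P" using ij P.I_prime by blast
        then show "\<not> K \<subseteq> P" using ij unfolding K_def by blast
      qed
    qed
    then have "S \<inter> T = {P \<in> spectrum R. \<not> K \<subseteq> P}" unfolding I(2) J(2) by blast
    then show "L (S \<inter> T)" unfolding L_def using K by blast
  next
    fix \<K> assume "\<forall>S\<in>\<K>. L S"
    then have "\<forall>S\<in>\<K>. \<exists>I \<subseteq> carrier R. S = {P \<in> spectrum R. \<not> I \<subseteq> P}" unfolding L_def .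
    then obtain I where I: "\<And>S. S \<in> \<K> \<Longrightarrow> I S \<subseteq> carrier R"
      "\<And>S. S \<in> \<K> \<Longrightarrow> S = {P \<in> spectrum R. \<not> I S \<subseteq> P}" by metis
    have "\<Union>\<K> = {P \<in> spectrum R. \<not> (\<Union>S\<in>\<K>. I S) \<subseteq> P}"
    proof (rule Set.set_eqI)
      fix P
      have "P \<in> S \<longleftrightarrow> P \<in> spectrum R \<and> \<not> I S \<subseteq> P" if "S \<in> \<K>" for S
        using I(2)[OF that] by blast
      then show "P \<in> \<Union>\<K> \<longleftrightarrow> P \<in> {P \<in> spectrum R. \<not> (\<Union>S\<in>\<K>. I S) \<subseteq> P}" by fast
    qed
    moreover have "(\<Union>S\<in>\<K>. I S) \<subseteq> carrier R" using I(1) by blast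
    ultimately show "L (\<Union>\<K>)" unfolding L_def by blast
  qed
  then have "openin (topology L) S \<longleftrightarrow> L S" by (simp add: topology_inverse')
  moreover have "spectrum_topology R = topology L" unfolding spectrum_topology_def L_def[abs_def] ..
  ultimately show ?thesis unfolding L_def by simp
qed

lemma topspace_spectrum:
  fixes R (structure)
  assumes "cring R" shows "topspace (spectrum_topology R) = spectrum R"
proof
  show "topspace (spectrum_topology R) \<subseteq> spectrum R"
    using openin_topspace[of "spectrum_topology R"] spectrum_topology_iff[OF assms] by blast
  have "\<not> carrier R \<subseteq> P" if "P \<in> spectrum R" for P
  proof -
    interpret P: primeideal P R using that unfolding spectrum_def by simp
    show ?thesis using P.I_notcarr P.a_subset by blast
  qed
  then have "spectrum R = {P \<in> spectrum R. \<not> carrier R \<subseteq> P}" by blast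
  then have "openin (spectrum_topology R) (spectrum R)"
    using spectrum_topology_iff[OF assms] by blast
  then show "spectrum R \<subseteq> topspace (spectrum_topology R)" by (rule openin_subset)
qed

locale fractions_at = cring R + P: primeideal P R for R :: "'r ring" (structure) and P
begin

lemma fraction_eq_iff:
  assumes "a \<in> carrier R" "b \<in> carrier R - P" "c \<in> carrier R" "d \<in> carrier R - P"
  shows "fraction R P a b = fraction R P c d \<longleftrightarrow> (\<exists>u\<in>carrier R - P. u \<otimes> (a \<otimes> d) = u \<otimes> (c \<otimes> b))"
proof
  assume eq: "fraction R P a b = fraction R P c d"
  have "\<one> \<notin> P" using P.one_imp_carrier P.I_notcarr by blast
  then have "(c, d) \<in> fraction R P c d" unfolding fraction_def using assms by blast
  then have "(c, d) \<in> fraction R P a b" by (simp only: eq)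
  then show "\<exists>u\<in>carrier R - P. u \<otimes> (a \<otimes> d) = u \<otimes> (c \<otimes> b)"
    unfolding fraction_def by blast
next
  have key: "fraction R P c d \<subseteq> fraction R P a b"
    if "a \<in> carrier R" "b \<in> carrier R - P" "c \<in> carrier R" "d \<in> carrier R - P"
      "u \<in> carrier R - P" "u \<otimes> (a \<otimes> d) = u \<otimes> (c \<otimes> b)" for a b c d u
  proof
    fix w assume "w \<in> fraction R P c d"
    then obtain x y v where w: "w = (x, y)" "x \<in> carrier R" "y \<in> carrier R - P" "v \<in> carrier R - P"
      "v \<otimes> (c \<otimes> y) = v \<otimes> (x \<otimes> d)" unfolding fraction_def by blast
    define z where "z = u \<otimes> v \<otimes> d"
    have mp: "s \<otimes> t \<notin> P" if "s \<in> carrier R - P" "t \<in> carrier R - P" for s t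
      using P.I_prime[of s t] that by blast
    have z: "z \<in> carrier R - P" unfolding z_def using that w mp by simp
    have "z \<otimes> (a \<otimes> y) = v \<otimes> y \<otimes> (u \<otimes> (a \<otimes> d))" unfolding z_def using that(1-5) w(2-4) by (simp add: m_ac)
    also have "\<dots> = u \<otimes> b \<otimes> (v \<otimes> (c \<otimes> y))" unfolding that(6) using that(1-5) w(2-4) by (simp add: m_ac)
    also have "\<dots> = z \<otimes> (x \<otimes> b)" unfolding w(5) z_def using that(1-5) w(2-4) by (simp add: m_ac)
    finally show "w \<in> fraction R P a b" unfolding fraction_def w(1) using w(2,3) z by blast
  qed
  assume "\<exists>u\<in>carrier R - P. u \<otimes> (a \<otimes> d) = u \<otimes> (c \<otimes> b)"
  then obtain u where u: "u \<in> carrier R - P" "u \<otimes> (a \<otimes> d) = u \<otimes> (c \<otimes> b)" by blast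
  show "fraction R P a b = fraction R P c d"
    using key[OF assms u] key[OF assms(3,4,1,2) u(1) u(2)[symmetric]] by blast
qed

lemma one_notin: "\<one> \<in> carrier R - P"
  using P.one_imp_carrier P.I_notcarr by blast

lemma mult_notin: "s \<in> carrier R - P \<Longrightarrow> t \<in> carrier R - P \<Longrightarrow> s \<otimes> t \<in> carrier R - P"
  using P.I_prime[of s t] by blast

lemma fraction_mult:
  assumes "a \<in> carrier R" "b \<in> carrier R - P" "c \<in> carrier R" "d \<in> carrier R - P"
  shows "fraction R P a b \<otimes>\<^bsub>localization R P\<^esub> fraction R P c d = fraction R P (a \<otimes> c) (b \<otimes> d)"
proof -
  have eq: "fraction R P (a' \<otimes> c') (b' \<otimes> d') = fraction R P (a \<otimes> c) (b \<otimes> d)"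
    if ab: "(a', b') \<in> fraction R P a b" and cd: "(c', d') \<in> fraction R P c d" for a' b' c' d'
  proof -
    obtain u where u: "a' \<in> carrier R" "b' \<in> carrier R - P" "u \<in> carrier R - P"
      "u \<otimes> (a \<otimes> b') = u \<otimes> (a' \<otimes> b)" using ab unfolding fraction_def by blast
    obtain v where v: "c' \<in> carrier R" "d' \<in> carrier R - P" "v \<in> carrier R - P"
      "v \<otimes> (c \<otimes> d') = v \<otimes> (c' \<otimes> d)" using cd unfolding fraction_def by blast
    have "u \<otimes> v \<otimes> (a' \<otimes> c' \<otimes> (b \<otimes> d)) = (u \<otimes> (a' \<otimes> b)) \<otimes> (v \<otimes> (c' \<otimes> d))"
      using assms u(1-3) v(1-3) by (simp add: m_ac)
    also have "\<dots> = u \<otimes> v \<otimes> (a \<otimes> c \<otimes> (b' \<otimes> d'))"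
      unfolding u(4)[symmetric] v(4)[symmetric] using assms u(1-3) v(1-3) by (simp add: m_ac)
    finally have "\<exists>w\<in>carrier R - P. w \<otimes> (a' \<otimes> c' \<otimes> (b \<otimes> d)) = w \<otimes> (a \<otimes> c \<otimes> (b' \<otimes> d'))"
      using mult_notin[OF u(3) v(3)] by blast
    then show ?thesis
      using fraction_eq_iff[of "a' \<otimes> c'" "b' \<otimes> d'" "a \<otimes> c" "b \<otimes> d"]
        mult_notin[OF u(2) v(2)] mult_notin[OF assms(2,4)] assms(1,3) u(1) v(1) by simp
  qed
  have "(a, b) \<in> fraction R P a b" "(c, d) \<in> fraction R P c d"
    unfolding fraction_def using assms one_notin by auto
  then have ne: "fraction R P a b \<noteq> {}" "fraction R P c d \<noteq> {}" by blast+
  have "(case x of (a', b') \<Rightarrow> \<Union>(c', d')\<in>fraction R P c d. fraction R P (a' \<otimes> c') (b' \<otimes> d'))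
      = fraction R P (a \<otimes> c) (b \<otimes> d)" if x: "x \<in> fraction R P a b" for x
  proof -
    have "(case y of (c', d') \<Rightarrow> fraction R P (fst x \<otimes> c') (snd x \<otimes> d')) = fraction R P (a \<otimes> c) (b \<otimes> d)"
      if "y \<in> fraction R P c d" for y
      using eq[of "fst x" "snd x" "fst y" "snd y"] that x by (simp add: case_prod_beta)
    then have "(\<Union>(c', d')\<in>fraction R P c d. fraction R P (fst x \<otimes> c') (snd x \<otimes> d'))
      = fraction R P (a \<otimes> c) (b \<otimes> d)" by (intro SUP_eq_const ne(2))
    then show ?thesis by (simp add: case_prod_beta)
  qed
  then have "(\<Union>(a', b')\<in>fraction R P a b. \<Union>(c', d')\<in>fraction R P c d.
      fraction R P (a' \<otimes> c') (b' \<otimes> d')) = fraction R P (a \<otimes> c) (b \<otimes> d)"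
    by (intro SUP_eq_const ne(1))
  then show ?thesis unfolding localization_def by simp
qed

end

text \<open>R is any ring whose spectrum is isomorphic to \<open>U\<close>; it is not identified
  with the sections over \<open>U\<close>. Its elements act on X through \<open>hat\<close>, and the
  facts that are finally extracted from a chart mention sections of X alone.\<close>

locale affine_chart = ringed_space_loc X + cring R
  for X :: "('p, 'r) ringed_space" and R :: "'r ring" (structure) +
  fixes U :: "'p set" and f :: "('p, 'r, 'r set, 'r set \<Rightarrow> ('r \<times> 'r) set) morphism"
  assumes U_open: "open_in X U" and iso: "ringed_isomorphism (open_subspace X U) (Spec R) f"
begin

abbreviation "\<Phi> \<equiv> pt f"
abbreviation "pre V \<equiv> preim (open_subspace X U) f V"
abbreviation "sopen \<equiv> openin (spectrum_topology R)"
abbreviation "ssec \<equiv> sec (Spec R)"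

definition const :: "'r \<Rightarrow> 'r set set \<Rightarrow> 'r set \<Rightarrow> ('r \<times> 'r) set" where
  "const a V = (\<lambda>P\<in>V. fraction R P a \<one>)"

lemma prime_fractions: "P \<in> spectrum R \<Longrightarrow> fractions_at R P"
  unfolding fractions_at_def spectrum_def by (simp add: is_cring)

lemma top_sub: "openin (top_of (open_subspace X U)) V \<longleftrightarrow> open_in X V \<and> V \<subseteq> U"
  unfolding open_subspace_def using U_open by (simp add: openin_open_subtopology)

lemma topspace_sub: "topspace (top_of (open_subspace X U)) = U"
  unfolding open_subspace_def using open_points[OF U_open] by (simp add: Int_absorb1)

lemma homeo: "homeomorphic_map (top_of (open_subspace X U)) (spectrum_topology R) \<Phi>"
  using iso unfolding ringed_isomorphism_def Spec_def by simp

lemma \<Phi>_image: "\<Phi> ` U = spectrum R"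
  using homeomorphic_imp_surjective_map[OF homeo] topspace_spectrum[OF is_cring] topspace_sub by simp

lemma \<Phi>_prime: "y \<in> U \<Longrightarrow> \<Phi> y \<in> spectrum R"
  using \<Phi>_image by blast

lemma \<Phi>_inj: "inj_on \<Phi> U"
  using homeomorphic_imp_injective_map[OF homeo] topspace_sub by simp

lemma \<Phi>_open: "open_in X V \<Longrightarrow> V \<subseteq> U \<Longrightarrow> sopen (\<Phi> ` V)"
  using homeomorphic_imp_open_map[OF homeo] top_sub unfolding open_map_def by blast

lemma pre_eq: "pre V = {x \<in> U. \<Phi> x \<in> V}"
  unfolding preim_def topspace_sub by simp

lemma pre_image: "V \<subseteq> U \<Longrightarrow> pre (\<Phi> ` V) = V"
  unfolding pre_eq using \<Phi>_inj by (auto dest: inj_onD)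

lemma pre_open: "sopen V \<Longrightarrow> open_in X (pre V)"
  using openin_continuous_map_preimage[OF homeomorphic_imp_continuous_map[OF homeo], of V]
  unfolding topspace_sub top_sub pre_eq by blast

lemma pre_sub: "pre V \<subseteq> U"
  unfolding pre_eq by blast

lemma pre_all: "pre (spectrum R) = U"
  unfolding pre_eq using \<Phi>_prime by blast

lemma sopen_sub: "sopen V \<Longrightarrow> V \<subseteq> spectrum R"
  using openin_subset topspace_spectrum[OF is_cring] by metis

lemma sopen_all: "sopen (spectrum R)"
  using openin_topspace[of "spectrum_topology R"] topspace_spectrum[OF is_cring] by simp

lemma comor_iso: "sopen V \<Longrightarrow> comor f V \<in> ring_iso (ssec V) (sec X (pre V))"
  using iso unfolding ringed_isomorphism_def by (simp add: Spec_def open_subspace_def)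

lemma comor_hom: "sopen V \<Longrightarrow> comor f V \<in> ring_hom (ssec V) (sec X (pre V))"
  using comor_iso unfolding ring_iso_def by blast

lemma comor_bij: "sopen V \<Longrightarrow> bij_betw (comor f V) (carrier (ssec V)) (carrier (sec X (pre V)))"
  using comor_iso unfolding ring_iso_def by blast

lemma comor_rst:
  assumes "sopen V" "sopen V'" "V' \<subseteq> V" "s \<in> carrier (ssec V)"
  shows "comor f V' (restrict s V') = rst X (pre V) (pre V') (comor f V s)"
proof -
  have "comor f V' (rst (Spec R) V V' s) = rst (open_subspace X U) (pre V) (pre V') (comor f V s)"
    using iso assms unfolding ringed_isomorphism_def ringed_morphism_def by (simp add: Spec_def)
  then show ?thesis by (simp add: Spec_def open_subspace_def)
qed

lemma ssec_carrier_iff: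
  "s \<in> carrier (ssec V) \<longleftrightarrow> s \<in> (\<Pi>\<^sub>E P\<in>V. carrier (localization R P)) \<and>
    (\<forall>P\<in>V. \<exists>V'. sopen V' \<and> P \<in> V' \<and> V' \<subseteq> V \<and>
      (\<exists>a\<in>carrier R. \<exists>b\<in>carrier R. \<forall>Q\<in>V'. b \<notin> Q \<and> s Q = fraction R Q a b))"
  unfolding Spec_def by simp

lemma frac_section:
  assumes V: "sopen V" and ab: "a \<in> carrier R" "b \<in> carrier R" "\<And>P. P \<in> V \<Longrightarrow> b \<notin> P"
  shows "(\<lambda>P\<in>V. fraction R P a b) \<in> carrier (ssec V)"
proof -
  have "(\<lambda>P\<in>V. fraction R P a b) \<in> (\<Pi>\<^sub>E P\<in>V. carrier (localization R P))"
    unfolding localization_def using ab by fastforce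
  moreover have "\<exists>V'. sopen V' \<and> P \<in> V' \<and> V' \<subseteq> V \<and>
     (\<exists>a'\<in>carrier R. \<exists>b'\<in>carrier R. \<forall>Q\<in>V'. b' \<notin> Q \<and> (\<lambda>P\<in>V. fraction R P a b) Q = fraction R Q a' b')"
    if "P \<in> V" for P
    using V ab that by (intro exI[of _ V] conjI bexI[of _ a] bexI[of _ b]) auto
  ultimately show ?thesis unfolding ssec_carrier_iff by blast
qed

lemma one_notin: "P \<in> spectrum R \<Longrightarrow> \<one> \<notin> P"
  using fractions_at.one_notin[OF prime_fractions] by blast

lemma const_closed:
  assumes "sopen V" "a \<in> carrier R" shows "const a V \<in> carrier (ssec V)"
  unfolding const_def using assms sopen_sub one_notin by (intro frac_section) auto

lemma ssec_mult: "s \<otimes>\<^bsub>ssec V\<^esub> t = (\<lambda>P\<in>V. s P \<otimes>\<^bsub>localization R P\<^esub> t P)"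
  unfolding Spec_def by simp

lemma const_restrict: "V' \<subseteq> V \<Longrightarrow> restrict (const a V) V' = const a V'"
  unfolding const_def by (auto simp: restrict_def fun_eq_iff)

lemma const_mult_frac:
  assumes V: "sopen V" and ab: "a \<in> carrier R" "b \<in> carrier R" "\<And>P. P \<in> V \<Longrightarrow> b \<notin> P"
    and s: "\<And>P. P \<in> V \<Longrightarrow> s P = fraction R P a b"
  shows "const b V \<otimes>\<^bsub>ssec V\<^esub> s = const a V"
  unfolding ssec_mult const_def
proof (rule restrict_ext)
  fix P assume P: "P \<in> V"
  interpret fractions_at R P using P V sopen_sub prime_fractions by blast
  have "b \<in> carrier R - P" using P ab by blast
  then show "(\<lambda>P\<in>V. fraction R P b \<one>) P \<otimes>\<^bsub>localization R P\<^esub> s P = fraction R P a \<one>"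
    using P ab(1) s[OF P] one_notin by (simp add: fraction_mult) (subst fraction_eq_iff, auto simp: m_comm)
qed

lemma const_mult:
  assumes V: "sopen V" and ab: "a \<in> carrier R" "b \<in> carrier R"
  shows "const a V \<otimes>\<^bsub>ssec V\<^esub> const b V = const (a \<otimes> b) V"
  unfolding ssec_mult const_def
proof (rule restrict_ext)
  fix P assume P: "P \<in> V"
  interpret fractions_at R P using P V sopen_sub prime_fractions by blast
  show "(\<lambda>P\<in>V. fraction R P a \<one>) P \<otimes>\<^bsub>localization R P\<^esub> (\<lambda>P\<in>V. fraction R P b \<one>) P
      = fraction R P (a \<otimes> b) \<one>"
    using P ab one_notin by (simp add: fraction_mult)
qed

definition hat :: "'r \<Rightarrow> 'r" where "hat a = comor f (spectrum R) (const a (spectrum R))"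

lemma hat_closed: "a \<in> carrier R \<Longrightarrow> hat a \<in> carrier (sec X U)"
  unfolding hat_def using const_closed[OF sopen_all] comor_bij[OF sopen_all]
  by (metis bij_betwE pre_all)

lemma hat_rst:
  assumes "sopen V" "a \<in> carrier R" shows "rst X U (pre V) (hat a) = comor f V (const a V)"
  using comor_rst[OF sopen_all assms(1) sopen_sub[OF assms(1)] const_closed[OF sopen_all assms(2)]]
    const_restrict[OF sopen_sub[OF assms(1)]] unfolding hat_def pre_all by simp

lemma hat_mult: "a \<in> carrier R \<Longrightarrow> b \<in> carrier R \<Longrightarrow> hat (a \<otimes> b) = hat a \<otimes>\<^bsub>sec X U\<^esub> hat b"
  unfolding hat_def const_mult[OF sopen_all, symmetric]
  using ring_hom_mult[OF comor_hom[OF sopen_all]] const_closed[OF sopen_all] pre_all by metis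

lemma ssec_one: "\<one>\<^bsub>ssec V\<^esub> = const \<one> V"
  unfolding Spec_def const_def localization_def by simp

lemma hat_one: "hat \<one> = \<one>\<^bsub>sec X U\<^esub>"
  using ring_hom_one[OF comor_hom[OF sopen_all]] unfolding hat_def ssec_one pre_all .

lemma hat_unit:
  assumes V: "sopen V" and a: "a \<in> carrier R" "\<And>P. P \<in> V \<Longrightarrow> a \<notin> P"
  shows "rst X U (pre V) (hat a) \<in> Units (sec X (pre V))"
proof -
  interpret V: cring "sec X (pre V)" by (rule sec_cring[OF pre_open[OF V]])
  let ?s = "\<lambda>P\<in>V. fraction R P \<one> a"
  have s: "?s \<in> carrier (ssec V)" using V a by (intro frac_section) auto
  have "const a V \<otimes>\<^bsub>ssec V\<^esub> ?s = const \<one> V" using V a by (intro const_mult_frac) auto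
  then have "comor f V (const a V) \<otimes>\<^bsub>sec X (pre V)\<^esub> comor f V ?s = \<one>\<^bsub>sec X (pre V)\<^esub>"
    using ring_hom_mult[OF comor_hom[OF V] const_closed[OF V a(1)] s]
      ring_hom_one[OF comor_hom[OF V]] unfolding ssec_one by simp
  moreover have "comor f V (const a V) \<in> carrier (sec X (pre V))" "comor f V ?s \<in> carrier (sec X (pre V))"
    using ring_hom_closed[OF comor_hom[OF V]] s const_closed[OF V a(1)] by blast+
  ultimately show ?thesis unfolding hat_rst[OF V a(1)] Units_def
    using V.m_comm[of "comor f V ?s" "comor f V (const a V)"] by auto
qed

text \<open>An inverse of the section \<open>a\<close> takes some value \<open>c/d\<close> at the
  prime \<open>\<Phi> y\<close>. The equation \<open>(a c)/d = 1\<close> in the localization says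
  that \<open>u d\<close>, with \<open>u\<close> and \<open>d\<close> outside the prime, is a
  multiple of \<open>a\<close>; so \<open>a\<close> is outside as well.\<close>

lemma hat_nonunit:
  assumes V: "sopen V" and y: "y \<in> pre V" and a: "a \<in> carrier R"
    and u: "rst X U (pre V) (hat a) \<in> Units (sec X (pre V))"
  shows "a \<notin> \<Phi> y"
proof
  assume aP: "a \<in> \<Phi> y"
  have P: "\<Phi> y \<in> V" using y unfolding pre_eq by simp
  interpret fractions_at R "\<Phi> y" using P V sopen_sub prime_fractions by blast
  obtain t where t: "t \<in> carrier (sec X (pre V))"
    "rst X U (pre V) (hat a) \<otimes>\<^bsub>sec X (pre V)\<^esub> t = \<one>\<^bsub>sec X (pre V)\<^esub>" using u unfolding Units_def by blast
  obtain s where s: "s \<in> carrier (ssec V)" "t = comor f V s"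
    using t(1) comor_bij[OF V] unfolding bij_betw_def by blast
  \<comment> \<open>Injectivity of \<open>comor f V\<close> holds on the carrier, so the product
    must first be known to be a section; locally it is the fraction
    \<open>(a a')/b'\<close>.\<close>
  have cm: "const a V \<otimes>\<^bsub>ssec V\<^esub> s \<in> carrier (ssec V)"
  proof -
    have sl: "\<And>P. P \<in> V \<Longrightarrow> \<exists>V'. sopen V' \<and> P \<in> V' \<and> V' \<subseteq> V \<and>
       (\<exists>a'\<in>carrier R. \<exists>b'\<in>carrier R. \<forall>Q\<in>V'. b' \<notin> Q \<and> s Q = fraction R Q a' b')"
      using s(1) unfolding ssec_carrier_iff by blast
    have pm: "fraction R Q a \<one> \<otimes>\<^bsub>localization R Q\<^esub> fraction R Q a' b' = fraction R Q (a \<otimes> a') b'"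
      if "Q \<in> V" "a' \<in> carrier R" "b' \<in> carrier R" "b' \<notin> Q" for Q a' b'
    proof -
      interpret Q: fractions_at R Q using that V sopen_sub prime_fractions by blast
      show ?thesis using that a Q.one_notin by (simp add: Q.fraction_mult)
    qed
    show ?thesis unfolding ssec_carrier_iff ssec_mult
    proof (intro conjI ballI)
      show "(\<lambda>P\<in>V. const a V P \<otimes>\<^bsub>localization R P\<^esub> s P) \<in> (\<Pi>\<^sub>E P\<in>V. carrier (localization R P))"
      proof (rule restrict_PiE_iff[THEN iffD2], rule ballI)
        fix Q assume Q: "Q \<in> V"
        then obtain a' b' where "a' \<in> carrier R" "b' \<in> carrier R" "b' \<notin> Q" "s Q = fraction R Q a' b'"
          using sl[OF Q] by blast
        then have "const a V Q \<otimes>\<^bsub>localization R Q\<^esub> s Q = fraction R Q (a \<otimes> a') b'"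
          "a \<otimes> a' \<in> carrier R" "b' \<in> carrier R - Q"
          using pm[OF Q] Q a unfolding const_def by auto
        then show "const a V Q \<otimes>\<^bsub>localization R Q\<^esub> s Q \<in> carrier (localization R Q)"
          unfolding localization_def by auto
      qed
      fix Q assume Q: "Q \<in> V"
      obtain V' a' b' where V': "sopen V'" "Q \<in> V'" "V' \<subseteq> V" "a' \<in> carrier R" "b' \<in> carrier R"
        "\<forall>Q\<in>V'. b' \<notin> Q \<and> s Q = fraction R Q a' b'" using sl[OF Q] by blast
      have D: "\<forall>Q\<in>V'. b' \<notin> Q \<and>
        (\<lambda>P\<in>V. const a V P \<otimes>\<^bsub>localization R P\<^esub> s P) Q = fraction R Q (a \<otimes> a') b'"
      proof
        fix P assume P: "P \<in> V'"
        then have "P \<in> V" "b' \<notin> P" "s P = fraction R P a' b'" using V' by auto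
        then show "b' \<notin> P \<and> (\<lambda>P\<in>V. const a V P \<otimes>\<^bsub>localization R P\<^esub> s P) P = fraction R P (a \<otimes> a') b'"
          using pm[of P a' b'] V'(4,5) by (simp add: const_def)
      qed
      have "\<exists>a'\<in>carrier R. \<exists>b'\<in>carrier R. \<forall>Q\<in>V'. b' \<notin> Q \<and>
        (\<lambda>P\<in>V. const a V P \<otimes>\<^bsub>localization R P\<^esub> s P) Q = fraction R Q a' b'"
        by (rule bexI[of _ "a \<otimes> a'"], rule bexI[of _ b'], rule D) (use V'(4,5) a in auto)
      with V'(1-3) show "\<exists>V'. sopen V' \<and> Q \<in> V' \<and> V' \<subseteq> V \<and> (\<exists>a'\<in>carrier R. \<exists>b'\<in>carrier R. \<forall>Q\<in>V'. b' \<notin> Q \<and>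
        (\<lambda>P\<in>V. const a V P \<otimes>\<^bsub>localization R P\<^esub> s P) Q = fraction R Q a' b')"
        by (intro exI[of _ V'] conjI)
    qed
  qed
  have "comor f V (const a V \<otimes>\<^bsub>ssec V\<^esub> s) = comor f V (const \<one> V)"
    using ring_hom_mult[OF comor_hom[OF V] const_closed[OF V a] s(1)]
      ring_hom_one[OF comor_hom[OF V]] t(2) unfolding ssec_one hat_rst[OF V a] s(2) by simp
  then have eq: "const a V \<otimes>\<^bsub>ssec V\<^esub> s = const \<one> V"
    using comor_bij[OF V] cm const_closed[OF V one_closed] unfolding bij_betw_def
    by (auto dest: inj_onD)
  have "s (\<Phi> y) \<in> carrier (localization R (\<Phi> y))" using s(1) P unfolding Spec_def by auto
  then obtain c d where cd: "c \<in> carrier R" "d \<in> carrier R - \<Phi> y" "s (\<Phi> y) = fraction R (\<Phi> y) c d"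
    unfolding localization_def by auto
  have "(const a V \<otimes>\<^bsub>ssec V\<^esub> s) (\<Phi> y) = fraction R (\<Phi> y) (a \<otimes> c) (\<one> \<otimes> d)"
    unfolding ssec_mult const_def using P cd a one_notin by (simp add: fraction_mult del: l_one)
  then have "fraction R (\<Phi> y) (a \<otimes> c) d = fraction R (\<Phi> y) \<one> \<one>"
    unfolding eq using P cd by (simp add: const_def)
  then obtain u where u: "u \<in> carrier R - \<Phi> y" "u \<otimes> (a \<otimes> c \<otimes> \<one>) = u \<otimes> (\<one> \<otimes> d)"
    using fraction_eq_iff[of "a \<otimes> c" d \<one> \<one>] cd a one_notin by auto
  have "u \<otimes> (a \<otimes> c \<otimes> \<one>) \<in> \<Phi> y" using u(1) cd aP by (intro P.I_l_closed P.I_r_closed) auto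
  moreover have "u \<otimes> (\<one> \<otimes> d) \<in> carrier R - \<Phi> y" using mult_notin u(1) cd(2) by simp
  ultimately show False using u(2) by simp
qed

text \<open>The zero section is recognized multiplicatively, as the absorbing element.\<close>

lemma comor_zero:
  assumes V: "sopen V" shows "comor f V (const \<zero> V) = \<zero>\<^bsub>sec X (pre V)\<^esub>"
proof -
  interpret V: cring "sec X (pre V)" by (rule sec_cring[OF pre_open[OF V]])
  have "\<zero>\<^bsub>sec X (pre V)\<^esub> \<in> comor f V ` carrier (ssec V)"
    using bij_betw_imp_surj_on[OF comor_bij[OF V]] V.zero_closed by simp
  then obtain s where s: "s \<in> carrier (ssec V)" "comor f V s = \<zero>\<^bsub>sec X (pre V)\<^esub>" by auto
  have "const \<zero> V \<otimes>\<^bsub>ssec V\<^esub> s = const \<zero> V" unfolding ssec_mult const_def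
  proof (rule restrict_ext)
    fix P assume P: "P \<in> V"
    interpret fractions_at R P using P V sopen_sub prime_fractions by blast
    have "s P \<in> carrier (localization R P)" using s(1) P unfolding Spec_def by auto
    then obtain c d where cd: "c \<in> carrier R" "d \<in> carrier R - P" "s P = fraction R P c d"
      unfolding localization_def by auto
    show "(\<lambda>P\<in>V. fraction R P \<zero> \<one>) P \<otimes>\<^bsub>localization R P\<^esub> s P = fraction R P \<zero> \<one>"
      using P cd one_notin by (simp add: fraction_mult) (subst fraction_eq_iff, auto)
  qed
  then have "comor f V (const \<zero> V) = comor f V (const \<zero> V) \<otimes>\<^bsub>sec X (pre V)\<^esub> \<zero>\<^bsub>sec X (pre V)\<^esub>"
    using ring_hom_mult[OF comor_hom[OF V] const_closed[OF V zero_closed] s(1)] s(2) by simp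
  then show ?thesis using ring_hom_closed[OF comor_hom[OF V] const_closed[OF V zero_closed]] by simp
qed

lemma hat_zero_iff:
  assumes V: "sopen V" and a: "a \<in> carrier R"
  shows "rst X U (pre V) (hat a) = \<zero>\<^bsub>sec X (pre V)\<^esub> \<longleftrightarrow> (\<forall>P\<in>V. \<exists>u\<in>carrier R - P. u \<otimes> a = \<zero>)"
proof -
  have "rst X U (pre V) (hat a) = \<zero>\<^bsub>sec X (pre V)\<^esub> \<longleftrightarrow> const a V = const \<zero> V"
    unfolding hat_rst[OF V a] comor_zero[OF V, symmetric]
    using comor_bij[OF V] const_closed[OF V] a zero_closed unfolding bij_betw_def
    by (metis inj_onD)
  also have "\<dots> \<longleftrightarrow> (\<forall>P\<in>V. fraction R P a \<one> = fraction R P \<zero> \<one>)"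
    unfolding const_def by (auto simp: restrict_def fun_eq_iff)
  also have "\<dots> \<longleftrightarrow> (\<forall>P\<in>V. \<exists>u\<in>carrier R - P. u \<otimes> a = \<zero>)"
  proof (rule ball_cong[OF refl])
    fix P assume P: "P \<in> V"
    interpret fractions_at R P using P V sopen_sub prime_fractions by blast
    show "fraction R P a \<one> = fraction R P \<zero> \<one> \<longleftrightarrow> (\<exists>u\<in>carrier R - P. u \<otimes> a = \<zero>)"
      using a one_notin by (subst fraction_eq_iff) auto
  qed
  finally show ?thesis .
qed

lemma rst_U: "s \<in> carrier (sec X U) \<Longrightarrow> rst X U U s = s"
  by (rule rst_self[OF U_open])

text \<open>A section of Spec R is locally a fraction \<open>a/b\<close>. Transported to X this
  reads \<open>b s = a\<close>, over a set where \<open>b\<close> avoids all primes and is therefore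
  invertible by \<open>hat_unit\<close>.\<close>

lemma local_fraction:
  assumes V: "open_in X V" "V \<subseteq> U" "y \<in> V" and s: "s \<in> carrier (sec X V)"
  obtains a b V' where "a \<in> carrier R" "b \<in> carrier R" "sopen V'" "y \<in> pre V'" "pre V' \<subseteq> V"
    "\<And>P. P \<in> V' \<Longrightarrow> b \<notin> P"
    "rst X U (pre V') (hat b) \<otimes>\<^bsub>sec X (pre V')\<^esub> rst X V (pre V') s = rst X U (pre V') (hat a)"
proof -
  have o: "sopen (\<Phi> ` V)" by (rule \<Phi>_open[OF V(1,2)])
  have pV: "pre (\<Phi> ` V) = V" by (rule pre_image[OF V(2)])
  have "s \<in> comor f (\<Phi> ` V) ` carrier (ssec (\<Phi> ` V))"
    using bij_betw_imp_surj_on[OF comor_bij[OF o]] s by (simp add: pV)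
  then obtain t where t: "t \<in> carrier (ssec (\<Phi> ` V))" "s = comor f (\<Phi> ` V) t" by auto
  have "\<Phi> y \<in> \<Phi> ` V" using V by blast
  then obtain V' a b where V': "sopen V'" "\<Phi> y \<in> V'" "V' \<subseteq> \<Phi> ` V" and ab: "a \<in> carrier R" "b \<in> carrier R"
    and fr: "\<forall>Q\<in>V'. b \<notin> Q \<and> t Q = fraction R Q a b"
    using t(1) unfolding Spec_def by auto
  have b: "b \<notin> P" if "P \<in> V'" for P using fr that by blast
  have pV': "pre V' \<subseteq> V" using V'(3) pV unfolding pre_eq by blast
  have "restrict t V' \<in> carrier (ssec V')"
  proof -
    have "restrict t V' = (\<lambda>P\<in>V'. fraction R P a b)" using fr by (auto simp: restrict_def fun_eq_iff)
    then show ?thesis using frac_section[OF V'(1) ab b] by simp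
  qed
  moreover have "const b V' \<otimes>\<^bsub>ssec V'\<^esub> restrict t V' = const a V'"
    using fr by (intro const_mult_frac V' ab b) auto
  ultimately have "comor f V' (const b V') \<otimes>\<^bsub>sec X (pre V')\<^esub> comor f V' (restrict t V') = comor f V' (const a V')"
    using ring_hom_mult[OF comor_hom[OF V'(1)] const_closed[OF V'(1) ab(2)]] by metis
  then have "rst X U (pre V') (hat b) \<otimes>\<^bsub>sec X (pre V')\<^esub> rst X V (pre V') s = rst X U (pre V') (hat a)"
    unfolding hat_rst[OF V'(1) ab(1)] hat_rst[OF V'(1) ab(2)] comor_rst[OF o V'(1,3) t(1)] pV t(2) .
  moreover have "y \<in> pre V'" using V' V unfolding pre_eq by blast
  ultimately show ?thesis using that ab V'(1) pV' b by blast
qed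

text \<open>The germ of \<open>hat a\<close> at a point is a unit exactly when \<open>a\<close> is
  outside the corresponding prime, so an element that belongs to exactly one of two primes tells the
  points apart. Phrased with units of stalks, the result no longer mentions R.\<close>

lemma separate:
  assumes "y \<in> U" "z \<in> U" "y \<noteq> z"
  shows "\<exists>r\<in>carrier (sec X U). (germ X y U r \<in> Units (stalk X y)) \<noteq> (germ X z U r \<in> Units (stalk X z))"
proof -
  have key: "germ X y U (hat a) \<in> Units (stalk X y) \<longleftrightarrow> a \<notin> \<Phi> y" if a: "a \<in> carrier R" and y: "y \<in> U" for a y
  proof
    assume "germ X y U (hat a) \<in> Units (stalk X y)"
    from Unit_spreads[OF U_open y hat_closed[OF a] this]
    obtain V where V: "open_in X V" "y \<in> V" "V \<subseteq> U" "rst X U V (hat a) \<in> Units (sec X V)" by blast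
    have pV: "pre (\<Phi> ` V) = V" by (rule pre_image[OF V(3)])
    show "a \<notin> \<Phi> y" using hat_nonunit[OF \<Phi>_open[OF V(1,3)], of y a] V(2,4) a unfolding pV by blast
  next
    assume n: "a \<notin> \<Phi> y"
    define V where "V = {P \<in> spectrum R. a \<notin> P}"
    have "V = {P \<in> spectrum R. \<not> {a} \<subseteq> P}" unfolding V_def by auto
    then have V: "sopen V" unfolding spectrum_topology_iff[OF is_cring] using a
      by (intro exI[of _ "{a}"]) auto
    have yV: "y \<in> pre V" unfolding pre_eq V_def using y n \<Phi>_prime by simp
    have "rst X U (pre V) (hat a) \<in> Units (sec X (pre V))"
      using V a by (intro hat_unit) (auto simp: V_def)
    from germ_Unit[OF pre_open[OF V] yV this]
    show "germ X y U (hat a) \<in> Units (stalk X y)"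
      using germ_restrict[OF U_open pre_open[OF V] pre_sub yV hat_closed[OF a]] by simp
  qed
  have "\<Phi> y \<noteq> \<Phi> z" using assms \<Phi>_inj by (auto dest: inj_onD)
  moreover have "\<Phi> y \<subseteq> carrier R" "\<Phi> z \<subseteq> carrier R"
    using \<Phi>_prime assms unfolding spectrum_def by (auto intro: ideal.Icarr primeideal.axioms(1))
  ultimately obtain a where "a \<in> carrier R" "a \<in> \<Phi> y \<longleftrightarrow> a \<notin> \<Phi> z" by blast
  then show ?thesis using key assms hat_closed by (intro bexI[of _ "hat a"]) auto
qed

text \<open>The generic point is the prime \<open>P0\<close> of the elements whose section over
  \<open>U\<close> is zero. It is prime because the sections form a domain, and it lies in every
  prime \<open>P\<close> because such an element is annihilated by something outside
  \<open>P\<close>. The dichotomy in the second half prepares the proof that the generic stalk is a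
  field.\<close>

lemma generic_exists:
  assumes dom: "domain (sec X U)"
  shows "\<exists>\<eta>\<in>U. (\<forall>V. open_in X V \<and> V \<noteq> {} \<and> V \<subseteq> U \<longrightarrow> \<eta> \<in> V) \<and>
    (\<forall>V s. open_in X V \<and> V \<subseteq> U \<and> \<eta> \<in> V \<and> s \<in> carrier (sec X V) \<longrightarrow>
       germ X \<eta> V s = \<zero>\<^bsub>stalk X \<eta>\<^esub> \<and> (\<forall>y\<in>V. germ X y V s = \<zero>\<^bsub>stalk X y\<^esub>) \<or>
       germ X \<eta> V s \<in> Units (stalk X \<eta>))"
proof -
  interpret U: domain "sec X U" by fact
  define P0 where "P0 = {a \<in> carrier R. hat a = \<zero>\<^bsub>sec X U\<^esub>}"
  have P0_iff: "a \<in> P0 \<longleftrightarrow> a \<in> carrier R \<and> (\<forall>P\<in>spectrum R. \<exists>u\<in>carrier R - P. u \<otimes> a = \<zero>)" for a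
    unfolding P0_def using hat_zero_iff[OF sopen_all, of a] rst_U[OF hat_closed[of a]]
    unfolding pre_all by auto
  have "ideal P0 R"
  proof (rule ideal_of_closed)
    show "P0 \<subseteq> carrier R" unfolding P0_def by blast
    show "\<zero> \<in> P0" unfolding P0_iff using one_notin by auto
    fix a b assume "a \<in> P0" "b \<in> P0"
    then have ab: "a \<in> carrier R" "b \<in> carrier R"
      "\<And>P. P \<in> spectrum R \<Longrightarrow> \<exists>u\<in>carrier R - P. u \<otimes> a = \<zero>"
      "\<And>P. P \<in> spectrum R \<Longrightarrow> \<exists>u\<in>carrier R - P. u \<otimes> b = \<zero>" unfolding P0_iff by auto
    have "\<exists>u\<in>carrier R - P. u \<otimes> (a \<oplus> b) = \<zero>" if P: "P \<in> spectrum R" for P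
    proof -
      interpret fractions_at R P by (rule prime_fractions[OF P])
      obtain u v where uv: "u \<in> carrier R - P" "v \<in> carrier R - P" "u \<otimes> a = \<zero>" "v \<otimes> b = \<zero>"
        using ab(3,4)[OF P] by blast
      have "u \<otimes> v \<otimes> (a \<oplus> b) = v \<otimes> (u \<otimes> a) \<oplus> u \<otimes> (v \<otimes> b)"
        using uv(1,2) ab(1,2) by (simp add: r_distr m_ac)
      also have "\<dots> = \<zero>" unfolding uv(3,4) using uv by simp
      finally show ?thesis using mult_notin[OF uv(1,2)] by blast
    qed
    then show "a \<oplus> b \<in> P0" unfolding P0_iff using ab by simp
  next
    fix r a assume "r \<in> carrier R" "a \<in> P0"
    then show "r \<otimes> a \<in> P0" unfolding P0_def
      by (simp add: hat_mult hat_closed)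
  qed
  then have P0: "primeideal P0 R"
  proof (rule primeidealI[OF _ is_cring])
    have "\<one> \<notin> P0" unfolding P0_def using hat_one by simp
    then show "carrier R \<noteq> P0" by auto
    fix a b assume "a \<in> carrier R" "b \<in> carrier R" "a \<otimes> b \<in> P0"
    then show "a \<in> P0 \<or> b \<in> P0" unfolding P0_def
      by (auto simp: hat_mult hat_closed U.integral_iff)
  qed
  then have P0s: "P0 \<in> spectrum R" unfolding spectrum_def by simp
  then have "P0 \<in> \<Phi> ` U" by (simp only: \<Phi>_image)
  then obtain \<eta> where \<eta>: "\<eta> \<in> U" "\<Phi> \<eta> = P0" by auto
  have P0_min: "P0 \<subseteq> P" if P: "P \<in> spectrum R" for P
  proof
    fix a assume a: "a \<in> P0"
    interpret fractions_at R P by (rule prime_fractions[OF P])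
    obtain u where u: "u \<in> carrier R - P" "u \<otimes> a = \<zero>" using a P unfolding P0_iff by blast
    have "u \<otimes> a \<in> P" unfolding u(2) by simp
    then show "a \<in> P" using P.I_prime[of u a] u a unfolding P0_def by blast
  qed
  have gen: "\<eta> \<in> V" if V: "open_in X V" "V \<noteq> {}" "V \<subseteq> U" for V
  proof -
    obtain I where I: "\<Phi> ` V = {P \<in> spectrum R. \<not> I \<subseteq> P}"
      using \<Phi>_open[OF V(1,3)] unfolding spectrum_topology_iff[OF is_cring] by blast
    obtain y where "y \<in> V" using V(2) by blast
    then have "\<Phi> y \<in> spectrum R" "\<not> I \<subseteq> \<Phi> y" using I by blast+
    then have "P0 \<in> \<Phi> ` V" unfolding I using P0_min[of "\<Phi> y"] P0s by blast
    then have "\<eta> \<in> pre (\<Phi> ` V)" unfolding pre_eq using \<eta> by simp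
    then show ?thesis using pre_image[OF V(3)] by simp
  qed
  have dich: "germ X \<eta> V s = \<zero>\<^bsub>stalk X \<eta>\<^esub> \<and> (\<forall>y\<in>V. germ X y V s = \<zero>\<^bsub>stalk X y\<^esub>) \<or>
       germ X \<eta> V s \<in> Units (stalk X \<eta>)"
    if V: "open_in X V" "V \<subseteq> U" "\<eta> \<in> V" "s \<in> carrier (sec X V)" for V s
  proof (cases "germ X \<eta> V s \<in> Units (stalk X \<eta>)")
    case nu: False
    have "germ X y V s = \<zero>\<^bsub>stalk X y\<^esub>" if y: "y \<in> V" for y
    proof -
      obtain a b V' where ab: "a \<in> carrier R" "b \<in> carrier R" and V': "sopen V'" "y \<in> pre V'" "pre V' \<subseteq> V"
        "\<And>P. P \<in> V' \<Longrightarrow> b \<notin> P"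
        "rst X U (pre V') (hat b) \<otimes>\<^bsub>sec X (pre V')\<^esub> rst X V (pre V') s = rst X U (pre V') (hat a)"
        using local_fraction[OF V(1,2) y V(4)] by blast
      let ?W = "pre V'"
      have W: "open_in X ?W" "\<eta> \<in> ?W" using pre_open[OF V'(1)] gen V'(2) pre_sub by blast+
      interpret W: cring "sec X ?W" by (rule sec_cring[OF W(1)])
      have c: "rst X U ?W (hat b) \<in> Units (sec X ?W)" "rst X V ?W s \<in> carrier (sec X ?W)"
        using hat_unit[OF V'(1) ab(2) V'(4)] V V'(3) W(1) by (auto intro: rst_closed)
      \<comment> \<open>If the numerator \<open>a\<close> were outside \<open>P0\<close>, it would
        be invertible on a neighbourhood of \<eta>, and with it \<open>s\<close>, contrary to the
        case assumption.\<close>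
      have "a \<in> P0"
      proof (rule ccontr)
        assume n: "a \<notin> P0"
        define D where "D = {P \<in> V'. a \<notin> P}"
        have "D = V' \<inter> {P \<in> spectrum R. \<not> {a} \<subseteq> P}" unfolding D_def using sopen_sub[OF V'(1)] by auto
        moreover have "sopen {P \<in> spectrum R. \<not> {a} \<subseteq> P}"
          unfolding spectrum_topology_iff[OF is_cring] using ab by (intro exI[of _ "{a}"]) auto
        ultimately have D: "sopen D" using V'(1) by (simp add: openin_Int)
        have \<eta>D: "\<eta> \<in> pre D" unfolding pre_eq D_def using \<eta> n W(2) unfolding pre_eq by simp
        have DW: "pre D \<subseteq> ?W" unfolding pre_eq D_def by blast
        have oD: "open_in X (pre D)" by (rule pre_open[OF D])
        interpret h: ring_hom_cring "sec X ?W" "sec X (pre D)" "rst X ?W (pre D)"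
          by (rule rst_hom_cring[OF W(1) oD DW])
        have "rst X ?W (pre D) (rst X U ?W (hat a)) = rst X U (pre D) (hat a)"
          using hat_closed ab(1) DW W(1) oD U_open pre_sub by (intro rst_trans) auto
        then have "rst X ?W (pre D) (rst X U ?W (hat b) \<otimes>\<^bsub>sec X ?W\<^esub> rst X V ?W s) \<in> Units (sec X (pre D))"
          unfolding V'(5) using hat_unit[OF D ab(1)] unfolding D_def by simp
        then have "rst X ?W (pre D) (rst X U ?W (hat b)) \<otimes>\<^bsub>sec X (pre D)\<^esub> rst X ?W (pre D) (rst X V ?W s)
           \<in> Units (sec X (pre D))"
          using c by (simp add: W.Units_closed)
        then have "rst X ?W (pre D) (rst X V ?W s) \<in> Units (sec X (pre D))"
          using h.S.unit_factor[of "rst X ?W (pre D) (rst X V ?W s)" "rst X ?W (pre D) (rst X U ?W (hat b))"]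
            c by (simp add: W.Units_closed h.S.m_comm)
        moreover have "rst X ?W (pre D) (rst X V ?W s) = rst X V (pre D) s"
          using V W oD DW V'(3) by (intro rst_trans) auto
        ultimately have "germ X \<eta> (pre D) (rst X V (pre D) s) \<in> Units (stalk X \<eta>)"
          using germ_Unit[OF oD \<eta>D] by simp
        then show False using nu germ_restrict[OF V(1) oD _ \<eta>D V(4)] DW V'(3) by auto
      qed
      then have "rst X U ?W (hat a) = \<zero>\<^bsub>sec X ?W\<^esub>"
        unfolding hat_zero_iff[OF V'(1) ab(1)] P0_iff using sopen_sub[OF V'(1)] by blast
      then have eq0: "rst X U ?W (hat b) \<otimes>\<^bsub>sec X ?W\<^esub> rst X V ?W s = \<zero>\<^bsub>sec X ?W\<^esub>" using V'(5) by simp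
      have "rst X V ?W s = inv\<^bsub>sec X ?W\<^esub> (rst X U ?W (hat b)) \<otimes>\<^bsub>sec X ?W\<^esub>
          (rst X U ?W (hat b) \<otimes>\<^bsub>sec X ?W\<^esub> rst X V ?W s)"
        using c by (simp add: W.Units_closed flip: W.m_assoc)
      then have "rst X V ?W s = \<zero>\<^bsub>sec X ?W\<^esub>" unfolding eq0 using c by simp
      then show ?thesis
        using germ_restrict[OF V(1) W(1) V'(3,2) V(4)] germ_zero[OF W(1) V'(2)] by simp
    qed
    then show ?thesis using V(3) by blast
  qed simp
  show ?thesis
  proof (intro bexI[of _ \<eta>] conjI allI impI)
    fix V assume "open_in X V \<and> V \<noteq> {} \<and> V \<subseteq> U"
    then show "\<eta> \<in> V" using gen by simp
  next
    fix V s assume "open_in X V \<and> V \<subseteq> U \<and> \<eta> \<in> V \<and> s \<in> carrier (sec X V)"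
    then show "germ X \<eta> V s = \<zero>\<^bsub>stalk X \<eta>\<^esub> \<and> (\<forall>y\<in>V. germ X y V s = \<zero>\<^bsub>stalk X y\<^esub>) \<or>
       germ X \<eta> V s \<in> Units (stalk X \<eta>)" by (elim conjE) (rule dich)
  qed (rule \<eta>(1))
qed

end

section \<open>Affine open sets in terms of their sections\<close>

context ringed_space_loc
begin

lemma affine_openE:
  assumes "affine_open X U"
  obtains R f where "affine_chart X R U f"
proof -
  obtain R :: "'r ring" and f where R: "open_in X U" "cring R"
    "ringed_isomorphism (open_subspace X U) (Spec R) f"
    using assms unfolding affine_open_def by blast
  have "affine_chart X R U f"
    by (intro affine_chart.intro affine_chart_axioms.intro ringed_space_loc_axioms R)
  then show ?thesis by (rule that)
qed

lemma affine_fraction: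
  assumes U: "affine_open X U" and V: "open_in X V" "V \<subseteq> U" "y \<in> V" "s \<in> carrier (sec X V)"
  obtains r g V' where "r \<in> carrier (sec X U)" "g \<in> carrier (sec X U)" "open_in X V'" "y \<in> V'" "V' \<subseteq> V"
    "rst X U V' g \<in> Units (sec X V')" "rst X U V' g \<otimes>\<^bsub>sec X V'\<^esub> rst X V V' s = rst X U V' r"
proof -
  obtain R f where "affine_chart X R U f" by (rule affine_openE[OF U])
  then interpret affine_chart X R U f .
  obtain a b V' where ab: "a \<in> carrier R" "b \<in> carrier R" and V': "sopen V'" "y \<in> pre V'" "pre V' \<subseteq> V"
    "\<And>P. P \<in> V' \<Longrightarrow> b \<notin> P"
    "rst X U (pre V') (hat b) \<otimes>\<^bsub>sec X (pre V')\<^esub> rst X V (pre V') s = rst X U (pre V') (hat a)"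
    using local_fraction[OF V] by blast
  show ?thesis
    by (rule that[OF hat_closed[OF ab(1)] hat_closed[OF ab(2)] pre_open[OF V'(1)] V'(2,3)
          hat_unit[OF V'(1) ab(2) V'(4)] V'(5)])
qed

lemma affine_separate:
  assumes "affine_open X U" "y \<in> U" "z \<in> U" "y \<noteq> z"
  shows "\<exists>r\<in>carrier (sec X U). (germ X y U r \<in> Units (stalk X y)) \<noteq> (germ X z U r \<in> Units (stalk X z))"
proof -
  obtain R f where "affine_chart X R U f" by (rule affine_openE[OF assms(1)])
  from affine_chart.separate[OF this assms(2-4)] show ?thesis .
qed

lemma affine_generic:
  assumes "affine_open X U" "domain (sec X U)"
  shows "\<exists>\<eta>\<in>U. (\<forall>V. open_in X V \<and> V \<noteq> {} \<and> V \<subseteq> U \<longrightarrow> \<eta> \<in> V) \<and>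
    (\<forall>V s. open_in X V \<and> V \<subseteq> U \<and> \<eta> \<in> V \<and> s \<in> carrier (sec X V) \<longrightarrow>
       germ X \<eta> V s = \<zero>\<^bsub>stalk X \<eta>\<^esub> \<and> (\<forall>y\<in>V. germ X y V s = \<zero>\<^bsub>stalk X y\<^esub>) \<or>
       germ X \<eta> V s \<in> Units (stalk X \<eta>))"
proof -
  obtain R f where "affine_chart X R U f" by (rule affine_openE[OF assms(1)])
  from affine_chart.generic_exists[OF this assms(2)] show ?thesis .
qed

end

section \<open>Integral schemes\<close>

context ringed_space_loc
begin

lemma sheaf_glue:
  assumes "\<And>V. V \<in> \<U> \<Longrightarrow> open_in X V" "\<And>V. V \<in> \<U> \<Longrightarrow> s V \<in> carrier (sec X V)"
    and "\<And>V V'. V \<in> \<U> \<Longrightarrow> V' \<in> \<U> \<Longrightarrow> rst X V (V \<inter> V') (s V) = rst X V' (V \<inter> V') (s V')"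
  obtains t where "t \<in> carrier (sec X (\<Union>\<U>))" "\<And>V. V \<in> \<U> \<Longrightarrow> rst X (\<Union>\<U>) V t = s V"
proof -
  have "\<forall>\<U> s. (\<forall>U \<in> \<U>. open_in X U \<and> s U \<in> carrier (sec X U)) \<and>
        (\<forall>U \<in> \<U>. \<forall>V \<in> \<U>. rst X U (U \<inter> V) (s U) = rst X V (U \<inter> V) (s V)) \<longrightarrow>
        (\<exists>!t. t \<in> carrier (sec X (\<Union>\<U>)) \<and> (\<forall>U \<in> \<U>. rst X (\<Union>\<U>) U t = s U))"
    using sheaf unfolding is_sheaf_def by (elim conjE)
  from this[rule_format, of \<U> s]
  have "\<exists>!t. t \<in> carrier (sec X (\<Union>\<U>)) \<and> (\<forall>U \<in> \<U>. rst X (\<Union>\<U>) U t = s U)"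
    using assms by blast
  then show ?thesis using that by blast
qed

lemma sheaf_separated:
  assumes "\<And>V. V \<in> \<U> \<Longrightarrow> open_in X V" "t \<in> carrier (sec X (\<Union>\<U>))" "t' \<in> carrier (sec X (\<Union>\<U>))"
    and "\<And>V. V \<in> \<U> \<Longrightarrow> rst X (\<Union>\<U>) V t = rst X (\<Union>\<U>) V t'"
  shows "t = t'"
proof -
  let ?s = "\<lambda>V. rst X (\<Union>\<U>) V t"
  have o: "open_in X (\<Union>\<U>)" using assms(1) by blast
  have A: "\<forall>U \<in> \<U>. open_in X U \<and> ?s U \<in> carrier (sec X U)"
    using assms(1,2) o by (auto intro!: rst_closed)
  have B: "\<forall>U \<in> \<U>. \<forall>V \<in> \<U>. rst X U (U \<inter> V) (?s U) = rst X V (U \<inter> V) (?s V)"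
  proof (intro ballI)
    fix U V assume UV: "U \<in> \<U>" "V \<in> \<U>"
    then have oUV: "open_in X U" "open_in X V" using assms(1) by auto
    have "rst X U (U \<inter> V) (?s U) = rst X (\<Union>\<U>) (U \<inter> V) t"
      using o oUV UV assms(2) by (intro rst_trans) auto
    moreover have "rst X V (U \<inter> V) (?s V) = rst X (\<Union>\<U>) (U \<inter> V) t"
      using o oUV UV assms(2) by (intro rst_trans) auto
    ultimately show "rst X U (U \<inter> V) (?s U) = rst X V (U \<inter> V) (?s V)" by simp
  qed
  have "\<forall>\<U> s. (\<forall>U \<in> \<U>. open_in X U \<and> s U \<in> carrier (sec X U)) \<and>
        (\<forall>U \<in> \<U>. \<forall>V \<in> \<U>. rst X U (U \<inter> V) (s U) = rst X V (U \<inter> V) (s V)) \<longrightarrow>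
        (\<exists>!t. t \<in> carrier (sec X (\<Union>\<U>)) \<and> (\<forall>U \<in> \<U>. rst X (\<Union>\<U>) U t = s U))"
    using sheaf unfolding is_sheaf_def by (elim conjE)
  from this[rule_format, of \<U> ?s, OF conjI[OF A B]]
  have u: "\<exists>!t'. t' \<in> carrier (sec X (\<Union>\<U>)) \<and> (\<forall>U \<in> \<U>. rst X (\<Union>\<U>) U t' = ?s U)" .
  have 1: "t \<in> carrier (sec X (\<Union>\<U>)) \<and> (\<forall>U \<in> \<U>. rst X (\<Union>\<U>) U t = ?s U)" using assms(2) by simp
  have 2: "t' \<in> carrier (sec X (\<Union>\<U>)) \<and> (\<forall>U \<in> \<U>. rst X (\<Union>\<U>) U t' = ?s U)" using assms(3,4) by simp
  show ?thesis using the1_equality[OF u 1] the1_equality[OF u 2] by simp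
qed

text \<open>The empty set is covered by the empty family, for which the sheaf condition is plain
  uniqueness.\<close>

lemma sec_empty: "s \<in> carrier (sec X {}) \<Longrightarrow> t \<in> carrier (sec X {}) \<Longrightarrow> s = t"
  using sheaf_separated[of "{}" s t] by simp

lemma zero_from_germs:
  assumes V: "open_in X V" "s \<in> carrier (sec X V)" and z: "\<And>y. y \<in> V \<Longrightarrow> germ X y V s = \<zero>\<^bsub>stalk X y\<^esub>"
  shows "s = \<zero>\<^bsub>sec X V\<^esub>"
proof -
  interpret V: cring "sec X V" by (rule sec_cring[OF V(1)])
  define \<U> where "\<U> = {V'. open_in X V' \<and> V' \<subseteq> V \<and> rst X V V' s = rst X V V' \<zero>\<^bsub>sec X V\<^esub>}"
  have "y \<in> \<Union>\<U>" if y: "y \<in> V" for y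
  proof -
    have "germ X y V s = germ X y V \<zero>\<^bsub>sec X V\<^esub>" using z[OF y] germ_zero[OF V(1) y] by simp
    then obtain V' where "open_in X V'" "y \<in> V'" "V' \<subseteq> V" "V' \<subseteq> V" "rst X V V' s = rst X V V' \<zero>\<^bsub>sec X V\<^esub>"
      by (rule germ_eqE) (use V y in auto)
    then show ?thesis unfolding \<U>_def by blast
  qed
  then have eq: "\<Union>\<U> = V" unfolding \<U>_def by blast
  show ?thesis
    by (rule sheaf_separated[of \<U>]) (use V in \<open>auto simp: eq\<close>, auto simp: \<U>_def)
qed

end

locale integral_loc = ringed_space_loc X for X :: "('p, 'r) ringed_space" +
  assumes integral: "integral_scheme X"
begin

abbreviation "\<eta> \<equiv> generic_point X"
abbreviation "K \<equiv> fun_field X"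

lemma is_scheme: "scheme X"
  using integral unfolding integral_scheme_def by blast

lemma stalk_local: "x \<in> points X \<Longrightarrow> local_ring (stalk X x)"
  using is_scheme unfolding scheme_def locally_ringed_space_def by blast

lemma stalk_cring: "x \<in> points X \<Longrightarrow> cring (stalk X x)"
  using stalk_local unfolding local_ring_def by blast

lemma affine_cover: "x \<in> points X \<Longrightarrow> \<exists>U. affine_open X U \<and> x \<in> U"
  using is_scheme unfolding scheme_def by blast

lemma affine_is_open: "affine_open X U \<Longrightarrow> open_in X U"
  unfolding affine_open_def by blast

lemma sec_domain: "open_in X U \<Longrightarrow> U \<noteq> {} \<Longrightarrow> domain (sec X U)"
  using integral unfolding integral_scheme_def by blast

lemma points_nonempty: "points X \<noteq> {}"
  using integral unfolding integral_scheme_def by blast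

text \<open>Over a disjoint union, sections can be prescribed on the two parts independently;
  \<open>(1, 0)\<close> and \<open>(0, 1)\<close> would be zero divisors in a domain.\<close>

lemma irreducible:
  assumes U: "open_in X U" "U \<noteq> {}" and V: "open_in X V" "V \<noteq> {}"
  shows "U \<inter> V \<noteq> {}"
proof
  assume disj: "U \<inter> V = {}"
  have UV: "U \<noteq> V" "V \<noteq> U" using disj U(2) by auto
  interpret U: domain "sec X U" by (rule sec_domain[OF U])
  interpret V: domain "sec X V" by (rule sec_domain[OF V])
  have o: "open_in X (U \<union> V)" using U V by auto
  interpret UV: domain "sec X (U \<union> V)" by (rule sec_domain[OF o]) (use U in blast)
  have oe: "open_in X {}" by simp
  have glue: "\<exists>t\<in>carrier (sec X (U \<union> V)). rst X (U \<union> V) U t = a \<and> rst X (U \<union> V) V t = b"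
    if a: "a \<in> carrier (sec X U)" and b: "b \<in> carrier (sec X V)" for a b
  proof -
    define s where "s Z = (if Z = U then a else b)" for Z
    have c: "s Z \<in> carrier (sec X Z)" if "Z \<in> {U, V}" for Z using that a b UV unfolding s_def by auto
    have e: "rst X Z (Z \<inter> Z') (s Z) = rst X Z' (Z \<inter> Z') (s Z')" if Z: "Z \<in> {U, V}" "Z' \<in> {U, V}" for Z Z'
    proof (cases "Z = Z'")
      case False
      then have zz: "Z \<inter> Z' = {}" using Z disj by auto
      have oo: "open_in X Z" "open_in X Z'" using Z U V by auto
      show ?thesis unfolding zz
        by (rule sec_empty[OF rst_closed[OF oo(1) oe empty_subsetI c[OF Z(1)]]
              rst_closed[OF oo(2) oe empty_subsetI c[OF Z(2)]]])
    qed simp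
    have oo: "\<And>Z. Z \<in> {U, V} \<Longrightarrow> open_in X Z" using U V by auto
    obtain t where t: "t \<in> carrier (sec X (\<Union>{U, V}))" "\<And>Z. Z \<in> {U, V} \<Longrightarrow> rst X (\<Union>{U, V}) Z t = s Z"
      using sheaf_glue[of "{U, V}" s, OF oo c e] by blast
    have "rst X (U \<union> V) U t = a" "rst X (U \<union> V) V t = b"
      using t(2)[of U] t(2)[of V] UV by (simp_all add: s_def)
    then show ?thesis using t(1) by auto
  qed
  obtain t where t: "t \<in> carrier (sec X (U \<union> V))" "rst X (U \<union> V) U t = \<one>\<^bsub>sec X U\<^esub>"
    "rst X (U \<union> V) V t = \<zero>\<^bsub>sec X V\<^esub>" using glue[OF U.one_closed V.zero_closed] by blast
  obtain t' where t': "t' \<in> carrier (sec X (U \<union> V))" "rst X (U \<union> V) U t' = \<zero>\<^bsub>sec X U\<^esub>"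
    "rst X (U \<union> V) V t' = \<one>\<^bsub>sec X V\<^esub>" using glue[OF U.zero_closed V.one_closed] by blast
  interpret h: ring_hom_cring "sec X (U \<union> V)" "sec X U" "rst X (U \<union> V) U"
    by (rule rst_hom_cring[OF o U(1)]) blast
  interpret h': ring_hom_cring "sec X (U \<union> V)" "sec X V" "rst X (U \<union> V) V"
    by (rule rst_hom_cring[OF o V(1)]) blast
  have "t \<otimes>\<^bsub>sec X (U \<union> V)\<^esub> t' = \<zero>\<^bsub>sec X (U \<union> V)\<^esub>"
  proof (rule sheaf_separated[of "{U, V}"])
    fix Z assume "Z \<in> {U, V}"
    then show "rst X (\<Union>{U, V}) Z (t \<otimes>\<^bsub>sec X (U \<union> V)\<^esub> t') = rst X (\<Union>{U, V}) Z \<zero>\<^bsub>sec X (U \<union> V)\<^esub>"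
      using t t' by auto
  qed (use U V t t' in auto)
  then have "t = \<zero>\<^bsub>sec X (U \<union> V)\<^esub> \<or> t' = \<zero>\<^bsub>sec X (U \<union> V)\<^esub>" using UV.integral t(1) t'(1) by blast
  then show False
  proof
    assume "t = \<zero>\<^bsub>sec X (U \<union> V)\<^esub>"
    then show False using t(2) by simp
  next
    assume "t' = \<zero>\<^bsub>sec X (U \<union> V)\<^esub>"
    then show False using t'(3) by simp
  qed
qed

definition is_gen :: "'p \<Rightarrow> bool" where
  "is_gen z \<longleftrightarrow> z \<in> points X \<and> (\<forall>V. open_in X V \<and> V \<noteq> {} \<longrightarrow> z \<in> V)"

lemma is_gen_closure: "is_gen z \<longleftrightarrow> z \<in> points X \<and> top_of X closure_of {z} = points X"
proof
  assume g: "is_gen z"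
  then have "points X \<subseteq> top_of X closure_of {z}" unfolding is_gen_def closure_of_def by blast
  then show "z \<in> points X \<and> top_of X closure_of {z} = points X"
    using g closure_of_subset_topspace[of "top_of X" "{z}"] unfolding is_gen_def by blast
next
  assume a: "z \<in> points X \<and> top_of X closure_of {z} = points X"
  have "z \<in> V" if V: "open_in X V" "V \<noteq> {}" for V
  proof -
    obtain y where y: "y \<in> V" using V(2) by blast
    then have "y \<in> points X" using open_points[OF V(1)] by blast
    then have "y \<in> top_of X closure_of {z}" using a by simp
    then show ?thesis using y V(1) unfolding closure_of_def by blast
  qed
  then show "is_gen z" unfolding is_gen_def using a by blast
qed

text \<open>The definite description in \<open>generic_point\<close> requires uniqueness. Two such
  points lie in the same open sets, while a section that is a unit at one of them and not at the
  other is invertible on an open set that cannot contain the other.\<close>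

lemma is_gen_unique: assumes "is_gen y" "is_gen z" shows "y = z"
proof (rule ccontr)
  assume ne: "y \<noteq> z"
  have key: False if ab: "is_gen a" "is_gen b" and U: "open_in X U" "a \<in> U" "b \<in> U" "r \<in> carrier (sec X U)"
    and u: "germ X a U r \<in> Units (stalk X a)" and n: "germ X b U r \<notin> Units (stalk X b)" for a b U r
  proof -
    obtain V where V: "open_in X V" "a \<in> V" "V \<subseteq> U" "rst X U V r \<in> Units (sec X V)"
      by (rule Unit_spreads[OF U(1,2,4) u])
    then have "b \<in> V" using ab(2) unfolding is_gen_def by blast
    then have "germ X b V (rst X U V r) \<in> Units (stalk X b)" using germ_Unit[OF V(1) _ V(4)] by blast
    then show False using germ_restrict[OF U(1) V(1,3) \<open>b \<in> V\<close> U(4)] n by simp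
  qed
  obtain U where U: "affine_open X U" "y \<in> U" using affine_cover assms(1) unfolding is_gen_def by blast
  have o: "open_in X U" by (rule affine_is_open[OF U(1)])
  have z: "z \<in> U" using assms(2) o U(2) unfolding is_gen_def by blast
  obtain r where r: "r \<in> carrier (sec X U)"
    "(germ X y U r \<in> Units (stalk X y)) \<noteq> (germ X z U r \<in> Units (stalk X z))"
    using affine_separate[OF U z ne] by blast
  show False using key[OF assms o U(2) z r(1)] key[OF assms(2,1) o z U(2) r(1)] r(2) by blast
qed

text \<open>By irreducibility the generic point of one affine open set lies in all nonempty open
  sets, so it is the generic point of X, and the dichotomy found in the chart is one about
  \<open>fun_field X\<close>.\<close>

lemma affine_gen:
  assumes U: "affine_open X U" "U \<noteq> {}"
  shows "is_gen \<eta>" and "\<And>V s. open_in X V \<Longrightarrow> V \<subseteq> U \<Longrightarrow> \<eta> \<in> V \<Longrightarrow> s \<in> carrier (sec X V) \<Longrightarrow>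
       germ X \<eta> V s = \<zero>\<^bsub>K\<^esub> \<and> (\<forall>y\<in>V. germ X y V s = \<zero>\<^bsub>stalk X y\<^esub>) \<or> germ X \<eta> V s \<in> Units K"
proof -
  have o: "open_in X U" by (rule affine_is_open[OF U(1)])
  obtain z where z: "z \<in> U" "\<forall>V. open_in X V \<and> V \<noteq> {} \<and> V \<subseteq> U \<longrightarrow> z \<in> V"
    and d: "\<forall>V s. open_in X V \<and> V \<subseteq> U \<and> z \<in> V \<and> s \<in> carrier (sec X V) \<longrightarrow>
       germ X z V s = \<zero>\<^bsub>stalk X z\<^esub> \<and> (\<forall>y\<in>V. germ X y V s = \<zero>\<^bsub>stalk X y\<^esub>) \<or>
       germ X z V s \<in> Units (stalk X z)"
    using affine_generic[OF U(1) sec_domain[OF o U(2)]] by (elim bexE conjE)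
  have g: "is_gen z" unfolding is_gen_def
  proof (intro conjI allI impI)
    show "z \<in> points X" using z(1) open_points[OF o] by blast
    fix V assume V: "open_in X V \<and> V \<noteq> {}"
    then have "V \<inter> U \<noteq> {}" using irreducible[of V U] o U(2) by blast
    moreover have "open_in X (V \<inter> U)" using V o by blast
    ultimately show "z \<in> V" using z(2)[rule_format, of "V \<inter> U"] by blast
  qed
  have eq: "\<eta> = z" unfolding generic_point_def is_gen_closure[symmetric]
  proof (rule the_equality)
    show "y = z" if "is_gen y" for y by (rule is_gen_unique[OF that g])
  qed (rule g)
  show "is_gen \<eta>" unfolding eq by (rule g)
  fix V s assume "open_in X V" "V \<subseteq> U" "\<eta> \<in> V" "s \<in> carrier (sec X V)"
  then show "germ X \<eta> V s = \<zero>\<^bsub>K\<^esub> \<and> (\<forall>y\<in>V. germ X y V s = \<zero>\<^bsub>stalk X y\<^esub>) \<or> germ X \<eta> V s \<in> Units K"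
    unfolding eq by (intro d[rule_format] conjI)
qed

lemma gen: "is_gen \<eta>"
proof -
  obtain x where "x \<in> points X" using points_nonempty by blast
  then obtain U where "affine_open X U" "x \<in> U" using affine_cover by blast
  then show ?thesis using affine_gen(1)[of U] by blast
qed

lemma gen_mem: "open_in X V \<Longrightarrow> V \<noteq> {} \<Longrightarrow> \<eta> \<in> V"
  using gen unfolding is_gen_def by blast

lemma gen_mem': "open_in X V \<Longrightarrow> y \<in> V \<Longrightarrow> \<eta> \<in> V"
  using gen_mem by blast

lemma gen_point: "\<eta> \<in> points X"
  using gen unfolding is_gen_def by blast

text \<open>The affine dichotomy is applied around each point of \<open>V\<close>. All charts share
  the generic point, so a section that is no unit there has zero germs throughout.\<close>

lemma gen_dichotomy:
  assumes V: "open_in X V" "s \<in> carrier (sec X V)" "V \<noteq> {}"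
  shows "germ X \<eta> V s = \<zero>\<^bsub>K\<^esub> \<and> s = \<zero>\<^bsub>sec X V\<^esub> \<or> germ X \<eta> V s \<in> Units K"
proof (cases "germ X \<eta> V s \<in> Units K")
  case nu: False
  have "germ X y V s = \<zero>\<^bsub>stalk X y\<^esub>" if y: "y \<in> V" for y
  proof -
    obtain U where U: "affine_open X U" "y \<in> U" using affine_cover open_points[OF V(1)] y by blast
    have o: "open_in X (V \<inter> U)" "y \<in> V \<inter> U" using V(1) affine_is_open[OF U(1)] U y by auto
    have e: "\<eta> \<in> V \<inter> U" by (rule gen_mem'[OF o])
    have c: "rst X V (V \<inter> U) s \<in> carrier (sec X (V \<inter> U))" using V o by (auto intro: rst_closed)
    have "germ X \<eta> (V \<inter> U) (rst X V (V \<inter> U) s) \<notin> Units K"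
      using nu germ_restrict[OF V(1) o(1) _ e V(2)] by simp
    then have "germ X y (V \<inter> U) (rst X V (V \<inter> U) s) = \<zero>\<^bsub>stalk X y\<^esub>"
      using affine_gen(2)[OF U(1) _ o(1) _ e c] U(2) o(2) by blast
    then show ?thesis using germ_restrict[OF V(1) o(1) _ o(2) V(2)] by simp
  qed
  then show ?thesis using zero_from_germs[OF V(1,2)] gen_mem[OF V(1,3)] by blast
qed simp

lemma K_cring: "cring K"
  by (rule stalk_cring[OF gen_point])

lemma germ_gen_eq_zero:
  assumes "open_in X V" "s \<in> carrier (sec X V)" "V \<noteq> {}" "germ X \<eta> V s = \<zero>\<^bsub>K\<^esub>"
  shows "s = \<zero>\<^bsub>sec X V\<^esub>"
proof -
  interpret K: cring K by (rule K_cring)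
  interpret V: domain "sec X V" by (rule sec_domain[OF assms(1,3)])
  have e: "\<eta> \<in> V" by (rule gen_mem[OF assms(1,3)])
  \<comment> \<open>The generic stalk is not the zero ring: the equation \<open>1 = 0\<close> would
    already hold on a nonempty open set, whose sections form a domain.\<close>
  have "germ X \<eta> V \<one>\<^bsub>sec X V\<^esub> \<noteq> \<zero>\<^bsub>K\<^esub>"
  proof
    assume z: "germ X \<eta> V \<one>\<^bsub>sec X V\<^esub> = \<zero>\<^bsub>K\<^esub>"
    then have "germ X \<eta> V \<one>\<^bsub>sec X V\<^esub> = germ X \<eta> V \<zero>\<^bsub>sec X V\<^esub>" using germ_zero[OF assms(1) e] by simp
    then obtain V' where V': "open_in X V'" "\<eta> \<in> V'" "V' \<subseteq> V" "V' \<subseteq> V"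
      "rst X V V' \<one>\<^bsub>sec X V\<^esub> = rst X V V' \<zero>\<^bsub>sec X V\<^esub>"
      by (rule germ_eqE) (use e assms in auto)
    interpret V': domain "sec X V'" using sec_domain[OF V'(1)] V'(2) by blast
    interpret h: ring_hom_cring "sec X V" "sec X V'" "rst X V V'"
      by (rule rst_hom_cring[OF assms(1) V'(1,3)])
    show False using V'(5) by simp
  qed
  then have ne: "\<one>\<^bsub>K\<^esub> \<noteq> \<zero>\<^bsub>K\<^esub>" using germ_one[OF assms(1) e] by simp
  have "\<zero>\<^bsub>K\<^esub> \<notin> Units K"
  proof
    assume "\<zero>\<^bsub>K\<^esub> \<in> Units K"
    then have "\<exists>x\<in>carrier K. \<zero>\<^bsub>K\<^esub> \<otimes>\<^bsub>K\<^esub> x = \<one>\<^bsub>K\<^esub>" by (rule K.Units_r_inv_ex)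
    then show False using ne by (elim bexE) simp
  qed
  then show ?thesis using gen_dichotomy[OF assms(1-3)] assms(4) by auto
qed

lemma K_field: "field K"
proof -
  interpret K: cring K by (rule K_cring)
  have "points X \<noteq> {}" by (rule points_nonempty)
  interpret P: domain "sec X (points X)" by (rule sec_domain[OF open_all points_nonempty])
  have ne: "\<one>\<^bsub>K\<^esub> \<noteq> \<zero>\<^bsub>K\<^esub>"
    using germ_gen_eq_zero[OF open_all P.one_closed points_nonempty] germ_one[OF open_all gen_point]
    by auto
  have "Units K = carrier K - {\<zero>\<^bsub>K\<^esub>}"
  proof
    have "\<zero>\<^bsub>K\<^esub> \<notin> Units K"
    proof
      assume "\<zero>\<^bsub>K\<^esub> \<in> Units K"
      then have "\<exists>x\<in>carrier K. \<zero>\<^bsub>K\<^esub> \<otimes>\<^bsub>K\<^esub> x = \<one>\<^bsub>K\<^esub>" by (rule K.Units_r_inv_ex)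
      then show False using ne by (elim bexE) simp
    qed
    then show "Units K \<subseteq> carrier K - {\<zero>\<^bsub>K\<^esub>}" using K.Units_closed by blast
    show "carrier K - {\<zero>\<^bsub>K\<^esub>} \<subseteq> Units K"
    proof
      fix a assume a: "a \<in> carrier K - {\<zero>\<^bsub>K\<^esub>}"
      then have "a \<in> carrier K" by simp
      then obtain U s where U: "open_in X U" "\<eta> \<in> U" "s \<in> carrier (sec X U)" "a = germ X \<eta> U s"
        unfolding stalk_carrier_iff by blast
      have "U \<noteq> {}" using U(2) by auto
      from gen_dichotomy[OF U(1,3) this] show "a \<in> Units K" using U(4) a by auto
    qed
  qed
  then show ?thesis by (rule K.cring_fieldI)
qed

sublocale K: field K by (rule K_field)

lemma emb_closed [intro, simp]: "open_in X V \<Longrightarrow> V \<noteq> {} \<Longrightarrow> s \<in> carrier (sec X V) \<Longrightarrow> germ X \<eta> V s \<in> carrier K"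
  using gen_mem by (intro germ_closed) auto

lemma emb_hom:
  assumes V: "open_in X V" "V \<noteq> {}" shows "ring_hom_cring (sec X V) K (germ X \<eta> V)"
proof -
  have e: "\<eta> \<in> V" by (rule gen_mem[OF V])
  have "germ X \<eta> V \<in> ring_hom (sec X V) K"
    by (rule ring_hom_memI) (use V e in \<open>auto simp: germ_mult germ_add germ_one intro: germ_closed\<close>)
  then show ?thesis
    by (simp add: ring_hom_cring_def ring_hom_cring_axioms_def sec_cring V K_cring)
qed

lemma emb_inj:
  assumes V: "open_in X V" "V \<noteq> {}" "s \<in> carrier (sec X V)" "t \<in> carrier (sec X V)"
    and eq: "germ X \<eta> V s = germ X \<eta> V t"
  shows "s = t"
proof -
  interpret h: ring_hom_cring "sec X V" K "germ X \<eta> V" by (rule emb_hom[OF V(1,2)])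
  have "germ X \<eta> V (s \<ominus>\<^bsub>sec X V\<^esub> t) = \<zero>\<^bsub>K\<^esub>" using V eq by (simp add: h.R.minus_eq K.r_neg)
  then have "s \<ominus>\<^bsub>sec X V\<^esub> t = \<zero>\<^bsub>sec X V\<^esub>" using germ_gen_eq_zero V by simp
  then show ?thesis using V by simp
qed

lemma emb_rst:
  "open_in X U \<Longrightarrow> open_in X V \<Longrightarrow> V \<subseteq> U \<Longrightarrow> V \<noteq> {} \<Longrightarrow> s \<in> carrier (sec X U) \<Longrightarrow>
    germ X \<eta> V (rst X U V s) = germ X \<eta> U s"
  using gen_mem by (intro germ_restrict) auto

lemma K_rep:
  assumes "a \<in> carrier K"
  obtains U s where "open_in X U" "U \<noteq> {}" "s \<in> carrier (sec X U)" "a = germ X \<eta> U s"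
  using assms unfolding stalk_carrier_iff by blast

lemma stalk_emb:
  assumes "open_in X U" "y \<in> U" "s \<in> carrier (sec X U)"
  shows "stalk_to_fun_field X (germ X y U s) = germ X \<eta> U s"
  unfolding stalk_to_fun_field_def germ_def
proof (rule UN_germ[OF assms])
  fix V t assume V: "open_in X V" "y \<in> V" "t \<in> carrier (sec X V)"
    and "grm y V t = grm y U s"
  then obtain V' where V': "open_in X V'" "y \<in> V'" "V' \<subseteq> V" "V' \<subseteq> U" "rst X V V' t = rst X U V' s"
    using germ_eqE[of y V t U s] assms unfolding germ_def by blast
  have "germ X \<eta> V t = germ X \<eta> V' (rst X V V' t)" using emb_rst[OF V(1) V'(1,3) _ V(3)] V'(2) by auto
  also have "\<dots> = germ X \<eta> U s" unfolding V'(5) using emb_rst[OF assms(1) V'(1,4) _ assms(3)] V'(2) by auto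
  finally show "grm \<eta> V t = grm \<eta> U s" unfolding germ_def .
qed

text \<open>The local ring at \<open>y\<close> as a subring of K. Regularity at different points and
  on different open sets can then be compared without restriction maps.\<close>

definition lring :: "'p \<Rightarrow> ('p set \<times> 'r) set set" where
  "lring y = stalk_to_fun_field X ` carrier (stalk X y)"

lemma lring_iff: "f \<in> lring y \<longleftrightarrow> (\<exists>U s. open_in X U \<and> y \<in> U \<and> s \<in> carrier (sec X U) \<and> f = germ X \<eta> U s)"
proof
  assume "f \<in> lring y"
  then obtain a where a: "a \<in> carrier (stalk X y)" "f = stalk_to_fun_field X a" unfolding lring_def by blast
  then obtain U s where U: "open_in X U" "y \<in> U" "s \<in> carrier (sec X U)" "a = germ X y U s"
    unfolding stalk_carrier_iff by blast
  then have "f = germ X \<eta> U s" using a(2) stalk_emb by simp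
  then show "\<exists>U s. open_in X U \<and> y \<in> U \<and> s \<in> carrier (sec X U) \<and> f = germ X \<eta> U s" using U by blast
next
  assume "\<exists>U s. open_in X U \<and> y \<in> U \<and> s \<in> carrier (sec X U) \<and> f = germ X \<eta> U s"
  then obtain U s where U: "open_in X U" "y \<in> U" "s \<in> carrier (sec X U)" "f = germ X \<eta> U s" by blast
  then have "f = stalk_to_fun_field X (germ X y U s)" using stalk_emb by simp
  then show "f \<in> lring y" unfolding lring_def using germ_closed[OF U(1-3)] by blast
qed

lemma emb_lring: "open_in X U \<Longrightarrow> y \<in> U \<Longrightarrow> s \<in> carrier (sec X U) \<Longrightarrow> germ X \<eta> U s \<in> lring y"
  unfolding lring_iff by blast

lemma lring_K: "f \<in> lring y \<Longrightarrow> f \<in> carrier K"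
  unfolding lring_iff by blast

lemma stalk_emb_hom:
  assumes y: "y \<in> points X" shows "ring_hom_cring (stalk X y) K (stalk_to_fun_field X)"
proof -
  interpret A: cring "stalk X y" by (rule stalk_cring[OF y])
  have "stalk_to_fun_field X \<in> ring_hom (stalk X y) K"
  proof (rule ring_hom_memI)
    fix a assume "a \<in> carrier (stalk X y)"
    then show "stalk_to_fun_field X a \<in> carrier K" using lring_K unfolding lring_def by blast
  next
    fix a b assume "a \<in> carrier (stalk X y)" "b \<in> carrier (stalk X y)"
    then obtain U s t where U: "open_in X U" "y \<in> U" "s \<in> carrier (sec X U)" "t \<in> carrier (sec X U)"
      "a = germ X y U s" "b = germ X y U t" by (rule common_open2)
    have e: "\<eta> \<in> U" by (rule gen_mem'[OF U(1,2)])
    interpret U: cring "sec X U" by (rule sec_cring[OF U(1)])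
    show "stalk_to_fun_field X (a \<otimes>\<^bsub>stalk X y\<^esub> b) = stalk_to_fun_field X a \<otimes>\<^bsub>K\<^esub> stalk_to_fun_field X b"
      unfolding U(5,6) using U(1-4) e by (simp add: germ_mult stalk_emb)
    show "stalk_to_fun_field X (a \<oplus>\<^bsub>stalk X y\<^esub> b) = stalk_to_fun_field X a \<oplus>\<^bsub>K\<^esub> stalk_to_fun_field X b"
      unfolding U(5,6) using U(1-4) e by (simp add: germ_add stalk_emb)
  next
    interpret P: cring "sec X (points X)" by (rule sec_cring[OF open_all])
    show "stalk_to_fun_field X \<one>\<^bsub>stalk X y\<^esub> = \<one>\<^bsub>K\<^esub>"
      using stalk_emb[OF open_all y P.one_closed] germ_one[OF open_all y] germ_one[OF open_all gen_point]
      by simp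
  qed
  then show ?thesis
    by (simp add: ring_hom_cring_def ring_hom_cring_axioms_def A.is_cring K_cring)
qed

lemma stalk_emb_inj:
  assumes y: "y \<in> points X" and ab: "a \<in> carrier (stalk X y)" "b \<in> carrier (stalk X y)"
    and eq: "stalk_to_fun_field X a = stalk_to_fun_field X b"
  shows "a = b"
proof -
  obtain U s t where U: "open_in X U" "y \<in> U" "s \<in> carrier (sec X U)" "t \<in> carrier (sec X U)"
      "a = germ X y U s" "b = germ X y U t" using ab by (rule common_open2)
  then have "germ X \<eta> U s = germ X \<eta> U t" using eq stalk_emb by simp
  then show ?thesis using emb_inj[OF U(1) _ U(3,4)] U by auto
qed

lemma lring_mult: "f \<in> lring y \<Longrightarrow> g \<in> lring y \<Longrightarrow> y \<in> points X \<Longrightarrow> f \<otimes>\<^bsub>K\<^esub> g \<in> lring y"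
proof -
  assume "f \<in> lring y" "g \<in> lring y" and y: "y \<in> points X"
  then obtain a b where ab: "a \<in> carrier (stalk X y)" "b \<in> carrier (stalk X y)"
    "f = stalk_to_fun_field X a" "g = stalk_to_fun_field X b" unfolding lring_def by blast
  interpret h: ring_hom_cring "stalk X y" K "stalk_to_fun_field X" by (rule stalk_emb_hom[OF y])
  have "f \<otimes>\<^bsub>K\<^esub> g = stalk_to_fun_field X (a \<otimes>\<^bsub>stalk X y\<^esub> b)" unfolding ab(3,4) using ab by simp
  then show ?thesis unfolding lring_def by (rule image_eqI) (use ab in simp)
qed

lemma lring_add: "f \<in> lring y \<Longrightarrow> g \<in> lring y \<Longrightarrow> y \<in> points X \<Longrightarrow> f \<oplus>\<^bsub>K\<^esub> g \<in> lring y"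
proof -
  assume "f \<in> lring y" "g \<in> lring y" and y: "y \<in> points X"
  then obtain a b where ab: "a \<in> carrier (stalk X y)" "b \<in> carrier (stalk X y)"
    "f = stalk_to_fun_field X a" "g = stalk_to_fun_field X b" unfolding lring_def by blast
  interpret h: ring_hom_cring "stalk X y" K "stalk_to_fun_field X" by (rule stalk_emb_hom[OF y])
  have "f \<oplus>\<^bsub>K\<^esub> g = stalk_to_fun_field X (a \<oplus>\<^bsub>stalk X y\<^esub> b)" unfolding ab(3,4) using ab by simp
  then show ?thesis unfolding lring_def by (rule image_eqI) (use ab in simp)
qed

lemma lring_zero: "y \<in> points X \<Longrightarrow> \<zero>\<^bsub>K\<^esub> \<in> lring y"
proof -
  assume y: "y \<in> points X"
  interpret h: ring_hom_cring "stalk X y" K "stalk_to_fun_field X" by (rule stalk_emb_hom[OF y])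
  show ?thesis unfolding lring_def using h.hom_zero h.R.zero_closed by (metis image_eqI)
qed

lemma lring_one: "y \<in> points X \<Longrightarrow> \<one>\<^bsub>K\<^esub> \<in> lring y"
proof -
  assume y: "y \<in> points X"
  interpret h: ring_hom_cring "stalk X y" K "stalk_to_fun_field X" by (rule stalk_emb_hom[OF y])
  show ?thesis unfolding lring_def using h.hom_one h.R.one_closed by (metis image_eqI)
qed

text \<open>Local representatives of \<open>f\<close> agree on overlaps, since any two nonempty open
  sets meet and sections embed into K; so they glue.\<close>

lemma glue_lring:
  assumes V: "open_in X V" "V \<noteq> {}" and f: "\<And>y. y \<in> V \<Longrightarrow> f \<in> lring y"
  obtains s where "s \<in> carrier (sec X V)" "germ X \<eta> V s = f"
proof -
  define \<U> where "\<U> = {Z. open_in X Z \<and> Z \<noteq> {} \<and> Z \<subseteq> V \<and> (\<exists>s\<in>carrier (sec X Z). germ X \<eta> Z s = f)}"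
  define s where "s Z = (SOME s. s \<in> carrier (sec X Z) \<and> germ X \<eta> Z s = f)" for Z
  have s: "s Z \<in> carrier (sec X Z)" "germ X \<eta> Z (s Z) = f" if "Z \<in> \<U>" for Z
  proof -
    have "\<exists>s. s \<in> carrier (sec X Z) \<and> germ X \<eta> Z s = f" using that unfolding \<U>_def by blast
    from someI_ex[OF this] show "s Z \<in> carrier (sec X Z)" "germ X \<eta> Z (s Z) = f" unfolding s_def by auto
  qed
  have cover: "\<Union>\<U> = V"
  proof
    show "\<Union>\<U> \<subseteq> V" unfolding \<U>_def by blast
    show "V \<subseteq> \<Union>\<U>"
    proof
      fix y assume y: "y \<in> V"
      obtain U t where U: "open_in X U" "y \<in> U" "t \<in> carrier (sec X U)" "f = germ X \<eta> U t"
        using f[OF y] unfolding lring_iff by blast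
      have o: "open_in X (U \<inter> V)" "y \<in> U \<inter> V" using U V y by auto
      have "germ X \<eta> (U \<inter> V) (rst X U (U \<inter> V) t) = f" using emb_rst[OF U(1) o(1) _ _ U(3)] o(2) U(4) by auto
      moreover have "rst X U (U \<inter> V) t \<in> carrier (sec X (U \<inter> V))" using U o by (auto intro: rst_closed)
      ultimately have "U \<inter> V \<in> \<U>" unfolding \<U>_def using o by blast
      then show "y \<in> \<Union>\<U>" using o(2) by blast
    qed
  qed
  have oU: "open_in X Z" "Z \<noteq> {}" if "Z \<in> \<U>" for Z using that unfolding \<U>_def by auto
  have compat: "rst X Z (Z \<inter> Z') (s Z) = rst X Z' (Z \<inter> Z') (s Z')" if Z: "Z \<in> \<U>" "Z' \<in> \<U>" for Z Z'
  proof -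
    have o: "open_in X (Z \<inter> Z')" using oU Z by blast
    have ne: "Z \<inter> Z' \<noteq> {}" using irreducible oU Z by blast
    show ?thesis
    proof (rule emb_inj[OF o ne])
      show "rst X Z (Z \<inter> Z') (s Z) \<in> carrier (sec X (Z \<inter> Z'))"
        "rst X Z' (Z \<inter> Z') (s Z') \<in> carrier (sec X (Z \<inter> Z'))"
        using s(1) oU Z o by (auto intro: rst_closed)
      show "germ X \<eta> (Z \<inter> Z') (rst X Z (Z \<inter> Z') (s Z)) = germ X \<eta> (Z \<inter> Z') (rst X Z' (Z \<inter> Z') (s Z'))"
        using emb_rst[OF oU(1)[OF Z(1)] o _ ne s(1)[OF Z(1)]] emb_rst[OF oU(1)[OF Z(2)] o _ ne s(1)[OF Z(2)]]
          s(2) Z by simp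
    qed
  qed
  obtain t where t: "t \<in> carrier (sec X V)" "\<And>Z. Z \<in> \<U> \<Longrightarrow> rst X V Z t = s Z"
    using sheaf_glue[of \<U> s, OF oU(1) s(1) compat] unfolding cover by blast
  obtain y where "y \<in> V" using V(2) by blast
  then obtain Z where Z: "Z \<in> \<U>" "y \<in> Z" using cover by blast
  have "germ X \<eta> V t = germ X \<eta> Z (rst X V Z t)"
    using emb_rst[OF V(1) oU(1)[OF Z(1)] _ oU(2)[OF Z(1)] t(1)] Z(1) unfolding \<U>_def by simp
  also have "\<dots> = f" using t(2)[OF Z(1)] s(2)[OF Z(1)] by simp
  finally show ?thesis using that t(1) by blast
qed

end

section \<open>Orders of vanishing\<close>

lemma (in domain) nat_pow_nonzero: "x \<in> carrier R \<Longrightarrow> x \<noteq> \<zero> \<Longrightarrow> x [^] (n::nat) \<noteq> \<zero>"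
  by (induction n) (auto simp: integral_iff)

text \<open>\<open>order_at\<close> uses integer powers taken in the ring K. Identifying them with
  powers in the multiplicative group makes the exponent laws of groups applicable.\<close>

lemma (in field) int_pow_mult_of:
  "x \<in> carrier R - {\<zero>} \<Longrightarrow> x [^]\<^bsub>R\<^esub> (n::int) = x [^]\<^bsub>Multiplicative_Group.mult_of R\<^esub> n"
  using m_inv_mult_of[of "x [^] nat (- n)"]
  unfolding int_pow_def2 by (auto simp: Multiplicative_Group.nat_pow_mult_of nat_pow_nonzero)

lemma (in field) nonzero_inv:
  "x \<in> carrier R - {\<zero>} \<Longrightarrow> inv x \<in> carrier R - {\<zero>} \<and> x \<otimes> inv x = \<one> \<and> inv x \<otimes> x = \<one>"
  using field_Units Units_inv_Units[of x] Units_r_inv[of x] Units_l_inv[of x] by simp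

locale normal_loc = integral_loc X for X :: "('p, 'r) ringed_space" +
  assumes noeth: "\<And>U. affine_open X U \<Longrightarrow> noetherian_ring (sec X U)"
    and normal: "\<And>x. x \<in> points X \<Longrightarrow> integrally_closed_domain (stalk X x)"
begin

abbreviation "\<iota> \<equiv> stalk_to_fun_field X"
abbreviation "Kx \<equiv> carrier K - {\<zero>\<^bsub>K\<^esub>}"

lemma germ_hom:
  assumes U: "open_in X U" "y \<in> U" shows "ring_hom_cring (sec X U) (stalk X y) (germ X y U)"
proof -
  have y: "y \<in> points X" using U open_points by blast
  have "germ X y U \<in> ring_hom (sec X U) (stalk X y)"
    by (rule ring_hom_memI) (use U in \<open>auto simp: germ_mult germ_add germ_one intro: germ_closed\<close>)
  then show ?thesis
    by (simp add: ring_hom_cring_def ring_hom_cring_axioms_def sec_cring U stalk_cring y)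
qed

lemma affine_fraction_stalk:
  assumes U: "affine_open X U" "y \<in> U" and a: "a \<in> carrier (stalk X y)"
  obtains r g where "r \<in> carrier (sec X U)" "g \<in> carrier (sec X U)" "germ X y U g \<in> Units (stalk X y)"
    "germ X y U g \<otimes>\<^bsub>stalk X y\<^esub> a = germ X y U r"
proof -
  have o: "open_in X U" by (rule affine_is_open[OF U(1)])
  obtain V s where V: "open_in X V" "y \<in> V" "s \<in> carrier (sec X V)" "a = germ X y V s"
    using a unfolding stalk_carrier_iff by blast
  let ?I = "V \<inter> U"
  have I: "open_in X ?I" "?I \<subseteq> U" "y \<in> ?I" "?I \<subseteq> V" using V U o by auto
  have s': "rst X V ?I s \<in> carrier (sec X ?I)" by (rule rst_closed[OF V(1) I(1,4) V(3)])
  obtain r g V' where r: "r \<in> carrier (sec X U)" "g \<in> carrier (sec X U)" "open_in X V'" "y \<in> V'" "V' \<subseteq> ?I"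
    "rst X U V' g \<in> Units (sec X V')"
    "rst X U V' g \<otimes>\<^bsub>sec X V'\<^esub> rst X ?I V' (rst X V ?I s) = rst X U V' r"
    by (rule affine_fraction[OF U(1) I(1-3) s'])
  have VU: "V' \<subseteq> U" "V' \<subseteq> V" using r(5) by auto
  have eq: "germ X y V' (rst X U V' x) = germ X y U x" if "x \<in> carrier (sec X U)" for x
    by (rule germ_restrict[OF o r(3) VU(1) r(4) that])
  have a': "germ X y V' (rst X ?I V' (rst X V ?I s)) = a"
    using germ_restrict[OF I(1) r(3,5,4) s'] germ_restrict[OF V(1) I(1,4,3) V(3)] V(4) by simp
  have c: "rst X U V' g \<in> carrier (sec X V')" "rst X ?I V' (rst X V ?I s) \<in> carrier (sec X V')"
    using rst_closed[OF o r(3) VU(1) r(2)] rst_closed[OF I(1) r(3,5) s'] by auto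
  have "germ X y V' (rst X U V' g) \<otimes>\<^bsub>stalk X y\<^esub> germ X y V' (rst X ?I V' (rst X V ?I s)) = germ X y V' (rst X U V' r)"
    unfolding germ_mult[OF r(3,4) c] r(7) ..
  then have "germ X y U g \<otimes>\<^bsub>stalk X y\<^esub> a = germ X y U r" unfolding a' eq[OF r(1)] eq[OF r(2)] .
  moreover have "germ X y U g \<in> Units (stalk X y)" using germ_Unit[OF r(3,4,6)] eq[OF r(2)] by simp
  ultimately show ?thesis using that r(1,2) by blast
qed

lemma affine_fraction_hom:
  assumes "affine_open X U" "y \<in> U"
  shows "fraction_hom (sec X U) (stalk X y) (germ X y U)"
proof -
  have h: "ring_hom_cring (sec X U) (stalk X y) (germ X y U)"
    by (rule germ_hom[OF affine_is_open[OF assms(1)] assms(2)])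
  show ?thesis
  proof (intro fraction_hom.intro h fraction_hom_axioms.intro)
    fix a assume "a \<in> carrier (stalk X y)"
    then obtain r g where "r \<in> carrier (sec X U)" "g \<in> carrier (sec X U)" "germ X y U g \<in> Units (stalk X y)"
      "germ X y U g \<otimes>\<^bsub>stalk X y\<^esub> a = germ X y U r" by (rule affine_fraction_stalk[OF assms])
    then show "\<exists>r\<in>carrier (sec X U). \<exists>f\<in>carrier (sec X U). germ X y U f \<in> Units (stalk X y) \<and>
      germ X y U f \<otimes>\<^bsub>stalk X y\<^esub> a = germ X y U r" by blast
  qed
qed

lemma stalk_noetherian: assumes "y \<in> points X" shows "noetherian_ring (stalk X y)"
proof -
  obtain U where U: "affine_open X U" "y \<in> U" using affine_cover assms by blast
  show ?thesis by (rule fraction_hom.noetherian_transfer[OF affine_fraction_hom[OF U] noeth[OF U(1)]])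
qed

lemma stalk_domain: "y \<in> points X \<Longrightarrow> domain (stalk X y)"
  using normal unfolding integrally_closed_domain_def by blast

lemma K_fraction:
  assumes U: "affine_open X U" "U \<noteq> {}" and f: "f \<in> carrier K"
  obtains r g where "r \<in> carrier (sec X U)" "g \<in> carrier (sec X U)" "germ X \<eta> U g \<in> Kx"
    "germ X \<eta> U g \<otimes>\<^bsub>K\<^esub> f = germ X \<eta> U r"
proof -
  have e: "\<eta> \<in> U" by (rule gen_mem[OF affine_is_open[OF U(1)] U(2)])
  obtain r g where rg: "r \<in> carrier (sec X U)" "g \<in> carrier (sec X U)" "germ X \<eta> U g \<in> Units K"
    "germ X \<eta> U g \<otimes>\<^bsub>K\<^esub> f = germ X \<eta> U r" by (rule affine_fraction_stalk[OF U(1) e f])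
  have "germ X \<eta> U g \<in> Kx" using rg(3) unfolding K.field_Units .
  then show ?thesis by (rule that[OF rg(1,2) _ rg(4)])
qed

lemma codim_point: "codim_one X y \<Longrightarrow> y \<in> points X"
  unfolding codim_one_def by blast

lemma codim_local:
  assumes "codim_one X y" shows "dim_one_local (stalk X y) (THE m. maximalideal m (stalk X y))"
  using assms codim_point[OF assms] unfolding codim_one_def
  by (intro dim_one_localI stalk_local stalk_noetherian normal) auto

lemma Unit_iota: assumes "y \<in> points X" "v \<in> Units (stalk X y)" shows "\<iota> v \<in> Kx"
proof -
  interpret h: ring_hom_cring "stalk X y" K \<iota> by (rule stalk_emb_hom[OF assms(1)])
  have "\<iota> v \<in> Units K"
  proof -
    have v: "v \<in> carrier (stalk X y)" "inv\<^bsub>stalk X y\<^esub> v \<in> carrier (stalk X y)" using assms by auto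
    have "\<iota> v \<otimes>\<^bsub>K\<^esub> \<iota> (inv\<^bsub>stalk X y\<^esub> v) = \<one>\<^bsub>K\<^esub>"
      using assms v by (simp flip: h.hom_mult)
    moreover have "\<iota> (inv\<^bsub>stalk X y\<^esub> v) \<otimes>\<^bsub>K\<^esub> \<iota> v = \<one>\<^bsub>K\<^esub>"
      using assms v by (simp flip: h.hom_mult)
    ultimately show ?thesis unfolding Units_def using v h.hom_closed by blast
  qed
  then show ?thesis using K.field_Units by simp
qed

lemma iota_nonzero:
  assumes "y \<in> points X" "a \<in> carrier (stalk X y)" "a \<noteq> \<zero>\<^bsub>stalk X y\<^esub>" shows "\<iota> a \<in> Kx"
proof -
  interpret h: ring_hom_cring "stalk X y" K \<iota> by (rule stalk_emb_hom[OF assms(1)])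
  have "\<iota> a \<noteq> \<zero>\<^bsub>K\<^esub>"
    using stalk_emb_inj[OF assms(1,2) h.R.zero_closed] assms(3) h.hom_zero by auto
  then show ?thesis using assms by simp
qed

text \<open>A subgroup is closed under integer powers. This absorbs a change of uniformizer, which
  multiplies its n-th power by the n-th power of a unit.\<close>

lemma units_subgroup:
  assumes y: "y \<in> points X" shows "subgroup (\<iota> ` Units (stalk X y)) (Multiplicative_Group.mult_of K)"
proof -
  interpret h: ring_hom_cring "stalk X y" K \<iota> by (rule stalk_emb_hom[OF y])
  interpret G: group "Multiplicative_Group.mult_of K" by (rule K.field_mult_group)
  show ?thesis
  proof (rule G.subgroupI)
    show "\<iota> ` Units (stalk X y) \<subseteq> carrier (Multiplicative_Group.mult_of K)" using Unit_iota[OF y] by auto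
    show "\<iota> ` Units (stalk X y) \<noteq> {}" using h.R.Units_one_closed by blast
  next
    fix a assume "a \<in> \<iota> ` Units (stalk X y)"
    then obtain v where v: "v \<in> Units (stalk X y)" "a = \<iota> v" by blast
    have "\<iota> (inv\<^bsub>stalk X y\<^esub> v) \<otimes>\<^bsub>K\<^esub> a = \<one>\<^bsub>K\<^esub>"
      unfolding v(2) using v(1) by (simp add: h.R.Units_closed flip: h.hom_mult)
    then have "inv\<^bsub>Multiplicative_Group.mult_of K\<^esub> a = \<iota> (inv\<^bsub>stalk X y\<^esub> v)"
      using v Unit_iota[OF y v(1)] Unit_iota[OF y h.R.Units_inv_Units[OF v(1)]]
      by (intro G.inv_equality) auto
    then show "inv\<^bsub>Multiplicative_Group.mult_of K\<^esub> a \<in> \<iota> ` Units (stalk X y)" using v by simp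
  next
    fix a b assume "a \<in> \<iota> ` Units (stalk X y)" "b \<in> \<iota> ` Units (stalk X y)"
    then obtain v w where v: "v \<in> Units (stalk X y)" "a = \<iota> v" "w \<in> Units (stalk X y)" "b = \<iota> w" by blast
    have "a \<otimes>\<^bsub>K\<^esub> b = \<iota> (v \<otimes>\<^bsub>stalk X y\<^esub> w)"
      unfolding v(2,4) using v(1,3) by (simp add: h.R.Units_closed)
    then show "a \<otimes>\<^bsub>Multiplicative_Group.mult_of K\<^esub> b \<in> \<iota> ` Units (stalk X y)" using v h.R.Units_m_closed by auto
  qed
qed

lemma iota_int_pow_unit:
  assumes y: "y \<in> points X" and v: "v \<in> Units (stalk X y)"
  shows "\<exists>w\<in>Units (stalk X y). \<iota> v [^]\<^bsub>K\<^esub> (n::int) = \<iota> w"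
proof -
  interpret G: group "Multiplicative_Group.mult_of K" by (rule K.field_mult_group)
  have "\<iota> v [^]\<^bsub>Multiplicative_Group.mult_of K\<^esub> n \<in> \<iota> ` Units (stalk X y)"
    by (rule G.subgroup_int_pow_closed[OF units_subgroup[OF y]]) (use v in blast)
  then show ?thesis using K.int_pow_mult_of[OF Unit_iota[OF y v]] by auto
qed

lemma K_int_pow:
  assumes t: "t \<in> Kx"
  shows "t [^]\<^bsub>K\<^esub> (n::int) \<in> Kx" "t [^]\<^bsub>K\<^esub> (n + n'::int) = t [^]\<^bsub>K\<^esub> n \<otimes>\<^bsub>K\<^esub> t [^]\<^bsub>K\<^esub> n'"
proof -
  interpret G: group "Multiplicative_Group.mult_of K" by (rule K.field_mult_group)
  show "t [^]\<^bsub>K\<^esub> n \<in> Kx" using G.int_pow_closed[of t n] t K.int_pow_mult_of[OF t] by simp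
  show "t [^]\<^bsub>K\<^esub> (n + n') = t [^]\<^bsub>K\<^esub> n \<otimes>\<^bsub>K\<^esub> t [^]\<^bsub>K\<^esub> n'"
    using G.int_pow_mult[of t n n'] t K.int_pow_mult_of[OF t] by simp
qed

lemma K_int_pow_distrib:
  assumes "s \<in> Kx" "t \<in> Kx"
  shows "(s \<otimes>\<^bsub>K\<^esub> t) [^]\<^bsub>K\<^esub> (n::int) = s [^]\<^bsub>K\<^esub> n \<otimes>\<^bsub>K\<^esub> t [^]\<^bsub>K\<^esub> n"
proof -
  interpret G: group "Multiplicative_Group.mult_of K" by (rule K.field_mult_group)
  have "s \<otimes>\<^bsub>K\<^esub> t \<in> Kx" using assms by (simp add: K.integral_iff)
  then show ?thesis
    using G.int_pow_mult_distrib[of s t n] assms K.m_comm[of s t]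
      K.int_pow_mult_of[OF assms(1)] K.int_pow_mult_of[OF assms(2)] K.int_pow_mult_of[of "s \<otimes>\<^bsub>K\<^esub> t"]
    by simp
qed

section \<open>The discrete valuation at a codimension one point\<close>

context
  fixes y
  assumes cod: "codim_one X y"
begin

abbreviation "A \<equiv> stalk X y"

interpretation A: dim_one_local A "THE m. maximalideal m A"
  by (rule codim_local[OF cod])

interpretation h: ring_hom_cring A K \<iota>
  by (rule stalk_emb_hom[OF codim_point[OF cod]])

lemma uniformizer_nonzero: assumes "uniformizer A t" shows "t \<in> carrier A" "t \<noteq> \<zero>\<^bsub>A\<^esub>" "t \<notin> Units A"
proof -
  show tA: "t \<in> carrier A" using assms unfolding uniformizer_def by blast
  obtain a where a: "a \<in> (THE m. maximalideal m A)" "a \<noteq> \<zero>\<^bsub>A\<^esub>" by (rule A.m_nonzero)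
  then obtain b where "b \<in> carrier A" "a = b \<otimes>\<^bsub>A\<^esub> t" using assms unfolding A.uniformizer_iff by blast
  then show "t \<noteq> \<zero>\<^bsub>A\<^esub>" using a(2) by auto
  show "t \<notin> Units A" using assms A.nonunit_iff[OF tA] unfolding A.uniformizer_iff by blast
qed

lemma uniformizer_K: "uniformizer A t \<Longrightarrow> \<iota> t \<in> Kx"
  using uniformizer_nonzero iota_nonzero codim_point[OF cod] by blast

lemma uniformizers_associated:
  assumes "uniformizer A t" "uniformizer A t'"
  obtains w where "w \<in> Units A" "t' = w \<otimes>\<^bsub>A\<^esub> t"
proof -
  note t = uniformizer_nonzero[OF assms(1)] and t' = uniformizer_nonzero[OF assms(2)]
  obtain w where w: "w \<in> carrier A" "t' = w \<otimes>\<^bsub>A\<^esub> t"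
    using assms unfolding A.uniformizer_iff by blast
  obtain w' where w': "w' \<in> carrier A" "t = w' \<otimes>\<^bsub>A\<^esub> t'"
    using assms unfolding A.uniformizer_iff by blast
  have "t \<otimes>\<^bsub>A\<^esub> \<one>\<^bsub>A\<^esub> = w' \<otimes>\<^bsub>A\<^esub> (w \<otimes>\<^bsub>A\<^esub> t)" using w' w t by simp
  also have "\<dots> = t \<otimes>\<^bsub>A\<^esub> (w' \<otimes>\<^bsub>A\<^esub> w)" using w(1) w'(1) t(1) by (simp add: A.m_ac)
  finally have "\<one>\<^bsub>A\<^esub> = w' \<otimes>\<^bsub>A\<^esub> w" using A.m_lcancel[OF t(2,1)] w(1) w'(1) by simp
  then have "w \<in> Units A" unfolding Units_def using w(1) w'(1) A.m_comm[of w w'] by auto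
  then show ?thesis using that w(2) by blast
qed

text \<open>Uniqueness justifies the definite description in \<open>order_at\<close>, and by
  symmetry one inequality suffices. If \<open>n\<close> were larger, cancelling the power of
  \<open>t\<close> with exponent \<open>n'\<close> would turn a positive power of \<open>t\<close>
  times a unit into a unit, so that \<open>t\<close> would be a unit.\<close>

lemma order_unique:
  assumes t: "uniformizer A t" "uniformizer A t'" and v: "v \<in> Units A" "v' \<in> Units A"
    and eq: "\<iota> v \<otimes>\<^bsub>K\<^esub> (\<iota> t [^]\<^bsub>K\<^esub> (n::int)) = \<iota> v' \<otimes>\<^bsub>K\<^esub> (\<iota> t' [^]\<^bsub>K\<^esub> (n'::int))"
  shows "n \<le> n'"
proof (rule ccontr)
  assume "\<not> n \<le> n'"
  define k where "k = nat (n - n')"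
  have k: "k > 0" "n = int k + n'" using \<open>\<not> n \<le> n'\<close> unfolding k_def by auto
  note y = codim_point[OF cod]
  obtain w where w: "w \<in> Units A" "t' = w \<otimes>\<^bsub>A\<^esub> t" by (rule uniformizers_associated[OF t])
  note tn = uniformizer_nonzero[OF t(1)]
  have tK: "\<iota> t \<in> Kx" by (rule uniformizer_K[OF t(1)])
  obtain w' where w': "w' \<in> Units A" "\<iota> w [^]\<^bsub>K\<^esub> n' = \<iota> w'" using iota_int_pow_unit[OF y w(1), of n'] by blast
  let ?T = "\<iota> t [^]\<^bsub>K\<^esub> n'"
  have TK: "?T \<in> Kx" by (rule K_int_pow(1)[OF tK])
  have vK: "\<iota> v \<in> Kx" "\<iota> v' \<in> Kx" "\<iota> w' \<in> Kx" using v w' Unit_iota[OF y] by auto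
  have "\<iota> t' [^]\<^bsub>K\<^esub> n' = \<iota> w' \<otimes>\<^bsub>K\<^esub> ?T"
    unfolding w(2) using K_int_pow_distrib[OF Unit_iota[OF y w(1)] tK] A.Units_closed[OF w(1)] tn w'(2) by simp
  moreover have "\<iota> t [^]\<^bsub>K\<^esub> n = \<iota> (t [^]\<^bsub>A\<^esub> k) \<otimes>\<^bsub>K\<^esub> ?T"
    unfolding k(2) K_int_pow(2)[OF tK] int_pow_int using tn by (simp)
  ultimately have "\<iota> v \<otimes>\<^bsub>K\<^esub> (\<iota> (t [^]\<^bsub>A\<^esub> k) \<otimes>\<^bsub>K\<^esub> ?T) = \<iota> v' \<otimes>\<^bsub>K\<^esub> (\<iota> w' \<otimes>\<^bsub>K\<^esub> ?T)" using eq by simp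
  then have "?T \<otimes>\<^bsub>K\<^esub> (\<iota> v \<otimes>\<^bsub>K\<^esub> \<iota> (t [^]\<^bsub>A\<^esub> k)) = ?T \<otimes>\<^bsub>K\<^esub> (\<iota> v' \<otimes>\<^bsub>K\<^esub> \<iota> w')"
    using TK vK tn by (simp add: K.m_ac)
  then have "\<iota> v \<otimes>\<^bsub>K\<^esub> \<iota> (t [^]\<^bsub>A\<^esub> k) = \<iota> v' \<otimes>\<^bsub>K\<^esub> \<iota> w'"
    using K.m_lcancel[of ?T] TK vK tn by simp
  then have "\<iota> (v \<otimes>\<^bsub>A\<^esub> t [^]\<^bsub>A\<^esub> k) = \<iota> (v' \<otimes>\<^bsub>A\<^esub> w')"
    using A.Units_closed[OF v(1)] A.Units_closed[OF v(2)] A.Units_closed[OF w'(1)] tn by simp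
  then have "v \<otimes>\<^bsub>A\<^esub> t [^]\<^bsub>A\<^esub> k = v' \<otimes>\<^bsub>A\<^esub> w'"
    by (rule stalk_emb_inj[OF y, rotated 2]) (use v w' tn in auto)
  then have "v \<otimes>\<^bsub>A\<^esub> t [^]\<^bsub>A\<^esub> k \<in> Units A" using v w' by simp
  moreover obtain k' where "k = Suc k'" using k(1) by (cases k) auto
  moreover have "v \<otimes>\<^bsub>A\<^esub> (t [^]\<^bsub>A\<^esub> k' \<otimes>\<^bsub>A\<^esub> t) = t \<otimes>\<^bsub>A\<^esub> (v \<otimes>\<^bsub>A\<^esub> t [^]\<^bsub>A\<^esub> k')"
    using v tn by (simp add: A.m_ac A.Units_closed)
  ultimately have "t \<otimes>\<^bsub>A\<^esub> (v \<otimes>\<^bsub>A\<^esub> t [^]\<^bsub>A\<^esub> k') \<in> Units A" by simp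
  then have "t \<in> Units A" by (rule A.unit_factor) (use v tn in auto)
  then show False using tn(3) by simp
qed

lemma order_eqI:
  assumes "uniformizer A t" "v \<in> Units A" "f = \<iota> v \<otimes>\<^bsub>K\<^esub> (\<iota> t [^]\<^bsub>K\<^esub> (n::int))"
  shows "order_at X y f = n"
  unfolding order_at_def
proof (rule the_equality)
  show "\<exists>t v. uniformizer A t \<and> v \<in> Units A \<and> f = \<iota> v \<otimes>\<^bsub>K\<^esub> (\<iota> t [^]\<^bsub>K\<^esub> n)" using assms by blast
  fix n' :: int
  assume "\<exists>t v. uniformizer A t \<and> v \<in> Units A \<and> f = \<iota> v \<otimes>\<^bsub>K\<^esub> (\<iota> t [^]\<^bsub>K\<^esub> n')"
  then obtain t' v' where 2: "uniformizer A t'" "v' \<in> Units A" "f = \<iota> v' \<otimes>\<^bsub>K\<^esub> (\<iota> t' [^]\<^bsub>K\<^esub> n')" by blast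
  have eq: "\<iota> v \<otimes>\<^bsub>K\<^esub> (\<iota> t [^]\<^bsub>K\<^esub> n) = \<iota> v' \<otimes>\<^bsub>K\<^esub> (\<iota> t' [^]\<^bsub>K\<^esub> n')" using assms(3) 2(3) by simp
  show "n' = n"
    using order_unique[OF assms(1) 2(1) assms(2) 2(2) eq] order_unique[OF 2(1) assms(1) 2(2) assms(2) eq[symmetric]]
    by simp
qed

lemma stalk_order:
  assumes t: "uniformizer A t" and a: "a \<in> carrier A" "a \<noteq> \<zero>\<^bsub>A\<^esub>"
  obtains v n where "v \<in> Units A" "a = v \<otimes>\<^bsub>A\<^esub> t [^]\<^bsub>A\<^esub> (n::nat)" "order_at X y (\<iota> a) = int n"
proof -
  note tn = uniformizer_nonzero[OF t]
  obtain v n where v: "v \<in> Units A" "a = v \<otimes>\<^bsub>A\<^esub> t [^]\<^bsub>A\<^esub> (n::nat)"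
    using A.uniformizer_factor[OF t tn(2) a] by blast
  have "\<iota> a = \<iota> v \<otimes>\<^bsub>K\<^esub> (\<iota> t [^]\<^bsub>K\<^esub> int n)"
    unfolding v(2) int_pow_int using A.Units_closed[OF v(1)] tn by (simp)
  then have "order_at X y (\<iota> a) = int n" by (rule order_eqI[OF t v(1)])
  then show ?thesis using that v by blast
qed

text \<open>In terms of an affine neighbourhood, \<open>f\<close> is a quotient of two nonzero
  elements of the local ring, to which \<open>stalk_order\<close> applies; the two exponents
  subtract.\<close>

lemma order_rep:
  assumes t: "uniformizer A t" and f: "f \<in> Kx"
  obtains v where "v \<in> Units A" "f = \<iota> v \<otimes>\<^bsub>K\<^esub> (\<iota> t [^]\<^bsub>K\<^esub> order_at X y f)"
proof -
  note y = codim_point[OF cod] and tn = uniformizer_nonzero[OF t]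
  have tK: "\<iota> t \<in> Kx" by (rule uniformizer_K[OF t])
  obtain U where U: "affine_open X U" "y \<in> U" using affine_cover y by blast
  have o: "open_in X U" by (rule affine_is_open[OF U(1)])
  have fK: "f \<in> carrier K" using f by simp
  obtain r g where rg: "r \<in> carrier (sec X U)" "g \<in> carrier (sec X U)" "germ X \<eta> U g \<in> Kx"
    "germ X \<eta> U g \<otimes>\<^bsub>K\<^esub> f = germ X \<eta> U r" using K_fraction[OF U(1) _ fK] U(2) by blast
  define a b where "a = germ X y U r" and "b = germ X y U g"
  have ab: "a \<in> carrier A" "b \<in> carrier A" "\<iota> a = germ X \<eta> U r" "\<iota> b = germ X \<eta> U g"
    unfolding a_def b_def using o U(2) rg stalk_emb by auto
  have b0: "b \<noteq> \<zero>\<^bsub>A\<^esub>" using rg(3) ab by auto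
  have eq: "\<iota> b \<otimes>\<^bsub>K\<^esub> f = \<iota> a" using ab rg(4) by simp
  have "\<iota> a \<noteq> \<zero>\<^bsub>K\<^esub>" using eq f rg(3) ab(4) K.integral_iff by (metis DiffD1 DiffD2 singletonI)
  then have a0: "a \<noteq> \<zero>\<^bsub>A\<^esub>" by auto
  obtain v n where v: "v \<in> Units A" "a = v \<otimes>\<^bsub>A\<^esub> t [^]\<^bsub>A\<^esub> (n::nat)" by (rule stalk_order[OF t ab(1) a0])
  obtain w k where w: "w \<in> Units A" "b = w \<otimes>\<^bsub>A\<^esub> t [^]\<^bsub>A\<^esub> (k::nat)" by (rule stalk_order[OF t ab(2) b0])
  define x where "x = \<iota> (v \<otimes>\<^bsub>A\<^esub> inv\<^bsub>A\<^esub> w) \<otimes>\<^bsub>K\<^esub> (\<iota> t [^]\<^bsub>K\<^esub> (int n - int k))"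
  note Uc = A.Units_closed[OF v(1)] A.Units_closed[OF w(1)]
  have u: "v \<otimes>\<^bsub>A\<^esub> inv\<^bsub>A\<^esub> w \<in> Units A" using v w by simp
  note Uc' = A.Units_closed[OF u]
  have xK: "x \<in> carrier K" unfolding x_def
    using K_int_pow(1)[OF tK, of "int n - int k"] h.hom_closed[OF A.Units_closed[OF u]]
    by (intro K.m_closed) auto
  have "\<iota> b \<otimes>\<^bsub>K\<^esub> x = \<iota> (w \<otimes>\<^bsub>A\<^esub> (v \<otimes>\<^bsub>A\<^esub> inv\<^bsub>A\<^esub> w)) \<otimes>\<^bsub>K\<^esub> (\<iota> t [^]\<^bsub>K\<^esub> int k \<otimes>\<^bsub>K\<^esub> \<iota> t [^]\<^bsub>K\<^esub> (int n - int k))"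
    unfolding x_def w(2) int_pow_int using Uc Uc' tn K_int_pow(1)[OF tK, of "int n - int k"]
      A.Units_inv_closed[OF w(1)] by (simp add: K.m_ac)
  also have "w \<otimes>\<^bsub>A\<^esub> (v \<otimes>\<^bsub>A\<^esub> inv\<^bsub>A\<^esub> w) = v"
    using Uc w(1) A.m_lcomm[of w v "inv\<^bsub>A\<^esub> w"] by simp
  also have "\<iota> t [^]\<^bsub>K\<^esub> int k \<otimes>\<^bsub>K\<^esub> \<iota> t [^]\<^bsub>K\<^esub> (int n - int k) = \<iota> t [^]\<^bsub>K\<^esub> int n"
    by (simp flip: K_int_pow(2)[OF tK])
  also have "\<iota> v \<otimes>\<^bsub>K\<^esub> \<iota> t [^]\<^bsub>K\<^esub> int n = \<iota> a" unfolding v(2) int_pow_int using A.Units_closed[OF v(1)] tn by (simp)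
  finally have "\<iota> b \<otimes>\<^bsub>K\<^esub> x = \<iota> b \<otimes>\<^bsub>K\<^esub> f" using eq by simp
  then have "f = x" using K.m_lcancel[of "\<iota> b" x f] xK f rg(3) ab(4) by simp
  then have "f = \<iota> (v \<otimes>\<^bsub>A\<^esub> inv\<^bsub>A\<^esub> w) \<otimes>\<^bsub>K\<^esub> (\<iota> t [^]\<^bsub>K\<^esub> (int n - int k))" unfolding x_def .
  moreover from order_eqI[OF t u this] have "order_at X y f = int n - int k" .
  ultimately show ?thesis using that u by metis
qed

lemma uniformizer_ex: obtains t where "uniformizer A t"
  using A.uniformizer_exists by blast

lemma order_mult:
  assumes "f \<in> Kx" "g \<in> Kx" shows "order_at X y (f \<otimes>\<^bsub>K\<^esub> g) = order_at X y f + order_at X y g"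
proof -
  obtain t where t: "uniformizer A t" by (rule uniformizer_ex)
  note tn = uniformizer_nonzero[OF t]
  have tK: "\<iota> t \<in> Kx" by (rule uniformizer_K[OF t])
  obtain v where v: "v \<in> Units A" "f = \<iota> v \<otimes>\<^bsub>K\<^esub> (\<iota> t [^]\<^bsub>K\<^esub> order_at X y f)" by (rule order_rep[OF t assms(1)])
  obtain w where w: "w \<in> Units A" "g = \<iota> w \<otimes>\<^bsub>K\<^esub> (\<iota> t [^]\<^bsub>K\<^esub> order_at X y g)" by (rule order_rep[OF t assms(2)])
  have c: "\<iota> t [^]\<^bsub>K\<^esub> order_at X y f \<in> carrier K" "\<iota> t [^]\<^bsub>K\<^esub> order_at X y g \<in> carrier K"
    "\<iota> v \<in> carrier K" "\<iota> w \<in> carrier K"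
    using K_int_pow(1)[OF tK] h.hom_closed[OF A.Units_closed] v(1) w(1) by auto
  have "f \<otimes>\<^bsub>K\<^esub> g = (\<iota> v \<otimes>\<^bsub>K\<^esub> (\<iota> t [^]\<^bsub>K\<^esub> order_at X y f)) \<otimes>\<^bsub>K\<^esub> (\<iota> w \<otimes>\<^bsub>K\<^esub> (\<iota> t [^]\<^bsub>K\<^esub> order_at X y g))"
    using v(2) w(2) by simp
  also have "\<dots> = \<iota> (v \<otimes>\<^bsub>A\<^esub> w) \<otimes>\<^bsub>K\<^esub> (\<iota> t [^]\<^bsub>K\<^esub> (order_at X y f + order_at X y g))"
    unfolding K_int_pow(2)[OF tK] using c A.Units_closed[OF v(1)] A.Units_closed[OF w(1)]
    by (simp add: K.m_ac)
  finally have eq: "f \<otimes>\<^bsub>K\<^esub> g = \<iota> (v \<otimes>\<^bsub>A\<^esub> w) \<otimes>\<^bsub>K\<^esub> (\<iota> t [^]\<^bsub>K\<^esub> (order_at X y f + order_at X y g))" .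
  show ?thesis by (rule order_eqI[OF t _ eq]) (use v w in auto)
qed

lemma order_unit: "v \<in> Units A \<Longrightarrow> order_at X y (\<iota> v) = 0"
proof -
  assume v: "v \<in> Units A"
  obtain t where t: "uniformizer A t" by (rule uniformizer_ex)
  show ?thesis by (rule order_eqI[OF t v]) (use A.Units_closed[OF v] in simp)
qed

lemma order_one: "order_at X y \<one>\<^bsub>K\<^esub> = 0"
  using order_unit[OF A.Units_one_closed] by simp

lemma order_inv: assumes "f \<in> Kx" shows "order_at X y (inv\<^bsub>K\<^esub> f) = - order_at X y f"
  using order_mult[of f "inv\<^bsub>K\<^esub> f"] K.nonzero_inv[OF assms] assms order_one by simp

lemma order_pow: assumes "f \<in> Kx" shows "order_at X y (f [^]\<^bsub>K\<^esub> (n::nat)) = int n * order_at X y f"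
proof (induction n)
  case (Suc n)
  then show ?case using order_mult[of "f [^]\<^bsub>K\<^esub> n" f] assms
    by (simp add: K.nat_pow_nonzero algebra_simps)
qed (simp add: order_one)

lemma order_uniformizer: assumes t: "uniformizer A t" shows "order_at X y (\<iota> t) = 1"
proof (rule order_eqI[OF t A.Units_one_closed])
  have "\<iota> t [^]\<^bsub>K\<^esub> int 1 = \<iota> t" unfolding int_pow_int using uniformizer_K[OF t] by simp
  then show "\<iota> t = \<iota> \<one>\<^bsub>A\<^esub> \<otimes>\<^bsub>K\<^esub> \<iota> t [^]\<^bsub>K\<^esub> (1::int)" using uniformizer_K[OF t] by simp
qed

lemma lring_order: assumes f: "f \<in> Kx" shows "f \<in> lring y \<longleftrightarrow> order_at X y f \<ge> 0"
proof
  obtain t where t: "uniformizer A t" by (rule uniformizer_ex)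
  note tn = uniformizer_nonzero[OF t]
  {
    assume "f \<in> lring y"
    then obtain a where a: "a \<in> carrier A" "f = \<iota> a" unfolding lring_def by blast
    then have a0: "a \<noteq> \<zero>\<^bsub>A\<^esub>" using f by auto
    obtain n where "order_at X y (\<iota> a) = int n" by (rule stalk_order[OF t a(1) a0])
    then show "order_at X y f \<ge> 0" using a(2) by simp
  next
    assume n: "order_at X y f \<ge> 0"
    obtain v where v: "v \<in> Units A" "f = \<iota> v \<otimes>\<^bsub>K\<^esub> (\<iota> t [^]\<^bsub>K\<^esub> order_at X y f)" by (rule order_rep[OF t f])
    have "\<iota> t [^]\<^bsub>K\<^esub> order_at X y f = \<iota> (t [^]\<^bsub>A\<^esub> nat (order_at X y f))"
      using tn pow_nat[OF n, of K "\<iota> t"] by simp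
    then have "f = \<iota> (v \<otimes>\<^bsub>A\<^esub> t [^]\<^bsub>A\<^esub> nat (order_at X y f))"
      using v A.Units_closed[OF v(1)] tn by simp
    then show "f \<in> lring y" unfolding lring_def by (rule image_eqI) (use A.Units_closed[OF v(1)] tn in simp)
  }
qed

lemma order_surj: obtains f where "f \<in> Kx" "order_at X y f = n"
proof -
  obtain t where t: "uniformizer A t" by (rule uniformizer_ex)
  have tK: "\<iota> t \<in> Kx" by (rule uniformizer_K[OF t])
  have "order_at X y (\<iota> t [^]\<^bsub>K\<^esub> n) = n"
    by (rule order_eqI[OF t A.Units_one_closed]) (use K_int_pow(1)[OF tK] in simp)
  then show ?thesis using that K_int_pow(1)[OF tK] by blast
qed

lemma order_section:
  assumes U: "open_in X U" "y \<in> U" "r \<in> carrier (sec X U)" "germ X \<eta> U r \<in> Kx"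
  shows "order_at X y (germ X \<eta> U r) \<ge> 0"
    "order_at X y (germ X \<eta> U r) = 0 \<longleftrightarrow> germ X y U r \<in> Units A"
proof -
  have e: "\<iota> (germ X y U r) = germ X \<eta> U r" by (rule stalk_emb[OF U(1-3)])
  show 1: "order_at X y (germ X \<eta> U r) \<ge> 0" using lring_order[OF U(4)] emb_lring[OF U(1-3)] by simp
  have a: "germ X y U r \<in> carrier A" using U by auto
  then have a0: "germ X y U r \<noteq> \<zero>\<^bsub>A\<^esub>" using U(4) e by auto
  obtain t where t: "uniformizer A t" by (rule uniformizer_ex)
  obtain v n where v: "v \<in> Units A" "germ X y U r = v \<otimes>\<^bsub>A\<^esub> t [^]\<^bsub>A\<^esub> (n::nat)"
    "order_at X y (\<iota> (germ X y U r)) = int n" by (rule stalk_order[OF t a a0])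
  show "order_at X y (germ X \<eta> U r) = 0 \<longleftrightarrow> germ X y U r \<in> Units A"
  proof
    assume "order_at X y (germ X \<eta> U r) = 0"
    then have "n = 0" using v(3) e by simp
    then show "germ X y U r \<in> Units A" using v(1,2) by simp
  next
    assume "germ X y U r \<in> Units A"
    then show "order_at X y (germ X \<eta> U r) = 0" using order_unit e by metis
  qed
qed

end

end

section \<open>Divisors\<close>

context normal_loc
begin

definition prime_at :: "'p set \<Rightarrow> 'p \<Rightarrow> 'r set" where
  "prime_at U y = {r \<in> carrier (sec X U). germ X y U r \<notin> Units (stalk X y)}"

lemma prime_at_inj:
  assumes U: "affine_open X U" shows "inj_on (prime_at U) U"
proof (rule inj_onI)
  fix y z assume yz: "y \<in> U" "z \<in> U" and eq: "prime_at U y = prime_at U z"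
  show "y = z"
  proof (rule ccontr)
    assume ne: "y \<noteq> z"
    obtain r where "r \<in> carrier (sec X U)"
      "(germ X y U r \<in> Units (stalk X y)) \<noteq> (germ X z U r \<in> Units (stalk X z))"
      using affine_separate[OF U yz ne] by blast
    then show False using eq unfolding prime_at_def by blast
  qed
qed

text \<open>Such a prime \<open>Q\<close> survives in the local ring at \<open>y\<close>, where the
  maximal ideal is the only nonzero prime; contracting it gives back \<open>Q\<close>. So points of
  codimension one belong to primes that are minimal among the nonzero ones.\<close>

lemma prime_at_codim_one:
  assumes U: "affine_open X U" "y \<in> U" and cod: "codim_one X y"
    and Q: "primeideal Q (sec X U)" "Q \<subseteq> prime_at U y" "r \<in> Q" "r \<noteq> \<zero>\<^bsub>sec X U\<^esub>"
  shows "Q = prime_at U y"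
proof -
  interpret fraction_hom "sec X U" "stalk X y" "germ X y U" by (rule affine_fraction_hom[OF U])
  interpret A: dim_one_local "stalk X y" "THE m. maximalideal m (stalk X y)" by (rule codim_local[OF cod])
  interpret Q: primeideal Q "sec X U" by (rule Q(1))
  have o: "open_in X U" "U \<noteq> {}" using affine_is_open[OF U(1)] U(2) by auto
  have ker: "s = \<zero>\<^bsub>sec X U\<^esub>" if "s \<in> carrier (sec X U)" "germ X y U s = \<zero>\<^bsub>stalk X y\<^esub>" for s
  proof -
    interpret h: ring_hom_cring "stalk X y" K \<iota> by (rule stalk_emb_hom[OF codim_point[OF cod]])
    have "germ X \<eta> U s = \<zero>\<^bsub>K\<^esub>" using stalk_emb[OF o(1) U(2) that(1)] that(2) h.hom_zero by simp
    then show ?thesis by (rule germ_gen_eq_zero[OF o(1) that(1) o(2)])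
  qed
  obtain Q' where Q': "primeideal Q' (stalk X y)" "{r \<in> carrier (sec X U). germ X y U r \<in> Q'} = Q"
    by (rule prime_extension[OF Q(1)]) (use Q(2) ker in \<open>auto simp: prime_at_def\<close>)
  have rQ: "r \<in> carrier (sec X U)" "germ X y U r \<in> Q'" using Q(3) Q'(2) by blast+
  have "germ X y U r \<noteq> \<zero>\<^bsub>stalk X y\<^esub>" using ker[OF rQ(1)] Q(4) by blast
  then have m: "Q' = (THE m. maximalideal m (stalk X y))" by (rule A.nonzero_prime[OF Q'(1) rQ(2)])
  have "s \<in> Q" if "s \<in> prime_at U y" for s
  proof -
    have s: "s \<in> carrier (sec X U)" "germ X y U s \<notin> Units (stalk X y)"
      using that unfolding prime_at_def by auto
    then have "germ X y U s \<in> Q'" unfolding m using A.nonunit_iff[of "germ X y U s"] hom_closed by blast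
    then show ?thesis using Q'(2) s by blast
  qed
  then show ?thesis using Q(2) by blast
qed

lemma prime_at_prime:
  assumes U: "open_in X U" "y \<in> U" and cod: "codim_one X y"
  shows "primeideal (prime_at U y) (sec X U)"
proof -
  interpret A: dim_one_local "stalk X y" "THE m. maximalideal m (stalk X y)" by (rule codim_local[OF cod])
  interpret h: ring_hom_cring "sec X U" "stalk X y" "germ X y U" by (rule germ_hom[OF U])
  let ?m = "THE m. maximalideal m (stalk X y)"
  interpret m: primeideal ?m "stalk X y" by (rule A.maximalideal_prime[OF A.max_m])
  have iff: "germ X y U r \<notin> Units (stalk X y) \<longleftrightarrow> germ X y U r \<in> ?m" if "r \<in> carrier (sec X U)" for r
    using A.nonunit_iff that by simp
  have eq: "prime_at U y = {r \<in> carrier (sec X U). germ X y U r \<in> ?m}"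
    unfolding prime_at_def using iff by blast
  show ?thesis unfolding eq
  proof (rule primeidealI)
    show "ideal {r \<in> carrier (sec X U). germ X y U r \<in> ?m} (sec X U)"
      by (rule h.R.ideal_of_closed) (auto intro: m.I_l_closed)
    show "cring (sec X U)" by (rule h.R.is_cring)
    have "\<one>\<^bsub>stalk X y\<^esub> \<notin> ?m" using m.one_imp_carrier m.I_notcarr by blast
    then have "\<one>\<^bsub>sec X U\<^esub> \<notin> {r \<in> carrier (sec X U). germ X y U r \<in> ?m}" by simp
    then show "carrier (sec X U) \<noteq> {r \<in> carrier (sec X U). germ X y U r \<in> ?m}"
      using h.R.one_closed by blast
    fix a b assume ab: "a \<in> carrier (sec X U)" "b \<in> carrier (sec X U)"
      "a \<otimes>\<^bsub>sec X U\<^esub> b \<in> {r \<in> carrier (sec X U). germ X y U r \<in> ?m}"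
    then have "germ X y U a \<otimes>\<^bsub>stalk X y\<^esub> germ X y U b \<in> ?m" by simp
    then have "germ X y U a \<in> ?m \<or> germ X y U b \<in> ?m" using ab by (intro m.I_prime) auto
    then show "a \<in> {r \<in> carrier (sec X U). germ X y U r \<in> ?m} \<or> b \<in> {r \<in> carrier (sec X U). germ X y U r \<in> ?m}"
      using ab by blast
  qed
qed

text \<open>A uniformizer is a fraction of sections over \<open>U\<close> whose denominator is a
  unit at \<open>y\<close>; its numerator is the section in question.\<close>

lemma prime_at_nonzero:
  assumes U: "affine_open X U" "y \<in> U" and cod: "codim_one X y"
  obtains r where "r \<in> prime_at U y" "r \<noteq> \<zero>\<^bsub>sec X U\<^esub>"
proof -
  have o: "open_in X U" "U \<noteq> {}" using affine_is_open[OF U(1)] U(2) by auto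
  interpret A: dim_one_local "stalk X y" "THE m. maximalideal m (stalk X y)" by (rule codim_local[OF cod])
  interpret h: ring_hom_cring "sec X U" "stalk X y" "germ X y U" by (rule germ_hom[OF o(1) U(2)])
  obtain t where t: "uniformizer (stalk X y) t" by (rule uniformizer_ex[OF cod])
  note tn = uniformizer_nonzero[OF cod t]
  obtain r g where rg: "r \<in> carrier (sec X U)" "g \<in> carrier (sec X U)" "germ X y U g \<in> Units (stalk X y)"
    "germ X y U g \<otimes>\<^bsub>stalk X y\<^esub> t = germ X y U r" by (rule affine_fraction_stalk[OF U tn(1)])
  have "germ X y U r \<notin> Units (stalk X y)"
  proof
    assume "germ X y U r \<in> Units (stalk X y)"
    then have "t \<otimes>\<^bsub>stalk X y\<^esub> germ X y U g \<in> Units (stalk X y)"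
      using rg(4) A.m_comm[OF tn(1), of "germ X y U g"] rg(2) by simp
    then have "t \<in> Units (stalk X y)" by (rule A.unit_factor) (use tn rg in auto)
    then show False using tn(3) by simp
  qed
  moreover have "germ X y U r \<noteq> \<zero>\<^bsub>stalk X y\<^esub>"
  proof -
    have "germ X y U g \<noteq> \<zero>\<^bsub>stalk X y\<^esub>"
    proof
      assume "germ X y U g = \<zero>\<^bsub>stalk X y\<^esub>"
      then have "\<one>\<^bsub>stalk X y\<^esub> = \<zero>\<^bsub>stalk X y\<^esub>" using A.Units_r_inv[OF rg(3)] A.Units_inv_closed[OF rg(3)] by simp
      then show False by simp
    qed
    then show ?thesis using rg(4)[symmetric] tn rg(2) by (simp add: A.integral_iff)
  qed
  then have "r \<noteq> \<zero>\<^bsub>sec X U\<^esub>" by auto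
  ultimately show ?thesis using that rg(1) unfolding prime_at_def by blast
qed

lemma codim_one_proper:
  assumes cod: "codim_one X z" shows "z \<noteq> \<eta>"
proof
  assume z: "z = \<eta>"
  obtain t where t: "uniformizer (stalk X z) t" by (rule uniformizer_ex[OF cod])
  note tn = uniformizer_nonzero[OF cod t]
  then show False unfolding z using K.field_Units by blast
qed

text \<open>A neighbourhood of \<open>y\<close> misses \<open>z\<close> unless the prime of
  \<open>z\<close> is contained in that of \<open>y\<close>. As the prime of \<open>z\<close> is
  nonzero, the two primes would coincide if \<open>y\<close> has codimension one; if
  \<open>y\<close> is the generic point, a nonzero section would fail to be a unit there.\<close>

lemma avoid:
  assumes y: "y \<in> points X" "codim_one X y \<or> y = \<eta>" and z: "codim_one X z" "z \<noteq> y"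
  obtains V where "open_in X V" "y \<in> V" "z \<notin> V"
proof -
  obtain U where U: "affine_open X U" "y \<in> U" using affine_cover y(1) by blast
  have o: "open_in X U" "U \<noteq> {}" using affine_is_open[OF U(1)] U(2) by auto
  show ?thesis
  proof (cases "z \<in> U")
    case False
    then show ?thesis using that o U by blast
  next
    case zU: True
    have "\<not> prime_at U z \<subseteq> prime_at U y"
    proof
      assume sub: "prime_at U z \<subseteq> prime_at U y"
      obtain r where r: "r \<in> prime_at U z" "r \<noteq> \<zero>\<^bsub>sec X U\<^esub>" by (rule prime_at_nonzero[OF U(1) zU z(1)])
      show False
      proof (cases "codim_one X y")
        case True
        have "prime_at U z = prime_at U y"
          by (rule prime_at_codim_one[OF U True prime_at_prime[OF o(1) zU z(1)] sub r])
        then show False using prime_at_inj[OF U(1)] zU U(2) z(2) unfolding inj_on_def by blast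
      next
        case False
        then have "y = \<eta>" using y(2) by blast
        then have "r \<in> carrier (sec X U)" "germ X \<eta> U r \<notin> Units K" using r(1) sub unfolding prime_at_def by auto
        then show False using gen_dichotomy[OF o(1) _ o(2)] r(2) by blast
      qed
    qed
    then obtain r where r: "r \<in> carrier (sec X U)" "germ X z U r \<notin> Units (stalk X z)"
      "germ X y U r \<in> Units (stalk X y)" unfolding prime_at_def by blast
    obtain V where V: "open_in X V" "y \<in> V" "V \<subseteq> U" "rst X U V r \<in> Units (sec X V)"
      by (rule Unit_spreads[OF o(1) U(2) r(1,3)])
    have "z \<notin> V"
    proof
      assume zV: "z \<in> V"
      have "germ X z V (rst X U V r) \<in> Units (stalk X z)" by (rule germ_Unit[OF V(1) zV V(4)])
      then show False using germ_restrict[OF o(1) V(1,3) zV r(1)] r(2) by simp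
    qed
    then show ?thesis using that V by blast
  qed
qed

lemma avoid_finite:
  assumes y: "y \<in> points X" "codim_one X y \<or> y = \<eta>" and Z: "finite Z" "\<And>z. z \<in> Z \<Longrightarrow> codim_one X z \<and> z \<noteq> y"
    and U: "open_in X U" "y \<in> U"
  shows "\<exists>V. open_in X V \<and> y \<in> V \<and> V \<subseteq> U \<and> V \<inter> Z = {}"
  using Z
proof (induction Z rule: finite_induct)
  case empty
  then show ?case using U by blast
next
  case (insert z Z)
  then obtain V where V: "open_in X V" "y \<in> V" "V \<subseteq> U" "V \<inter> Z = {}" by blast
  have zz: "codim_one X z" "z \<noteq> y" using insert.prems by auto
  obtain V' where V': "open_in X V'" "y \<in> V'" "z \<notin> V'" by (rule avoid[OF y zz])
  show ?case by (rule exI[of _ "V \<inter> V'"]) (use V V' in auto)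
qed

text \<open>This turns a condition at the single point \<open>y\<close> into one on a neighbourhood,
  since \<open>D\<close> vanishes at all other points of \<open>V\<close>. For the generic point it
  yields an open set disjoint from the divisor.\<close>

lemma divisor_isolate:
  assumes D: "Q_divisor X D" and y: "y \<in> points X" "codim_one X y \<or> y = \<eta>"
  obtains V where "open_in X V" "y \<in> V" "\<And>z. z \<in> V \<Longrightarrow> D z \<noteq> 0 \<Longrightarrow> z = y"
proof -
  obtain U where U: "open_in X U" "y \<in> U" "finite {z \<in> U. D z \<noteq> 0}"
    using D y(1) unfolding Q_divisor_def by blast
  have "finite ({z \<in> U. D z \<noteq> 0} - {y})" using U(3) by blast
  moreover have "codim_one X z \<and> z \<noteq> y" if "z \<in> {z \<in> U. D z \<noteq> 0} - {y}" for z
    using D that unfolding Q_divisor_def by blast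
  ultimately have "\<exists>V. open_in X V \<and> y \<in> V \<and> V \<subseteq> U \<and> V \<inter> ({z \<in> U. D z \<noteq> 0} - {y}) = {}"
    by (intro avoid_finite[OF y _ _ U(1,2)])
  then obtain V where V: "open_in X V" "y \<in> V" "V \<subseteq> U" "V \<inter> ({z \<in> U. D z \<noteq> 0} - {y}) = {}"
    by blast
  show ?thesis by (rule that[OF V(1,2)]) (use V(3,4) in blast)
qed

text \<open>By \<open>prime_at_codim_one\<close> the prime of each such point is one of the finitely
  many minimal primes over \<open>r\<close>, and within \<open>U\<close> a point is determined by
  its prime.\<close>

lemma finite_zero_set:
  assumes U: "affine_open X U" and r: "r \<in> carrier (sec X U)" "r \<noteq> \<zero>\<^bsub>sec X U\<^esub>"
  shows "finite {y \<in> U. codim_one X y \<and> r \<in> prime_at U y}" (is "finite ?Y")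
proof (cases "U = {}")
  case False
  have o: "open_in X U" by (rule affine_is_open[OF U])
  interpret R: domain "sec X U" by (rule sec_domain[OF o False])
  have id: "ideal (PIdl\<^bsub>sec X U\<^esub> r) (sec X U)" by (rule R.cgenideal_ideal[OF r(1)])
  obtain \<P> where P: "finite \<P>" "\<forall>P\<in>\<P>. primeideal P (sec X U) \<and> PIdl\<^bsub>sec X U\<^esub> r \<subseteq> P"
    "\<forall>Q. primeideal Q (sec X U) \<and> PIdl\<^bsub>sec X U\<^esub> r \<subseteq> Q \<longrightarrow> (\<exists>P\<in>\<P>. P \<subseteq> Q)"
    using finitely_many_minimal_primes[OF noeth[OF U] R.is_cring id] by (elim exE conjE) (rule that)
  have "prime_at U ` ?Y \<subseteq> \<P>"
  proof
    fix Q assume "Q \<in> prime_at U ` ?Y"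
    then obtain y where y: "y \<in> U" "codim_one X y" "r \<in> prime_at U y" "Q = prime_at U y" by blast
    have pr: "primeideal (prime_at U y) (sec X U)" by (rule prime_at_prime[OF o y(1,2)])
    have "PIdl\<^bsub>sec X U\<^esub> r \<subseteq> prime_at U y"
      by (rule R.cgenideal_minimal[OF primeideal.axioms(1)[OF pr] y(3)])
    then obtain P where P': "P \<in> \<P>" "P \<subseteq> prime_at U y" using P(3) pr by blast
    have "r \<in> P" using P(2) P'(1) R.cgenideal_self[OF r(1)] by blast
    then have "P = prime_at U y"
      using prime_at_codim_one[OF U y(1,2) _ P'(2) _ r(2)] P(2) P'(1) by blast
    then show "Q \<in> \<P>" using P'(1) y(4) by simp
  qed
  then have "finite (prime_at U ` ?Y)" using P(1) by (rule finite_subset)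
  moreover have "inj_on (prime_at U) ?Y" by (rule inj_on_subset[OF prime_at_inj[OF U]]) blast
  ultimately show ?thesis by (rule finite_imageD)
qed simp

lemma finite_support:
  assumes U: "affine_open X U" and f: "f \<in> Kx"
  shows "finite {y \<in> U. principal_divisor X f y \<noteq> 0}"
proof (cases "U = {}")
  case False
  have o: "open_in X U" by (rule affine_is_open[OF U])
  have fK: "f \<in> carrier K" using f by simp
  interpret h: ring_hom_cring "sec X U" K "germ X \<eta> U" by (rule emb_hom[OF o False])
  obtain r g where rg: "r \<in> carrier (sec X U)" "g \<in> carrier (sec X U)" "germ X \<eta> U g \<in> Kx"
    "germ X \<eta> U g \<otimes>\<^bsub>K\<^esub> f = germ X \<eta> U r" by (rule K_fraction[OF U False fK])
  have rK: "germ X \<eta> U r \<in> Kx" unfolding rg(4)[symmetric] using rg(3) f by (simp add: K.integral_iff)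
  have r0: "r \<noteq> \<zero>\<^bsub>sec X U\<^esub>" "g \<noteq> \<zero>\<^bsub>sec X U\<^esub>" using rK rg(3) by auto
  have "y \<in> {y \<in> U. codim_one X y \<and> r \<in> prime_at U y} \<union> {y \<in> U. codim_one X y \<and> g \<in> prime_at U y}"
    if y: "y \<in> {y \<in> U. principal_divisor X f y \<noteq> 0}" for y
  proof -
    have c: "codim_one X y" "order_at X y f \<noteq> 0" "y \<in> U"
      using y unfolding principal_divisor_def by (auto split: if_splits)
    have "order_at X y (germ X \<eta> U g) + order_at X y f = order_at X y (germ X \<eta> U r)"
      using order_mult[OF c(1) rg(3) f] rg(4) by simp
    then have "order_at X y (germ X \<eta> U g) \<noteq> 0 \<or> order_at X y (germ X \<eta> U r) \<noteq> 0" using c(2) by auto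
    then have "germ X y U g \<notin> Units (stalk X y) \<or> germ X y U r \<notin> Units (stalk X y)"
      using order_section(2)[OF c(1) o c(3) rg(2,3)] order_section(2)[OF c(1) o c(3) rg(1) rK] by blast
    then show ?thesis unfolding prime_at_def using rg(1,2) c by blast
  qed
  then have "{y \<in> U. principal_divisor X f y \<noteq> 0} \<subseteq>
    {y \<in> U. codim_one X y \<and> r \<in> prime_at U y} \<union> {y \<in> U. codim_one X y \<and> g \<in> prime_at U y}"
    by (rule subsetI)
  then show ?thesis
    by (rule finite_subset) (rule finite_UnI[OF finite_zero_set[OF U rg(1) r0(1)] finite_zero_set[OF U rg(2) r0(2)]])
qed simp

lemma Q_divisor_principal: "f \<in> Kx \<Longrightarrow> Q_divisor X (principal_divisor X f)"
  unfolding Q_divisor_def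
proof (intro conjI allI impI ballI)
  fix y assume "principal_divisor X f y \<noteq> 0"
  then show "codim_one X y" unfolding principal_divisor_def by (simp split: if_splits)
next
  fix x assume f: "f \<in> Kx" and "x \<in> points X"
  then obtain U where U: "affine_open X U" "x \<in> U" using affine_cover by blast
  then show "\<exists>U. open_in X U \<and> x \<in> U \<and> finite {y \<in> U. principal_divisor X f y \<noteq> 0}"
    using affine_is_open[OF U(1)] finite_support[OF U(1) f] by blast
qed

lemma Q_divisor_comb:
  assumes "Q_divisor X D" "Q_divisor X D'"
  shows "Q_divisor X (\<lambda>y. a * D y + b * D' y)"
  unfolding Q_divisor_def
proof (intro conjI allI impI ballI)
  fix y assume "a * D y + b * D' y \<noteq> 0"
  then have "D y \<noteq> 0 \<or> D' y \<noteq> 0" by auto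
  then show "codim_one X y" using assms unfolding Q_divisor_def by blast
next
  fix x assume x: "x \<in> points X"
  obtain U where U: "open_in X U" "x \<in> U" "finite {y \<in> U. D y \<noteq> 0}"
    using assms(1) x unfolding Q_divisor_def by blast
  obtain V where V: "open_in X V" "x \<in> V" "finite {y \<in> V. D' y \<noteq> 0}"
    using assms(2) x unfolding Q_divisor_def by blast
  have "finite {y \<in> U \<inter> V. a * D y + b * D' y \<noteq> 0}"
    by (rule finite_subset[of _ "{y \<in> U. D y \<noteq> 0} \<union> {y \<in> V. D' y \<noteq> 0}"]) (use U V in auto)
  then show "\<exists>U. open_in X U \<and> x \<in> U \<and> finite {y \<in> U. a * D y + b * D' y \<noteq> 0}"
    using U V by (intro exI[of _ "U \<inter> V"]) auto
qed

end

section \<open>Frobenius-linear maps\<close>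

locale frobenius_loc = normal_loc X for X :: "('p, 'r) ringed_space" +
  fixes p e :: nat
  assumes p_prime: "Factorial_Ring.prime p" and e_pos: "e > 0"
    and char: "has_characteristic p X" and F_finite: "F_finite_scheme p X"
begin

abbreviation "q \<equiv> p ^ e"

lemma q_ge_2: "q \<ge> 2"
proof -
  have "2 \<le> p" using p_prime by (rule prime_ge_2_nat)
  also have "p ^ 1 \<le> p ^ e" using e_pos \<open>2 \<le> p\<close> by (intro power_increasing) auto
  finally show ?thesis by simp
qed

lemma sec_char: assumes U: "open_in X U" shows "add_pow (sec X U) p \<one>\<^bsub>sec X U\<^esub> = \<zero>\<^bsub>sec X U\<^esub>"
proof -
  interpret h: ring_hom_cring "sec X (points X)" "sec X U" "rst X (points X) U"
    by (rule rst_hom_cring[OF open_all U open_points[OF U]])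
  have "rst X (points X) U (add_pow (sec X (points X)) n \<one>\<^bsub>sec X (points X)\<^esub>) = add_pow (sec X U) n \<one>\<^bsub>sec X U\<^esub>" for n :: nat
    by (induction n) simp_all
  then show ?thesis using char[unfolded has_characteristic_def] h.hom_zero by metis
qed

lemma power_generators:
  assumes U: "affine_open X U" shows "\<exists>B. finite B \<and> power_generating (sec X U) q B"
proof -
  obtain B where B: "B \<subseteq> carrier (sec X U)" "finite B" "\<forall>a\<in>carrier (sec X U). \<exists>c \<in> B \<rightarrow> carrier (sec X U).
       a = (\<Oplus>\<^bsub>sec X U\<^esub>b\<in>B. c b [^]\<^bsub>sec X U\<^esub> p \<otimes>\<^bsub>sec X U\<^esub> b)"
    using F_finite[unfolded F_finite_scheme_def Let_def, rule_format, OF U]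
    by (elim exE conjE) (rule that)
  have o: "open_in X U" by (rule affine_is_open[OF U])
  show ?thesis
    by (rule power_generating_iterate[OF sec_cring[OF o] p_prime sec_char[OF o] B(1,2)]) (use B(3) in blast)
qed

text \<open>In other words, K-linear maps from F^e_* K to K. They are what remains of sections of
  Hom(F^e_* O_X, O_X), or of a map on a trivialised line bundle, at the generic point.\<close>

definition plin :: "(('p set \<times> 'r) set \<Rightarrow> ('p set \<times> 'r) set) \<Rightarrow> bool" where
  "plin \<beta> \<longleftrightarrow> \<beta> \<in> carrier K \<rightarrow> carrier K \<and>
     (\<forall>a\<in>carrier K. \<forall>b\<in>carrier K. \<beta> (a \<oplus>\<^bsub>K\<^esub> b) = \<beta> a \<oplus>\<^bsub>K\<^esub> \<beta> b) \<and>
     (\<forall>a\<in>carrier K. \<forall>b\<in>carrier K. \<beta> (a [^]\<^bsub>K\<^esub> q \<otimes>\<^bsub>K\<^esub> b) = a \<otimes>\<^bsub>K\<^esub> \<beta> b)"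

definition regular :: "(('p set \<times> 'r) set \<Rightarrow> ('p set \<times> 'r) set) \<Rightarrow> 'p \<Rightarrow> bool" where
  "regular \<beta> y \<longleftrightarrow> (\<forall>f\<in>lring y. \<beta> f \<in> lring y)"

text \<open>The action of F^e_* K on these maps, in agreement with the scalar action in
  \<open>frobenius_dual\<close>.\<close>

definition twist :: "('p set \<times> 'r) set \<Rightarrow> (('p set \<times> 'r) set \<Rightarrow> ('p set \<times> 'r) set) \<Rightarrow>
    ('p set \<times> 'r) set \<Rightarrow> ('p set \<times> 'r) set" where
  "twist c \<beta> f = \<beta> (c \<otimes>\<^bsub>K\<^esub> f)"

lemma plin_closed: "plin \<beta> \<Longrightarrow> a \<in> carrier K \<Longrightarrow> \<beta> a \<in> carrier K"
  unfolding plin_def by blast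

lemma plin_add: "plin \<beta> \<Longrightarrow> a \<in> carrier K \<Longrightarrow> b \<in> carrier K \<Longrightarrow> \<beta> (a \<oplus>\<^bsub>K\<^esub> b) = \<beta> a \<oplus>\<^bsub>K\<^esub> \<beta> b"
  unfolding plin_def by blast

lemma plin_mult: "plin \<beta> \<Longrightarrow> a \<in> carrier K \<Longrightarrow> b \<in> carrier K \<Longrightarrow> \<beta> (a [^]\<^bsub>K\<^esub> q \<otimes>\<^bsub>K\<^esub> b) = a \<otimes>\<^bsub>K\<^esub> \<beta> b"
  unfolding plin_def by blast

lemma plin_zero: assumes "plin \<beta>" shows "\<beta> \<zero>\<^bsub>K\<^esub> = \<zero>\<^bsub>K\<^esub>"
  using plin_mult[OF assms K.zero_closed K.zero_closed] plin_closed[OF assms K.zero_closed] by simp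

lemma plin_twist: assumes "plin \<beta>" "c \<in> carrier K" shows "plin (twist c \<beta>)"
  unfolding plin_def twist_def
proof (intro conjI ballI)
  show "(\<lambda>f. \<beta> (c \<otimes>\<^bsub>K\<^esub> f)) \<in> carrier K \<rightarrow> carrier K" using assms plin_closed by auto
  fix a b assume ab: "a \<in> carrier K" "b \<in> carrier K"
  show "\<beta> (c \<otimes>\<^bsub>K\<^esub> (a \<oplus>\<^bsub>K\<^esub> b)) = \<beta> (c \<otimes>\<^bsub>K\<^esub> a) \<oplus>\<^bsub>K\<^esub> \<beta> (c \<otimes>\<^bsub>K\<^esub> b)"
    using assms ab by (simp add: K.r_distr plin_add)
  have "c \<otimes>\<^bsub>K\<^esub> (a [^]\<^bsub>K\<^esub> q \<otimes>\<^bsub>K\<^esub> b) = a [^]\<^bsub>K\<^esub> q \<otimes>\<^bsub>K\<^esub> (c \<otimes>\<^bsub>K\<^esub> b)" using assms ab by (simp add: K.m_lcomm)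
  then show "\<beta> (c \<otimes>\<^bsub>K\<^esub> (a [^]\<^bsub>K\<^esub> q \<otimes>\<^bsub>K\<^esub> b)) = a \<otimes>\<^bsub>K\<^esub> \<beta> (c \<otimes>\<^bsub>K\<^esub> b)"
    using assms ab by (simp add: plin_mult)
qed

text \<open>The closure property of \<open>power_generating\<close> reduces sections over
  \<open>U\<close> to the generators. An element of the local ring is a fraction \<open>r/g\<close>,
  and writing it as \<open>(1/g)^q g^(q-1) r\<close> lets the denominator leave the map as the
  factor \<open>1/g\<close>.\<close>

lemma regular_from_generators:
  assumes \<beta>: "plin \<beta>" and U: "affine_open X U" "z \<in> U" and B: "power_generating (sec X U) q B"
    and reg: "\<And>b. b \<in> B \<Longrightarrow> \<beta> (germ X \<eta> U b) \<in> lring z"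
  shows "regular \<beta> z"
proof -
  have o: "open_in X U" "U \<noteq> {}" using affine_is_open[OF U(1)] U(2) by auto
  have z: "z \<in> points X" using open_points[OF o(1)] U(2) by blast
  interpret h: ring_hom_cring "sec X U" K "germ X \<eta> U" by (rule emb_hom[OF o])
  interpret i: ring_hom_cring "stalk X z" K \<iota> by (rule stalk_emb_hom[OF z])
  define S where "S = {r \<in> carrier (sec X U). \<beta> (germ X \<eta> U r) \<in> lring z}"
  have BR: "B \<subseteq> carrier (sec X U)" using B unfolding power_generating_def by blast
  have 1: "S \<subseteq> carrier (sec X U)" unfolding S_def by blast
  have 2: "B \<subseteq> S" unfolding S_def using BR reg by blast
  have 3: "\<zero>\<^bsub>sec X U\<^esub> \<in> S" unfolding S_def using plin_zero[OF \<beta>] lring_zero[OF z] by simp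
  have 4: "x \<oplus>\<^bsub>sec X U\<^esub> y \<in> S" if "x \<in> S" "y \<in> S" for x y
    using that plin_add[OF \<beta>] lring_add z unfolding S_def by simp
  have 5: "c [^]\<^bsub>sec X U\<^esub> q \<otimes>\<^bsub>sec X U\<^esub> x \<in> S" if c: "c \<in> carrier (sec X U)" and x: "x \<in> S" for c x
  proof -
    have xR: "x \<in> carrier (sec X U)" "\<beta> (germ X \<eta> U x) \<in> lring z" using x unfolding S_def by auto
    have "\<beta> (germ X \<eta> U (c [^]\<^bsub>sec X U\<^esub> q \<otimes>\<^bsub>sec X U\<^esub> x)) = germ X \<eta> U c \<otimes>\<^bsub>K\<^esub> \<beta> (germ X \<eta> U x)"
      using c xR(1) plin_mult[OF \<beta>] by simp
    also have "\<dots> \<in> lring z" by (rule lring_mult[OF emb_lring[OF o(1) U(2) c] xR(2) z])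
    finally show ?thesis unfolding S_def using c xR(1) by simp
  qed
  have S: "S = carrier (sec X U)"
    using B[unfolded power_generating_def, THEN conjunct2, rule_format, of S] 1 2 3 4 5 by simp
  show ?thesis unfolding regular_def
  proof
    fix f assume "f \<in> lring z"
    then obtain a where a: "a \<in> carrier (stalk X z)" "f = \<iota> a" unfolding lring_def by blast
    obtain r g where rg: "r \<in> carrier (sec X U)" "g \<in> carrier (sec X U)" "germ X z U g \<in> Units (stalk X z)"
      "germ X z U g \<otimes>\<^bsub>stalk X z\<^esub> a = germ X z U r" by (rule affine_fraction_stalk[OF U a(1)])
    define w where "w = inv\<^bsub>stalk X z\<^esub> (germ X z U g)"
    have w: "w \<in> carrier (stalk X z)" unfolding w_def using rg(3) by simp
    have gs: "germ X z U g \<in> carrier (stalk X z)" using rg(2) o(1) U(2) by auto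
    let ?G = "germ X \<eta> U g" and ?W = "\<iota> w"
    have e: "\<iota> (germ X z U g) = ?G" "\<iota> (germ X z U r) = germ X \<eta> U r"
      using stalk_emb[OF o(1) U(2)] rg by auto
    have GK: "?G \<in> carrier K" "?W \<in> carrier K" "f \<in> carrier K" "germ X \<eta> U r \<in> carrier K"
      using rg(1,2) w a by auto
    have "?W \<otimes>\<^bsub>K\<^esub> ?G = \<iota> (w \<otimes>\<^bsub>stalk X z\<^esub> germ X z U g)" using w gs e by simp
    then have WG: "?W \<otimes>\<^bsub>K\<^esub> ?G = \<one>\<^bsub>K\<^esub>" unfolding w_def using rg(3) by simp
    have Gf: "?G \<otimes>\<^bsub>K\<^esub> f = germ X \<eta> U r" using a(1) gs rg(4) e unfolding a(2) by (metis i.hom_mult)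
    have q: "q = Suc (q - 1)" using q_ge_2 by simp
    have "?W [^]\<^bsub>K\<^esub> q \<otimes>\<^bsub>K\<^esub> (?G [^]\<^bsub>K\<^esub> (q - 1) \<otimes>\<^bsub>K\<^esub> germ X \<eta> U r)
        = ?W [^]\<^bsub>K\<^esub> q \<otimes>\<^bsub>K\<^esub> (?G [^]\<^bsub>K\<^esub> (q - 1) \<otimes>\<^bsub>K\<^esub> ?G) \<otimes>\<^bsub>K\<^esub> f"
      unfolding Gf[symmetric] using GK by (simp add: K.m_assoc)
    also have "?G [^]\<^bsub>K\<^esub> (q - 1) \<otimes>\<^bsub>K\<^esub> ?G = ?G [^]\<^bsub>K\<^esub> q"
      using K.nat_pow_Suc[of ?G "q - 1"] by (simp only: q[symmetric])
    also have "?W [^]\<^bsub>K\<^esub> q \<otimes>\<^bsub>K\<^esub> ?G [^]\<^bsub>K\<^esub> q = \<one>\<^bsub>K\<^esub>"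
      using K.nat_pow_distrib[of ?W ?G q] WG GK by simp
    finally have f: "f = ?W [^]\<^bsub>K\<^esub> q \<otimes>\<^bsub>K\<^esub> germ X \<eta> U (g [^]\<^bsub>sec X U\<^esub> (q - 1) \<otimes>\<^bsub>sec X U\<^esub> r)"
      using GK rg(1,2) by simp
    have gr: "g [^]\<^bsub>sec X U\<^esub> (q - 1) \<otimes>\<^bsub>sec X U\<^esub> r \<in> carrier (sec X U)" using rg by simp
    have "\<beta> f = ?W \<otimes>\<^bsub>K\<^esub> \<beta> (germ X \<eta> U (g [^]\<^bsub>sec X U\<^esub> (q - 1) \<otimes>\<^bsub>sec X U\<^esub> r))"
      by (subst f) (rule plin_mult[OF \<beta> GK(2) h.hom_closed[OF gr]])
    also have "\<dots> \<in> lring z"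
    proof (rule lring_mult[OF _ _ z])
      show "?W \<in> lring z" unfolding lring_def using w by blast
      show "\<beta> (germ X \<eta> U (g [^]\<^bsub>sec X U\<^esub> (q - 1) \<otimes>\<^bsub>sec X U\<^esub> r)) \<in> lring z"
        using gr S unfolding S_def by blast
    qed
    finally show "\<beta> f \<in> lring z" .
  qed
qed

text \<open>The values at the finitely many generators are regular at \<open>y\<close>, hence on a
  common neighbourhood, and they decide regularity at each of its points.\<close>

lemma regular_open:
  assumes \<beta>: "plin \<beta>" and y: "y \<in> points X" and reg: "regular \<beta> y"
  obtains V where "open_in X V" "y \<in> V" "\<And>z. z \<in> V \<Longrightarrow> regular \<beta> z"
proof -
  obtain U where U: "affine_open X U" "y \<in> U" using affine_cover y by blast
  have o: "open_in X U" by (rule affine_is_open[OF U(1)])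
  obtain B where B: "finite B" "power_generating (sec X U) q B" using power_generators[OF U(1)] by blast
  have BR: "B \<subseteq> carrier (sec X U)" using B unfolding power_generating_def by blast
  have "\<exists>V. open_in X V \<and> y \<in> V \<and> V \<subseteq> U \<and> (\<forall>b\<in>B0. \<forall>z\<in>V. \<beta> (germ X \<eta> U b) \<in> lring z)"
    if "finite B0" "B0 \<subseteq> B" for B0
    using that
  proof (induction B0 rule: finite_induct)
    case empty
    then show ?case using o U(2) by blast
  next
    case (insert b F)
    then obtain V where V: "open_in X V" "y \<in> V" "V \<subseteq> U" "\<forall>b\<in>F. \<forall>z\<in>V. \<beta> (germ X \<eta> U b) \<in> lring z" by blast
    have "germ X \<eta> U b \<in> lring y" using emb_lring[OF o U(2)] insert.prems BR by blast
    then have "\<beta> (germ X \<eta> U b) \<in> lring y" using reg unfolding regular_def by blast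
    then obtain V' s where V': "open_in X V'" "y \<in> V'" "s \<in> carrier (sec X V')" "\<beta> (germ X \<eta> U b) = germ X \<eta> V' s"
      unfolding lring_iff by blast
    have "\<beta> (germ X \<eta> U b) \<in> lring z" if "z \<in> V'" for z
      unfolding V'(4) by (rule emb_lring[OF V'(1) that V'(3)])
    then show ?case using V V' by (intro exI[of _ "V \<inter> V'"]) auto
  qed
  from this[OF B(1) subset_refl] obtain V where V: "open_in X V" "y \<in> V" "V \<subseteq> U"
    "\<forall>b\<in>B. \<forall>z\<in>V. \<beta> (germ X \<eta> U b) \<in> lring z" by blast
  show ?thesis
    by (rule that[OF V(1,2)], rule regular_from_generators[OF \<beta> U(1) _ B(2)]) (use V in auto)
qed

lemma common_denominator:
  assumes U: "affine_open X U" "U \<noteq> {}" and F: "finite F" "F \<subseteq> carrier K"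
  shows "\<exists>h\<in>carrier (sec X U). germ X \<eta> U h \<in> Kx \<and>
    (\<forall>f\<in>F. germ X \<eta> U h \<otimes>\<^bsub>K\<^esub> f \<in> germ X \<eta> U ` carrier (sec X U))"
  using F
proof (induction F rule: finite_induct)
  case empty
  interpret h: ring_hom_cring "sec X U" K "germ X \<eta> U" by (rule emb_hom[OF affine_is_open[OF U(1)] U(2)])
  show ?case by (rule bexI[of _ "\<one>\<^bsub>sec X U\<^esub>"]) auto
next
  case (insert f F)
  interpret h: ring_hom_cring "sec X U" K "germ X \<eta> U" by (rule emb_hom[OF affine_is_open[OF U(1)] U(2)])
  obtain h where h: "h \<in> carrier (sec X U)" "germ X \<eta> U h \<in> Kx"
    "\<forall>f\<in>F. germ X \<eta> U h \<otimes>\<^bsub>K\<^esub> f \<in> germ X \<eta> U ` carrier (sec X U)" using insert by auto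
  have fK: "f \<in> carrier K" using insert.prems by simp
  obtain r g where rg: "r \<in> carrier (sec X U)" "g \<in> carrier (sec X U)" "germ X \<eta> U g \<in> Kx"
    "germ X \<eta> U g \<otimes>\<^bsub>K\<^esub> f = germ X \<eta> U r" by (rule K_fraction[OF U fK])
  have "germ X \<eta> U (h \<otimes>\<^bsub>sec X U\<^esub> g) \<otimes>\<^bsub>K\<^esub> f' \<in> germ X \<eta> U ` carrier (sec X U)" if f': "f' \<in> insert f F" for f'
  proof (cases "f' = f")
    case True
    have "germ X \<eta> U (h \<otimes>\<^bsub>sec X U\<^esub> g) \<otimes>\<^bsub>K\<^esub> f = germ X \<eta> U h \<otimes>\<^bsub>K\<^esub> (germ X \<eta> U g \<otimes>\<^bsub>K\<^esub> f)"
      using h(1) rg(2) fK by (simp add: K.m_assoc)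
    also have "\<dots> = germ X \<eta> U (h \<otimes>\<^bsub>sec X U\<^esub> r)" unfolding rg(4) using h(1) rg(1) by simp
    finally show ?thesis unfolding True by (rule image_eqI) (use h(1) rg(1) in simp)
  next
    case False
    then have f'F: "f' \<in> F" "f' \<in> carrier K" using f' insert.prems by auto
    obtain s where s: "s \<in> carrier (sec X U)" "germ X \<eta> U h \<otimes>\<^bsub>K\<^esub> f' = germ X \<eta> U s" using h(3) f'F(1) by blast
    have "germ X \<eta> U (h \<otimes>\<^bsub>sec X U\<^esub> g) \<otimes>\<^bsub>K\<^esub> f' = germ X \<eta> U g \<otimes>\<^bsub>K\<^esub> (germ X \<eta> U h \<otimes>\<^bsub>K\<^esub> f')"
      using h(1) rg(2) f'F(2) by (simp add: K.m_ac)
    also have "\<dots> = germ X \<eta> U (g \<otimes>\<^bsub>sec X U\<^esub> s)" unfolding s(2) using s(1) rg(2) by simp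
    finally show ?thesis by (rule image_eqI) (use s(1) rg(2) in simp)
  qed
  moreover have "germ X \<eta> U (h \<otimes>\<^bsub>sec X U\<^esub> g) \<in> Kx" using h(1,2) rg(2,3) by (simp add: K.integral_iff)
  ultimately show ?case using h(1) rg(2) by (intro bexI[of _ "h \<otimes>\<^bsub>sec X U\<^esub> g"]) auto
qed

text \<open>\<open>h\<close> is a common denominator for the values at the generators. Since
  \<open>h^q\<close> leaves the map as \<open>h\<close>, the twist by \<open>h^q\<close> clears
  these denominators. This is the source of the Cartier divisor \<open>G_0\<close> in
  \<open>map_divisor_exists\<close>.\<close>

lemma regular_after_twist:
  assumes \<alpha>: "plin \<alpha>" and x: "x \<in> points X"
  obtains U h where "affine_open X U" "x \<in> U" "h \<in> carrier (sec X U)" "germ X \<eta> U h \<in> Kx"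
    "\<And>z. z \<in> U \<Longrightarrow> regular (twist (germ X \<eta> U h [^]\<^bsub>K\<^esub> q) \<alpha>) z"
proof -
  obtain U where U: "affine_open X U" "x \<in> U" using affine_cover x by blast
  have o: "open_in X U" "U \<noteq> {}" using affine_is_open[OF U(1)] U(2) by auto
  obtain B where B: "finite B" "power_generating (sec X U) q B" using power_generators[OF U(1)] by blast
  have BR: "B \<subseteq> carrier (sec X U)" using B unfolding power_generating_def by blast
  have F: "(\<lambda>b. \<alpha> (germ X \<eta> U b)) ` B \<subseteq> carrier K" using BR plin_closed[OF \<alpha>] emb_closed[OF o] by blast
  obtain h where h: "h \<in> carrier (sec X U)" "germ X \<eta> U h \<in> Kx"
    "\<forall>f\<in>(\<lambda>b. \<alpha> (germ X \<eta> U b)) ` B. germ X \<eta> U h \<otimes>\<^bsub>K\<^esub> f \<in> germ X \<eta> U ` carrier (sec X U)"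
    using common_denominator[OF U(1) o(2) finite_imageI[OF B(1)] F] by blast
  have HK: "germ X \<eta> U h \<in> carrier K" using h(2) by simp
  have "regular (twist (germ X \<eta> U h [^]\<^bsub>K\<^esub> q) \<alpha>) z" if z: "z \<in> U" for z
  proof (rule regular_from_generators[OF plin_twist[OF \<alpha>] U(1) z B(2)])
    show "germ X \<eta> U h [^]\<^bsub>K\<^esub> q \<in> carrier K" using HK by simp
    fix b assume b: "b \<in> B"
    have "twist (germ X \<eta> U h [^]\<^bsub>K\<^esub> q) \<alpha> (germ X \<eta> U b) = germ X \<eta> U h \<otimes>\<^bsub>K\<^esub> \<alpha> (germ X \<eta> U b)"
      unfolding twist_def using plin_mult[OF \<alpha> HK] emb_closed[OF o] b BR by blast
    also have "\<dots> \<in> germ X \<eta> U ` carrier (sec X U)" using h(3) b by blast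
    finally show "twist (germ X \<eta> U h [^]\<^bsub>K\<^esub> q) \<alpha> (germ X \<eta> U b) \<in> lring z"
      by (elim imageE) (simp add: emb_lring[OF o(1) z])
  qed
  then show ?thesis using that[OF U h(1,2)] by blast
qed

text \<open>At the generic point the local ring is all of K, so every map is regular there, and
  regularity is an open condition.\<close>

lemma generically_regular:
  assumes \<alpha>: "plin \<alpha>"
  obtains V where "open_in X V" "V \<noteq> {}" "\<And>z. z \<in> V \<Longrightarrow> regular \<alpha> z"
proof -
  have "regular \<alpha> \<eta>" unfolding regular_def
  proof
    fix f assume "f \<in> lring \<eta>"
    then have "\<alpha> f \<in> carrier K" using lring_K plin_closed[OF \<alpha>] by blast
    then obtain U s where "open_in X U" "\<eta> \<in> U" "s \<in> carrier (sec X U)" "\<alpha> f = germ X \<eta> U s"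
      unfolding stalk_carrier_iff by blast
    then show "\<alpha> f \<in> lring \<eta>" using emb_lring by simp
  qed
  then show ?thesis using regular_open[OF \<alpha> gen_point] that by blast
qed

text \<open>The map on sections that a regular \<open>\<beta>\<close> induces. Over the empty set,
  where there is one section only, the argument itself is returned, so that the result is a section
  there as well.\<close>

definition family :: "(('p set \<times> 'r) set \<Rightarrow> ('p set \<times> 'r) set) \<Rightarrow> 'p set \<Rightarrow> 'r \<Rightarrow> 'r" where
  "family \<beta> V s = (if V = {} then s
     else SOME t. t \<in> carrier (sec X V) \<and> germ X \<eta> V t = \<beta> (germ X \<eta> V s))"

lemma family:
  assumes V: "open_in X V" "V \<noteq> {}" "s \<in> carrier (sec X V)" and reg: "\<And>z. z \<in> V \<Longrightarrow> regular \<beta> z"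
  shows "family \<beta> V s \<in> carrier (sec X V)" "germ X \<eta> V (family \<beta> V s) = \<beta> (germ X \<eta> V s)"
proof -
  have "\<beta> (germ X \<eta> V s) \<in> lring z" if z: "z \<in> V" for z
    using reg[OF z] emb_lring[OF V(1) z V(3)] unfolding regular_def by blast
  then obtain t where "t \<in> carrier (sec X V)" "germ X \<eta> V t = \<beta> (germ X \<eta> V s)"
    by (rule glue_lring[OF V(1,2)])
  then have "\<exists>t. t \<in> carrier (sec X V) \<and> germ X \<eta> V t = \<beta> (germ X \<eta> V s)" by blast
  from someI_ex[OF this] show "family \<beta> V s \<in> carrier (sec X V)"
    "germ X \<eta> V (family \<beta> V s) = \<beta> (germ X \<eta> V s)" unfolding family_def using V(2) by simp_all
qed

text \<open>Each identity between sections is checked after embedding into K, where it is a property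
  of \<open>\<beta>\<close>; over the empty set any two sections are equal.\<close>

lemma family_hom:
  assumes \<beta>: "plin \<beta>" and U: "open_in X U" and reg: "\<And>z. z \<in> U \<Longrightarrow> regular \<beta> z"
  shows "module_sheaf_hom X U (frobenius_push X p e (structure_module X)) (structure_module X) (family \<beta>)"
proof -
  have fc: "family \<beta> V s \<in> carrier (sec X V)" if "open_in X V" "V \<subseteq> U" "s \<in> carrier (sec X V)" for V s
    using family(1)[of V s \<beta>] that reg by (cases "V = {}") (auto simp: family_def)
  have fg: "germ X \<eta> V (family \<beta> V s) = \<beta> (germ X \<eta> V s)"
    if "open_in X V" "V \<subseteq> U" "s \<in> carrier (sec X V)" "V \<noteq> {}" for V s
    using family(2)[of V s \<beta>] that reg by auto
  have fa: "family \<beta> V (s \<oplus>\<^bsub>sec X V\<^esub> t) = family \<beta> V s \<oplus>\<^bsub>sec X V\<^esub> family \<beta> V t"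
    if V: "open_in X V" "V \<subseteq> U" and st: "s \<in> carrier (sec X V)" "t \<in> carrier (sec X V)" for V s t
  proof -
    interpret V: cring "sec X V" by (rule sec_cring[OF V(1)])
    have c: "family \<beta> V (s \<oplus>\<^bsub>sec X V\<^esub> t) \<in> carrier (sec X V)"
      "family \<beta> V s \<oplus>\<^bsub>sec X V\<^esub> family \<beta> V t \<in> carrier (sec X V)" using fc[OF V] st by auto
    show ?thesis
    proof (cases "V = {}")
      case True
      then show ?thesis using c sec_empty by blast
    next
      case False
      interpret h: ring_hom_cring "sec X V" K "germ X \<eta> V" by (rule emb_hom[OF V(1) False])
      show ?thesis
        by (rule emb_inj[OF V(1) False c]) (use fg[OF V _ False] fc[OF V] st plin_add[OF \<beta>] in simp)
    qed
  qed
  have fm: "family \<beta> V (r [^]\<^bsub>sec X V\<^esub> q \<otimes>\<^bsub>sec X V\<^esub> s) = r \<otimes>\<^bsub>sec X V\<^esub> family \<beta> V s"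
    if V: "open_in X V" "V \<subseteq> U" and st: "r \<in> carrier (sec X V)" "s \<in> carrier (sec X V)" for V r s
  proof -
    interpret V: cring "sec X V" by (rule sec_cring[OF V(1)])
    have c: "family \<beta> V (r [^]\<^bsub>sec X V\<^esub> q \<otimes>\<^bsub>sec X V\<^esub> s) \<in> carrier (sec X V)"
      "r \<otimes>\<^bsub>sec X V\<^esub> family \<beta> V s \<in> carrier (sec X V)" using fc[OF V] st by auto
    show ?thesis
    proof (cases "V = {}")
      case True
      then show ?thesis using c sec_empty by blast
    next
      case False
      interpret h: ring_hom_cring "sec X V" K "germ X \<eta> V" by (rule emb_hom[OF V(1) False])
      show ?thesis
        by (rule emb_inj[OF V(1) False c]) (use fg[OF V _ False] fc[OF V] st plin_mult[OF \<beta>] in simp)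
    qed
  qed
  have fr: "family \<beta> V' (rst X V V' s) = rst X V V' (family \<beta> V s)"
    if V: "open_in X V" "open_in X V'" "V \<subseteq> U" "V' \<subseteq> V" and s: "s \<in> carrier (sec X V)" for V V' s
  proof -
    have V'U: "V' \<subseteq> U" using V by blast
    have c: "family \<beta> V' (rst X V V' s) \<in> carrier (sec X V')" "rst X V V' (family \<beta> V s) \<in> carrier (sec X V')"
      using fc[OF V(2) V'U rst_closed[OF V(1,2,4) s]] rst_closed[OF V(1,2,4) fc[OF V(1,3) s]] by auto
    show ?thesis
    proof (cases "V' = {}")
      case True
      then show ?thesis using c sec_empty by blast
    next
      case False
      then have V0: "V \<noteq> {}" using V(4) by blast
      show ?thesis
        by (rule emb_inj[OF V(2) False c])
          (simp add: fg[OF V(2) V'U rst_closed[OF V(1,2,4) s] False] fg[OF V(1,3) s V0]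
            emb_rst[OF V(1,2,4) False s] emb_rst[OF V(1,2,4) False fc[OF V(1,3) s]])
    qed
  qed
  show ?thesis unfolding module_sheaf_hom_def frobenius_push_def structure_module_def restrict_scalars_def
    using fc fa fm fr by simp
qed

definition dual_section :: "(('p set \<times> 'r) set \<Rightarrow> ('p set \<times> 'r) set) \<Rightarrow> 'p set \<Rightarrow> 'p set \<Rightarrow> 'r \<Rightarrow> 'r" where
  "dual_section \<beta> U = normalise_family X U (family \<beta>)"

lemma dual_section_closed:
  assumes "plin \<beta>" "open_in X U" "\<And>z. z \<in> U \<Longrightarrow> regular \<beta> z"
  shows "dual_section \<beta> U \<in> carrier (msec (frobenius_dual X p e) U)"
  using family_hom[OF assms] unfolding frobenius_dual_def dual_section_def by auto

lemma normalise_normalise: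
  assumes "U' \<subseteq> U" shows "normalise_family X U' (normalise_family X U k) = normalise_family X U' k"
  unfolding normalise_family_def using assms by (auto simp: fun_eq_iff restrict_def)

text \<open>Multiplying the argument by the section \<open>r\<close> is, at the generic point,
  multiplying it by the rational function of \<open>r\<close>. So the module structure of the dual
  sheaf becomes \<open>twist\<close>.\<close>

lemma dual_section_twist:
  assumes U: "open_in X U" and r: "r \<in> carrier (sec X U)" 
  shows "r \<odot>\<^bsub>msec (frobenius_dual X p e) U\<^esub> dual_section \<beta> U = dual_section (twist (germ X \<eta> U r) \<beta>) U"
proof -
  have "normalise_family X U (\<lambda>V s. dual_section \<beta> U V (rst X U V r \<otimes>\<^bsub>sec X V\<^esub> s))
      = normalise_family X U (family (twist (germ X \<eta> U r) \<beta>))"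
  proof (rule ext)
    fix V
    have "dual_section \<beta> U V (rst X U V r \<otimes>\<^bsub>sec X V\<^esub> s) = family (twist (germ X \<eta> U r) \<beta>) V s"
      if V: "open_in X V" "V \<subseteq> U" and s: "s \<in> carrier (sec X V)" for s
    proof -
      interpret V: cring "sec X V" by (rule sec_cring[OF V(1)])
      have rs: "rst X U V r \<in> carrier (sec X V)" by (rule rst_closed[OF U V r])
      have "dual_section \<beta> U V (rst X U V r \<otimes>\<^bsub>sec X V\<^esub> s) = family \<beta> V (rst X U V r \<otimes>\<^bsub>sec X V\<^esub> s)"
        unfolding dual_section_def normalise_family_def using V rs s by simp
      also have "\<dots> = family (twist (germ X \<eta> U r) \<beta>) V s"
      proof (cases "V = {}")
        case True
        then show ?thesis unfolding family_def using sec_empty rs s V.m_closed by auto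
      next
        case False
        interpret h: ring_hom_cring "sec X V" K "germ X \<eta> V" by (rule emb_hom[OF V(1) False])
        have "germ X \<eta> V (rst X U V r \<otimes>\<^bsub>sec X V\<^esub> s) = germ X \<eta> U r \<otimes>\<^bsub>K\<^esub> germ X \<eta> V s"
          using rs s emb_rst[OF U V False r] by simp
        then show ?thesis unfolding family_def twist_def using False by simp
      qed
      finally show ?thesis .
    qed
    then show "normalise_family X U (\<lambda>V s. dual_section \<beta> U V (rst X U V r \<otimes>\<^bsub>sec X V\<^esub> s)) V
      = normalise_family X U (family (twist (germ X \<eta> U r) \<beta>)) V"
      unfolding normalise_family_def by (auto simp: fun_eq_iff restrict_def)
  qed
  then show ?thesis unfolding frobenius_dual_def dual_section_def by simp
qed

end

lemma module_sheaf_homD: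
  assumes "module_sheaf_hom X U M N h"
  shows "open_in X V \<Longrightarrow> V \<subseteq> U \<Longrightarrow> s \<in> carrier (msec M V) \<Longrightarrow> h V s \<in> carrier (msec N V)"
    and "open_in X V \<Longrightarrow> V \<subseteq> U \<Longrightarrow> s \<in> carrier (msec M V) \<Longrightarrow> t \<in> carrier (msec M V) \<Longrightarrow>
      h V (s \<oplus>\<^bsub>msec M V\<^esub> t) = h V s \<oplus>\<^bsub>msec N V\<^esub> h V t"
    and "open_in X V \<Longrightarrow> V \<subseteq> U \<Longrightarrow> r \<in> carrier (sec X V) \<Longrightarrow> s \<in> carrier (msec M V) \<Longrightarrow>
      h V (r \<odot>\<^bsub>msec M V\<^esub> s) = r \<odot>\<^bsub>msec N V\<^esub> h V s"
    and "open_in X V \<Longrightarrow> open_in X V' \<Longrightarrow> V \<subseteq> U \<Longrightarrow> V' \<subseteq> V \<Longrightarrow> s \<in> carrier (msec M V) \<Longrightarrow>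
      h V' (mrst M V V' s) = mrst N V V' (h V s)"
proof -
  note 1 = assms[unfolded module_sheaf_hom_def, THEN conjunct1, rule_format, OF conjI]
  note 2 = assms[unfolded module_sheaf_hom_def, THEN conjunct2, rule_format]
  show "h V s \<in> carrier (msec N V)" if "open_in X V" "V \<subseteq> U" "s \<in> carrier (msec M V)"
    using 1[OF that(1,2), THEN conjunct1] that(3) by (rule funcset_mem)
  show "h V (s \<oplus>\<^bsub>msec M V\<^esub> t) = h V s \<oplus>\<^bsub>msec N V\<^esub> h V t"
    if "open_in X V" "V \<subseteq> U" "s \<in> carrier (msec M V)" "t \<in> carrier (msec M V)"
    using 1[OF that(1,2), THEN conjunct2, THEN conjunct1] that(3,4) by simp
  show "h V (r \<odot>\<^bsub>msec M V\<^esub> s) = r \<odot>\<^bsub>msec N V\<^esub> h V s"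
    if "open_in X V" "V \<subseteq> U" "r \<in> carrier (sec X V)" "s \<in> carrier (msec M V)"
    using 1[OF that(1,2), THEN conjunct2, THEN conjunct2] that(3,4) by simp
  show "h V' (mrst M V V' s) = mrst N V V' (h V s)"
    if "open_in X V" "open_in X V'" "V \<subseteq> U" "V' \<subseteq> V" "s \<in> carrier (msec M V)"
    by (rule 2) (use that in auto)
qed

lemma module_sheaf_hom_restrict:
  assumes h: "module_sheaf_hom X U M N h" and U': "U' \<subseteq> U"
  shows "module_sheaf_hom X U' M N h"
  unfolding module_sheaf_hom_def
proof (intro conjI allI impI ballI, goal_cases)
  case (1 V)
  then show ?case using U' module_sheaf_homD(1)[OF h, of V] by auto
next
  case (2 V s t)
  then show ?case using U' module_sheaf_homD(2)[OF h, of V s t] by auto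
next
  case (3 V r s)
  then show ?case using U' module_sheaf_homD(3)[OF h, of V r s] by auto
next
  case (4 V V' s)
  then show ?case using U' module_sheaf_homD(4)[OF h, of V V' s] by auto
qed

section \<open>Frobenius duality at the generic point\<close>

text \<open>Two sections of \<open>Hom(F\<^sup>e\<^sub>* O\<^sub>X, O\<^sub>X) \<cong> O\<^sub>X((1 - p\<^sup>e) K\<^sub>X)\<close> that agree generically correspond to the
  same rational function. This extends the duality isomorphism to all \<open>p\<^sup>e\<close>-linear maps of the function
  field.\<close>

locale duality_loc = frobenius_loc X p e for X :: "('p, 'r) ringed_space" and p e :: nat +
  fixes KX :: "'p \<Rightarrow> rat" and h
  assumes KX_Weil: "Weil_divisor X KX"
    and h_hom: "module_sheaf_hom X (points X) (frobenius_dual X p e)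
              (divisor_sheaf X (\<lambda>y. (1 - of_nat p ^ e) * KX y)) h"
    and h_bij: "\<And>V. open_in X V \<Longrightarrow> bij_betw (h V) (carrier (msec (frobenius_dual X p e) V))
              (carrier (msec (divisor_sheaf X (\<lambda>y. (1 - of_nat p ^ e) * KX y)) V))"
begin

abbreviation "DX \<equiv> (\<lambda>y. (1 - of_nat p ^ e) * KX y)"
abbreviation "Dual \<equiv> frobenius_dual X p e"

lemma div_carrier: "U \<noteq> {} \<Longrightarrow> carrier (msec (divisor_sheaf X D) U) = {f \<in> carrier K. f = \<zero>\<^bsub>K\<^esub> \<or>
    (\<forall>y\<in>U. codim_one X y \<longrightarrow> of_int (order_at X y f) + D y \<ge> 0)}"
  unfolding divisor_sheaf_def fun_field_subsheaf_def Let_def by simp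

lemma h_closed: "open_in X U \<Longrightarrow> \<sigma> \<in> carrier (msec Dual U) \<Longrightarrow> h U \<sigma> \<in> carrier (msec (divisor_sheaf X DX) U)"
  using h_bij bij_betwE by blast

lemma h_rst:
  assumes "open_in X U" "open_in X V" "V \<subseteq> U" "V \<noteq> {}" "\<sigma> \<in> carrier (msec Dual U)"
  shows "h V (normalise_family X V \<sigma>) = h U \<sigma>"
proof -
  have "h V (mrst Dual U V \<sigma>) = mrst (divisor_sheaf X DX) U V (h U \<sigma>)"
    by (rule module_sheaf_homD(4)[OF h_hom assms(1,2) open_points[OF assms(1)] assms(3,5)])
  moreover have "mrst (divisor_sheaf X DX) U V (h U \<sigma>) = h U \<sigma>"
    using assms(4) unfolding divisor_sheaf_def fun_field_subsheaf_def Let_def by simp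
  ultimately show ?thesis unfolding frobenius_dual_def by simp
qed

lemma h_smult:
  assumes "open_in X U" "U \<noteq> {}" "r \<in> carrier (sec X U)" "\<sigma> \<in> carrier (msec Dual U)"
  shows "h U (r \<odot>\<^bsub>msec Dual U\<^esub> \<sigma>) = germ X \<eta> U r \<otimes>\<^bsub>K\<^esub> h U \<sigma>"
proof -
  have "h U (r \<odot>\<^bsub>msec Dual U\<^esub> \<sigma>) = r \<odot>\<^bsub>msec (divisor_sheaf X DX) U\<^esub> h U \<sigma>"
    by (rule module_sheaf_homD(3)[OF h_hom assms(1) open_points[OF assms(1)] assms(3,4)])
  then show ?thesis
    using assms(2) unfolding divisor_sheaf_def fun_field_subsheaf_def Let_def by simp
qed

definition reg_on :: "(('p set \<times> 'r) set \<Rightarrow> ('p set \<times> 'r) set) \<Rightarrow> 'p set \<Rightarrow> bool" where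
  "reg_on \<beta> U \<longleftrightarrow> open_in X U \<and> U \<noteq> {} \<and> (\<forall>z\<in>U. regular \<beta> z)"

lemma reg_onD: "reg_on \<beta> U \<Longrightarrow> open_in X U" "reg_on \<beta> U \<Longrightarrow> U \<noteq> {}" "reg_on \<beta> U \<Longrightarrow> z \<in> U \<Longrightarrow> regular \<beta> z"
  unfolding reg_on_def by auto

text \<open>The rational function that corresponds to \<open>\<beta>\<close> under duality. A set of
  regularity has to be chosen, because over the whole of X \<open>\<beta>\<close> need not be a
  section of the dual sheaf.\<close>

definition dual :: "(('p set \<times> 'r) set \<Rightarrow> ('p set \<times> 'r) set) \<Rightarrow> ('p set \<times> 'r) set" where
  "dual \<beta> = (let U = SOME U. reg_on \<beta> U in h U (dual_section \<beta> U))"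

lemma dual_section_reg: "plin \<beta> \<Longrightarrow> reg_on \<beta> U \<Longrightarrow> dual_section \<beta> U \<in> carrier (msec Dual U)"
  by (rule dual_section_closed[OF _ reg_onD(1) reg_onD(3)])

text \<open>Restriction in \<open>divisor_sheaf\<close> leaves rational functions unchanged, so the
  values of \<open>h\<close> on two sets of regularity both equal the value on their nonempty
  intersection.\<close>

lemma dual_eq:
  assumes \<beta>: "plin \<beta>" and U: "reg_on \<beta> U" shows "dual \<beta> = h U (dual_section \<beta> U)"
proof -
  have key: "h (U \<inter> V) (dual_section \<beta> (U \<inter> V)) = h U (dual_section \<beta> U)"
    if U: "reg_on \<beta> U" and V: "reg_on \<beta> V" for U V
  proof -
    have o: "open_in X (U \<inter> V)" "U \<inter> V \<noteq> {}" using irreducible[OF reg_onD(1,2)[OF U] reg_onD(1,2)[OF V]] reg_onD(1)[OF U] reg_onD(1)[OF V] by auto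
    have "h (U \<inter> V) (normalise_family X (U \<inter> V) (dual_section \<beta> U)) = h U (dual_section \<beta> U)"
      by (rule h_rst[OF reg_onD(1)[OF U] o(1) _ o(2) dual_section_reg[OF \<beta> U]]) blast
    then show ?thesis unfolding dual_section_def by (simp add: normalise_normalise)
  qed
  define V where "V = (SOME U. reg_on \<beta> U)"
  have V: "reg_on \<beta> V" unfolding V_def by (rule someI[of "reg_on \<beta>", OF U])
  have "dual \<beta> = h V (dual_section \<beta> V)" unfolding dual_def V_def Let_def ..
  then show ?thesis using key[OF U V] key[OF V U] by (simp add: Int_commute)
qed

lemma reg_on_exists: assumes "plin \<beta>" obtains U where "reg_on \<beta> U"
proof -
  obtain V where "open_in X V" "V \<noteq> {}" "\<And>z. z \<in> V \<Longrightarrow> regular \<beta> z" by (rule generically_regular[OF assms]) blast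
  then have "reg_on \<beta> V" unfolding reg_on_def by blast
  then show ?thesis by (rule that)
qed

lemma dual_closed: assumes \<beta>: "plin \<beta>" shows "dual \<beta> \<in> carrier K"
proof -
  obtain U where U: "reg_on \<beta> U" by (rule reg_on_exists[OF \<beta>])
  have "h U (dual_section \<beta> U) \<in> carrier (msec (divisor_sheaf X DX) U)"
    by (rule h_closed[OF reg_onD(1)[OF U] dual_section_reg[OF \<beta> U]])
  then show ?thesis unfolding dual_eq[OF \<beta> U] div_carrier[OF reg_onD(2)[OF U]] by blast
qed

text \<open>\<open>c\<close> is a section over some open set, and there \<open>h\<close> is linear
  over sections. Through this formula all orders of twisted maps are computed later.\<close>

lemma dual_twist:
  assumes \<beta>: "plin \<beta>" and c: "c \<in> carrier K" shows "dual (twist c \<beta>) = c \<otimes>\<^bsub>K\<^esub> dual \<beta>"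
proof -
  obtain U where U: "reg_on \<beta> U" by (rule reg_on_exists[OF \<beta>])
  have tw: "plin (twist c \<beta>)" by (rule plin_twist[OF \<beta> c])
  obtain V where V: "reg_on (twist c \<beta>) V" by (rule reg_on_exists[OF tw])
  obtain Z r where Z: "open_in X Z" "Z \<noteq> {}" "r \<in> carrier (sec X Z)" "c = germ X \<eta> Z r" by (rule K_rep[OF c])
  define W where "W = U \<inter> V \<inter> Z"
  have UV: "open_in X (U \<inter> V)" "U \<inter> V \<noteq> {}" using irreducible[OF reg_onD(1,2)[OF U] reg_onD(1,2)[OF V]] reg_onD(1)[OF U] reg_onD(1)[OF V] by auto
  have W: "open_in X W" "W \<noteq> {}" unfolding W_def using irreducible[OF UV Z(1,2)] UV Z by auto
  have WZ: "W \<subseteq> Z" unfolding W_def by blast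
  have rU: "reg_on \<beta> W" "reg_on (twist c \<beta>) W"
    using W U V unfolding reg_on_def W_def by auto
  have r: "rst X Z W r \<in> carrier (sec X W)" by (rule rst_closed[OF Z(1) W(1) WZ Z(3)])
  have cr: "germ X \<eta> W (rst X Z W r) = c" using emb_rst[OF Z(1) W(1) WZ W(2) Z(3)] Z(4) by simp
  have "dual (twist c \<beta>) = h W (rst X Z W r \<odot>\<^bsub>msec Dual W\<^esub> dual_section \<beta> W)"
    unfolding dual_section_twist[OF W(1) r] cr dual_eq[OF tw rU(2)] ..
  also have "\<dots> = c \<otimes>\<^bsub>K\<^esub> dual \<beta>"
    unfolding h_smult[OF W r dual_section_reg[OF \<beta> rU(1)]] cr dual_eq[OF \<beta> rU(1)] ..
  finally show ?thesis .
qed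

lemma dual_section_apply:
  assumes "open_in X V" "V \<subseteq> U" "s \<in> carrier (sec X V)"
  shows "dual_section \<beta> U V s = family \<beta> V s"
  using assms unfolding dual_section_def normalise_family_def by simp

text \<open>\<open>h\<close> is injective on sections over \<open>U\<close>, and a map on K is
  determined by its values on sections over small open sets, which exhaust K.\<close>

lemma dual_inj:
  assumes \<beta>: "plin \<beta>" "plin \<beta>'" and U: "reg_on \<beta> U" "reg_on \<beta>' U" and eq: "dual \<beta> = dual \<beta>'"
    and f: "f \<in> carrier K"
  shows "\<beta> f = \<beta>' f"
proof -
  have o: "open_in X U" "U \<noteq> {}" using reg_onD U by auto
  have "h U (dual_section \<beta> U) = h U (dual_section \<beta>' U)" using eq dual_eq[OF \<beta>(1) U(1)] dual_eq[OF \<beta>(2) U(2)] by simp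
  then have ds: "dual_section \<beta> U = dual_section \<beta>' U"
    using bij_betw_imp_inj_on[OF h_bij[OF o(1)]] dual_section_reg \<beta> U by (auto dest: inj_onD)
  obtain Z s where Z: "open_in X Z" "Z \<noteq> {}" "s \<in> carrier (sec X Z)" "f = germ X \<eta> Z s" by (rule K_rep[OF f])
  define W where "W = U \<inter> Z"
  have W: "open_in X W" "W \<noteq> {}" "W \<subseteq> Z" "W \<subseteq> U" unfolding W_def using irreducible[OF o Z(1,2)] o Z by auto
  have s: "rst X Z W s \<in> carrier (sec X W)" by (rule rst_closed[OF Z(1) W(1,3) Z(3)])
  have fs: "f = germ X \<eta> W (rst X Z W s)" using emb_rst[OF Z(1) W(1,3,2) Z(3)] Z(4) by simp
  have rz: "regular \<beta> z" "regular \<beta>' z" if "z \<in> W" for z using reg_onD(3) U that W(4) by blast+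
  have "family \<beta> W (rst X Z W s) = family \<beta>' W (rst X Z W s)"
    using dual_section_apply[OF W(1,4) s, of \<beta>] dual_section_apply[OF W(1,4) s, of \<beta>'] ds by simp
  then show ?thesis unfolding fs
    using family(2)[OF W(1,2) s, of \<beta>, OF rz(1)] family(2)[OF W(1,2) s, of \<beta>', OF rz(2)] by simp
qed

text \<open>The zero map is the twist by zero and has dual zero, so injectivity of duality on a
  common set of regularity gives the claim.\<close>

lemma dual_nonzero:
  assumes \<beta>: "plin \<beta>" and f: "f \<in> carrier K" "\<beta> f \<noteq> \<zero>\<^bsub>K\<^esub>" shows "dual \<beta> \<in> Kx"
proof -
  have "dual \<beta> \<noteq> \<zero>\<^bsub>K\<^esub>"
  proof
    assume z: "dual \<beta> = \<zero>\<^bsub>K\<^esub>"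
    define \<beta>' where "\<beta>' = twist \<zero>\<^bsub>K\<^esub> \<beta>"
    have \<beta>': "plin \<beta>'" unfolding \<beta>'_def by (rule plin_twist[OF \<beta> K.zero_closed])
    have eq: "dual \<beta> = dual \<beta>'" unfolding \<beta>'_def dual_twist[OF \<beta> K.zero_closed] z by simp
    obtain U where U: "reg_on \<beta> U" by (rule reg_on_exists[OF \<beta>])
    obtain V where V: "reg_on \<beta>' V" by (rule reg_on_exists[OF \<beta>'])
    have UV: "open_in X (U \<inter> V)" "U \<inter> V \<noteq> {}" using irreducible[OF reg_onD(1,2)[OF U] reg_onD(1,2)[OF V]] reg_onD(1)[OF U] reg_onD(1)[OF V] by auto
    have r: "reg_on \<beta> (U \<inter> V)" "reg_on \<beta>' (U \<inter> V)" using UV U V unfolding reg_on_def by auto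
    have "\<beta> f = \<beta>' f" by (rule dual_inj[OF \<beta> \<beta>' r eq f(1)])
    then show False using f plin_zero[OF \<beta>] unfolding \<beta>'_def twist_def by simp
  qed
  then show ?thesis using dual_closed[OF \<beta>] by simp
qed

lemma Q_divisor_KX: "Q_divisor X KX"
  using KX_Weil unfolding Weil_divisor_def by blast

text \<open>Duality localised at one point. A map regular at \<open>y\<close> is a section near
  \<open>y\<close>, so its dual is one of O_X((1 - p^e) K_X). Conversely the inequality at
  \<open>y\<close> is spread to a neighbourhood, where the dual is the image of some section; this
  section induces \<open>\<beta>\<close>, since the two have the same dual.\<close>

lemma regular_iff_order:
  assumes \<beta>: "plin \<beta>" and nz: "dual \<beta> \<in> Kx" and cod: "codim_one X y"
  shows "regular \<beta> y \<longleftrightarrow> of_int (order_at X y (dual \<beta>)) + DX y \<ge> 0"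
proof
  note y = codim_point[OF cod]
  assume "regular \<beta> y"
  then obtain V where V: "open_in X V" "y \<in> V" "\<And>z. z \<in> V \<Longrightarrow> regular \<beta> z"
    by (rule regular_open[OF \<beta> y]) blast
  have U: "reg_on \<beta> V" unfolding reg_on_def using V by blast
  have "h V (dual_section \<beta> V) \<in> carrier (msec (divisor_sheaf X DX) V)"
    by (rule h_closed[OF V(1) dual_section_reg[OF \<beta> U]])
  then have "dual \<beta> = \<zero>\<^bsub>K\<^esub> \<or> (\<forall>y\<in>V. codim_one X y \<longrightarrow> of_int (order_at X y (dual \<beta>)) + DX y \<ge> 0)"
    unfolding dual_eq[OF \<beta> U] div_carrier[OF reg_onD(2)[OF U]] by blast
  then show "of_int (order_at X y (dual \<beta>)) + DX y \<ge> 0" using nz V(2) cod by blast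
next
  note y = codim_point[OF cod]
  assume ord: "of_int (order_at X y (dual \<beta>)) + DX y \<ge> 0"
  \<comment> \<open>At codimension one points where \<open>D\<close> vanishes the inequality holds
    with equality. Hence it holds throughout a neighbourhood \<open>V\<close> that meets the support
    of \<open>D\<close> at most in \<open>y\<close>.\<close>
  define D where "D z = 1 * principal_divisor X (dual \<beta>) z + (1 - of_nat p ^ e) * KX z" for z
  have "Q_divisor X D" unfolding D_def by (rule Q_divisor_comb[OF Q_divisor_principal[OF nz] Q_divisor_KX])
  then obtain V where V: "open_in X V" "y \<in> V" "\<And>z. z \<in> V \<Longrightarrow> D z \<noteq> 0 \<Longrightarrow> z = y"
    by (rule divisor_isolate[OF _ y disjI1[OF cod]]) blast
  have V0: "V \<noteq> {}" using V(2) by blast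
  have "of_int (order_at X z (dual \<beta>)) + DX z \<ge> 0" if z: "z \<in> V" "codim_one X z" for z
  proof (cases "z = y")
    case False
    then have "D z = 0" using V(3) z(1) by blast
    then show ?thesis unfolding D_def principal_divisor_def using z(2) by simp
  qed (use ord in simp)
  then have mem: "dual \<beta> \<in> carrier (msec (divisor_sheaf X DX) V)" unfolding div_carrier[OF V0] using nz by blast
  then have "dual \<beta> \<in> h V ` carrier (msec Dual V)" using bij_betw_imp_surj_on[OF h_bij[OF V(1)]] by simp
  then obtain \<sigma> where \<sigma>: "\<sigma> \<in> carrier (msec Dual V)" "h V \<sigma> = dual \<beta>" by (elim imageE) simp
  obtain k where k: "\<sigma> = normalise_family X V k"
    "module_sheaf_hom X V (frobenius_push X p e (structure_module X)) (structure_module X) k"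
    using \<sigma>(1) unfolding frobenius_dual_def by auto
  have kc: "k Z s \<in> carrier (sec X Z)" if "open_in X Z" "Z \<subseteq> V" "s \<in> carrier (sec X Z)" for Z s
    using module_sheaf_homD(1)[OF k(2) that(1,2), of s] that(3)
    unfolding frobenius_push_def structure_module_def restrict_scalars_def by simp
  have kr: "k Z' (rst X Z Z' s) = rst X Z Z' (k Z s)"
    if "open_in X Z" "open_in X Z'" "Z \<subseteq> V" "Z' \<subseteq> Z" "s \<in> carrier (sec X Z)" for Z Z' s
    using module_sheaf_homD(4)[OF k(2) that(1-4), of s] that(5)
    unfolding frobenius_push_def structure_module_def restrict_scalars_def by simp
  obtain U where U: "reg_on \<beta> U" by (rule reg_on_exists[OF \<beta>])
  define W where "W = U \<inter> V"
  have W: "open_in X W" "W \<noteq> {}" "W \<subseteq> V" unfolding W_def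
    using irreducible[OF reg_onD(1,2)[OF U] V(1) V0] reg_onD(1)[OF U] V(1) by auto
  have rW: "reg_on \<beta> W" using W U unfolding reg_on_def W_def by auto
  \<comment> \<open>Over \<open>W\<close> both \<open>\<sigma>\<close> and \<open>\<beta>\<close>
    give sections of the dual sheaf, and injectivity of \<open>h\<close> identifies them; a section
    \<open>f\<close> near \<open>y\<close> can then be evaluated with \<open>k\<close> and compared
    with \<open>\<beta> f\<close> over a smaller set inside \<open>W\<close>.\<close>
  have "h W (normalise_family X W \<sigma>) = h W (dual_section \<beta> W)"
    using h_rst[OF V(1) W(1,3,2) \<sigma>(1)] \<sigma>(2) dual_eq[OF \<beta> rW] by simp
  moreover have "normalise_family X W \<sigma> \<in> carrier (msec Dual W)"
  proof -
    have "module_sheaf_hom X W (frobenius_push X p e (structure_module X)) (structure_module X) k"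
      using k(2) W(3) by (rule module_sheaf_hom_restrict)
    then show ?thesis unfolding k(1) normalise_normalise[OF W(3)] frobenius_dual_def by auto
  qed
  ultimately have nf: "normalise_family X W \<sigma> = dual_section \<beta> W"
    using bij_betw_imp_inj_on[OF h_bij[OF W(1)]] dual_section_reg[OF \<beta> rW] by (auto dest: inj_onD)
  have kf: "k Z s = family \<beta> Z s" if Z: "open_in X Z" "Z \<subseteq> W" "s \<in> carrier (sec X Z)" for Z s
  proof -
    have "normalise_family X W \<sigma> Z s = k Z s"
      unfolding k(1) normalise_normalise[OF W(3)] unfolding normalise_family_def using Z by simp
    then show ?thesis unfolding nf using dual_section_apply[OF Z] by simp
  qed
  show "regular \<beta> y" unfolding regular_def
  proof
    fix f assume "f \<in> lring y"
    then obtain Z s where Z: "open_in X Z" "y \<in> Z" "s \<in> carrier (sec X Z)" "f = germ X \<eta> Z s"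
      unfolding lring_iff by blast
    define Y where "Y = Z \<inter> V"
    have Y: "open_in X Y" "y \<in> Y" "Y \<noteq> {}" "Y \<subseteq> V" "Y \<subseteq> Z" unfolding Y_def using Z V by auto
    define t where "t = rst X Z Y s"
    have t: "t \<in> carrier (sec X Y)" "germ X \<eta> Y t = f" unfolding t_def
      using rst_closed[OF Z(1) Y(1,5) Z(3)] emb_rst[OF Z(1) Y(1,5,3) Z(3)] Z(4) by auto
    define Y' where "Y' = Y \<inter> W"
    have Y': "open_in X Y'" "Y' \<noteq> {}" "Y' \<subseteq> Y" "Y' \<subseteq> W" unfolding Y'_def
      using irreducible[OF Y(1,3) W(1,2)] Y(1) W(1) by auto
    have t': "rst X Y Y' t \<in> carrier (sec X Y')" by (rule rst_closed[OF Y(1) Y'(1,3) t(1)])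
    have "germ X \<eta> Y (k Y t) = germ X \<eta> Y' (rst X Y Y' (k Y t))"
      by (rule emb_rst[OF Y(1) Y'(1,3,2) kc[OF Y(1,4) t(1)], symmetric])
    also have "\<dots> = germ X \<eta> Y' (family \<beta> Y' (rst X Y Y' t))"
      unfolding kr[OF Y(1) Y'(1) Y(4) Y'(3) t(1), symmetric] kf[OF Y'(1,4) t'] ..
    also have "\<dots> = \<beta> (germ X \<eta> Y' (rst X Y Y' t))"
      by (rule family(2)[OF Y'(1,2) t']) (use reg_onD(3)[OF rW] Y'(4) in blast)
    also have "germ X \<eta> Y' (rst X Y Y' t) = f" using emb_rst[OF Y(1) Y'(1,3,2) t(1)] t(2) by simp
    finally show "\<beta> f \<in> lring y" using emb_lring[OF Y(1,2) kc[OF Y(1,4) t(1)]] by simp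
  qed
qed

end

lemma canonical_divisor_duality:
  assumes "frobenius_loc X p e" "canonical_divisor p X KX"
  obtains h where "duality_loc X p e KX h"
proof -
  interpret frobenius_loc X p e by fact
  have "module_sheaf_iso X (points X) (frobenius_dual X p e) (divisor_sheaf X (\<lambda>y. (1 - of_nat p ^ e) * KX y))"
    using assms(2) e_pos unfolding canonical_divisor_def by blast
  then obtain h where h: "module_sheaf_hom X (points X) (frobenius_dual X p e)
              (divisor_sheaf X (\<lambda>y. (1 - of_nat p ^ e) * KX y)) h"
    and hb: "\<forall>V. open_in X V \<and> V \<subseteq> points X \<longrightarrow> bij_betw (h V) (carrier (msec (frobenius_dual X p e) V))
              (carrier (msec (divisor_sheaf X (\<lambda>y. (1 - of_nat p ^ e) * KX y)) V))"
    unfolding module_sheaf_iso_def by blast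
  have w: "Weil_divisor X KX" using assms(2) unfolding canonical_divisor_def by blast
  have "duality_loc X p e KX h"
    by (intro duality_loc.intro assms(1) duality_loc_axioms.intro w h) (use hb open_points in blast)
  then show ?thesis by (rule that)
qed

section \<open>The divisor of a map on a line bundle\<close>

context duality_loc
begin

text \<open>Maps on K are total functions with arbitrary values outside \<open>carrier K\<close>, so
  it has to be shown that equality on the carrier suffices.\<close>

lemma dual_cong:
  assumes \<beta>: "plin \<beta>" "plin \<beta>'" and eq: "\<And>f. f \<in> carrier K \<Longrightarrow> \<beta> f = \<beta>' f"
  shows "dual \<beta> = dual \<beta>'"
proof -
  obtain U where U: "reg_on \<beta> U" by (rule reg_on_exists[OF \<beta>(1)])
  have "regular \<beta>' z" if z: "z \<in> U" for z
  proof -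
    have r: "regular \<beta> z" by (rule reg_onD(3)[OF U z])
    show ?thesis unfolding regular_def
    proof
      fix f assume f: "f \<in> lring z"
      then have "\<beta> f \<in> lring z" using r unfolding regular_def by blast
      then show "\<beta>' f \<in> lring z" using eq[OF lring_K[OF f]] by simp
    qed
  qed
  then have U': "reg_on \<beta>' U" using U unfolding reg_on_def by blast
  have "family \<beta> V s = family \<beta>' V s" if "open_in X V" "s \<in> carrier (sec X V)" for V s
    using eq emb_closed[OF that(1) _ that(2)] unfolding family_def by simp
  then have "dual_section \<beta> U = dual_section \<beta>' U"
    unfolding dual_section_def normalise_family_def by (auto simp: fun_eq_iff restrict_def)
  then show ?thesis using dual_eq[OF \<beta>(1) U] dual_eq[OF \<beta>(2) U'] by simp
qed

end

text \<open>A nonzero map from F^e_* L to K(X), together with a duality isomorphism. The main proof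
  instantiates it on W with the map induced by \<open>\<phi>\<^sub>E\<close>.\<close>

locale map_loc = duality_loc X p e KX h for X :: "('p, 'r) ringed_space" and p e :: nat and KX h +
  fixes L :: "('p, 'r, 'l) module_sheaf" and \<phi> :: "'p set \<Rightarrow> 'l \<Rightarrow> ('p set \<times> 'r) set"
  assumes L_line: "line_bundle X L"
    and \<phi>_hom: "module_sheaf_hom X (points X) (frobenius_push X p e L) (constant_sheaf X) \<phi>"
    and \<phi>_nonzero: "\<exists>V l. open_in X V \<and> l \<in> carrier (msec L V) \<and> \<phi> V l \<noteq> \<zero>\<^bsub>K\<^esub>"
begin

sublocale L: module_presheaf X L
  using sheaf_of_modules_presheaf[OF ringed] L_line unfolding line_bundle_def by blast

lemma \<phi>_closed: "open_in X V \<Longrightarrow> V \<noteq> {} \<Longrightarrow> s \<in> carrier (msec L V) \<Longrightarrow> \<phi> V s \<in> carrier K"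
  using module_sheaf_homD(1)[OF \<phi>_hom, of V s] open_points[of V]
  unfolding frobenius_push_def constant_sheaf_def fun_field_subsheaf_def Let_def by simp

lemma \<phi>_add: "open_in X V \<Longrightarrow> V \<noteq> {} \<Longrightarrow> s \<in> carrier (msec L V) \<Longrightarrow> t \<in> carrier (msec L V) \<Longrightarrow>
    \<phi> V (s \<oplus>\<^bsub>msec L V\<^esub> t) = \<phi> V s \<oplus>\<^bsub>K\<^esub> \<phi> V t"
  using module_sheaf_homD(2)[OF \<phi>_hom, of V s t] open_points[of V]
  unfolding frobenius_push_def constant_sheaf_def fun_field_subsheaf_def Let_def by simp

lemma \<phi>_smult: "open_in X V \<Longrightarrow> V \<noteq> {} \<Longrightarrow> r \<in> carrier (sec X V) \<Longrightarrow> s \<in> carrier (msec L V) \<Longrightarrow>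
    \<phi> V ((r [^]\<^bsub>sec X V\<^esub> q) \<odot>\<^bsub>msec L V\<^esub> s) = germ X \<eta> V r \<otimes>\<^bsub>K\<^esub> \<phi> V s"
  using module_sheaf_homD(3)[OF \<phi>_hom, of V r s] open_points[of V]
  unfolding frobenius_push_def constant_sheaf_def fun_field_subsheaf_def Let_def by simp

lemma \<phi>_rst: "open_in X V \<Longrightarrow> open_in X V' \<Longrightarrow> V' \<subseteq> V \<Longrightarrow> V' \<noteq> {} \<Longrightarrow> s \<in> carrier (msec L V) \<Longrightarrow>
    \<phi> V' (mrst L V V' s) = \<phi> V s"
  using module_sheaf_homD(4)[OF \<phi>_hom, of V V' s] open_points[of V]
  unfolding frobenius_push_def constant_sheaf_def fun_field_subsheaf_def Let_def by simp

definition generator :: "'p set \<Rightarrow> 'l \<Rightarrow> bool" where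
  "generator U l \<longleftrightarrow> open_in X U \<and> U \<noteq> {} \<and> l \<in> carrier (msec L U) \<and>
     (\<forall>V. open_in X V \<and> V \<subseteq> U \<longrightarrow>
       bij_betw (\<lambda>s. s \<odot>\<^bsub>msec L V\<^esub> mrst L U V l) (carrier (sec X V)) (carrier (msec L V)))"

lemma generator_exists:
  assumes x: "x \<in> points X" obtains U l where "generator U l" "x \<in> U"
proof -
  obtain U where U: "open_in X U" "x \<in> U" "module_sheaf_iso X U (structure_module X) L"
    using L_line x unfolding line_bundle_def by blast
  obtain k where k: "module_sheaf_hom X U (structure_module X) L k"
    "\<forall>V. open_in X V \<and> V \<subseteq> U \<longrightarrow> bij_betw (k V) (carrier (msec (structure_module X) V)) (carrier (msec L V))"
    using U(3) unfolding module_sheaf_iso_def by blast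
  have sc: "carrier (msec (structure_module X) V) = carrier (sec X V)" for V
    unfolding structure_module_def restrict_scalars_def by simp
  have kb: "bij_betw (k V) (carrier (sec X V)) (carrier (msec L V))" if "open_in X V" "V \<subseteq> U" for V
    using k(2) that unfolding sc by blast
  define l where "l = k U \<one>\<^bsub>sec X U\<^esub>"
  have one: "\<one>\<^bsub>sec X V\<^esub> \<in> carrier (sec X V)" if "open_in X V" for V
    using cring.axioms(1)[OF sec_cring[OF that]] by (simp add: ring.ring_simprules(6))
  have l: "l \<in> carrier (msec L U)" unfolding l_def using module_sheaf_homD(1)[OF k(1) U(1)] one[OF U(1)] sc by auto
  have eq: "k V s = s \<odot>\<^bsub>msec L V\<^esub> mrst L U V l" if V: "open_in X V" "V \<subseteq> U" and s: "s \<in> carrier (sec X V)" for V s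
  proof -
    interpret V: cring "sec X V" by (rule sec_cring[OF V(1)])
    have "mrst L U V l = k V (mrst (structure_module X) U V \<one>\<^bsub>sec X U\<^esub>)" unfolding l_def
      by (rule module_sheaf_homD(4)[OF k(1) U(1) V(1) _ V(2), symmetric]) (use one[OF U(1)] sc in auto)
    also have "mrst (structure_module X) U V \<one>\<^bsub>sec X U\<^esub> = \<one>\<^bsub>sec X V\<^esub>"
      unfolding structure_module_def using ring_hom_one[OF rst_hom[OF U(1) V]] by simp
    finally have lV: "mrst L U V l = k V \<one>\<^bsub>sec X V\<^esub>" .
    have "k V (s \<odot>\<^bsub>msec (structure_module X) V\<^esub> \<one>\<^bsub>sec X V\<^esub>) = s \<odot>\<^bsub>msec L V\<^esub> k V \<one>\<^bsub>sec X V\<^esub>"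
      by (rule module_sheaf_homD(3)[OF k(1) V s]) (simp add: sc)
    moreover have "s \<odot>\<^bsub>msec (structure_module X) V\<^esub> \<one>\<^bsub>sec X V\<^esub> = s"
      unfolding structure_module_def restrict_scalars_def using s by simp
    ultimately show ?thesis unfolding lV by simp
  qed
  have "generator U l" unfolding generator_def
  proof (intro conjI allI impI)
    fix V assume "open_in X V \<and> V \<subseteq> U"
    then show "bij_betw (\<lambda>s. s \<odot>\<^bsub>msec L V\<^esub> mrst L U V l) (carrier (sec X V)) (carrier (msec L V))"
      using kb[of V] eq[of V] bij_betw_cong[of "carrier (sec X V)" "k V" "\<lambda>s. s \<odot>\<^bsub>msec L V\<^esub> mrst L U V l"] by simp
  qed (use U l in auto)
  then show ?thesis using that U(2) by blast
qed

lemma generatorD: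
  assumes "generator U l"
  shows "open_in X U" "U \<noteq> {}" "l \<in> carrier (msec L U)"
    "open_in X V \<Longrightarrow> V \<subseteq> U \<Longrightarrow> bij_betw (\<lambda>s. s \<odot>\<^bsub>msec L V\<^esub> mrst L U V l) (carrier (sec X V)) (carrier (msec L V))"
  using assms unfolding generator_def by auto

lemma generator_rep:
  assumes "generator U l" "open_in X V" "V \<subseteq> U" "n \<in> carrier (msec L V)"
  obtains s where "s \<in> carrier (sec X V)" "n = s \<odot>\<^bsub>msec L V\<^esub> mrst L U V l"
proof -
  have "n \<in> (\<lambda>s. s \<odot>\<^bsub>msec L V\<^esub> mrst L U V l) ` carrier (sec X V)"
    using bij_betw_imp_surj_on[OF generatorD(4)[OF assms(1-3)]] assms(4) by simp
  then obtain s where "n = s \<odot>\<^bsub>msec L V\<^esub> mrst L U V l" "s \<in> carrier (sec X V)" by (rule imageE)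
  then show ?thesis using that by simp
qed

lemma generator_inj:
  assumes "generator U l" "open_in X V" "V \<subseteq> U" "s \<in> carrier (sec X V)" "t \<in> carrier (sec X V)"
    "s \<odot>\<^bsub>msec L V\<^esub> mrst L U V l = t \<odot>\<^bsub>msec L V\<^esub> mrst L U V l"
  shows "s = t"
  using inj_onD[OF bij_betw_imp_inj_on[OF generatorD(4)[OF assms(1-3)]], of s t] assms(4-6) by simp

lemma generator_closed:
  assumes "generator U l" "open_in X V" "V \<subseteq> U" "s \<in> carrier (sec X V)"
  shows "s \<odot>\<^bsub>msec L V\<^esub> mrst L U V l \<in> carrier (msec L V)"
  using bij_betwE[OF generatorD(4)[OF assms(1-3)], rule_format, OF assms(4)] .

lemma generator_rst:
  assumes "generator U l" "open_in X V" "V \<subseteq> U" shows "mrst L U V l \<in> carrier (msec L V)"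
  by (rule L.m.rst_closed[OF generatorD(1)[OF assms(1)] assms(2,3) generatorD(3)[OF assms(1)]])

lemma generator_mult_rst:
  assumes g: "generator U l" and V: "open_in X V" "V \<subseteq> U" "open_in X V'" "V' \<subseteq> V" and s: "s \<in> carrier (sec X V)"
  shows "mrst L V V' (s \<odot>\<^bsub>msec L V\<^esub> mrst L U V l) = rst X V V' s \<odot>\<^bsub>msec L V'\<^esub> mrst L U V' l"
  using L.mrst_smult[OF V(1,3,4) s generator_rst[OF g V(1,2)]]
    L.m.rst_trans[OF generatorD(1)[OF g] V(1,3,4,2) generatorD(3)[OF g]] by simp

text \<open>The map \<open>f \<mapsto> \<phi>(f l)\<close> on K. A rational function is a section
  over some smaller open set, where \<open>f l\<close> makes sense; by \<open>local_map_eq\<close>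
  the description has a unique value.\<close>

definition local_map :: "'p set \<Rightarrow> 'l \<Rightarrow> ('p set \<times> 'r) set \<Rightarrow> ('p set \<times> 'r) set" where
  "local_map U l f = (THE z. \<exists>V s. open_in X V \<and> V \<noteq> {} \<and> V \<subseteq> U \<and> s \<in> carrier (sec X V) \<and>
     f = germ X \<eta> V s \<and> z = \<phi> V (s \<odot>\<^bsub>msec L V\<^esub> mrst L U V l))"

lemma local_map_eq:
  assumes g: "generator U l" and V: "open_in X V" "V \<noteq> {}" "V \<subseteq> U" and s: "s \<in> carrier (sec X V)"
  shows "local_map U l (germ X \<eta> V s) = \<phi> V (s \<odot>\<^bsub>msec L V\<^esub> mrst L U V l)"
  unfolding local_map_def
proof (rule the_equality)
  show "\<exists>V' s'. open_in X V' \<and> V' \<noteq> {} \<and> V' \<subseteq> U \<and> s' \<in> carrier (sec X V') \<and>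
     germ X \<eta> V s = germ X \<eta> V' s' \<and> \<phi> V (s \<odot>\<^bsub>msec L V\<^esub> mrst L U V l) = \<phi> V' (s' \<odot>\<^bsub>msec L V'\<^esub> mrst L U V' l)"
    using V s by blast
  fix z assume "\<exists>V' s'. open_in X V' \<and> V' \<noteq> {} \<and> V' \<subseteq> U \<and> s' \<in> carrier (sec X V') \<and>
     germ X \<eta> V s = germ X \<eta> V' s' \<and> z = \<phi> V' (s' \<odot>\<^bsub>msec L V'\<^esub> mrst L U V' l)"
  then obtain V' s' where V': "open_in X V'" "V' \<noteq> {}" "V' \<subseteq> U" "s' \<in> carrier (sec X V')"
    "germ X \<eta> V s = germ X \<eta> V' s'" "z = \<phi> V' (s' \<odot>\<^bsub>msec L V'\<^esub> mrst L U V' l)" by blast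
  define W where "W = V \<inter> V'"
  have W: "open_in X W" "W \<noteq> {}" "W \<subseteq> V" "W \<subseteq> V'" unfolding W_def
    using irreducible[OF V(1,2) V'(1,2)] V(1) V'(1) by auto
  have eq: "rst X V W s = rst X V' W s'"
    by (rule emb_inj[OF W(1,2) rst_closed[OF V(1) W(1,3) s] rst_closed[OF V'(1) W(1,4) V'(4)]])
      (simp add: emb_rst[OF V(1) W(1,3,2) s] emb_rst[OF V'(1) W(1,4,2) V'(4)] V'(5))
  have "\<phi> V (s \<odot>\<^bsub>msec L V\<^esub> mrst L U V l) = \<phi> W (rst X V W s \<odot>\<^bsub>msec L W\<^esub> mrst L U W l)"
    using \<phi>_rst[OF V(1) W(1,3,2) generator_closed[OF g V(1,3) s]] generator_mult_rst[OF g V(1,3) W(1,3) s] by simp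
  moreover have "z = \<phi> W (rst X V' W s' \<odot>\<^bsub>msec L W\<^esub> mrst L U W l)"
    using \<phi>_rst[OF V'(1) W(1,4,2) generator_closed[OF g V'(1,3,4)]] generator_mult_rst[OF g V'(1,3) W(1,4) V'(4)] V'(6) by simp
  ultimately show "z = \<phi> V (s \<odot>\<^bsub>msec L V\<^esub> mrst L U V l)" using eq by simp
qed

lemma K_rep2:
  assumes g: "open_in X U" "U \<noteq> {}" and a: "a \<in> carrier K" and b: "b \<in> carrier K"
  obtains V s t where "open_in X V" "V \<noteq> {}" "V \<subseteq> U" "s \<in> carrier (sec X V)" "t \<in> carrier (sec X V)"
    "a = germ X \<eta> V s" "b = germ X \<eta> V t"
proof -
  obtain Z s t where Z: "open_in X Z" "\<eta> \<in> Z" "s \<in> carrier (sec X Z)" "t \<in> carrier (sec X Z)"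
    "a = germ X \<eta> Z s" "b = germ X \<eta> Z t" by (rule common_open2[OF a b])
  define V where "V = Z \<inter> U"
  have V: "open_in X V" "V \<subseteq> Z" "V \<subseteq> U" "V \<noteq> {}" unfolding V_def using Z(1,2) g gen_mem[OF g] by auto
  show ?thesis
    by (rule that[OF V(1,4,3) rst_closed[OF Z(1) V(1,2) Z(3)] rst_closed[OF Z(1) V(1,2) Z(4)]])
      (simp_all add: emb_rst[OF Z(1) V(1,2,4) Z(3)] emb_rst[OF Z(1) V(1,2,4) Z(4)] Z(5,6))
qed

lemma local_map_plin: assumes g: "generator U l" shows "plin (local_map U l)"
  unfolding plin_def
proof (intro conjI ballI)
  note gU = generatorD(1,2)[OF g]
  show "local_map U l \<in> carrier K \<rightarrow> carrier K"
  proof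
    fix a assume a: "a \<in> carrier K"
    obtain V s t where V: "open_in X V" "V \<noteq> {}" "V \<subseteq> U" "s \<in> carrier (sec X V)" "t \<in> carrier (sec X V)"
      "a = germ X \<eta> V s" "a = germ X \<eta> V t" by (rule K_rep2[OF gU a a])
    show "local_map U l a \<in> carrier K" unfolding V(6) local_map_eq[OF g V(1-4)]
      by (rule \<phi>_closed[OF V(1,2) generator_closed[OF g V(1,3,4)]])
  qed
  fix a b assume ab: "a \<in> carrier K" "b \<in> carrier K"
  obtain V s t where V: "open_in X V" "V \<noteq> {}" "V \<subseteq> U" "s \<in> carrier (sec X V)" "t \<in> carrier (sec X V)"
    "a = germ X \<eta> V s" "b = germ X \<eta> V t" by (rule K_rep2[OF gU ab])
  interpret hh: ring_hom_cring "sec X V" K "germ X \<eta> V" by (rule emb_hom[OF V(1,2)])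
  interpret LV: module "sec X V" "msec L V" by (rule L.msec_module[OF V(1)])
  have lV: "mrst L U V l \<in> carrier (msec L V)" by (rule generator_rst[OF g V(1,3)])
  have "local_map U l (germ X \<eta> V (s \<oplus>\<^bsub>sec X V\<^esub> t)) = \<phi> V ((s \<oplus>\<^bsub>sec X V\<^esub> t) \<odot>\<^bsub>msec L V\<^esub> mrst L U V l)"
    by (rule local_map_eq[OF g V(1-3)]) (use V in simp)
  also have "\<dots> = \<phi> V (s \<odot>\<^bsub>msec L V\<^esub> mrst L U V l) \<oplus>\<^bsub>K\<^esub> \<phi> V (t \<odot>\<^bsub>msec L V\<^esub> mrst L U V l)"
    unfolding LV.smult_l_distr[OF V(4,5) lV]
    by (rule \<phi>_add[OF V(1,2) generator_closed[OF g V(1,3,4)] generator_closed[OF g V(1,3,5)]])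
  finally show "local_map U l (a \<oplus>\<^bsub>K\<^esub> b) = local_map U l a \<oplus>\<^bsub>K\<^esub> local_map U l b"
    unfolding V(6,7) using local_map_eq[OF g V(1-4)] local_map_eq[OF g V(1-3,5)] V(4,5) by simp
  have sq: "s [^]\<^bsub>sec X V\<^esub> q \<in> carrier (sec X V)" using V(4) by simp
  have "local_map U l (germ X \<eta> V (s [^]\<^bsub>sec X V\<^esub> q \<otimes>\<^bsub>sec X V\<^esub> t))
      = \<phi> V ((s [^]\<^bsub>sec X V\<^esub> q \<otimes>\<^bsub>sec X V\<^esub> t) \<odot>\<^bsub>msec L V\<^esub> mrst L U V l)"
    by (rule local_map_eq[OF g V(1-3)]) (use V in simp)
  also have "\<dots> = germ X \<eta> V s \<otimes>\<^bsub>K\<^esub> \<phi> V (t \<odot>\<^bsub>msec L V\<^esub> mrst L U V l)"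
    unfolding LV.smult_assoc1[OF sq V(5) lV]
    by (rule \<phi>_smult[OF V(1,2,4) generator_closed[OF g V(1,3,5)]])
  finally show "local_map U l (a [^]\<^bsub>K\<^esub> q \<otimes>\<^bsub>K\<^esub> b) = a \<otimes>\<^bsub>K\<^esub> local_map U l b"
    unfolding V(6,7) using local_map_eq[OF g V(1-3,5)] V(4,5) by simp
qed

abbreviation "rat_section U l \<equiv> dual (local_map U l)"

lemma rat_section_nonzero: assumes g: "generator U l" shows "rat_section U l \<in> Kx"
proof -
  note gU = generatorD(1,2)[OF g]
  obtain V n where V: "open_in X V" "n \<in> carrier (msec L V)" "\<phi> V n \<noteq> \<zero>\<^bsub>K\<^esub>" using \<phi>_nonzero by blast
  \<comment> \<open>Over the empty set the constant sheaf is zero, so the witness for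
    \<open>\<phi>\<close> being nonzero lives on a nonempty open set.\<close>
  have V0: "V \<noteq> {}"
  proof
    assume "V = {}"
    then have "\<phi> V n \<in> {\<zero>\<^bsub>K\<^esub>}"
      using module_sheaf_homD(1)[OF \<phi>_hom V(1) open_points[OF V(1)], of n] V(2)
      unfolding frobenius_push_def constant_sheaf_def fun_field_subsheaf_def Let_def by simp
    then show False using V(3) by simp
  qed
  define W where "W = U \<inter> V"
  have W: "open_in X W" "W \<noteq> {}" "W \<subseteq> U" "W \<subseteq> V" unfolding W_def using irreducible[OF gU V(1) V0] gU(1) V(1) by auto
  have nW: "mrst L V W n \<in> carrier (msec L W)" by (rule L.m.rst_closed[OF V(1) W(1,4) V(2)])
  obtain s where s: "s \<in> carrier (sec X W)" "mrst L V W n = s \<odot>\<^bsub>msec L W\<^esub> mrst L U W l"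
    by (rule generator_rep[OF g W(1,3) nW])
  have "local_map U l (germ X \<eta> W s) = \<phi> V n"
    unfolding local_map_eq[OF g W(1-3) s(1)] s(2)[symmetric] by (rule \<phi>_rst[OF V(1) W(1,4,2) V(2)])
  then have "local_map U l (germ X \<eta> W s) \<noteq> \<zero>\<^bsub>K\<^esub>" using V(3) by simp
  then show ?thesis by (rule dual_nonzero[OF local_map_plin[OF g] emb_closed[OF W(1,2) s(1)]])
qed

text \<open>If \<open>l' = c l\<close>, the map in the trivialisation \<open>l'\<close> is the twist
  by \<open>c\<close> of the map in the trivialisation \<open>l\<close>, and
  \<open>dual_twist\<close> applies.\<close>

lemma rat_section_change:
  assumes g: "generator U l" "generator U' l'" and c: "c \<in> carrier (sec X (U \<inter> U'))"
    "mrst L U' (U \<inter> U') l' = c \<odot>\<^bsub>msec L (U \<inter> U')\<^esub> mrst L U (U \<inter> U') l"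
  shows "rat_section U' l' = germ X \<eta> (U \<inter> U') c \<otimes>\<^bsub>K\<^esub> rat_section U l"
proof -
  let ?I = "U \<inter> U'"
  note gU = generatorD(1,2)[OF g(1)] and gU' = generatorD(1,2)[OF g(2)]
  have I: "open_in X ?I" "?I \<noteq> {}" using irreducible[OF gU gU'] gU(1) gU'(1) by auto
  have cK: "germ X \<eta> ?I c \<in> carrier K" by (rule emb_closed[OF I c(1)])
  have "local_map U' l' f = twist (germ X \<eta> ?I c) (local_map U l) f" if f: "f \<in> carrier K" for f
  proof -
    obtain V s t where V: "open_in X V" "V \<noteq> {}" "V \<subseteq> ?I" "s \<in> carrier (sec X V)" "t \<in> carrier (sec X V)"
      "f = germ X \<eta> V s" "f = germ X \<eta> V t" by (rule K_rep2[OF I f f])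
    have VU: "V \<subseteq> U" "V \<subseteq> U'" using V(3) by auto
    interpret hh: ring_hom_cring "sec X V" K "germ X \<eta> V" by (rule emb_hom[OF V(1,2)])
    interpret LV: module "sec X V" "msec L V" by (rule L.msec_module[OF V(1)])
    have cV: "rst X ?I V c \<in> carrier (sec X V)" by (rule rst_closed[OF I(1) V(1,3) c(1)])
    have lV: "mrst L U V l \<in> carrier (msec L V)" by (rule generator_rst[OF g(1) V(1) VU(1)])
    have "mrst L U' V l' = mrst L ?I V (mrst L U' ?I l')"
      by (rule L.m.rst_trans[OF gU'(1) I(1) V(1,3) _ generatorD(3)[OF g(2)], symmetric]) blast
    also have "\<dots> = rst X ?I V c \<odot>\<^bsub>msec L V\<^esub> mrst L U V l"
      unfolding c(2) by (rule generator_mult_rst[OF g(1) I(1) _ V(1,3) c(1)]) blast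
    finally have l'V: "mrst L U' V l' = rst X ?I V c \<odot>\<^bsub>msec L V\<^esub> mrst L U V l" .
    have "local_map U' l' f = \<phi> V ((s \<otimes>\<^bsub>sec X V\<^esub> rst X ?I V c) \<odot>\<^bsub>msec L V\<^esub> mrst L U V l)"
      unfolding V(6) local_map_eq[OF g(2) V(1,2) VU(2) V(4)] l'V LV.smult_assoc1[OF V(4) cV lV] ..
    also have "\<dots> = local_map U l (germ X \<eta> V (s \<otimes>\<^bsub>sec X V\<^esub> rst X ?I V c))"
      by (rule local_map_eq[OF g(1) V(1,2) VU(1), symmetric]) (use V(4) cV in simp)
    also have "germ X \<eta> V (s \<otimes>\<^bsub>sec X V\<^esub> rst X ?I V c) = germ X \<eta> ?I c \<otimes>\<^bsub>K\<^esub> f"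
      unfolding V(6) using V(4) cV emb_rst[OF I(1) V(1,3,2) c(1)] cK by (simp add: K.m_comm)
    finally show ?thesis unfolding twist_def .
  qed
  then have "rat_section U' l' = dual (twist (germ X \<eta> ?I c) (local_map U l))"
    by (rule dual_cong[OF local_map_plin[OF g(2)] plin_twist[OF local_map_plin[OF g(1)] cK]])
  then show ?thesis using dual_twist[OF local_map_plin[OF g(1)] cK] by simp
qed

lemma transition:
  assumes g: "generator U l" "generator U' l'"
  obtains c where "c \<in> carrier (sec X (U \<inter> U'))"
    "mrst L U' (U \<inter> U') l' = c \<odot>\<^bsub>msec L (U \<inter> U')\<^esub> mrst L U (U \<inter> U') l"
    "\<And>y. y \<in> U \<inter> U' \<Longrightarrow> germ X y (U \<inter> U') c \<in> Units (stalk X y)"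
proof -
  let ?I = "U \<inter> U'"
  note gU = generatorD(1,2)[OF g(1)] and gU' = generatorD(1,2)[OF g(2)]
  have I: "open_in X ?I" "?I \<subseteq> U" "?I \<subseteq> U'" using gU(1) gU'(1) by auto
  interpret LV: module "sec X ?I" "msec L ?I" by (rule L.msec_module[OF I(1)])
  obtain c where c: "c \<in> carrier (sec X ?I)" "mrst L U' ?I l' = c \<odot>\<^bsub>msec L ?I\<^esub> mrst L U ?I l"
    by (rule generator_rep[OF g(1) I(1,2) generator_rst[OF g(2) I(1,3)]])
  obtain d where d: "d \<in> carrier (sec X ?I)" "mrst L U ?I l = d \<odot>\<^bsub>msec L ?I\<^esub> mrst L U' ?I l'"
    by (rule generator_rep[OF g(2) I(1,3) generator_rst[OF g(1) I(1,2)]])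
  have lI: "mrst L U ?I l \<in> carrier (msec L ?I)" by (rule generator_rst[OF g(1) I(1,2)])
  have "(d \<otimes>\<^bsub>sec X ?I\<^esub> c) \<odot>\<^bsub>msec L ?I\<^esub> mrst L U ?I l = \<one>\<^bsub>sec X ?I\<^esub> \<odot>\<^bsub>msec L ?I\<^esub> mrst L U ?I l"
    unfolding LV.smult_assoc1[OF d(1) c(1) lI] c(2)[symmetric] d(2)[symmetric] LV.smult_one[OF lI] ..
  then have "d \<otimes>\<^bsub>sec X ?I\<^esub> c = \<one>\<^bsub>sec X ?I\<^esub>"
    by (rule generator_inj[OF g(1) I(1,2), rotated 2]) (use c d in auto)
  then have "c \<in> Units (sec X ?I)" unfolding Units_def using c(1) d(1) LV.R.m_comm[OF c(1) d(1)] by auto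
  then show ?thesis using that[OF c] germ_Unit[OF I(1)] by blast
qed

lemma rat_section_order:
  assumes g: "generator U l" "generator U' l'" and y: "y \<in> U" "y \<in> U'" "codim_one X y"
  shows "order_at X y (rat_section U' l') = order_at X y (rat_section U l)"
proof -
  let ?I = "U \<inter> U'"
  have I: "open_in X ?I" "y \<in> ?I" using generatorD(1)[OF g(1)] generatorD(1)[OF g(2)] y by auto
  obtain c where c: "c \<in> carrier (sec X ?I)" "mrst L U' ?I l' = c \<odot>\<^bsub>msec L ?I\<^esub> mrst L U ?I l"
    "\<And>y. y \<in> ?I \<Longrightarrow> germ X y ?I c \<in> Units (stalk X y)" by (rule transition[OF g]) blast
  have u: "germ X y ?I c \<in> Units (stalk X y)" by (rule c(3)[OF I(2)])
  have e: "\<iota> (germ X y ?I c) = germ X \<eta> ?I c" by (rule stalk_emb[OF I c(1)])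
  have "germ X \<eta> ?I c \<in> Kx" using Unit_iota[OF codim_point[OF y(3)] u] e by simp
  moreover have "order_at X y (germ X \<eta> ?I c) = 0" using order_unit[OF y(3) u] e by simp
  ultimately show ?thesis
    unfolding rat_section_change[OF g c(1,2)] using order_mult[OF y(3) _ rat_section_nonzero[OF g(1)]] by simp
qed

text \<open>The formula solves \<open>(p^e - 1)(K_X + \<Delta>) = div(rat_section U l)\<close> for
  \<Delta>; the term \<open>DX y\<close> is \<open>- (p^e - 1) KX y\<close>. By
  \<open>rat_section_order\<close> the chosen generator does not influence the value.\<close>

definition divisor :: "'p \<Rightarrow> rat" where
  "divisor y = (if codim_one X y
     then (let (U, l) = SOME (U, l). generator U l \<and> y \<in> U in
       (of_int (order_at X y (rat_section U l)) + DX y) / (of_nat p ^ e - 1)) else 0)"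

lemma divisor_eq:
  assumes g: "generator U l" and y: "y \<in> U" "codim_one X y"
  shows "divisor y = (of_int (order_at X y (rat_section U l)) + DX y) / (of_nat p ^ e - 1)"
proof -
  define Ul where "Ul = (SOME (U, l). generator U l \<and> y \<in> U)"
  have "case (U, l) of (U, l) \<Rightarrow> generator U l \<and> y \<in> U" using g y by simp
  then have "case Ul of (U, l) \<Rightarrow> generator U l \<and> y \<in> U" unfolding Ul_def by (rule someI)
  then have Ul: "generator (fst Ul) (snd Ul)" "y \<in> fst Ul" by (auto simp: case_prod_beta)
  have "divisor y = (of_int (order_at X y (rat_section (fst Ul) (snd Ul))) + DX y) / (of_nat p ^ e - 1)"
    unfolding divisor_def Let_def Ul_def[symmetric] using y(2) by (simp add: case_prod_beta)
  then show ?thesis using rat_section_order[OF g Ul(1) y(1) Ul(2) y(2)] by simp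
qed

text \<open>On a trivialising set the divisor is, up to the factor \<open>p^e - 1\<close>, the
  divisor of one rational function plus a multiple of the canonical divisor, and both are locally
  finite.\<close>

lemma divisor_Q_divisor: "Q_divisor X divisor"
  unfolding Q_divisor_def
proof (intro conjI allI impI ballI)
  fix y assume "divisor y \<noteq> 0" then show "codim_one X y" unfolding divisor_def by (auto split: if_splits)
next
  fix x assume x: "x \<in> points X"
  obtain U l where g: "generator U l" "x \<in> U" by (rule generator_exists[OF x])
  define D where "D y = 1 * principal_divisor X (rat_section U l) y + (1 - of_nat p ^ e) * KX y" for y
  have "Q_divisor X D" unfolding D_def
    by (rule Q_divisor_comb[OF Q_divisor_principal[OF rat_section_nonzero[OF g(1)]] Q_divisor_KX])
  then obtain V where V: "open_in X V" "x \<in> V" "finite {y \<in> V. D y \<noteq> 0}" using x unfolding Q_divisor_def by blast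
  have "D y \<noteq> 0" if y: "y \<in> U \<inter> V" "divisor y \<noteq> 0" for y
  proof -
    have c: "codim_one X y" using y(2) unfolding divisor_def by (auto split: if_splits)
    have "divisor y = D y / (of_nat p ^ e - 1)"
      using divisor_eq[OF g(1) _ c] y(1) c unfolding D_def principal_divisor_def by simp
    then show ?thesis using y(2) by auto
  qed
  then have "{y \<in> U \<inter> V. divisor y \<noteq> 0} \<subseteq> {y \<in> V. D y \<noteq> 0}" by blast
  then have "finite {y \<in> U \<inter> V. divisor y \<noteq> 0}" by (rule finite_subset) (rule V(3))
  then show "\<exists>U. open_in X U \<and> x \<in> U \<and> finite {y \<in> U. divisor y \<noteq> 0}"
    using g(2) V(1,2) generatorD(1)[OF g(1)] by (intro exI[of _ "U \<inter> V"]) auto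
qed

end

section \<open>Orders of vanishing of Frobenius-linear maps\<close>

context map_loc
begin

lemma map_at_stalk_mgerm:
  assumes V: "open_in X V" "y \<in> V" "n \<in> carrier (msec L V)"
  shows "map_at_stalk \<phi> (mgerm X L y V n) = \<phi> V n"
  unfolding map_at_stalk_def
proof (rule the_equality)
  have "(V, n) \<in> mgerm X L y V n" unfolding mgerm_def by (rule L.m.germ_self[OF V])
  then show "\<exists>(V', s)\<in>mgerm X L y V n. \<phi> V n = \<phi> V' s" by blast
  fix k assume "\<exists>(V', s)\<in>mgerm X L y V n. k = \<phi> V' s"
  then obtain V' s where V': "(V', s) \<in> mgerm X L y V n" "k = \<phi> V' s" by blast
  note m = L.m.germ_mem[OF V V'(1)[unfolded mgerm_def]]
  have "mgerm X L y V' s = mgerm X L y V n" unfolding mgerm_def by (rule m(4))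
  then obtain W where W: "open_in X W" "y \<in> W" "W \<subseteq> V'" "W \<subseteq> V" "mrst L V' W s = mrst L V W n"
    by (rule L.mgerm_eqE) (use V m in auto)
  have W0: "W \<noteq> {}" using W(2) by blast
  have "k = \<phi> W (mrst L V' W s)" unfolding V'(2) by (rule \<phi>_rst[OF m(1) W(1,3) W0 m(3), symmetric])
  also have "\<dots> = \<phi> V n" unfolding W(5) by (rule \<phi>_rst[OF V(1) W(1,4) W0 V(3)])
  finally show "k = \<phi> V n" .
qed

section \<open>The stalk of the line bundle as a free module of rank one\<close>

context
  fixes U l y
  assumes g: "generator U l" and yU: "y \<in> U"
begin

abbreviation "S \<equiv> stalk X y"
abbreviation "LS \<equiv> mstalk X L y"
abbreviation "gl \<equiv> mgerm X L y U l"
abbreviation "\<alpha> \<equiv> local_map U l"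

lemma y_point: "y \<in> points X"
  using open_points[OF generatorD(1)[OF g]] yU by blast

lemma stalk_rep2:
  assumes a: "a \<in> carrier S" and b: "b \<in> carrier S"
  obtains V s t where "open_in X V" "y \<in> V" "V \<subseteq> U" "V \<noteq> {}" "s \<in> carrier (sec X V)" "t \<in> carrier (sec X V)"
    "a = germ X y V s" "b = germ X y V t"
proof -
  obtain Z s t where Z: "open_in X Z" "y \<in> Z" "s \<in> carrier (sec X Z)" "t \<in> carrier (sec X Z)"
    "a = germ X y Z s" "b = germ X y Z t" by (rule common_open2[OF a b])
  define V where "V = Z \<inter> U"
  have V: "open_in X V" "V \<subseteq> Z" "V \<subseteq> U" "y \<in> V" unfolding V_def using Z(1,2) generatorD(1)[OF g] yU by auto
  have V0: "V \<noteq> {}" using V(4) by blast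
  show ?thesis
    by (rule that[OF V(1,4,3) V0 rst_closed[OF Z(1) V(1,2) Z(3)] rst_closed[OF Z(1) V(1,2) Z(4)]])
      (simp_all add: germ_restrict[OF Z(1) V(1,2,4) Z(3)] germ_restrict[OF Z(1) V(1,2,4) Z(4)] Z(5,6))
qed

lemma germ_gl:
  assumes V: "open_in X V" "y \<in> V" "V \<subseteq> U" "s \<in> carrier (sec X V)"
  shows "germ X y V s \<odot>\<^bsub>LS\<^esub> gl = mgerm X L y V (s \<odot>\<^bsub>msec L V\<^esub> mrst L U V l)"
  using L.mgerm_smult[OF V(1,2,4) generator_rst[OF g V(1,3)]]
    L.mgerm_restrict[OF generatorD(1)[OF g] V(1,3,2) generatorD(3)[OF g]] by simp

lemma gl_closed: "a \<in> carrier S \<Longrightarrow> a \<odot>\<^bsub>LS\<^esub> gl \<in> carrier LS"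
proof -
  assume a: "a \<in> carrier S"
  obtain V s t where V: "open_in X V" "y \<in> V" "V \<subseteq> U" "V \<noteq> {}" "s \<in> carrier (sec X V)" "t \<in> carrier (sec X V)"
    "a = germ X y V s" "a = germ X y V t" by (rule stalk_rep2[OF a a])
  show ?thesis unfolding V(7) germ_gl[OF V(1-3,5)]
    by (rule L.mgerm_closed[OF V(1,2) generator_closed[OF g V(1,3,5)]])
qed

lemma gl_rep:
  assumes n: "n \<in> carrier LS" obtains a where "a \<in> carrier S" "n = a \<odot>\<^bsub>LS\<^esub> gl"
proof -
  obtain Z m where Z: "open_in X Z" "y \<in> Z" "m \<in> carrier (msec L Z)" "n = mgerm X L y Z m"
    using n unfolding L.mstalk_carrier_iff by blast
  define V where "V = Z \<inter> U"
  have V: "open_in X V" "V \<subseteq> Z" "V \<subseteq> U" "y \<in> V" unfolding V_def using Z(1,2) generatorD(1)[OF g] yU by auto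
  obtain s where s: "s \<in> carrier (sec X V)" "mrst L Z V m = s \<odot>\<^bsub>msec L V\<^esub> mrst L U V l"
    by (rule generator_rep[OF g V(1,3) L.m.rst_closed[OF Z(1) V(1,2) Z(3)]])
  have "n = mgerm X L y V (mrst L Z V m)" unfolding Z(4) by (rule L.mgerm_restrict[OF Z(1) V(1,2,4) Z(3), symmetric])
  then have "n = germ X y V s \<odot>\<^bsub>LS\<^esub> gl" unfolding s(2) germ_gl[OF V(1,4,3) s(1)] .
  then show ?thesis using that germ_closed[OF V(1,4) s(1)] by blast
qed

lemma gl_inj:
  assumes a: "a \<in> carrier S" and b: "b \<in> carrier S" and eq: "a \<odot>\<^bsub>LS\<^esub> gl = b \<odot>\<^bsub>LS\<^esub> gl" shows "a = b"
proof -
  obtain V s t where V: "open_in X V" "y \<in> V" "V \<subseteq> U" "V \<noteq> {}" "s \<in> carrier (sec X V)" "t \<in> carrier (sec X V)"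
    "a = germ X y V s" "b = germ X y V t" by (rule stalk_rep2[OF a b])
  note sc = generator_closed[OF g V(1,3,5)] and tc = generator_closed[OF g V(1,3,6)]
  have "mgerm X L y V (s \<odot>\<^bsub>msec L V\<^esub> mrst L U V l) = mgerm X L y V (t \<odot>\<^bsub>msec L V\<^esub> mrst L U V l)"
    using eq unfolding V(7,8) germ_gl[OF V(1-3,5)] germ_gl[OF V(1-3,6)] .
  then obtain W where W: "open_in X W" "y \<in> W" "W \<subseteq> V" "W \<subseteq> V"
    "mrst L V W (s \<odot>\<^bsub>msec L V\<^esub> mrst L U V l) = mrst L V W (t \<odot>\<^bsub>msec L V\<^esub> mrst L U V l)"
    by (rule L.mgerm_eqE) (use V sc tc in auto)
  have WU: "W \<subseteq> U" using W(3) V(3) by blast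
  have "rst X V W s \<odot>\<^bsub>msec L W\<^esub> mrst L U W l = rst X V W t \<odot>\<^bsub>msec L W\<^esub> mrst L U W l"
    using W(5) generator_mult_rst[OF g V(1,3) W(1,3) V(5)] generator_mult_rst[OF g V(1,3) W(1,3) V(6)] by simp
  then have "rst X V W s = rst X V W t"
    by (rule generator_inj[OF g W(1) WU rst_closed[OF V(1) W(1,3) V(5)] rst_closed[OF V(1) W(1,3) V(6)]])
  then show ?thesis unfolding V(7,8)
    using germ_restrict[OF V(1) W(1,3,2) V(5)] germ_restrict[OF V(1) W(1,3,2) V(6)] by simp
qed

lemma gl_mult:
  assumes a: "a \<in> carrier S" and b: "b \<in> carrier S"
  shows "a \<odot>\<^bsub>LS\<^esub> (b \<odot>\<^bsub>LS\<^esub> gl) = (a \<otimes>\<^bsub>S\<^esub> b) \<odot>\<^bsub>LS\<^esub> gl"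
proof -
  obtain V s t where V: "open_in X V" "y \<in> V" "V \<subseteq> U" "V \<noteq> {}" "s \<in> carrier (sec X V)" "t \<in> carrier (sec X V)"
    "a = germ X y V s" "b = germ X y V t" by (rule stalk_rep2[OF a b])
  interpret LV: module "sec X V" "msec L V" by (rule L.msec_module[OF V(1)])
  have st: "s \<otimes>\<^bsub>sec X V\<^esub> t \<in> carrier (sec X V)" using V(5,6) by simp
  show ?thesis unfolding V(7,8) germ_mult[OF V(1,2,5,6)] germ_gl[OF V(1-3) st] germ_gl[OF V(1-3,6)]
      L.mgerm_smult[OF V(1,2,5) generator_closed[OF g V(1,3,6)]]
      LV.smult_assoc1[OF V(5,6) generator_rst[OF g V(1,3)]] ..
qed

lemma gl_add:
  assumes a: "a \<in> carrier S" and b: "b \<in> carrier S"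
  shows "(a \<odot>\<^bsub>LS\<^esub> gl) \<oplus>\<^bsub>LS\<^esub> (b \<odot>\<^bsub>LS\<^esub> gl) = (a \<oplus>\<^bsub>S\<^esub> b) \<odot>\<^bsub>LS\<^esub> gl"
proof -
  obtain V s t where V: "open_in X V" "y \<in> V" "V \<subseteq> U" "V \<noteq> {}" "s \<in> carrier (sec X V)" "t \<in> carrier (sec X V)"
    "a = germ X y V s" "b = germ X y V t" by (rule stalk_rep2[OF a b])
  interpret LV: module "sec X V" "msec L V" by (rule L.msec_module[OF V(1)])
  have st: "s \<oplus>\<^bsub>sec X V\<^esub> t \<in> carrier (sec X V)" using V(5,6) by simp
  show ?thesis unfolding V(7,8) germ_add[OF V(1,2,5,6)] germ_gl[OF V(1-3) st] germ_gl[OF V(1-3,6)] germ_gl[OF V(1-3,5)]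
      L.mgerm_add[OF V(1,2) generator_closed[OF g V(1,3,5)] generator_closed[OF g V(1,3,6)]]
      LV.smult_l_distr[OF V(5,6) generator_rst[OF g V(1,3)]] ..
qed

lemma map_at_stalk_gl:
  assumes a: "a \<in> carrier S" shows "map_at_stalk \<phi> (a \<odot>\<^bsub>LS\<^esub> gl) = \<alpha> (\<iota> a)"
proof -
  obtain V s t where V: "open_in X V" "y \<in> V" "V \<subseteq> U" "V \<noteq> {}" "s \<in> carrier (sec X V)" "t \<in> carrier (sec X V)"
    "a = germ X y V s" "a = germ X y V t" by (rule stalk_rep2[OF a a])
  show ?thesis unfolding V(7) germ_gl[OF V(1-3,5)] map_at_stalk_mgerm[OF V(1,2) generator_closed[OF g V(1,3,5)]]
      stalk_emb[OF V(1,2,5)] local_map_eq[OF g V(1,4,3,5)] ..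
qed

text \<open>The elements of the submodule are \<open>\<gamma> a\<close> times the generator
  \<open>gl\<close>, and on them \<open>\<phi>\<close> is given by \<open>\<alpha>\<close>. To
  divide \<open>\<phi>\<close> by \<open>\<tau>\<close> therefore means to pass from
  \<open>\<alpha>\<close> to \<open>f \<mapsto> \<alpha>(f/\<tau>)\<close>, whose values on
  multiples of \<open>\<gamma>\<close> have to be regular.\<close>

lemma divisible_iff:
  assumes \<gamma>: "\<gamma> \<in> carrier S" "\<gamma> \<noteq> \<zero>\<^bsub>S\<^esub>" and \<tau>: "\<tau> \<in> carrier S" "\<tau> \<noteq> \<zero>\<^bsub>S\<^esub>"
  shows "(\<exists>\<psi>\<in>frobenius_maps X p e L y ((\<lambda>n. \<gamma> \<odot>\<^bsub>LS\<^esub> n) ` carrier LS).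
      \<forall>n\<in>(\<lambda>n. \<gamma> \<odot>\<^bsub>LS\<^esub> n) ` carrier LS. map_at_stalk \<phi> n = \<psi> (\<tau> \<odot>\<^bsub>LS\<^esub> n))
    \<longleftrightarrow> regular (twist (\<iota> \<gamma> \<otimes>\<^bsub>K\<^esub> inv\<^bsub>K\<^esub> \<iota> \<tau>) \<alpha>) y"
proof -
  define N where "N = (\<lambda>n. \<gamma> \<odot>\<^bsub>LS\<^esub> n) ` carrier LS"
  interpret i: ring_hom_cring S K \<iota> by (rule stalk_emb_hom[OF y_point])
  have pl: "plin \<alpha>" by (rule local_map_plin[OF g])
  define P Q where "P = \<iota> \<tau>" and "Q = inv\<^bsub>K\<^esub> P"
  have PK: "P \<in> Kx" unfolding P_def by (rule iota_nonzero[OF y_point \<tau>])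
  have QK: "Q \<in> Kx" "Q \<otimes>\<^bsub>K\<^esub> P = \<one>\<^bsub>K\<^esub>" unfolding Q_def using K.nonzero_inv[OF PK] by auto
  have c: "P \<in> carrier K" "Q \<in> carrier K" "\<iota> \<gamma> \<in> carrier K" using PK QK \<gamma> by auto
  have N_mem: "(\<gamma> \<otimes>\<^bsub>S\<^esub> a) \<odot>\<^bsub>LS\<^esub> gl \<in> N" if a: "a \<in> carrier S" for a
    unfolding N_def
    by (rule image_eqI[where x = "a \<odot>\<^bsub>LS\<^esub> gl"]) (simp_all add: gl_mult[OF \<gamma>(1) a] gl_closed[OF a])
  have N_rep: "\<exists>a\<in>carrier S. n = (\<gamma> \<otimes>\<^bsub>S\<^esub> a) \<odot>\<^bsub>LS\<^esub> gl" if n: "n \<in> N" for n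
  proof -
    obtain m where m: "m \<in> carrier LS" "n = \<gamma> \<odot>\<^bsub>LS\<^esub> m" using n unfolding N_def by blast
    obtain a where a: "a \<in> carrier S" "m = a \<odot>\<^bsub>LS\<^esub> gl" by (rule gl_rep[OF m(1)])
    have "n = (\<gamma> \<otimes>\<^bsub>S\<^esub> a) \<odot>\<^bsub>LS\<^esub> gl" unfolding m(2) a(2) by (rule gl_mult[OF \<gamma>(1) a(1)])
    then show ?thesis using a(1) by blast
  qed
  have q: "Suc (q - 1) = q" using q_ge_2 by simp
  show ?thesis unfolding N_def[symmetric] P_def[symmetric] Q_def[symmetric]
  proof
    assume "\<exists>\<psi>\<in>frobenius_maps X p e L y N. \<forall>n\<in>N. map_at_stalk \<phi> n = \<psi> (\<tau> \<odot>\<^bsub>LS\<^esub> n)"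
    then obtain \<psi> where \<psi>: "\<psi> \<in> frobenius_maps X p e L y N" "\<forall>n\<in>N. map_at_stalk \<phi> n = \<psi> (\<tau> \<odot>\<^bsub>LS\<^esub> n)" by blast
    have \<psi>1: "\<psi> n \<in> lring y" if "n \<in> N" for n
      using \<psi>(1) that unfolding frobenius_maps_def lring_def by blast
    have \<psi>2: "\<psi> ((a [^]\<^bsub>S\<^esub> q) \<odot>\<^bsub>LS\<^esub> n) = \<iota> a \<otimes>\<^bsub>K\<^esub> \<psi> n" if "a \<in> carrier S" "n \<in> N" for a n
      using \<psi>(1) that unfolding frobenius_maps_def by blast
    show "regular (twist (\<iota> \<gamma> \<otimes>\<^bsub>K\<^esub> Q) \<alpha>) y" unfolding regular_def
    proof
      fix f assume "f \<in> lring y"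
      then obtain a where a: "a \<in> carrier S" "f = \<iota> a" unfolding lring_def by blast
      \<comment> \<open>\<open>\<tau>\<close> cannot be divided out inside the stalk. With
        \<open>b = \<tau>^(q-1) a\<close> one has
        \<open>\<gamma> a / \<tau> = (1/\<tau>)^q \<gamma> b\<close>, and the q-th power leaves
        \<open>\<alpha>\<close> as the factor \<open>1/\<tau>\<close>, which cancels the factor
        \<open>\<tau>\<close> that comes out of \<open>\<psi>\<close>.\<close>
      define b where "b = \<tau> [^]\<^bsub>S\<^esub> (q - 1) \<otimes>\<^bsub>S\<^esub> a"
      have b: "b \<in> carrier S" unfolding b_def using a \<tau> by simp
      have ga: "\<gamma> \<otimes>\<^bsub>S\<^esub> a \<in> carrier S" "\<gamma> \<otimes>\<^bsub>S\<^esub> b \<in> carrier S" using \<gamma> a b by auto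
      have fK: "f \<in> carrier K" unfolding a(2) using a(1) by simp
      have e1: "\<iota> \<gamma> \<otimes>\<^bsub>K\<^esub> Q \<otimes>\<^bsub>K\<^esub> f = Q [^]\<^bsub>K\<^esub> q \<otimes>\<^bsub>K\<^esub> \<iota> (\<gamma> \<otimes>\<^bsub>S\<^esub> b)"
      proof -
        have "Q [^]\<^bsub>K\<^esub> q \<otimes>\<^bsub>K\<^esub> \<iota> (\<gamma> \<otimes>\<^bsub>S\<^esub> b) = Q [^]\<^bsub>K\<^esub> Suc (q - 1) \<otimes>\<^bsub>K\<^esub> (\<iota> \<gamma> \<otimes>\<^bsub>K\<^esub> (P [^]\<^bsub>K\<^esub> (q - 1) \<otimes>\<^bsub>K\<^esub> f))"
          unfolding q b_def P_def a(2) using \<gamma> a \<tau> by simp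
        also have "\<dots> = (Q [^]\<^bsub>K\<^esub> (q - 1) \<otimes>\<^bsub>K\<^esub> P [^]\<^bsub>K\<^esub> (q - 1)) \<otimes>\<^bsub>K\<^esub> (\<iota> \<gamma> \<otimes>\<^bsub>K\<^esub> Q \<otimes>\<^bsub>K\<^esub> f)"
          using c fK by (simp add: K.m_ac)
        also have "Q [^]\<^bsub>K\<^esub> (q - 1) \<otimes>\<^bsub>K\<^esub> P [^]\<^bsub>K\<^esub> (q - 1) = \<one>\<^bsub>K\<^esub>"
          using K.nat_pow_distrib[of Q P "q - 1"] c QK(2) by simp
        finally show ?thesis using c fK by simp
      qed
      have e2: "\<tau> \<otimes>\<^bsub>S\<^esub> (\<gamma> \<otimes>\<^bsub>S\<^esub> b) = \<tau> [^]\<^bsub>S\<^esub> q \<otimes>\<^bsub>S\<^esub> (\<gamma> \<otimes>\<^bsub>S\<^esub> a)"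
      proof -
        have "\<tau> [^]\<^bsub>S\<^esub> Suc (q - 1) \<otimes>\<^bsub>S\<^esub> (\<gamma> \<otimes>\<^bsub>S\<^esub> a) = \<tau> \<otimes>\<^bsub>S\<^esub> (\<gamma> \<otimes>\<^bsub>S\<^esub> b)"
          unfolding b_def using \<gamma> a \<tau> by (simp add: i.R.m_ac)
        then show ?thesis unfolding q by simp
      qed
      have "twist (\<iota> \<gamma> \<otimes>\<^bsub>K\<^esub> Q) \<alpha> f = Q \<otimes>\<^bsub>K\<^esub> \<alpha> (\<iota> (\<gamma> \<otimes>\<^bsub>S\<^esub> b))"
        unfolding twist_def e1 by (rule plin_mult[OF pl c(2) i.hom_closed[OF ga(2)]])
      also have "\<alpha> (\<iota> (\<gamma> \<otimes>\<^bsub>S\<^esub> b)) = \<psi> (\<tau> \<odot>\<^bsub>LS\<^esub> ((\<gamma> \<otimes>\<^bsub>S\<^esub> b) \<odot>\<^bsub>LS\<^esub> gl))"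
        using \<psi>(2) N_mem[OF b] map_at_stalk_gl[OF ga(2)] by simp
      also have "\<tau> \<odot>\<^bsub>LS\<^esub> ((\<gamma> \<otimes>\<^bsub>S\<^esub> b) \<odot>\<^bsub>LS\<^esub> gl) = (\<tau> [^]\<^bsub>S\<^esub> q) \<odot>\<^bsub>LS\<^esub> ((\<gamma> \<otimes>\<^bsub>S\<^esub> a) \<odot>\<^bsub>LS\<^esub> gl)"
        unfolding gl_mult[OF \<tau>(1) ga(2)] e2 using gl_mult[of "\<tau> [^]\<^bsub>S\<^esub> q" "\<gamma> \<otimes>\<^bsub>S\<^esub> a"] \<tau>(1) ga(1) by simp
      also have "\<psi> \<dots> = P \<otimes>\<^bsub>K\<^esub> \<psi> ((\<gamma> \<otimes>\<^bsub>S\<^esub> a) \<odot>\<^bsub>LS\<^esub> gl)" unfolding P_def by (rule \<psi>2[OF \<tau>(1) N_mem[OF a(1)]])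
      also have "Q \<otimes>\<^bsub>K\<^esub> \<dots> = \<psi> ((\<gamma> \<otimes>\<^bsub>S\<^esub> a) \<odot>\<^bsub>LS\<^esub> gl)"
        using lring_K[OF \<psi>1[OF N_mem[OF a(1)]]] c QK(2) by (simp flip: K.m_assoc)
      finally show "twist (\<iota> \<gamma> \<otimes>\<^bsub>K\<^esub> Q) \<alpha> f \<in> lring y" using \<psi>1[OF N_mem[OF a(1)]] by simp
    qed
  next
    assume reg: "regular (twist (\<iota> \<gamma> \<otimes>\<^bsub>K\<^esub> Q) \<alpha>) y"
    \<comment> \<open>The coordinate with respect to the generator, by which the formula
      \<open>b gl \<mapsto> \<alpha>(b/\<tau>)\<close> becomes a definition of
      \<open>\<psi>\<close>.\<close>
    define co where "co n = (THE b. b \<in> carrier S \<and> n = b \<odot>\<^bsub>LS\<^esub> gl)" for n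
    have co: "co (b \<odot>\<^bsub>LS\<^esub> gl) = b" if "b \<in> carrier S" for b
      unfolding co_def by (rule the_equality) (use that gl_inj in auto)
    define \<psi> where "\<psi> n = \<alpha> (Q \<otimes>\<^bsub>K\<^esub> \<iota> (co n))" for n
    have \<psi>: "\<psi> (b \<odot>\<^bsub>LS\<^esub> gl) = \<alpha> (Q \<otimes>\<^bsub>K\<^esub> \<iota> b)" if "b \<in> carrier S" for b
      unfolding \<psi>_def co[OF that] ..
    have "\<psi> \<in> frobenius_maps X p e L y N" unfolding frobenius_maps_def
    proof (intro CollectI conjI ballI)
      show "\<psi> \<in> N \<rightarrow> \<iota> ` carrier S"
      proof
        fix n assume "n \<in> N"
        then obtain a where a: "a \<in> carrier S" "n = (\<gamma> \<otimes>\<^bsub>S\<^esub> a) \<odot>\<^bsub>LS\<^esub> gl" using N_rep by blast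
        have "\<psi> n = twist (\<iota> \<gamma> \<otimes>\<^bsub>K\<^esub> Q) \<alpha> (\<iota> a)"
          unfolding a(2) using \<psi>[of "\<gamma> \<otimes>\<^bsub>S\<^esub> a"] \<gamma> a(1) c unfolding twist_def by (simp add: K.m_ac)
        moreover have "\<iota> a \<in> lring y" unfolding lring_def using a(1) by blast
        ultimately have "\<psi> n \<in> lring y" using reg unfolding regular_def by simp
        then show "\<psi> n \<in> \<iota> ` carrier S" unfolding lring_def .
      qed
    next
      fix n n' assume "n \<in> N" "n' \<in> N"
      then obtain a a' where a: "a \<in> carrier S" "n = (\<gamma> \<otimes>\<^bsub>S\<^esub> a) \<odot>\<^bsub>LS\<^esub> gl"
        "a' \<in> carrier S" "n' = (\<gamma> \<otimes>\<^bsub>S\<^esub> a') \<odot>\<^bsub>LS\<^esub> gl" using N_rep by metis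
      have ga: "\<gamma> \<otimes>\<^bsub>S\<^esub> a \<in> carrier S" "\<gamma> \<otimes>\<^bsub>S\<^esub> a' \<in> carrier S" using \<gamma> a by auto
      have "\<psi> (n \<oplus>\<^bsub>LS\<^esub> n') = \<alpha> (Q \<otimes>\<^bsub>K\<^esub> \<iota> (\<gamma> \<otimes>\<^bsub>S\<^esub> a \<oplus>\<^bsub>S\<^esub> \<gamma> \<otimes>\<^bsub>S\<^esub> a'))"
        unfolding a(2,4) gl_add[OF ga] by (rule \<psi>) (use ga in simp)
      also have "Q \<otimes>\<^bsub>K\<^esub> \<iota> (\<gamma> \<otimes>\<^bsub>S\<^esub> a \<oplus>\<^bsub>S\<^esub> \<gamma> \<otimes>\<^bsub>S\<^esub> a') = Q \<otimes>\<^bsub>K\<^esub> \<iota> (\<gamma> \<otimes>\<^bsub>S\<^esub> a) \<oplus>\<^bsub>K\<^esub> Q \<otimes>\<^bsub>K\<^esub> \<iota> (\<gamma> \<otimes>\<^bsub>S\<^esub> a')"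
        unfolding i.hom_add[OF ga] by (rule K.r_distr[OF i.hom_closed[OF ga(1)] i.hom_closed[OF ga(2)] c(2)])
      also have "\<alpha> \<dots> = \<psi> n \<oplus>\<^bsub>K\<^esub> \<psi> n'" unfolding a(2,4) \<psi>[OF ga(1)] \<psi>[OF ga(2)]
        by (rule plin_add[OF pl]) (use c ga i.hom_closed in auto)
      finally show "\<psi> (n \<oplus>\<^bsub>LS\<^esub> n') = \<psi> n \<oplus>\<^bsub>K\<^esub> \<psi> n'" .
    next
      fix d n assume d: "d \<in> carrier S" and "n \<in> N"
      then obtain a where a: "a \<in> carrier S" "n = (\<gamma> \<otimes>\<^bsub>S\<^esub> a) \<odot>\<^bsub>LS\<^esub> gl" using N_rep by blast
      have ga: "\<gamma> \<otimes>\<^bsub>S\<^esub> a \<in> carrier S" using \<gamma> a by auto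
      have dq: "d [^]\<^bsub>S\<^esub> q \<in> carrier S" using d by simp
      have "\<psi> ((d [^]\<^bsub>S\<^esub> q) \<odot>\<^bsub>LS\<^esub> n) = \<alpha> (Q \<otimes>\<^bsub>K\<^esub> \<iota> (d [^]\<^bsub>S\<^esub> q \<otimes>\<^bsub>S\<^esub> (\<gamma> \<otimes>\<^bsub>S\<^esub> a)))"
        unfolding a(2) gl_mult[OF dq ga] by (rule \<psi>) (use dq ga in simp)
      also have "Q \<otimes>\<^bsub>K\<^esub> \<iota> (d [^]\<^bsub>S\<^esub> q \<otimes>\<^bsub>S\<^esub> (\<gamma> \<otimes>\<^bsub>S\<^esub> a)) = \<iota> d [^]\<^bsub>K\<^esub> q \<otimes>\<^bsub>K\<^esub> (Q \<otimes>\<^bsub>K\<^esub> \<iota> (\<gamma> \<otimes>\<^bsub>S\<^esub> a))"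
      proof -
        have "\<iota> (d [^]\<^bsub>S\<^esub> q \<otimes>\<^bsub>S\<^esub> (\<gamma> \<otimes>\<^bsub>S\<^esub> a)) = \<iota> d [^]\<^bsub>K\<^esub> q \<otimes>\<^bsub>K\<^esub> \<iota> (\<gamma> \<otimes>\<^bsub>S\<^esub> a)"
          using i.hom_mult[OF dq ga] d by simp
        moreover have "\<iota> d [^]\<^bsub>K\<^esub> q \<in> carrier K" "\<iota> (\<gamma> \<otimes>\<^bsub>S\<^esub> a) \<in> carrier K"
          using d i.hom_closed[OF ga] by auto
        ultimately show ?thesis using c(2) by (simp only: K.m_lcomm)
      qed
      also have "\<alpha> \<dots> = \<iota> d \<otimes>\<^bsub>K\<^esub> \<psi> n" unfolding a(2) \<psi>[OF ga]
        by (rule plin_mult[OF pl]) (use d c i.hom_closed[OF ga] in auto)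
      finally show "\<psi> ((d [^]\<^bsub>S\<^esub> p ^ e) \<odot>\<^bsub>LS\<^esub> n) = \<iota> d \<otimes>\<^bsub>K\<^esub> \<psi> n" .
    qed
    moreover have "map_at_stalk \<phi> n = \<psi> (\<tau> \<odot>\<^bsub>LS\<^esub> n)" if n: "n \<in> N" for n
    proof -
      obtain a where a: "a \<in> carrier S" "n = (\<gamma> \<otimes>\<^bsub>S\<^esub> a) \<odot>\<^bsub>LS\<^esub> gl" using N_rep[OF n] by blast
      have ga: "\<gamma> \<otimes>\<^bsub>S\<^esub> a \<in> carrier S" using \<gamma> a by auto
      have "\<psi> (\<tau> \<odot>\<^bsub>LS\<^esub> n) = \<alpha> (Q \<otimes>\<^bsub>K\<^esub> \<iota> (\<tau> \<otimes>\<^bsub>S\<^esub> (\<gamma> \<otimes>\<^bsub>S\<^esub> a)))"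
        unfolding a(2) gl_mult[OF \<tau>(1) ga] by (rule \<psi>) (use \<tau> ga in simp)
      also have "Q \<otimes>\<^bsub>K\<^esub> \<iota> (\<tau> \<otimes>\<^bsub>S\<^esub> (\<gamma> \<otimes>\<^bsub>S\<^esub> a)) = \<iota> (\<gamma> \<otimes>\<^bsub>S\<^esub> a)"
        unfolding i.hom_mult[OF \<tau>(1) ga] P_def[symmetric] using c QK(2) i.hom_closed[OF ga]
        by (simp flip: K.m_assoc del: i.hom_mult)
      also have "\<alpha> \<dots> = map_at_stalk \<phi> n" unfolding a(2) by (rule map_at_stalk_gl[OF ga, symmetric])
      finally show ?thesis ..
    qed
    ultimately show "\<exists>\<psi>\<in>frobenius_maps X p e L y N. \<forall>n\<in>N. map_at_stalk \<phi> n = \<psi> (\<tau> \<odot>\<^bsub>LS\<^esub> n)" by blast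
  qed
qed

end

text \<open>Divisibility by \<open>t^k\<close> is regularity of the twist by
  \<open>G^(q-1)/t^k\<close>. The dual of this twist has order
  \<open>(q-1) ord(G) - k + ord(rat_section U l)\<close>, so by \<open>regular_iff_order\<close> the
  condition is \<open>k \<le> c\<close>, with \<open>c\<close> the right-hand side of the
  formula.\<close>

lemma vanishing_order_iff:
  assumes g: "generator U l" and y: "y \<in> U" "codim_one X y"
    and G: "open_in X Z" "y \<in> Z" "G \<in> carrier (sec X Z)" "germ X \<eta> Z G \<in> Kx"
  shows "vanishing_order X p e L y
       ((\<lambda>n. (germ X y Z G [^]\<^bsub>stalk X y\<^esub> (p ^ e - 1)) \<odot>\<^bsub>mstalk X L y\<^esub> n) ` carrier (mstalk X L y))
       (map_at_stalk \<phi>) n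
    \<longleftrightarrow> of_nat n = of_int (order_at X y (rat_section U l)) + (of_nat p ^ e - 1) * of_int (order_at X y (germ X \<eta> Z G)) + DX y"
proof -
  define \<gamma> where "\<gamma> = germ X y Z G [^]\<^bsub>stalk X y\<^esub> (q - 1)"
  note yp = codim_point[OF y(2)]
  interpret S: domain "stalk X y" by (rule stalk_domain[OF yp])
  interpret i: ring_hom_cring "stalk X y" K \<iota> by (rule stalk_emb_hom[OF yp])
  have Gs: "germ X y Z G \<in> carrier (stalk X y)" using G by auto
  have e: "\<iota> (germ X y Z G) = germ X \<eta> Z G" by (rule stalk_emb[OF G(1-3)])
  have G0: "germ X y Z G \<noteq> \<zero>\<^bsub>stalk X y\<^esub>" using G(4) e by auto
  have \<gamma>: "\<gamma> \<in> carrier (stalk X y)" "\<gamma> \<noteq> \<zero>\<^bsub>stalk X y\<^esub>" unfolding \<gamma>_def using Gs S.nat_pow_nonzero[OF Gs G0] by auto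
  have \<iota>\<gamma>: "\<iota> \<gamma> = germ X \<eta> Z G [^]\<^bsub>K\<^esub> (q - 1)" unfolding \<gamma>_def using Gs e by simp
  have \<gamma>K: "\<iota> \<gamma> \<in> Kx" by (rule iota_nonzero[OF yp \<gamma>])
  define c :: rat where "c = of_int (order_at X y (rat_section U l)) + (of_nat p ^ e - 1) * of_int (order_at X y (germ X \<eta> Z G)) + DX y"
  have q1: "rat_of_nat (q - 1) = of_nat p ^ e - 1" using q_ge_2 by (simp add: of_nat_diff)
  have pl: "plin (local_map U l)" by (rule local_map_plin[OF g])
  have div: "(\<exists>\<psi>\<in>frobenius_maps X p e L y ((\<lambda>n. \<gamma> \<odot>\<^bsub>mstalk X L y\<^esub> n) ` carrier (mstalk X L y)).
      \<forall>n\<in>(\<lambda>n. \<gamma> \<odot>\<^bsub>mstalk X L y\<^esub> n) ` carrier (mstalk X L y).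
        map_at_stalk \<phi> n = \<psi> ((t [^]\<^bsub>stalk X y\<^esub> k) \<odot>\<^bsub>mstalk X L y\<^esub> n)) \<longleftrightarrow> of_nat k \<le> c"
    if t: "uniformizer (stalk X y) t" for t and k :: nat
  proof -
    note tn = uniformizer_nonzero[OF y(2) t]
    have tk: "t [^]\<^bsub>stalk X y\<^esub> k \<in> carrier (stalk X y)" "t [^]\<^bsub>stalk X y\<^esub> k \<noteq> \<zero>\<^bsub>stalk X y\<^esub>"
      using tn(1) S.nat_pow_nonzero[OF tn(1,2)] by auto
    have TK: "\<iota> (t [^]\<^bsub>stalk X y\<^esub> k) \<in> Kx" by (rule iota_nonzero[OF yp tk])
    have iK: "inv\<^bsub>K\<^esub> \<iota> (t [^]\<^bsub>stalk X y\<^esub> k) \<in> Kx" using K.nonzero_inv[OF TK] by blast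
    define d where "d = \<iota> \<gamma> \<otimes>\<^bsub>K\<^esub> inv\<^bsub>K\<^esub> \<iota> (t [^]\<^bsub>stalk X y\<^esub> k)"
    have dK: "d \<in> Kx" unfolding d_def using \<gamma>K iK by (simp add: K.integral_iff)
    have dc: "d \<in> carrier K" using dK by simp
    have dual: "dual (twist d (local_map U l)) = d \<otimes>\<^bsub>K\<^esub> rat_section U l" by (rule dual_twist[OF pl dc])
    have nz: "d \<otimes>\<^bsub>K\<^esub> rat_section U l \<in> Kx" using dK rat_section_nonzero[OF g] by (simp add: K.integral_iff)
    have ot: "order_at X y (\<iota> (t [^]\<^bsub>stalk X y\<^esub> k)) = int k"
      using order_pow[OF y(2) uniformizer_K[OF y(2) t], of k] order_uniformizer[OF y(2) t] tn(1) by simp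
    have og: "order_at X y (\<iota> \<gamma>) = int (q - 1) * order_at X y (germ X \<eta> Z G)"
      unfolding \<iota>\<gamma> by (rule order_pow[OF y(2) G(4)])
    have "order_at X y (d \<otimes>\<^bsub>K\<^esub> rat_section U l) = int (q - 1) * order_at X y (germ X \<eta> Z G) - int k + order_at X y (rat_section U l)"
      using order_mult[OF y(2) dK rat_section_nonzero[OF g]] order_mult[OF y(2) \<gamma>K iK] order_inv[OF y(2) TK] ot og
      unfolding d_def by simp
    then have o: "rat_of_int (order_at X y (d \<otimes>\<^bsub>K\<^esub> rat_section U l)) + DX y = c - of_nat k"
      unfolding c_def q1[symmetric] by simp
    have "regular (twist d (local_map U l)) y \<longleftrightarrow> of_nat k \<le> c"
      using regular_iff_order[OF plin_twist[OF pl dc] _ y(2)] nz o unfolding dual by simp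
    then show ?thesis using divisible_iff[OF g y(1) \<gamma> tk] unfolding d_def by simp
  qed
  obtain t0 where t0: "uniformizer (stalk X y) t0" by (rule uniformizer_ex[OF y(2)])
  have ex: "(\<exists>t. uniformizer (stalk X y) t \<and>
      (\<exists>\<psi>\<in>frobenius_maps X p e L y ((\<lambda>n. \<gamma> \<odot>\<^bsub>mstalk X L y\<^esub> n) ` carrier (mstalk X L y)).
      \<forall>n\<in>(\<lambda>n. \<gamma> \<odot>\<^bsub>mstalk X L y\<^esub> n) ` carrier (mstalk X L y).
        map_at_stalk \<phi> n = \<psi> ((t [^]\<^bsub>stalk X y\<^esub> k) \<odot>\<^bsub>mstalk X L y\<^esub> n))) \<longleftrightarrow> of_nat k \<le> c"
    (is "(\<exists>t. ?u t \<and> ?d t) \<longleftrightarrow> _") for k :: nat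
  proof
    assume "\<exists>t. ?u t \<and> ?d t"
    then obtain t where t: "?u t" "?d t" by (elim exE conjE) (rule that)
    show "of_nat k \<le> c" by (rule iffD1[OF div[OF t(1)] t(2)])
  next
    assume "of_nat k \<le> c"
    then have "?d t0" by (rule iffD2[OF div[OF t0]])
    with t0 show "\<exists>t. ?u t \<and> ?d t" by (intro exI[of _ t0] conjI)
  qed
  have "vanishing_order X p e L y ((\<lambda>n. \<gamma> \<odot>\<^bsub>mstalk X L y\<^esub> n) ` carrier (mstalk X L y)) (map_at_stalk \<phi>) n
    \<longleftrightarrow> of_nat n \<le> c \<and> (\<forall>k. of_nat k \<le> c \<longrightarrow> k \<le> n)"
    unfolding vanishing_order_def Let_def ex ..
  also have "\<dots> \<longleftrightarrow> of_nat n = c"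
  proof
    \<comment> \<open>Integrality of the canonical divisor makes \<open>c\<close> an integer;
      therefore the largest natural number below \<open>c\<close> is \<open>c\<close>
      itself.\<close>
    have "KX y \<in> \<int>" using KX_Weil unfolding Weil_divisor_def by blast
    then have "c \<in> \<int>" unfolding c_def by (intro Ints_add Ints_mult Ints_diff Ints_power) auto
    then obtain z where z: "c = of_int z" by (elim Ints_cases)
    assume a: "of_nat n \<le> c \<and> (\<forall>k. of_nat k \<le> c \<longrightarrow> k \<le> n)"
    then have "rat_of_int (int n) \<le> of_int z" unfolding z by simp
    then have "int n \<le> z" by (simp only: of_int_le_iff)
    then have "rat_of_nat (nat z) \<le> c" unfolding z by simp
    then have "nat z \<le> n" using a by blast
    then have "z = int n" using \<open>int n \<le> z\<close> by simp
    then show "of_nat n = c" unfolding z by simp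
  next
    assume "of_nat n = c"
    then show "of_nat n \<le> c \<and> (\<forall>k. of_nat k \<le> c \<longrightarrow> k \<le> n)" by auto
  qed
  finally show ?thesis unfolding c_def \<gamma>_def .
qed

lemma q_minus_one: "rat_of_nat p ^ e - 1 \<noteq> 0"
proof -
  have "rat_of_nat (p ^ e) \<ge> of_nat 2" using q_ge_2 by (simp only: of_nat_le_iff)
  then show ?thesis by simp
qed

text \<open>The order of \<open>G\<close> enters the vanishing order with the factor
  \<open>p^e - 1\<close>, and after division by this factor it is subtracted again. The coefficient
  thus depends neither on \<open>G\<close> nor on the neighbourhood.\<close>

lemma map_divisor_unique:
  assumes D: "map_divisor X p e L \<phi> \<Delta>" shows "\<Delta> = divisor"
proof
  fix y
  have Q: "Q_divisor X \<Delta>" using D unfolding map_divisor_def by blast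
  show "\<Delta> y = divisor y"
  proof (cases "codim_one X y")
    case False
    then show ?thesis using Q unfolding Q_divisor_def divisor_def by auto
  next
    case cod: True
    note yp = codim_point[OF cod]
    obtain U l where g: "generator U l" "y \<in> U" by (rule generator_exists[OF yp])
    have "\<exists>Z G. open_in X Z \<and> y \<in> Z \<and> G \<in> carrier (sec X Z) - {\<zero>\<^bsub>sec X Z\<^esub>} \<and>
        (\<forall>y \<in> Z. codim_one X y \<longrightarrow>
           (\<exists>n. vanishing_order X p e L y
                 ((\<lambda>l. (germ X y Z G [^]\<^bsub>stalk X y\<^esub> (p ^ e - 1)) \<odot>\<^bsub>mstalk X L y\<^esub> l) ` carrier (mstalk X L y))
                 (map_at_stalk \<phi>) n \<and>
              \<Delta> y = of_nat n / (of_nat p ^ e - 1) - of_int (order_at X y (to_fun_field X Z G))))"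
      using D[unfolded map_divisor_def, THEN conjunct2, THEN conjunct2, THEN conjunct2, rule_format, OF yp]
      by (elim exE conjE) (intro exI conjI)
    then obtain Z G where Z': "open_in X Z" "y \<in> Z" "G \<in> carrier (sec X Z) - {\<zero>\<^bsub>sec X Z\<^esub>}"
      and v: "\<forall>y \<in> Z. codim_one X y \<longrightarrow>
           (\<exists>n. vanishing_order X p e L y
                 ((\<lambda>l. (germ X y Z G [^]\<^bsub>stalk X y\<^esub> (p ^ e - 1)) \<odot>\<^bsub>mstalk X L y\<^esub> l) ` carrier (mstalk X L y))
                 (map_at_stalk \<phi>) n \<and>
              \<Delta> y = of_nat n / (of_nat p ^ e - 1) - of_int (order_at X y (to_fun_field X Z G)))"
      by (elim exE conjE) (rule that)
    have Z: "open_in X Z" "y \<in> Z" "G \<in> carrier (sec X Z)" "G \<noteq> \<zero>\<^bsub>sec X Z\<^esub>" using Z' by auto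
    have Z0: "Z \<noteq> {}" using Z(2) by blast
    have GK: "germ X \<eta> Z G \<in> Kx" using germ_gen_eq_zero[OF Z(1,3) Z0] Z(4) emb_closed[OF Z(1) Z0 Z(3)] by auto
    obtain n where n: "vanishing_order X p e L y
                 ((\<lambda>l. (germ X y Z G [^]\<^bsub>stalk X y\<^esub> (p ^ e - 1)) \<odot>\<^bsub>mstalk X L y\<^esub> l) ` carrier (mstalk X L y))
                 (map_at_stalk \<phi>) n"
      "\<Delta> y = of_nat n / (of_nat p ^ e - 1) - of_int (order_at X y (to_fun_field X Z G))"
      using v[rule_format, OF Z(2) cod] by (elim exE conjE) (rule that)
    have "rat_of_nat n = of_int (order_at X y (rat_section U l)) + (of_nat p ^ e - 1) * of_int (order_at X y (germ X \<eta> Z G)) + DX y"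
      using n(1) vanishing_order_iff[OF g cod Z(1-3) GK] by blast
    then show ?thesis unfolding n(2) divisor_eq[OF g cod] using q_minus_one by (simp add: field_simps)
  qed
qed

lemma map_divisor_exists: "map_divisor X p e L \<phi> divisor"
  unfolding map_divisor_def
proof (intro conjI ballI \<phi>_hom \<phi>_nonzero divisor_Q_divisor)
  fix x assume x: "x \<in> points X"
  obtain U l where g: "generator U l" "x \<in> U" by (rule generator_exists[OF x])
  let ?\<alpha> = "local_map U l"
  have pl: "plin ?\<alpha>" by (rule local_map_plin[OF g(1)])
  obtain U1 hh where U1: "affine_open X U1" "x \<in> U1" "hh \<in> carrier (sec X U1)" "germ X \<eta> U1 hh \<in> Kx"
    and reg: "\<And>z. z \<in> U1 \<Longrightarrow> regular (twist (germ X \<eta> U1 hh [^]\<^bsub>K\<^esub> q) ?\<alpha>) z" by (rule regular_after_twist[OF pl x]) blast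
  have oU1: "open_in X U1" by (rule affine_is_open[OF U1(1)])
  define Z where "Z = U \<inter> U1"
  have Z: "open_in X Z" "x \<in> Z" "Z \<subseteq> U" "Z \<subseteq> U1" "Z \<noteq> {}" unfolding Z_def
    using generatorD(1)[OF g(1)] oU1 g(2) U1(2) by auto
  define H where "H = germ X \<eta> U1 hh"
  have HK: "H \<in> Kx" "H \<in> carrier K" using U1(4) unfolding H_def by auto
  have hZ: "rst X U1 Z hh \<in> carrier (sec X Z)" by (rule rst_closed[OF oU1 Z(1,4) U1(3)])
  interpret Z: ring_hom_cring "sec X Z" K "germ X \<eta> Z" by (rule emb_hom[OF Z(1,5)])
  \<comment> \<open>What is wanted is regularity after the twist by \<open>G^(q-1)\<close>; what is
    known is regularity after the twist by \<open>hh^q\<close>. The power \<open>hh^(q-1)\<close>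
    would fall short by one factor, whereas the square gives \<open>hh^q\<close> times
    \<open>hh^(q-2)\<close>, and the second factor is regular because
    \<open>q \<ge> 2\<close>.\<close>
  define G where "G = rst X U1 Z hh [^]\<^bsub>sec X Z\<^esub> (2::nat)"
  have Gc: "G \<in> carrier (sec X Z)" unfolding G_def using hZ by simp
  have GH: "germ X \<eta> Z G = H [^]\<^bsub>K\<^esub> (2::nat)" unfolding G_def H_def
    using hZ emb_rst[OF oU1 Z(1,4,5) U1(3)] by simp
  have GK: "germ X \<eta> Z G \<in> Kx" unfolding GH using HK K.nat_pow_nonzero[of H 2] by simp
  have pow: "germ X \<eta> Z G [^]\<^bsub>K\<^esub> (q - 1) = H [^]\<^bsub>K\<^esub> q \<otimes>\<^bsub>K\<^esub> H [^]\<^bsub>K\<^esub> (q - 2)"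
  proof -
    have "2 * (q - 1) = q + (q - 2)" using q_ge_2 by simp
    then show ?thesis unfolding GH using HK(2) by (simp add: K.nat_pow_pow K.nat_pow_mult)
  qed
  have regG: "?\<alpha> (germ X \<eta> Z G [^]\<^bsub>K\<^esub> (q - 1) \<otimes>\<^bsub>K\<^esub> f) \<in> lring z" if z: "z \<in> Z" and f: "f \<in> lring z" for z f
  proof -
    have zp: "z \<in> points X" using open_points[OF Z(1)] z by blast
    have Hz: "H \<in> lring z" unfolding H_def using emb_lring[OF oU1 _ U1(3)] z Z(4) by blast
    have "H [^]\<^bsub>K\<^esub> n \<in> lring z" for n :: nat
      by (induction n) (use lring_one[OF zp] lring_mult[OF _ Hz zp] in auto)
    then have m: "H [^]\<^bsub>K\<^esub> (q - 2) \<otimes>\<^bsub>K\<^esub> f \<in> lring z" by (rule lring_mult[OF _ f zp])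
    have "z \<in> U1" using z Z(4) by blast
    then have "twist (H [^]\<^bsub>K\<^esub> q) ?\<alpha> (H [^]\<^bsub>K\<^esub> (q - 2) \<otimes>\<^bsub>K\<^esub> f) \<in> lring z"
      using reg m unfolding regular_def H_def by blast
    then show ?thesis unfolding twist_def pow using HK(2) lring_K[OF f] by (simp add: K.m_assoc)
  qed
  show "\<exists>U g. open_in X U \<and> x \<in> U \<and> g \<in> carrier (sec X U) - {\<zero>\<^bsub>sec X U\<^esub>} \<and>
        (\<forall>V l. open_in X V \<and> V \<noteq> {} \<and> V \<subseteq> U \<and> l \<in> carrier (msec L V) \<longrightarrow>
           \<phi> V ((rst X U V g [^]\<^bsub>sec X V\<^esub> (p ^ e - 1)) \<odot>\<^bsub>msec L V\<^esub> l) \<in> to_fun_field X V ` carrier (sec X V)) \<and>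
        (\<forall>y \<in> U. codim_one X y \<longrightarrow>
           (\<exists>n. vanishing_order X p e L y
                 ((\<lambda>l. (germ X y U g [^]\<^bsub>stalk X y\<^esub> (p ^ e - 1)) \<odot>\<^bsub>mstalk X L y\<^esub> l) ` carrier (mstalk X L y))
                 (map_at_stalk \<phi>) n \<and>
              divisor y = of_nat n / (of_nat p ^ e - 1) - of_int (order_at X y (to_fun_field X U g))))"
  proof (intro exI[of _ Z] exI[of _ G] conjI allI impI ballI Z(1,2))
    show "G \<in> carrier (sec X Z) - {\<zero>\<^bsub>sec X Z\<^esub>}" using Gc GK by auto
    fix V l' assume "open_in X V \<and> V \<noteq> {} \<and> V \<subseteq> Z \<and> l' \<in> carrier (msec L V)"
    then have V: "open_in X V" "V \<noteq> {}" "V \<subseteq> Z" "l' \<in> carrier (msec L V)" by auto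
    have VU: "V \<subseteq> U" using V(3) Z(3) by blast
    interpret V: ring_hom_cring "sec X V" K "germ X \<eta> V" by (rule emb_hom[OF V(1,2)])
    interpret LV: module "sec X V" "msec L V" by (rule L.msec_module[OF V(1)])
    obtain s where s: "s \<in> carrier (sec X V)" "l' = s \<odot>\<^bsub>msec L V\<^esub> mrst L U V l" by (rule generator_rep[OF g(1) V(1) VU V(4)])
    have GV: "rst X Z V G \<in> carrier (sec X V)" by (rule rst_closed[OF Z(1) V(1,3) Gc])
    have Gp: "rst X Z V G [^]\<^bsub>sec X V\<^esub> (q - 1) \<in> carrier (sec X V)" using GV by simp
    have "\<phi> V ((rst X Z V G [^]\<^bsub>sec X V\<^esub> (q - 1)) \<odot>\<^bsub>msec L V\<^esub> l') = ?\<alpha> (germ X \<eta> V (rst X Z V G [^]\<^bsub>sec X V\<^esub> (q - 1) \<otimes>\<^bsub>sec X V\<^esub> s))"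
      unfolding s(2) LV.smult_assoc1[OF Gp s(1) generator_rst[OF g(1) V(1) VU], symmetric]
      by (rule local_map_eq[OF g(1) V(1,2) VU, symmetric]) (use Gp s in simp)
    also have "germ X \<eta> V (rst X Z V G [^]\<^bsub>sec X V\<^esub> (q - 1) \<otimes>\<^bsub>sec X V\<^esub> s) = germ X \<eta> Z G [^]\<^bsub>K\<^esub> (q - 1) \<otimes>\<^bsub>K\<^esub> germ X \<eta> V s"
      using GV s(1) emb_rst[OF Z(1) V(1,3,2) Gc] by simp
    finally have eq: "\<phi> V ((rst X Z V G [^]\<^bsub>sec X V\<^esub> (p ^ e - 1)) \<odot>\<^bsub>msec L V\<^esub> l')
      = ?\<alpha> (germ X \<eta> Z G [^]\<^bsub>K\<^esub> (q - 1) \<otimes>\<^bsub>K\<^esub> germ X \<eta> V s)" .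
    have "?\<alpha> (germ X \<eta> Z G [^]\<^bsub>K\<^esub> (q - 1) \<otimes>\<^bsub>K\<^esub> germ X \<eta> V s) \<in> lring z" if z: "z \<in> V" for z
      by (rule regG[OF subsetD[OF V(3) z] emb_lring[OF V(1) z s(1)]])
    then obtain w where "w \<in> carrier (sec X V)" "germ X \<eta> V w = ?\<alpha> (germ X \<eta> Z G [^]\<^bsub>K\<^esub> (q - 1) \<otimes>\<^bsub>K\<^esub> germ X \<eta> V s)"
      by (rule glue_lring[OF V(1,2)])
    then show "\<phi> V ((rst X Z V G [^]\<^bsub>sec X V\<^esub> (p ^ e - 1)) \<odot>\<^bsub>msec L V\<^esub> l') \<in> to_fun_field X V ` carrier (sec X V)"
      unfolding eq by (intro image_eqI) auto
  next
    fix y assume y: "y \<in> Z" "codim_one X y"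
    have yU: "y \<in> U" using y(1) Z(3) by blast
    define d where "d = germ X \<eta> Z G [^]\<^bsub>K\<^esub> (q - 1)"
    have dK: "d \<in> Kx" "d \<in> carrier K" unfolding d_def using GK K.nat_pow_nonzero[of "germ X \<eta> Z G"] by auto
    \<comment> \<open>Regularity of the twisted map says that \<open>c\<close> below is nonnegative,
      so that it can serve as the natural number \<open>n\<close>.\<close>
    have "regular (twist d ?\<alpha>) y" unfolding regular_def twist_def d_def using regG[OF y(1)] by blast
    moreover have dual: "dual (twist d ?\<alpha>) = d \<otimes>\<^bsub>K\<^esub> rat_section U l" by (rule dual_twist[OF pl dK(2)])
    moreover have nz: "d \<otimes>\<^bsub>K\<^esub> rat_section U l \<in> Kx" using dK rat_section_nonzero[OF g(1)] by (simp add: K.integral_iff)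
    ultimately have ge: "of_int (order_at X y (d \<otimes>\<^bsub>K\<^esub> rat_section U l)) + DX y \<ge> 0"
      using regular_iff_order[OF plin_twist[OF pl dK(2)] _ y(2)] by simp
    have q1: "rat_of_nat (q - 1) = of_nat p ^ e - 1" using q_ge_2 by (simp add: of_nat_diff)
    note q0 = q_minus_one
    have od: "order_at X y (d \<otimes>\<^bsub>K\<^esub> rat_section U l) = int (q - 1) * order_at X y (germ X \<eta> Z G) + order_at X y (rat_section U l)"
      using order_mult[OF y(2) dK(1) rat_section_nonzero[OF g(1)]] order_pow[OF y(2) GK, of "q - 1"] unfolding d_def by simp
    define c :: rat where "c = of_int (order_at X y (rat_section U l)) + (of_nat p ^ e - 1) * of_int (order_at X y (germ X \<eta> Z G)) + DX y"
    have c0: "c \<ge> 0" using ge unfolding od c_def q1[symmetric] by simp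
    have "KX y \<in> \<int>" using KX_Weil unfolding Weil_divisor_def by blast
    then have "c \<in> \<int>" unfolding c_def by (intro Ints_add Ints_mult Ints_diff Ints_power) auto
    then obtain z where z: "c = of_int z" by (elim Ints_cases)
    define n where "n = nat z"
    have n: "of_nat n = c" using c0 unfolding z n_def by simp
    have v: "vanishing_order X p e L y
       ((\<lambda>n. (germ X y Z G [^]\<^bsub>stalk X y\<^esub> (p ^ e - 1)) \<odot>\<^bsub>mstalk X L y\<^esub> n) ` carrier (mstalk X L y))
       (map_at_stalk \<phi>) n"
      unfolding vanishing_order_iff[OF g(1) yU y(2) Z(1) y(1) Gc GK] n c_def ..
    have "divisor y = of_nat n / (of_nat p ^ e - 1) - of_int (order_at X y (germ X \<eta> Z G))"
      unfolding divisor_eq[OF g(1) yU y(2)] n c_def using q0 by (simp add: field_simps)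
    with v show "\<exists>n. vanishing_order X p e L y
       ((\<lambda>l. (germ X y Z G [^]\<^bsub>stalk X y\<^esub> (p ^ e - 1)) \<odot>\<^bsub>mstalk X L y\<^esub> l) ` carrier (mstalk X L y))
       (map_at_stalk \<phi>) n \<and> divisor y = of_nat n / (of_nat p ^ e - 1) - of_int (order_at X y (to_fun_field X Z G))"
      by blast
  qed
qed

end

section \<open>The sheaf of a divisor\<close>

context normal_loc
begin

text \<open>Factor out the term of smaller order: \<open>f + g = f (1 + g/f)\<close>, where
  \<open>g/f\<close> and hence \<open>1 + g/f\<close> lie in the local ring.\<close>

lemma order_add:
  assumes cod: "codim_one X y" and f: "f \<in> Kx" "g \<in> Kx" "f \<oplus>\<^bsub>K\<^esub> g \<in> Kx" and le: "order_at X y f \<le> order_at X y g"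
  shows "order_at X y f \<le> order_at X y (f \<oplus>\<^bsub>K\<^esub> g)"
proof -
  note y = codim_point[OF cod]
  have i: "inv\<^bsub>K\<^esub> f \<in> Kx" "f \<otimes>\<^bsub>K\<^esub> inv\<^bsub>K\<^esub> f = \<one>\<^bsub>K\<^esub>" using K.nonzero_inv[OF f(1)] by auto
  define r where "r = inv\<^bsub>K\<^esub> f \<otimes>\<^bsub>K\<^esub> g"
  have r: "r \<in> Kx" unfolding r_def using i f by (simp add: K.integral_iff)
  have fr: "f \<otimes>\<^bsub>K\<^esub> r = g" unfolding r_def using i f by (simp flip: K.m_assoc)
  have "order_at X y r = order_at X y g - order_at X y f"
    unfolding r_def using order_mult[OF cod i(1) f(2)] order_inv[OF cod f(1)] by simp
  then have "r \<in> lring y" using lring_order[OF cod r] le by simp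
  then have l: "\<one>\<^bsub>K\<^esub> \<oplus>\<^bsub>K\<^esub> r \<in> lring y" by (rule lring_add[OF lring_one[OF y] _ y])
  have e: "f \<otimes>\<^bsub>K\<^esub> (\<one>\<^bsub>K\<^esub> \<oplus>\<^bsub>K\<^esub> r) = f \<oplus>\<^bsub>K\<^esub> g" using f r fr by (simp add: K.r_distr)
  have n: "\<one>\<^bsub>K\<^esub> \<oplus>\<^bsub>K\<^esub> r \<in> Kx"
  proof -
    have "\<one>\<^bsub>K\<^esub> \<oplus>\<^bsub>K\<^esub> r \<noteq> \<zero>\<^bsub>K\<^esub>"
    proof
      assume "\<one>\<^bsub>K\<^esub> \<oplus>\<^bsub>K\<^esub> r = \<zero>\<^bsub>K\<^esub>"
      then have "f \<oplus>\<^bsub>K\<^esub> g = \<zero>\<^bsub>K\<^esub>" using e f by simp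
      then show False using f(3) by simp
    qed
    then show ?thesis using r by simp
  qed
  show ?thesis using order_mult[OF cod f(1) n] lring_order[OF cod n] l unfolding e by simp
qed

lemma div_mem_iff: "U \<noteq> {} \<Longrightarrow> f \<in> carrier (msec (divisor_sheaf X D) U) \<longleftrightarrow> f \<in> carrier K \<and> (f = \<zero>\<^bsub>K\<^esub> \<or>
    (\<forall>y\<in>U. codim_one X y \<longrightarrow> of_int (order_at X y f) + D y \<ge> 0))"
  unfolding divisor_sheaf_def fun_field_subsheaf_def Let_def by simp

lemma div_empty: "f \<in> carrier (msec (divisor_sheaf X D) {}) \<longleftrightarrow> f = \<zero>\<^bsub>K\<^esub>"
  unfolding divisor_sheaf_def fun_field_subsheaf_def Let_def by simp

lemma div_ops:
  "f \<oplus>\<^bsub>msec (divisor_sheaf X D) U\<^esub> g = f \<oplus>\<^bsub>K\<^esub> g" "\<zero>\<^bsub>msec (divisor_sheaf X D) U\<^esub> = \<zero>\<^bsub>K\<^esub>"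
  "r \<odot>\<^bsub>msec (divisor_sheaf X D) U\<^esub> f = (if U = {} then \<zero>\<^bsub>K\<^esub> else germ X \<eta> U r \<otimes>\<^bsub>K\<^esub> f)"
  "mrst (divisor_sheaf X D) U V f = (if V = {} then \<zero>\<^bsub>K\<^esub> else f)"
  unfolding divisor_sheaf_def fun_field_subsheaf_def Let_def by simp_all

lemma div_carrier_K: "f \<in> carrier (msec (divisor_sheaf X D) U) \<Longrightarrow> f \<in> carrier K"
  by (cases "U = {}") (auto simp: div_mem_iff div_empty)

lemma div_add:
  assumes "f \<in> carrier (msec (divisor_sheaf X D) U)" "g \<in> carrier (msec (divisor_sheaf X D) U)"
  shows "f \<oplus>\<^bsub>K\<^esub> g \<in> carrier (msec (divisor_sheaf X D) U)"
proof (cases "U = {}")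
  case False
  have fK: "f \<in> carrier K" "g \<in> carrier K" using assms div_carrier_K by auto
  consider "f = \<zero>\<^bsub>K\<^esub>" | "g = \<zero>\<^bsub>K\<^esub>" | "f \<oplus>\<^bsub>K\<^esub> g = \<zero>\<^bsub>K\<^esub>" | "f \<in> Kx" "g \<in> Kx" "f \<oplus>\<^bsub>K\<^esub> g \<in> Kx"
    using fK by auto
  then show ?thesis
  proof cases
    case 4
    have "of_int (order_at X y (f \<oplus>\<^bsub>K\<^esub> g)) + D y \<ge> 0" if y: "y \<in> U" "codim_one X y" for y
    proof -
      have 1: "of_int (order_at X y f) + D y \<ge> 0" "of_int (order_at X y g) + D y \<ge> 0"
        using assms 4 y unfolding div_mem_iff[OF False] by auto
      have "order_at X y f \<le> order_at X y (f \<oplus>\<^bsub>K\<^esub> g) \<or> order_at X y g \<le> order_at X y (f \<oplus>\<^bsub>K\<^esub> g)"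
      proof (cases "order_at X y f \<le> order_at X y g")
        case True
        then show ?thesis by (intro disjI1 order_add[OF y(2) 4(1,2,3)])
      next
        case False
        have c: "f \<oplus>\<^bsub>K\<^esub> g = g \<oplus>\<^bsub>K\<^esub> f" by (rule K.a_comm[OF fK])
        show ?thesis unfolding c by (intro disjI2 order_add[OF y(2) 4(2,1) 4(3)[unfolded c]]) (use False in linarith)
      qed
      then have "rat_of_int (order_at X y f) \<le> of_int (order_at X y (f \<oplus>\<^bsub>K\<^esub> g)) \<or>
          rat_of_int (order_at X y g) \<le> of_int (order_at X y (f \<oplus>\<^bsub>K\<^esub> g))" by (simp only: of_int_le_iff)
      then show ?thesis using 1 by auto
    qed
    then show ?thesis unfolding div_mem_iff[OF False] using fK by simp
  qed (use assms fK div_mem_iff[OF False] in auto)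
qed (use assms in \<open>simp add: div_empty\<close>)

lemma div_smult:
  assumes U: "open_in X U" "U \<noteq> {}" "r \<in> carrier (sec X U)" and f: "f \<in> carrier (msec (divisor_sheaf X D) U)"
  shows "germ X \<eta> U r \<otimes>\<^bsub>K\<^esub> f \<in> carrier (msec (divisor_sheaf X D) U)"
proof -
  have fK: "f \<in> carrier K" by (rule div_carrier_K[OF f])
  have rK: "germ X \<eta> U r \<in> carrier K" by (rule emb_closed[OF U])
  show ?thesis
  proof (cases "germ X \<eta> U r = \<zero>\<^bsub>K\<^esub> \<or> f = \<zero>\<^bsub>K\<^esub>")
    case True
    then have "germ X \<eta> U r \<otimes>\<^bsub>K\<^esub> f = \<zero>\<^bsub>K\<^esub>"
      by (elim disjE) (simp_all only: K.l_null K.r_null fK rK)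
    then show ?thesis unfolding div_mem_iff[OF U(2)] by simp
  next
    case False
    then have nz: "germ X \<eta> U r \<in> Kx" "f \<in> Kx" using fK rK by auto
    have "of_int (order_at X y (germ X \<eta> U r \<otimes>\<^bsub>K\<^esub> f)) + D y \<ge> 0" if y: "y \<in> U" "codim_one X y" for y
    proof -
      have "of_int (order_at X y f) + D y \<ge> 0" using f nz(2) y unfolding div_mem_iff[OF U(2)] by auto
      moreover have "order_at X y (germ X \<eta> U r) \<ge> 0" by (rule order_section(1)[OF y(2) U(1) y(1) U(3) nz(1)])
      then have "rat_of_int (order_at X y (germ X \<eta> U r)) \<ge> 0" by simp
      ultimately show ?thesis unfolding order_mult[OF y(2) nz] of_int_add by linarith
    qed
    then show ?thesis unfolding div_mem_iff[OF U(2)] using fK rK by simp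
  qed
qed

lemma div_presheaf: "module_presheaf X (divisor_sheaf X D)"
proof -
  let ?N = "divisor_sheaf X D"
  have sub: "f \<in> carrier (msec ?N V)" if "V \<subseteq> U" "V \<noteq> {}" "f \<in> carrier (msec ?N U)" for U V f
  proof -
    have "U \<noteq> {}" using that by auto
    then show ?thesis using that by (auto simp: div_mem_iff)
  qed
  have zero: "\<zero>\<^bsub>K\<^esub> \<in> carrier (msec ?N U)" for U by (cases "U = {}") (auto simp: div_mem_iff div_empty)
  have pre: "presheaf_on (top_of X) (\<lambda>U. carrier (msec ?N U)) (mrst ?N)"
  proof
    fix U s assume "open_in X U" "s \<in> carrier (msec ?N U)"
    then show "mrst ?N U U s = s" by (cases "U = {}") (auto simp: div_ops div_empty)
  next
    fix U V s assume "open_in X U" "open_in X V" "V \<subseteq> U" "s \<in> carrier (msec ?N U)"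
    then show "mrst ?N U V s \<in> carrier (msec ?N V)" using sub zero by (auto simp: div_ops)
  qed (auto simp: div_ops)
  have mod: "module (sec X U) (msec ?N U)" if U: "open_in X U" for U
  proof -
    interpret R: cring "sec X U" by (rule sec_cring[OF U])
    have ag: "abelian_group (msec ?N U)"
    proof (rule abelian_groupI)
      fix x assume x: "x \<in> carrier (msec ?N U)"
      have xK: "x \<in> carrier K" by (rule div_carrier_K[OF x])
      show "\<exists>y\<in>carrier (msec ?N U). y \<oplus>\<^bsub>msec ?N U\<^esub> x = \<zero>\<^bsub>msec ?N U\<^esub>"
      proof (cases "U = {}")
        case True
        then show ?thesis using x by (auto simp: div_empty div_ops)
      next
        case False
        interpret h: ring_hom_cring "sec X U" K "germ X \<eta> U" by (rule emb_hom[OF U False])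
        have "germ X \<eta> U (\<ominus>\<^bsub>sec X U\<^esub> \<one>\<^bsub>sec X U\<^esub>) \<otimes>\<^bsub>K\<^esub> x \<in> carrier (msec ?N U)"
          by (rule div_smult[OF U False _ x]) simp
        then have "\<ominus>\<^bsub>K\<^esub> x \<in> carrier (msec ?N U)" using xK by (simp add: K.l_minus)
        then show ?thesis using K.l_neg[OF xK] by (auto simp: div_ops)
      qed
    qed (auto simp: div_ops div_add zero div_carrier_K K.a_ac intro: K.a_comm)
    show ?thesis
    proof (cases "U = {}")
      case True
      show ?thesis
        by (intro module.intro module_axioms.intro ag R.is_cring)
          (auto simp: div_ops True div_empty)
    next
      case False
      interpret h: ring_hom_cring "sec X U" K "germ X \<eta> U" by (rule emb_hom[OF U False])
      show ?thesis
        by (intro module.intro module_axioms.intro ag R.is_cring)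
          (use False in \<open>auto simp: div_ops div_smult[OF U False] div_carrier_K K.l_distr K.r_distr K.m_assoc\<close>)
    qed
  qed
  show ?thesis
  proof (intro module_presheaf.intro module_presheaf_axioms.intro ringed_space_loc_axioms pre mod)
    fix U V s t assume "open_in X U" "open_in X V" "V \<subseteq> U"
    then show "mrst ?N U V (s \<oplus>\<^bsub>msec ?N U\<^esub> t) = mrst ?N U V s \<oplus>\<^bsub>msec ?N V\<^esub> mrst ?N U V t"
      by (auto simp: div_ops)
  next
    fix U V r s assume *: "open_in X U" "open_in X V" "V \<subseteq> U" "r \<in> carrier (sec X U)"
    show "mrst ?N U V (r \<odot>\<^bsub>msec ?N U\<^esub> s) = rst X U V r \<odot>\<^bsub>msec ?N V\<^esub> mrst ?N U V s"
      using emb_rst[OF *(1-3) _ *(4)] *(3) by (auto simp: div_ops)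
  qed
qed

text \<open>A function with the right order at \<open>y\<close> may violate the conditions of O_X(D)
  at other points; isolating \<open>y\<close> removes these. Integrality of \<open>D y\<close>
  allows an order of exactly \<open>- D y\<close>.\<close>

lemma div_local_generator:
  assumes D: "Q_divisor X D" and y: "codim_one X y" and int: "D y \<in> \<int>"
  obtains V f where "open_in X V" "y \<in> V" "f \<in> carrier (msec (divisor_sheaf X D) V)" "f \<in> Kx"
    "of_int (order_at X y f) = - D y"
proof -
  obtain z where z: "D y = of_int z" using int by (elim Ints_cases)
  obtain f where f: "f \<in> Kx" "order_at X y f = - z" by (rule order_surj[OF y])
  define D' where "D' w = 1 * principal_divisor X f w + 1 * D w" for w
  have "Q_divisor X D'" unfolding D'_def by (rule Q_divisor_comb[OF Q_divisor_principal[OF f(1)] D])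
  then obtain V where V: "open_in X V" "y \<in> V" "\<And>w. w \<in> V \<Longrightarrow> D' w \<noteq> 0 \<Longrightarrow> w = y"
    by (rule divisor_isolate[OF _ codim_point[OF y] disjI1[OF y]]) blast
  have V0: "V \<noteq> {}" using V(2) by blast
  have "of_int (order_at X w f) + D w \<ge> 0" if w: "w \<in> V" "codim_one X w" for w
  proof (cases "w = y")
    case False
    then have "D' w = 0" using V(3) w(1) by blast
    then show ?thesis unfolding D'_def principal_divisor_def using w(2) by simp
  qed (use f z in simp)
  then have "f \<in> carrier (msec (divisor_sheaf X D) V)" unfolding div_mem_iff[OF V0] using f by simp
  then show ?thesis using that V(1,2) f z by simp
qed

text \<open>The generic point has a neighbourhood without components of \<open>D\<close>, where the
  constant function 1 satisfies all conditions. It will witness that local generators pulled back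
  from W are nonzero.\<close>

lemma div_generic_section:
  assumes D: "Q_divisor X D"
  obtains V where "open_in X V" "\<eta> \<in> V" "\<one>\<^bsub>K\<^esub> \<in> carrier (msec (divisor_sheaf X D) V)"
proof -
  obtain V where V: "open_in X V" "\<eta> \<in> V" "\<And>w. w \<in> V \<Longrightarrow> D w \<noteq> 0 \<Longrightarrow> w = \<eta>"
    by (rule divisor_isolate[OF D gen_point]) blast+
  have V0: "V \<noteq> {}" using V(2) by blast
  have "of_int (order_at X w \<one>\<^bsub>K\<^esub>) + D w \<ge> 0" if w: "w \<in> V" "codim_one X w" for w
  proof -
    have "D w = 0" using V(3)[OF w(1)] codim_one_proper[OF w(2)] by blast
    then show ?thesis using order_one[OF w(2)] by simp
  qed
  then have "\<one>\<^bsub>K\<^esub> \<in> carrier (msec (divisor_sheaf X D) V)" unfolding div_mem_iff[OF V0] by simp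
  then show ?thesis using that V(1,2) by blast
qed

text \<open>All representatives of an element of the stalk of \<open>O\<^sub>X(D)\<close> are the same rational function.\<close>

definition div_stalk_value :: "('p set \<times> ('p set \<times> 'r) set) set \<Rightarrow> ('p set \<times> 'r) set" where
  "div_stalk_value n = (THE k. \<exists>(V, s)\<in>n. k = s)"

lemma div_stalk_value:
  assumes V: "open_in X V" "y \<in> V" "s \<in> carrier (msec (divisor_sheaf X D) V)"
  shows "div_stalk_value (mgerm X (divisor_sheaf X D) y V s) = s"
proof -
  interpret N: module_presheaf X "divisor_sheaf X D" by (rule div_presheaf)
  show ?thesis unfolding div_stalk_value_def
  proof (rule the_equality)
    have "(V, s) \<in> mgerm X (divisor_sheaf X D) y V s" unfolding mgerm_def by (rule N.m.germ_self[OF V])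
    then show "\<exists>(V', t)\<in>mgerm X (divisor_sheaf X D) y V s. s = t" by blast
    fix k assume "\<exists>(V', t)\<in>mgerm X (divisor_sheaf X D) y V s. k = t"
    then obtain V' where V': "(V', k) \<in> mgerm X (divisor_sheaf X D) y V s" by blast
    note m = N.m.germ_mem[OF V V'[unfolded mgerm_def]]
    have "mgerm X (divisor_sheaf X D) y V' k = mgerm X (divisor_sheaf X D) y V s" unfolding mgerm_def by (rule m(4))
    then obtain W where W: "open_in X W" "y \<in> W" "W \<subseteq> V'" "W \<subseteq> V"
      "mrst (divisor_sheaf X D) V' W k = mrst (divisor_sheaf X D) V W s"
      by (rule N.mgerm_eqE) (use V m in auto)
    have "W \<noteq> {}" using W(2) by blast
    then show "k = s" using W(5) by (simp add: div_ops)
  qed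
qed

text \<open>\<open>tensor_eval\<close> produces integer combinations of values of
  \<open>\<beta>\<close>. A property of all elements of a tensor product can thus be checked on pure
  tensors, provided that it defines a subgroup.\<close>

lemma tensor_eval_in_subgroup:
  assumes C: "abelian_group C" and J: "subgroup J (add_monoid C)"
    and f: "f \<in> free_tensors M N" and \<beta>: "\<And>m n. m \<in> carrier M \<Longrightarrow> n \<in> carrier N \<Longrightarrow> \<beta> m n \<in> J"
  shows "tensor_eval C \<beta> f \<in> J"
proof -
  interpret C: abelian_group C by fact
  have JC: "J \<subseteq> carrier C" using subgroup.subset[OF J] by simp
  have fin: "finite {z. f z \<noteq> 0}" and sub: "{z. f z \<noteq> 0} \<subseteq> carrier M \<times> carrier N"
    using f unfolding free_tensors_def by auto
  have term_J: "add_pow C (f z) (\<beta> (fst z) (snd z)) \<in> J" if z: "z \<in> {z. f z \<noteq> 0}" for z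
  proof -
    have "\<beta> (fst z) (snd z) \<in> J" using \<beta> sub z by auto
    then show ?thesis unfolding add_pow_def by (rule group.subgroup_int_pow_closed[OF C.a_group J])
  qed
  have "finsum C (\<lambda>z. add_pow C (f z) (\<beta> (fst z) (snd z))) Z \<in> J" if "finite Z" "Z \<subseteq> {z. f z \<noteq> 0}" for Z
    using that
  proof (induction Z rule: finite_induct)
    case empty
    then show ?case using subgroup.one_closed[OF J] by simp
  next
    case (insert z Z)
    have c: "add_pow C (f w) (\<beta> (fst w) (snd w)) \<in> carrier C" if "w \<in> insert z Z" for w
      using term_J[of w] insert.prems that JC by blast
    have "finsum C (\<lambda>z. add_pow C (f z) (\<beta> (fst z) (snd z))) (insert z Z)
        = add_pow C (f z) (\<beta> (fst z) (snd z)) \<oplus>\<^bsub>C\<^esub> finsum C (\<lambda>z. add_pow C (f z) (\<beta> (fst z) (snd z))) Z"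
      by (rule C.finsum_insert) (use insert c in auto)
    then show ?case using subgroup.m_closed[OF J term_J[of z] insert.IH] insert.prems by simp
  qed
  then show ?thesis unfolding tensor_eval_def using fin by blast
qed

end

section \<open>Dominant morphisms\<close>

locale dominant_loc = E: normal_loc E + W: normal_loc W
  for E :: "('x, 'a) ringed_space" and W :: "('w, 'b) ringed_space" +
  fixes \<pi> :: "('x, 'a, 'w, 'b) morphism"
  assumes mor: "ringed_morphism E W \<pi>" and dominant: "dominant_morphism E W \<pi>"
begin

abbreviation "pre V \<equiv> preim E \<pi> V"
abbreviation "pb \<equiv> fun_field_pullback E \<pi>"

lemma mor_cont: "continuous_map (top_of E) (top_of W) (pt \<pi>)"
  using mor unfolding ringed_morphism_def by (rule conjunct1)

lemma pre_open: "open_in W V \<Longrightarrow> open_in E (pre V)"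
  unfolding preim_def by (rule openin_continuous_map_preimage[OF mor_cont])

lemma pre_mono: "V' \<subseteq> V \<Longrightarrow> pre V' \<subseteq> pre V"
  unfolding preim_def by blast

lemma pre_empty: "pre {} = {}"
  unfolding preim_def by blast

text \<open>By density of the image every nonempty open set meets it. The preimage then contains the
  generic point of E, which is what makes the pullback of rational functions possible.\<close>

lemma pre_nonempty:
  assumes V: "open_in W V" "V \<noteq> {}" shows "pre V \<noteq> {}"
proof -
  obtain w where w: "w \<in> V" using V(2) by blast
  then have "w \<in> top_of W closure_of (pt \<pi> ` points E)"
    using W.open_points[OF V(1)] dominant unfolding dominant_morphism_def by blast
  then have "\<exists>z\<in>pt \<pi> ` points E. z \<in> V" using w V(1) unfolding in_closure_of by blast
  then show ?thesis unfolding preim_def by blast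
qed

lemma comor_hom:
  assumes V: "open_in W V"
  shows "ring_hom_cring (sec W V) (sec E (pre V)) (comor \<pi> V)"
proof -
  have "comor \<pi> V \<in> ring_hom (sec W V) (sec E (pre V))"
    using mor V unfolding ringed_morphism_def by simp
  then show ?thesis
    by (intro ring_hom_cring.intro ring_hom_cring_axioms.intro W.sec_cring[OF V] E.sec_cring[OF pre_open[OF V]])
qed

lemma comor_closed: "open_in W V \<Longrightarrow> s \<in> carrier (sec W V) \<Longrightarrow> comor \<pi> V s \<in> carrier (sec E (pre V))"
  by (rule ring_hom_closed[OF ring_hom_cring.homh[OF comor_hom]])

lemma comor_rst: "open_in W V \<Longrightarrow> open_in W V' \<Longrightarrow> V' \<subseteq> V \<Longrightarrow> s \<in> carrier (sec W V) \<Longrightarrow>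
    comor \<pi> V' (rst W V V' s) = rst E (pre V) (pre V') (comor \<pi> V s)"
  using mor unfolding ringed_morphism_def by simp

text \<open>Representatives of a generic germ on W live on nonempty open sets, whose preimages all
  contain the generic point of E; so the union in \<open>stalk_map\<close> has a single
  value.\<close>

lemma pb_germ:
  assumes V: "open_in W V" "V \<noteq> {}" "s \<in> carrier (sec W V)"
  shows "pb (germ W W.\<eta> V s) = germ E E.\<eta> (pre V) (comor \<pi> V s)"
  unfolding fun_field_pullback_def stalk_map_def germ_def[of W]
proof (rule W.UN_germ[OF V(1) W.gen_mem[OF V(1,2)] V(3)])
  fix V' s' assume V': "open_in W V'" "W.\<eta> \<in> V'" "s' \<in> carrier (sec W V')" "W.grm W.\<eta> V' s' = W.grm W.\<eta> V s"
  then obtain Z where Z: "open_in W Z" "W.\<eta> \<in> Z" "Z \<subseteq> V'" "Z \<subseteq> V" "rst W V' Z s' = rst W V Z s"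
    using W.germ_eqE[of W.\<eta> V' s' V s] V W.gen_mem[OF V(1,2)] unfolding germ_def by blast
  have Z0: "Z \<noteq> {}" using Z(2) by blast
  note pZ = pre_nonempty[OF Z(1) Z0]
  have "germ E E.\<eta> (pre V') (comor \<pi> V' s') = germ E E.\<eta> (pre Z) (rst E (pre V') (pre Z) (comor \<pi> V' s'))"
    by (rule E.emb_rst[OF pre_open[OF V'(1)] pre_open[OF Z(1)] pre_mono[OF Z(3)] pZ comor_closed[OF V'(1,3)], symmetric])
  also have "\<dots> = germ E E.\<eta> (pre Z) (rst E (pre V) (pre Z) (comor \<pi> V s))"
    unfolding comor_rst[OF V'(1) Z(1,3) V'(3), symmetric] comor_rst[OF V(1) Z(1,4) V(3), symmetric] Z(5) ..
  also have "\<dots> = germ E E.\<eta> (pre V) (comor \<pi> V s)"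
    by (rule E.emb_rst[OF pre_open[OF V(1)] pre_open[OF Z(1)] pre_mono[OF Z(4)] pZ comor_closed[OF V(1,3)]])
  finally show "germ E E.\<eta> (pre V') (comor \<pi> V' s') = germ E E.\<eta> (pre V) (comor \<pi> V s)" .
qed

lemma pb_hom: "ring_hom_cring W.K E.K pb"
proof -
  have "pb \<in> ring_hom W.K E.K"
  proof (rule ring_hom_memI)
    fix a assume "a \<in> carrier W.K"
    then obtain V s where V: "open_in W V" "V \<noteq> {}" "s \<in> carrier (sec W V)" "a = germ W W.\<eta> V s" by (rule W.K_rep)
    show "pb a \<in> carrier E.K" unfolding V(4) pb_germ[OF V(1-3)]
      by (rule E.emb_closed[OF pre_open[OF V(1)] pre_nonempty[OF V(1,2)] comor_closed[OF V(1,3)]])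
  next
    fix a b assume "a \<in> carrier W.K" "b \<in> carrier W.K"
    then obtain V s t where V: "open_in W V" "W.\<eta> \<in> V" "s \<in> carrier (sec W V)" "t \<in> carrier (sec W V)"
      "a = germ W W.\<eta> V s" "b = germ W W.\<eta> V t" by (rule W.common_open2)
    have V0: "V \<noteq> {}" using V(2) by blast
    interpret c: ring_hom_cring "sec W V" "sec E (pre V)" "comor \<pi> V" by (rule comor_hom[OF V(1)])
    interpret g: ring_hom_cring "sec E (pre V)" E.K "germ E E.\<eta> (pre V)"
      by (rule E.emb_hom[OF pre_open[OF V(1)] pre_nonempty[OF V(1) V0]])
    have st: "s \<otimes>\<^bsub>sec W V\<^esub> t \<in> carrier (sec W V)" "s \<oplus>\<^bsub>sec W V\<^esub> t \<in> carrier (sec W V)" using V(3,4) by auto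
    show "pb (a \<otimes>\<^bsub>W.K\<^esub> b) = pb a \<otimes>\<^bsub>E.K\<^esub> pb b"
      unfolding V(5,6) W.germ_mult[OF V(1-4)] pb_germ[OF V(1) V0 st(1)] pb_germ[OF V(1) V0 V(3)] pb_germ[OF V(1) V0 V(4)]
      using V(3,4) by simp
    show "pb (a \<oplus>\<^bsub>W.K\<^esub> b) = pb a \<oplus>\<^bsub>E.K\<^esub> pb b"
      unfolding V(5,6) W.germ_add[OF V(1-4)] pb_germ[OF V(1) V0 st(2)] pb_germ[OF V(1) V0 V(3)] pb_germ[OF V(1) V0 V(4)]
      using V(3,4) by simp
  next
    have o: "open_in W (points W)" "points W \<noteq> {}" by (rule W.open_all, rule W.points_nonempty)
    interpret c: ring_hom_cring "sec W (points W)" "sec E (pre (points W))" "comor \<pi> (points W)" by (rule comor_hom[OF o(1)])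
    interpret g: ring_hom_cring "sec E (pre (points W))" E.K "germ E E.\<eta> (pre (points W))"
      by (rule E.emb_hom[OF pre_open[OF o(1)] pre_nonempty[OF o]])
    show "pb \<one>\<^bsub>W.K\<^esub> = \<one>\<^bsub>E.K\<^esub>"
      unfolding W.germ_one[OF o(1) W.gen_point, symmetric] pb_germ[OF o c.R.one_closed] by simp
  qed
  then show ?thesis by (simp add: ring_hom_cring_def ring_hom_cring_axioms_def E.K_cring W.K_cring)
qed

sublocale pb: ring_hom_cring W.K E.K pb by (rule pb_hom)

lemma pb_nonzero: assumes a: "a \<in> W.Kx" shows "pb a \<in> E.Kx"
proof -
  have i: "inv\<^bsub>W.K\<^esub> a \<in> W.Kx" "a \<otimes>\<^bsub>W.K\<^esub> inv\<^bsub>W.K\<^esub> a = \<one>\<^bsub>W.K\<^esub>" using W.K.nonzero_inv[OF a] by auto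
  have "pb a \<otimes>\<^bsub>E.K\<^esub> pb (inv\<^bsub>W.K\<^esub> a) = \<one>\<^bsub>E.K\<^esub>"
    using pb.hom_mult[of a "inv\<^bsub>W.K\<^esub> a"] a i by simp
  then have "pb a \<noteq> \<zero>\<^bsub>E.K\<^esub>" using i by auto
  then show ?thesis using a by simp
qed

lemma pb_inj: "inj_on pb (carrier W.K)"
proof (rule inj_onI)
  fix a b assume ab: "a \<in> carrier W.K" "b \<in> carrier W.K" and eq: "pb a = pb b"
  have "pb (a \<ominus>\<^bsub>W.K\<^esub> b) = \<zero>\<^bsub>E.K\<^esub>" using ab eq by (simp add: W.K.minus_eq E.K.r_neg)
  then have "a \<ominus>\<^bsub>W.K\<^esub> b = \<zero>\<^bsub>W.K\<^esub>" using pb_nonzero[of "a \<ominus>\<^bsub>W.K\<^esub> b"] ab by auto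
  then show "a = b" using ab by simp
qed

end

section \<open>Descent of the divisor\<close>

text \<open>\<open>M\<close> stands for \<open>(1 - p^e)(K\<^sub>E + \<Delta>\<^sub>E)\<close>. Its
  integrality ensures that O_E(M), which is defined by rounding down, has local sections of order
  exactly \<open>- M x\<close> at \<open>x\<close>.\<close>

locale pullback_loc = dominant_loc E W \<pi> + L: module_presheaf W L
  for E :: "('x, 'a) ringed_space" and W :: "('w, 'b) ringed_space"
    and \<pi> :: "('x, 'a, 'w, 'b) morphism" and L :: "('w, 'b, 'l) module_sheaf" +
  fixes M :: "'x \<Rightarrow> rat" and u :: "'w set \<Rightarrow> 'l \<Rightarrow> ('x set \<times> 'a) set"
  assumes pullback: "pullback_iso E W \<pi> L (divisor_sheaf E M) u"
    and M_divisor: "Q_divisor E M"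
    and M_integral: "\<And>y. codim_one E y \<Longrightarrow> M y \<in> \<int>"
begin

abbreviation "N \<equiv> divisor_sheaf E M"

sublocale N: module_presheaf E N by (rule E.div_presheaf)

lemma u_hom: "module_sheaf_hom W (points W) L (direct_image E \<pi> N) u"
  using pullback unfolding pullback_iso_def by (rule conjunct1)

lemma u_closed: "open_in W V \<Longrightarrow> l \<in> carrier (msec L V) \<Longrightarrow> u V l \<in> carrier (msec N (pre V))"
  using module_sheaf_homD(1)[OF u_hom, of V l] W.open_points[of V] unfolding direct_image_def Let_def by simp

lemma u_K: "open_in W V \<Longrightarrow> l \<in> carrier (msec L V) \<Longrightarrow> u V l \<in> carrier E.K"
  by (rule E.div_carrier_K[OF u_closed])

lemma u_add: "open_in W V \<Longrightarrow> l \<in> carrier (msec L V) \<Longrightarrow> l' \<in> carrier (msec L V) \<Longrightarrow>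
    u V (l \<oplus>\<^bsub>msec L V\<^esub> l') = u V l \<oplus>\<^bsub>E.K\<^esub> u V l'"
  using module_sheaf_homD(2)[OF u_hom, of V l l'] W.open_points[of V]
  unfolding direct_image_def Let_def by (simp add: E.div_ops)

lemma u_smult: "open_in W V \<Longrightarrow> V \<noteq> {} \<Longrightarrow> r \<in> carrier (sec W V) \<Longrightarrow> l \<in> carrier (msec L V) \<Longrightarrow>
    u V (r \<odot>\<^bsub>msec L V\<^esub> l) = germ E E.\<eta> (pre V) (comor \<pi> V r) \<otimes>\<^bsub>E.K\<^esub> u V l"
  using module_sheaf_homD(3)[OF u_hom, of V r l] W.open_points[of V] pre_nonempty[of V]
  unfolding direct_image_def Let_def by (simp add: E.div_ops)

lemma u_rst: "open_in W V \<Longrightarrow> open_in W V' \<Longrightarrow> V' \<subseteq> V \<Longrightarrow> V' \<noteq> {} \<Longrightarrow> l \<in> carrier (msec L V) \<Longrightarrow>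
    u V' (mrst L V V' l) = u V l"
  using module_sheaf_homD(4)[OF u_hom, of V V' l] W.open_points[of V] pre_nonempty[of V']
  unfolding direct_image_def Let_def by (simp add: E.div_ops)

text \<open>Evaluates the union that occurs in \<open>pullback_iso\<close>: \<open>u\<close> yields
  the same rational function for all representatives of a germ of L, because restriction does not
  change rational functions.\<close>

lemma pure_tensor:
  assumes x: "x \<in> pre V" and V: "open_in W V" "l \<in> carrier (msec L V)"
  shows "(\<Union>(V', s)\<in>mgerm W L (pt \<pi> x) V l. mgerm E N x (pre V') (u V' s)) = mgerm E N x (pre V) (u V l)"
  unfolding mgerm_def[of W]
proof (rule L.m.UN_germ[OF V(1) _ V(2)])
  have xE: "x \<in> points E" and xV: "pt \<pi> x \<in> V" using x unfolding preim_def by auto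
  show "pt \<pi> x \<in> V" by (rule xV)
  fix V' s assume V': "open_in W V'" "pt \<pi> x \<in> V'" "s \<in> carrier (msec L V')"
    "L.m.grm (pt \<pi> x) V' s = L.m.grm (pt \<pi> x) V l"
  obtain Z where Z: "open_in W Z" "pt \<pi> x \<in> Z" "Z \<subseteq> V'" "Z \<subseteq> V" "mrst L V' Z s = mrst L V Z l"
    by (rule L.mgerm_eqE[of "pt \<pi> x" V' s V l]) (use V V' xV in \<open>simp_all add: mgerm_def\<close>)
  have Z0: "Z \<noteq> {}" using Z(2) by blast
  have xZ: "x \<in> pre Z" using xE Z(2) unfolding preim_def by blast
  have eq: "u V' s = u V l"
    using u_rst[OF V'(1) Z(1,3) Z0 V'(3)] u_rst[OF V(1) Z(1,4) Z0 V(2)] Z(5) by simp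
  have r: "mgerm E N x (pre Z) (u V' s) = mgerm E N x (pre V') (u V' s)"
    using N.mgerm_restrict[OF pre_open[OF V'(1)] pre_open[OF Z(1)] pre_mono[OF Z(3)] xZ u_closed[OF V'(1,3)]]
      pre_nonempty[OF Z(1) Z0] by (simp add: E.div_ops)
  have r': "mgerm E N x (pre Z) (u V l) = mgerm E N x (pre V) (u V l)"
    using N.mgerm_restrict[OF pre_open[OF V(1)] pre_open[OF Z(1)] pre_mono[OF Z(4)] xZ u_closed[OF V]]
      pre_nonempty[OF Z(1) Z0] by (simp add: E.div_ops)
  show "mgerm E N x (pre V') (u V' s) = mgerm E N x (pre V) (u V l)" using r r' eq by simp
qed

lemma stalk_value_add:
  assumes "n \<in> carrier (mstalk E N x)" "n' \<in> carrier (mstalk E N x)"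
  shows "E.div_stalk_value (n \<oplus>\<^bsub>mstalk E N x\<^esub> n') = E.div_stalk_value n \<oplus>\<^bsub>E.K\<^esub> E.div_stalk_value n'"
proof -
  obtain V s t where V: "open_in E V" "x \<in> V" "s \<in> carrier (msec N V)" "t \<in> carrier (msec N V)"
    "n = mgerm E N x V s" "n' = mgerm E N x V t" by (rule N.mcommon_open2[OF assms])
  have st: "s \<oplus>\<^bsub>E.K\<^esub> t \<in> carrier (msec N V)" by (rule E.div_add[OF V(3,4)])
  show ?thesis unfolding V(5,6) N.mgerm_add[OF V(1-4)] E.div_ops
    unfolding E.div_stalk_value[OF V(1,2) st] E.div_stalk_value[OF V(1,2,3)] E.div_stalk_value[OF V(1,2,4)] ..
qed

lemma stalk_value_K:
  assumes "n \<in> carrier (mstalk E N x)" shows "E.div_stalk_value n \<in> carrier E.K"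
proof -
  obtain V s where V: "open_in E V" "x \<in> V" "s \<in> carrier (msec N V)" "n = mgerm E N x V s"
    using assms unfolding N.mstalk_carrier_iff by (elim exE conjE)
  show ?thesis unfolding V(4) E.div_stalk_value[OF V(1-3)] by (rule E.div_carrier_K[OF V(3)])
qed

text \<open>The elements of the stalk whose rational function is a regular multiple of
  \<open>u U l\<close> form a subgroup. It contains the pure tensors, as every germ of L is a
  multiple of the germ of \<open>l\<close>; by surjectivity of the tensor map it is the whole
  stalk.\<close>

lemma stalk_value_multiple:
  assumes U: "open_in W U" "l \<in> carrier (msec L U)"
    and gen: "\<And>V s. open_in W V \<Longrightarrow> V \<subseteq> U \<Longrightarrow> s \<in> carrier (msec L V) \<Longrightarrow>
      \<exists>r\<in>carrier (sec W V). s = r \<odot>\<^bsub>msec L V\<^esub> mrst L U V l"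
    and x: "x \<in> pre U" and n: "n \<in> carrier (mstalk E N x)"
  shows "\<exists>c\<in>E.lring x. E.div_stalk_value n = c \<otimes>\<^bsub>E.K\<^esub> u U l"
proof -
  let ?C = "mstalk E N x" and ?dv = "E.div_stalk_value" and ?h = "u U l"
  let ?\<beta> = "\<lambda>l a. a \<odot>\<^bsub>mstalk E N x\<^esub> (\<Union>(V, s)\<in>l. mgerm E N x (pre V) (u V s))"
  have xE: "x \<in> points E" and xU: "pt \<pi> x \<in> U" using x unfolding preim_def by auto
  have hK: "?h \<in> carrier E.K" by (rule u_K[OF U])
  interpret C: abelian_group ?C by (rule N.mstalk_abelian_group[OF xE])
  define J where "J = {n \<in> carrier ?C. \<exists>c\<in>E.lring x. ?dv n = c \<otimes>\<^bsub>E.K\<^esub> ?h}"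
  have dv0: "?dv \<zero>\<^bsub>?C\<^esub> = \<zero>\<^bsub>E.K\<^esub>"
    using stalk_value_add[OF C.zero_closed C.zero_closed] stalk_value_K[OF C.zero_closed]
      E.K.add.l_cancel_one by simp
  have dvm: "?dv (\<ominus>\<^bsub>?C\<^esub> m) = \<ominus>\<^bsub>E.K\<^esub> ?dv m" if m: "m \<in> carrier ?C" for m
  proof -
    have "?dv (\<ominus>\<^bsub>?C\<^esub> m) \<oplus>\<^bsub>E.K\<^esub> ?dv m = \<zero>\<^bsub>E.K\<^esub>"
      using stalk_value_add[OF C.a_inv_closed[OF m] m] dv0 C.l_neg[OF m] by simp
    then show ?thesis
      by (rule E.K.minus_equality[OF _ stalk_value_K[OF m] stalk_value_K[OF C.a_inv_closed[OF m]], symmetric])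
  qed
  have J: "subgroup J (add_monoid ?C)"
  proof (rule group.subgroupI[OF C.a_group])
    show "J \<subseteq> carrier (add_monoid ?C)" unfolding J_def by auto
    have "\<zero>\<^bsub>?C\<^esub> \<in> J" unfolding J_def mem_Collect_eq
      by (intro conjI C.zero_closed bexI[OF _ E.lring_zero[OF xE]]) (simp add: dv0 hK)
    then show "J \<noteq> {}" by blast
  next
    fix a assume "a \<in> J"
    then obtain c where c: "a \<in> carrier ?C" "c \<in> E.lring x" "?dv a = c \<otimes>\<^bsub>E.K\<^esub> ?h" unfolding J_def by blast
    have cK: "c \<in> carrier E.K" by (rule E.lring_K[OF c(2)])
    have "?dv (\<ominus>\<^bsub>?C\<^esub> a) = \<ominus>\<^bsub>E.K\<^esub> c \<otimes>\<^bsub>E.K\<^esub> ?h" using dvm[OF c(1)] c(3) cK hK by (simp add: E.K.l_minus)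
    moreover have "\<ominus>\<^bsub>E.K\<^esub> c \<in> E.lring x"
    proof -
      obtain Z b where Z: "open_in E Z" "x \<in> Z" "b \<in> carrier (sec E Z)" "c = germ E E.\<eta> Z b"
        using c(2) unfolding E.lring_iff by (elim exE conjE)
      have Z0: "Z \<noteq> {}" using Z(2) by blast
      interpret g: ring_hom_cring "sec E Z" E.K "germ E E.\<eta> Z" by (rule E.emb_hom[OF Z(1) Z0])
      have "germ E E.\<eta> Z (\<ominus>\<^bsub>sec E Z\<^esub> b) \<in> E.lring x" by (rule E.emb_lring[OF Z(1,2)]) (simp add: Z(3))
      then show ?thesis using Z(3,4) by simp
    qed
    moreover have "\<ominus>\<^bsub>?C\<^esub> a \<in> carrier ?C" using c(1) by simp
    ultimately show "inv\<^bsub>add_monoid ?C\<^esub> a \<in> J" unfolding J_def a_inv_def[symmetric] mem_Collect_eq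
      by (intro conjI bexI)
  next
    fix a b assume ab: "a \<in> J" "b \<in> J"
    obtain c where c: "a \<in> carrier ?C" "c \<in> E.lring x" "?dv a = c \<otimes>\<^bsub>E.K\<^esub> ?h" using ab(1) unfolding J_def by blast
    obtain d where d: "b \<in> carrier ?C" "d \<in> E.lring x" "?dv b = d \<otimes>\<^bsub>E.K\<^esub> ?h" using ab(2) unfolding J_def by blast
    have "?dv (a \<oplus>\<^bsub>?C\<^esub> b) = (c \<oplus>\<^bsub>E.K\<^esub> d) \<otimes>\<^bsub>E.K\<^esub> ?h"
      using stalk_value_add[OF c(1) d(1)] c(3) d(3) E.K.l_distr[OF E.lring_K[OF c(2)] E.lring_K[OF d(2)] hK] by simp
    moreover have "a \<oplus>\<^bsub>?C\<^esub> b \<in> carrier ?C" using c(1) d(1) by simp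
    ultimately show "a \<otimes>\<^bsub>add_monoid ?C\<^esub> b \<in> J" unfolding J_def mem_Collect_eq monoid.simps
      by (intro conjI bexI[OF _ E.lring_add[OF c(2) d(2) xE]])
  qed
  have pure: "?\<beta> m a \<in> J"
    if m: "m \<in> carrier (mstalk W L (pt \<pi> x))" and a: "a \<in> carrier (restrict_scalars (stalk_map E \<pi> x) (stalk E x))" for m a
  proof -
    have a': "a \<in> carrier (stalk E x)" using a unfolding restrict_scalars_def by simp
    obtain V s where V: "open_in W V" "pt \<pi> x \<in> V" "s \<in> carrier (msec L V)" "m = mgerm W L (pt \<pi> x) V s"
      using m unfolding L.mstalk_carrier_iff by (elim exE conjE)
    define V' where "V' = V \<inter> U"
    have V': "open_in W V'" "pt \<pi> x \<in> V'" "V' \<subseteq> V" "V' \<subseteq> U" "V' \<noteq> {}"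
      unfolding V'_def using V(1,2) U(1) xU by auto
    have sV: "mrst L V V' s \<in> carrier (msec L V')" by (rule L.m.rst_closed[OF V(1) V'(1,3) V(3)])
    have m': "m = mgerm W L (pt \<pi> x) V' (mrst L V V' s)"
      unfolding V(4) by (rule L.mgerm_restrict[OF V(1) V'(1,3,2) V(3), symmetric])
    obtain r where r: "r \<in> carrier (sec W V')" "mrst L V V' s = r \<odot>\<^bsub>msec L V'\<^esub> mrst L U V' l"
      using gen[OF V'(1,4) sV] by blast
    have lV: "mrst L U V' l \<in> carrier (msec L V')" by (rule L.m.rst_closed[OF U(1) V'(1,4) U(2)])
    have xV: "x \<in> pre V'" using xE V'(2) unfolding preim_def by blast
    define c where "c = germ E E.\<eta> (pre V') (comor \<pi> V' r)"
    have cl: "c \<in> E.lring x" unfolding c_def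
      by (rule E.emb_lring[OF pre_open[OF V'(1)] xV comor_closed[OF V'(1) r(1)]])
    have us: "u V' (mrst L V V' s) = c \<otimes>\<^bsub>E.K\<^esub> ?h"
      unfolding r(2) u_smult[OF V'(1,5) r(1) lV] u_rst[OF U(1) V'(1,4,5) U(2)] c_def ..
    obtain Z b where Z: "open_in E Z" "x \<in> Z" "b \<in> carrier (sec E Z)" "a = germ E x Z b"
      using a' unfolding E.stalk_carrier_iff by (elim exE conjE)
    define Y where "Y = Z \<inter> pre V'"
    have Y: "open_in E Y" "x \<in> Y" "Y \<subseteq> Z" "Y \<subseteq> pre V'" "Y \<noteq> {}"
      unfolding Y_def using Z(1,2) pre_open[OF V'(1)] xV by auto
    have bY: "rst E Z Y b \<in> carrier (sec E Y)" by (rule E.rst_closed[OF Z(1) Y(1,3) Z(3)])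
    have aY: "a = germ E x Y (rst E Z Y b)" unfolding Z(4) by (rule E.germ_restrict[OF Z(1) Y(1,3,2) Z(3), symmetric])
    have uV: "u V' (mrst L V V' s) \<in> carrier (msec N (pre V'))" by (rule u_closed[OF V'(1) sV])
    have rY: "mrst N (pre V') Y (u V' (mrst L V V' s)) = c \<otimes>\<^bsub>E.K\<^esub> ?h" using us Y(5) by (simp add: E.div_ops)
    have hY: "c \<otimes>\<^bsub>E.K\<^esub> ?h \<in> carrier (msec N Y)"
      using N.m.rst_closed[OF pre_open[OF V'(1)] Y(1,4) uV] unfolding rY .
    have g: "mgerm E N x (pre V') (u V' (mrst L V V' s)) = mgerm E N x Y (c \<otimes>\<^bsub>E.K\<^esub> ?h)"
      using N.mgerm_restrict[OF pre_open[OF V'(1)] Y(1,4,2) uV] unfolding rY by simp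
    let ?d = "germ E E.\<eta> Y (rst E Z Y b)"
    have dl: "?d \<in> E.lring x" by (rule E.emb_lring[OF Y(1,2) bY])
    have pr: "?d \<otimes>\<^bsub>E.K\<^esub> (c \<otimes>\<^bsub>E.K\<^esub> ?h) \<in> carrier (msec N Y)" by (rule E.div_smult[OF Y(1,5) bY hY])
    have "?\<beta> m a = mgerm E N x Y (?d \<otimes>\<^bsub>E.K\<^esub> (c \<otimes>\<^bsub>E.K\<^esub> ?h))"
      unfolding m' pure_tensor[OF xV V'(1) sV] g unfolding aY N.mgerm_smult[OF Y(1,2) bY hY] E.div_ops using Y(5) by simp
    moreover have "?dv (mgerm E N x Y (?d \<otimes>\<^bsub>E.K\<^esub> (c \<otimes>\<^bsub>E.K\<^esub> ?h))) = (?d \<otimes>\<^bsub>E.K\<^esub> c) \<otimes>\<^bsub>E.K\<^esub> ?h"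
      unfolding E.div_stalk_value[OF Y(1,2) pr]
      by (rule E.K.m_assoc[OF E.lring_K[OF dl] E.lring_K[OF cl] hK, symmetric])
    moreover have "mgerm E N x Y (?d \<otimes>\<^bsub>E.K\<^esub> (c \<otimes>\<^bsub>E.K\<^esub> ?h)) \<in> carrier ?C" by (rule N.mgerm_closed[OF Y(1,2) pr])
    ultimately show ?thesis unfolding J_def mem_Collect_eq
      by (intro conjI bexI[OF _ E.lring_mult[OF dl cl xE]]) simp_all
  qed
  have "tensor_eval ?C ?\<beta> ` free_tensors (mstalk W L (pt \<pi> x)) (restrict_scalars (stalk_map E \<pi> x) (stalk E x)) = carrier ?C"
    using pullback xE unfolding pullback_iso_def is_tensor_product_def by blast
  then have "n \<in> tensor_eval ?C ?\<beta> ` free_tensors (mstalk W L (pt \<pi> x)) (restrict_scalars (stalk_map E \<pi> x) (stalk E x))"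
    using n by simp
  then obtain f where f: "n = tensor_eval ?C ?\<beta> f"
    "f \<in> free_tensors (mstalk W L (pt \<pi> x)) (restrict_scalars (stalk_map E \<pi> x) (stalk E x))" by (rule imageE)
  have "n \<in> J" unfolding f(1) by (rule E.tensor_eval_in_subgroup[OF C.abelian_group_axioms J f(2) pure])
  then show ?thesis unfolding J_def by blast
qed

text \<open>At the generic point 1 is a multiple of \<open>u U l\<close>, which is therefore
  nonzero. At a codimension one point some section of order exactly \<open>- M x\<close> is a
  regular multiple of \<open>u U l\<close>, which bounds its order from above; the lower bound holds
  because \<open>u U l\<close> is itself a section of O_E(M).\<close>

lemma
  assumes U: "open_in W U" "U \<noteq> {}" "l \<in> carrier (msec L U)"
    and gen: "\<And>V s. open_in W V \<Longrightarrow> V \<subseteq> U \<Longrightarrow> s \<in> carrier (msec L V) \<Longrightarrow>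
      \<exists>r\<in>carrier (sec W V). s = r \<odot>\<^bsub>msec L V\<^esub> mrst L U V l"
  shows u_generator_nonzero: "u U l \<in> E.Kx"
    and u_generator_order: "x \<in> pre U \<Longrightarrow> codim_one E x \<Longrightarrow> of_int (order_at E x (u U l)) = - M x"
proof -
  have hK: "u U l \<in> carrier E.K" by (rule u_K[OF U(1,3)])
  obtain V where V: "open_in E V" "E.\<eta> \<in> V" "\<one>\<^bsub>E.K\<^esub> \<in> carrier (msec N V)"
    by (rule E.div_generic_section[OF M_divisor])
  have e: "E.\<eta> \<in> pre U" by (rule E.gen_mem[OF pre_open[OF U(1)] pre_nonempty[OF U(1,2)]])
  obtain c where c: "c \<in> E.lring E.\<eta>" "\<one>\<^bsub>E.K\<^esub> = c \<otimes>\<^bsub>E.K\<^esub> u U l"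
    using stalk_value_multiple[OF U(1,3) gen e N.mgerm_closed[OF V]] unfolding E.div_stalk_value[OF V] by blast
  have "u U l \<noteq> \<zero>\<^bsub>E.K\<^esub>"
  proof
    assume "u U l = \<zero>\<^bsub>E.K\<^esub>"
    then have "\<one>\<^bsub>E.K\<^esub> = \<zero>\<^bsub>E.K\<^esub>" using c(2) E.lring_K[OF c(1)] by simp
    then show False by simp
  qed
  then show h0: "u U l \<in> E.Kx" using hK by simp
  assume x: "x \<in> pre U" "codim_one E x"
  have p0: "pre U \<noteq> {}" using x(1) by blast
  have le: "of_int (order_at E x (u U l)) + M x \<ge> 0"
    using u_closed[OF U(1,3)] h0 x unfolding E.div_mem_iff[OF p0] by blast
  obtain Z f where Z: "open_in E Z" "x \<in> Z" "f \<in> carrier (msec N Z)" "f \<in> E.Kx" "of_int (order_at E x f) = - M x"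
    by (rule E.div_local_generator[OF M_divisor x(2) M_integral[OF x(2)]])
  obtain d where d: "d \<in> E.lring x" "f = d \<otimes>\<^bsub>E.K\<^esub> u U l"
    using stalk_value_multiple[OF U(1,3) gen x(1) N.mgerm_closed[OF Z(1-3)]] unfolding E.div_stalk_value[OF Z(1-3)] by blast
  have d0: "d \<in> E.Kx"
  proof -
    have "d \<noteq> \<zero>\<^bsub>E.K\<^esub>" using d(2) Z(4) hK by (metis E.K.l_null DiffD2 singletonI)
    then show ?thesis using E.lring_K[OF d(1)] by simp
  qed
  have "order_at E x d \<ge> 0" using E.lring_order[OF x(2) d0] d(1) by simp
  then have "order_at E x f \<ge> order_at E x (u U l)" unfolding d(2) E.order_mult[OF x(2) d0 h0] by simp
  then have "rat_of_int (order_at E x f) \<ge> of_int (order_at E x (u U l))" by (simp only: of_int_le_iff)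
  then show "of_int (order_at E x (u U l)) = - M x" using le Z(5) by linarith
qed

end

section \<open>The map induced on the base\<close>

context pullback_loc
begin

text \<open>\<open>u V l\<close> comes from L over the whole of \<open>pre V\<close>, so it is a
  section of the inverse image and \<open>\<phi>\<close> sends it into the image of K(W). On this
  image \<open>inv_into\<close> is a true right inverse of \<open>pb\<close>.\<close>

lemma induced_map_value:
  assumes im: "\<phi> (pre V) ` inverse_image_sections E W \<pi> L N u (pre V) \<subseteq> pb ` carrier W.K"
    and V: "open_in W V" and l: "l \<in> carrier (msec L V)"
  shows "induced_map E W \<pi> u \<phi> V l \<in> carrier W.K"
    and "pb (induced_map E W \<pi> u \<phi> V l) = \<phi> (pre V) (u V l)"
proof -
  have o: "open_in E (pre V)" by (rule pre_open[OF V])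
  have uc: "u V l \<in> carrier (msec N (pre V))" by (rule u_closed[OF V l])
  have "u V l \<in> inverse_image_sections E W \<pi> L N u (pre V)"
    unfolding inverse_image_sections_def mem_Collect_eq
  proof (intro conjI ballI uc)
    fix x assume "x \<in> pre V"
    then show "\<exists>V' l' U'. open_in W V' \<and> l' \<in> carrier (msec L V') \<and> open_in E U' \<and> x \<in> U' \<and>
        U' \<subseteq> pre V \<inter> pre V' \<and> mrst N (pre V) U' (u V l) = mrst N (pre V') U' (u V' l')"
      by (intro exI[of _ V] exI[of _ l] exI[of _ "pre V"]) (simp add: V l o)
  qed
  then have "\<phi> (pre V) (u V l) \<in> pb ` carrier W.K" using im by blast
  then show "induced_map E W \<pi> u \<phi> V l \<in> carrier W.K"
    "pb (induced_map E W \<pi> u \<phi> V l) = \<phi> (pre V) (u V l)"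
    unfolding induced_map_def by (rule inv_into_into, rule f_inv_into_f)
qed

text \<open>Each identity is checked after applying the injective map \<open>pb\<close>, where it
  becomes an identity for \<open>\<phi>\<close> and \<open>u\<close>. The Frobenius twist of the
  scalars is respected because \<open>comor\<close> commutes with powers.\<close>

lemma induced_map_hom:
  assumes \<phi>: "module_sheaf_hom E (points E) (frobenius_push E p e N) (constant_sheaf E) \<phi>"
    and im: "\<And>U. open_in E U \<Longrightarrow> \<phi> U ` inverse_image_sections E W \<pi> L N u U \<subseteq> pb ` carrier W.K"
  shows "module_sheaf_hom W (points W) (frobenius_push W p e L) (constant_sheaf W) (induced_map E W \<pi> u \<phi>)"
proof -
  let ?i = "induced_map E W \<pi> u \<phi>"
  note val = induced_map_value[of \<phi>, OF im[OF pre_open]]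
  note homE = \<phi>[THEN module_sheaf_homD(1)] \<phi>[THEN module_sheaf_homD(2)] \<phi>[THEN module_sheaf_homD(3)] \<phi>[THEN module_sheaf_homD(4)]
  have sm: "msec (frobenius_push X p e F) V = (msec F V)\<lparr>smult := (\<lambda>r s. (r [^]\<^bsub>sec X V\<^esub> (p ^ e)) \<odot>\<^bsub>msec F V\<^esub> s)\<rparr>"
    "mrst (frobenius_push X p e F) = mrst F" for X :: "('y, 'c) ringed_space" and F :: "('y, 'c, 'm) module_sheaf" and V
    unfolding frobenius_push_def by simp_all
  have const: "carrier (msec (constant_sheaf X) V) = (if V = {} then {\<zero>\<^bsub>fun_field X\<^esub>} else carrier (fun_field X))"
    "a \<oplus>\<^bsub>msec (constant_sheaf X) V\<^esub> b = a \<oplus>\<^bsub>fun_field X\<^esub> b"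
    "r \<odot>\<^bsub>msec (constant_sheaf X) V\<^esub> a = (if V = {} then \<zero>\<^bsub>fun_field X\<^esub> else to_fun_field X V r \<otimes>\<^bsub>fun_field X\<^esub> a)"
    "mrst (constant_sheaf X) V V' a = (if V' = {} then \<zero>\<^bsub>fun_field X\<^esub> else a)"
    for X :: "('y, 'c) ringed_space" and V V' a b r
    unfolding constant_sheaf_def fun_field_subsheaf_def Let_def by simp_all
  \<comment> \<open>The constant sheaf is zero over the empty set, and so is the sheaf on E over its
    preimage; injectivity of \<open>pb\<close> forces the induced value to be zero too.\<close>
  have empty: "?i {} l = \<zero>\<^bsub>W.K\<^esub>" if l: "l \<in> carrier (msec L {})" for l
  proof -
    have o: "open_in W {}" by simp
    have "\<phi> (pre {}) (u {} l) = \<zero>\<^bsub>E.K\<^esub>"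
      using homE(1)[OF pre_open[OF o] E.open_points[OF pre_open[OF o]], of "u {} l"] u_closed[OF o l]
      by (simp add: sm const pre_empty)
    then have "pb (?i {} l) = pb \<zero>\<^bsub>W.K\<^esub>" using val(2)[OF o o l] by simp
    then show ?thesis by (rule inj_onD[OF pb_inj _ val(1)[OF o o l] W.K.zero_closed])
  qed
  show ?thesis
    unfolding module_sheaf_hom_def
  proof (intro conjI allI impI ballI, goal_cases)
    case (1 V)
    show ?case using val(1) empty 1 by (auto simp: sm const)
  next
    case (2 V s t)
    then have st: "open_in W V" "s \<in> carrier (msec L V)" "t \<in> carrier (msec L V)" by (simp_all add: sm)
    interpret M: module "sec W V" "msec L V" by (rule L.msec_module[OF st(1)])
    note o = pre_open[OF st(1)]
    have "\<phi> (pre V) (u V s \<oplus>\<^bsub>E.K\<^esub> u V t) = \<phi> (pre V) (u V s) \<oplus>\<^bsub>E.K\<^esub> \<phi> (pre V) (u V t)"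
      using homE(2)[OF o E.open_points[OF o], of "u V s" "u V t"] u_closed[OF st(1,2)] u_closed[OF st(1,3)]
      by (simp add: sm const E.div_ops)
    then have "pb (?i V (s \<oplus>\<^bsub>msec L V\<^esub> t)) = pb (?i V s \<oplus>\<^bsub>W.K\<^esub> ?i V t)"
      unfolding val(2)[OF st(1) st(1) M.a_closed[OF st(2,3)]] u_add[OF st] pb.hom_add[OF val(1)[OF st(1,1,2)] val(1)[OF st(1,1,3)]]
        val(2)[OF st(1,1,2)] val(2)[OF st(1,1,3)] .
    then have "?i V (s \<oplus>\<^bsub>msec L V\<^esub> t) = ?i V s \<oplus>\<^bsub>W.K\<^esub> ?i V t"
      by (rule inj_onD[OF pb_inj _ val(1)[OF st(1,1) M.a_closed[OF st(2,3)]] W.K.a_closed[OF val(1)[OF st(1,1,2)] val(1)[OF st(1,1,3)]]])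
    then show ?case by (simp add: sm const)
  next
    case (3 V r s)
    then have st: "open_in W V" "s \<in> carrier (msec L V)" "r \<in> carrier (sec W V)" by (simp_all add: sm)
    interpret M: module "sec W V" "msec L V" by (rule L.msec_module[OF st(1)])
    have rq: "r [^]\<^bsub>sec W V\<^esub> (p ^ e) \<in> carrier (sec W V)" using st(3) by simp
    have rs: "(r [^]\<^bsub>sec W V\<^esub> (p ^ e)) \<odot>\<^bsub>msec L V\<^esub> s \<in> carrier (msec L V)" by (rule M.smult_closed[OF rq st(2)])
    show ?case
    proof (cases "V = {}")
      case True
      then show ?thesis using empty rs by (simp add: sm const)
    next
      case False
      note o = pre_open[OF st(1)]
      note p0 = pre_nonempty[OF st(1) False]
      note cr = comor_closed[OF st(1,3)]
      interpret c: ring_hom_cring "sec W V" "sec E (pre V)" "comor \<pi> V" by (rule comor_hom[OF st(1)])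
      have gK: "germ W W.\<eta> V r \<in> carrier W.K" by (rule W.emb_closed[OF st(1) False st(3)])
      note iK = val(1)[OF st(1,1,2)]
      have cq: "comor \<pi> V (r [^]\<^bsub>sec W V\<^esub> (p ^ e)) = comor \<pi> V r [^]\<^bsub>sec E (pre V)\<^esub> (p ^ e)" using st(3) by simp
      have "\<phi> (pre V) (germ E E.\<eta> (pre V) (comor \<pi> V r [^]\<^bsub>sec E (pre V)\<^esub> (p ^ e)) \<otimes>\<^bsub>E.K\<^esub> u V s)
          = germ E E.\<eta> (pre V) (comor \<pi> V r) \<otimes>\<^bsub>E.K\<^esub> \<phi> (pre V) (u V s)"
        using homE(3)[OF o E.open_points[OF o] cr, of "u V s"] u_closed[OF st(1,2)] p0
        by (simp add: sm const E.div_ops)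
      then have "pb (?i V ((r [^]\<^bsub>sec W V\<^esub> (p ^ e)) \<odot>\<^bsub>msec L V\<^esub> s)) = pb (germ W W.\<eta> V r \<otimes>\<^bsub>W.K\<^esub> ?i V s)"
        unfolding val(2)[OF st(1,1) rs] u_smult[OF st(1) False rq st(2)] cq pb.hom_mult[OF gK iK]
          val(2)[OF st(1,1,2)] pb_germ[OF st(1) False st(3)] .
      then have "?i V ((r [^]\<^bsub>sec W V\<^esub> (p ^ e)) \<odot>\<^bsub>msec L V\<^esub> s) = germ W W.\<eta> V r \<otimes>\<^bsub>W.K\<^esub> ?i V s"
        by (rule inj_onD[OF pb_inj _ val(1)[OF st(1,1) rs] W.K.m_closed[OF gK iK]])
      then show ?thesis using False by (simp add: sm const)
    qed
  next
    case (4 V V' s)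
    then have st: "open_in W V" "open_in W V'" "V' \<subseteq> V" "s \<in> carrier (msec L V)" by (simp_all add: sm)
    have sV: "mrst L V V' s \<in> carrier (msec L V')" by (rule L.m.rst_closed[OF st])
    show ?case
    proof (cases "V' = {}")
      case True
      then show ?thesis using empty sV by (simp add: sm const)
    next
      case False
      note o = pre_open[OF st(1)] pre_open[OF st(2)]
      have "\<phi> (pre V') (u V s) = \<phi> (pre V) (u V s)"
        using homE(4)[OF o E.open_points[OF o(1)] pre_mono[OF st(3)], of "u V s"] u_closed[OF st(1,4)]
          pre_nonempty[OF st(2) False] by (simp add: sm const E.div_ops)
      then have "pb (?i V' (mrst L V V' s)) = pb (?i V s)"
        unfolding val(2)[OF st(2,2) sV] u_rst[OF st(1-3) False st(4)] val(2)[OF st(1,1,4)] .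
      then have "?i V' (mrst L V V' s) = ?i V s"
        by (rule inj_onD[OF pb_inj _ val(1)[OF st(2,2) sV] val(1)[OF st(1,1,4)]])
      then show ?thesis using False by (simp add: sm const)
    qed
  qed
qed

end

text \<open>The data of both schemes side by side: \<open>B\<close> stands for
  \<open>K\<^sub>E + \<Delta>\<^sub>E\<close>, while \<open>KW\<close>, \<open>h\<close> and
  \<open>\<phi>\<close> determine the divisor on W.\<close>

locale descent_loc = pullback_loc E W \<pi> L M u + m: map_loc W p e KW h L \<phi>
  for E :: "('x, 'a) ringed_space" and W :: "('w, 'b) ringed_space"
    and \<pi> :: "('x, 'a, 'w, 'b) morphism" and L :: "('w, 'b, 'l) module_sheaf"
    and M u p e KW h \<phi> +
  fixes B :: "'x \<Rightarrow> rat"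
  assumes B_divisor: "Q_divisor E B" and M_eq: "M = (\<lambda>x. (1 - of_nat p ^ e) * B x)"
begin

lemma pt_closed: "x \<in> points E \<Longrightarrow> pt \<pi> x \<in> points W"
  using mor_cont unfolding continuous_map_def by blast

text \<open>A generator of O_E(M) has order \<open>- M x\<close>, and this sign turns the multiple
  \<open>1 - p^e\<close> of \<open>B\<close> into \<open>p^e - 1\<close>. At points that are not of
  codimension one both sides are zero by convention.\<close>

lemma u_generator:
  assumes g: "m.generator U l"
  shows "u U l \<in> E.Kx"
    and "x \<in> pre U \<Longrightarrow> of_nat (p ^ e - 1) * B x = principal_divisor E (u U l) x"
proof -
  note gU = m.generatorD(1-3)[OF g]
  have gen: "\<exists>r\<in>carrier (sec W V). s = r \<odot>\<^bsub>msec L V\<^esub> mrst L U V l"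
    if "open_in W V" "V \<subseteq> U" "s \<in> carrier (msec L V)" for V s
    by (rule m.generator_rep[OF g that]) (rule bexI)
  show "u U l \<in> E.Kx" by (rule u_generator_nonzero[OF gU gen])
  assume x: "x \<in> pre U"
  have q1: "rat_of_nat (p ^ e - 1) = of_nat p ^ e - 1" using m.q_ge_2 by (simp add: of_nat_diff)
  show "of_nat (p ^ e - 1) * B x = principal_divisor E (u U l) x"
  proof (cases "codim_one E x")
    case True
    have "rat_of_int (order_at E x (u U l)) = - M x" by (rule u_generator_order[OF gU gen x True])
    then show ?thesis using True unfolding principal_divisor_def q1 M_eq by (simp add: algebra_simps)
  next
    case False
    then have "B x = 0" using B_divisor unfolding Q_divisor_def by blast
    then show ?thesis using False unfolding principal_divisor_def by simp
  qed
qed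

lemma comparison_function:
  obtains f where "f \<in> E.Kx"
    "\<And>U l. m.generator U l \<Longrightarrow> u U l = f \<otimes>\<^bsub>E.K\<^esub> pb (m.rat_section U l)"
proof -
  obtain U0 l0 where g0: "m.generator U0 l0" by (rule m.generator_exists[OF W.gen_point])
  define h0 where "h0 = u U0 l0"
  define m0 where "m0 = m.rat_section U0 l0"
  have h0: "h0 \<in> E.Kx" unfolding h0_def by (rule u_generator(1)[OF g0])
  have m0: "m0 \<in> W.Kx" unfolding m0_def by (rule m.rat_section_nonzero[OF g0])
  note pm = pb_nonzero[OF m0]
  note i = E.K.nonzero_inv[OF pm]
  \<comment> \<open>The ratio for one fixed generator. Passing to another generator multiplies
    numerator and denominator by the same function \<open>pb k\<close>.\<close>
  define f where "f = h0 \<otimes>\<^bsub>E.K\<^esub> inv\<^bsub>E.K\<^esub> (pb m0)"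
  have f: "f \<in> E.Kx" unfolding f_def using h0 i(1) by (simp add: E.K.integral_iff)
  have "u U l = f \<otimes>\<^bsub>E.K\<^esub> pb (m.rat_section U l)" if g: "m.generator U l" for U l
  proof -
    let ?I = "U0 \<inter> U"
    note g0U = m.generatorD(1-3)[OF g0] and gU = m.generatorD(1-3)[OF g]
    have I: "open_in W ?I" "?I \<subseteq> U0" "?I \<subseteq> U" "?I \<noteq> {}"
      using g0U(1) gU(1) W.irreducible[OF g0U(1,2) gU(1,2)] by auto
    obtain c where c: "c \<in> carrier (sec W ?I)" "mrst L U ?I l = c \<odot>\<^bsub>msec L ?I\<^esub> mrst L U0 ?I l0"
      by (rule m.transition[OF g0 g])
    have lI: "mrst L U0 ?I l0 \<in> carrier (msec L ?I)" by (rule m.generator_rst[OF g0 I(1,2)])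
    define k where "k = germ W W.\<eta> ?I c"
    have k: "k \<in> carrier W.K" unfolding k_def by (rule W.emb_closed[OF I(1,4) c(1)])
    have pk: "pb k \<in> carrier E.K" using k by simp
    have "u U l = u ?I (mrst L U ?I l)" by (rule u_rst[OF gU(1) I(1,3,4) gU(3), symmetric])
    also have "\<dots> = pb k \<otimes>\<^bsub>E.K\<^esub> h0"
      unfolding c(2) u_smult[OF I(1,4) c(1) lI] u_rst[OF g0U(1) I(1,2,4) g0U(3)] h0_def k_def
        pb_germ[OF I(1,4) c(1)] ..
    also have "\<dots> = f \<otimes>\<^bsub>E.K\<^esub> (pb k \<otimes>\<^bsub>E.K\<^esub> pb m0)"
    proof -
      have "f \<otimes>\<^bsub>E.K\<^esub> (pb k \<otimes>\<^bsub>E.K\<^esub> pb m0) = (pb k \<otimes>\<^bsub>E.K\<^esub> h0) \<otimes>\<^bsub>E.K\<^esub> (pb m0 \<otimes>\<^bsub>E.K\<^esub> inv\<^bsub>E.K\<^esub> (pb m0))"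
        unfolding f_def using pk h0 pm i(1) by (simp add: E.K.m_ac)
      then show ?thesis using i pk h0 by simp
    qed
    also have "pb k \<otimes>\<^bsub>E.K\<^esub> pb m0 = pb (m.rat_section U l)"
      unfolding m.rat_section_change[OF g0 g c] k_def[symmetric] m0_def[symmetric]
      using k m0 by simp
    finally show ?thesis .
  qed
  then show ?thesis by (rule that[OF f])
qed

lemma descent:
  "\<exists>D. Q_Cartier_pullback E W \<pi> (\<lambda>w. KW w + m.divisor w) D \<and> Q_linearly_equivalent E B D"
proof -
  obtain f where f: "f \<in> E.Kx" and comp: "\<And>U l. m.generator U l \<Longrightarrow> u U l = f \<otimes>\<^bsub>E.K\<^esub> pb (m.rat_section U l)"
    by (rule comparison_function) blast
  define n where "n = p ^ e - 1"
  have n: "n > 0" "rat_of_nat n = of_nat p ^ e - 1" unfolding n_def using m.q_ge_2 by (simp_all add: of_nat_diff)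
  \<comment> \<open>\<open>D\<close> is built on E, by subtracting \<open>div(f)/n\<close> from
    \<open>B\<close>, so the linear equivalence holds by construction. What remains to be seen is
    that the pulled back functions \<open>pb (m.rat_section U l)\<close> are local equations of
    \<open>n D\<close>.\<close>
  define D where "D x = 1 * B x + (- 1 / of_nat n) * principal_divisor E f x" for x
  have QD: "Q_divisor E D" unfolding D_def by (rule E.Q_divisor_comb[OF B_divisor E.Q_divisor_principal[OF f]])
  have nD: "of_nat n * D x = of_nat n * B x - principal_divisor E f x" for x
    unfolding D_def using n(1) by (simp add: field_simps)
  have local: "of_nat n * D x = principal_divisor E (pb (m.rat_section U l)) x"
    if g: "m.generator U l" and x: "x \<in> pre U" for U l x
  proof -
    have "principal_divisor E (u U l) x = principal_divisor E f x + principal_divisor E (pb (m.rat_section U l)) x"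
      unfolding comp[OF g] principal_divisor_def
      using E.order_mult[OF _ f pb_nonzero[OF m.rat_section_nonzero[OF g]]] by simp
    then show ?thesis unfolding nD using u_generator(2)[OF g x] unfolding n_def by simp
  qed
  \<comment> \<open>Integrality can be tested over the preimages of trivialising sets, as these
    cover E; at points outside E the coefficients are zero.\<close>
  have Weil: "Weil_divisor E (\<lambda>x. of_nat n * C x)"
    if C: "Q_divisor E C" and int: "\<And>U l x. m.generator U l \<Longrightarrow> x \<in> pre U \<Longrightarrow> of_nat n * C x \<in> \<int>" for C
    unfolding Weil_divisor_def
  proof (intro conjI allI)
    show "Q_divisor E (\<lambda>x. of_nat n * C x)" using E.Q_divisor_comb[OF C C, of "of_nat n" 0] by simp
    fix x show "of_nat n * C x \<in> \<int>"
    proof (cases "x \<in> points E")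
      case True
      obtain U l where "m.generator U l" "pt \<pi> x \<in> U" by (rule m.generator_exists[OF pt_closed[OF True]])
      then show ?thesis using int[of U l x] True unfolding preim_def by blast
    next
      case False
      then have "C x = 0" using C E.codim_point unfolding Q_divisor_def by blast
      then show ?thesis by simp
    qed
  qed
  have princ_int: "principal_divisor E k x \<in> \<int>" for k x unfolding principal_divisor_def by simp
  have WB: "Weil_divisor E (\<lambda>x. of_nat n * B x)"
    by (rule Weil[OF B_divisor]) (simp add: u_generator(2)[folded n_def] princ_int)
  have WD: "Weil_divisor E (\<lambda>x. of_nat n * D x)" by (rule Weil[OF QD]) (simp add: local princ_int)
  have "Q_linearly_equivalent E B D" unfolding Q_linearly_equivalent_def nonzero_rational_def
    by (intro exI[of _ n] conjI n(1) WB WD bexI[OF _ f] allI) (simp add: nD)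
  moreover have "Q_Cartier_pullback E W \<pi> (\<lambda>w. KW w + m.divisor w) D"
    unfolding Q_Cartier_pullback_def
  proof (intro conjI QD exI[of _ n] n(1) ballI)
    show QW: "Q_divisor W (\<lambda>w. KW w + m.divisor w)"
      using W.Q_divisor_comb[OF m.Q_divisor_KX m.divisor_Q_divisor, of 1 1] by simp
    fix w assume w: "w \<in> points W"
    obtain U l where g: "m.generator U l" "w \<in> U" by (rule m.generator_exists[OF w])
    \<comment> \<open>Multiplying the formula of \<open>m.divisor_eq\<close> by
      \<open>n = p^e - 1\<close> leaves the order plus \<open>(1 - p^e) KW y\<close>, and the
      canonical terms cancel.\<close>
    have "of_nat n * (KW y + m.divisor y) = principal_divisor W (m.rat_section U l) y" if y: "y \<in> U" for y
    proof (cases "codim_one W y")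
      case True
      show ?thesis unfolding m.divisor_eq[OF g(1) y True] n(2) principal_divisor_def
        using True m.q_minus_one by (simp add: field_simps)
    next
      case False
      then have "KW y + m.divisor y = 0" using QW unfolding Q_divisor_def by blast
      then show ?thesis using False unfolding principal_divisor_def by simp
    qed
    then show "\<exists>U. open_in W U \<and> w \<in> U \<and> (\<exists>g\<in>nonzero_rational W.
           (\<forall>y \<in> U. of_nat n * (KW y + m.divisor y) = principal_divisor W g y) \<and>
           (\<forall>x \<in> pre U. of_nat n * D x = principal_divisor E (pb g) x))"
      unfolding nonzero_rational_def
      by (intro exI[of _ U] conjI bexI[OF _ m.rat_section_nonzero[OF g(1)]] ballI g(2) m.generatorD(1)[OF g(1)])
        (simp_all add: local[OF g(1)])
  qed
  ultimately show ?thesis by blast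
qed

end

lemma normal_F_finite_integral_frobenius_loc:
  assumes "Factorial_Ring.prime p" "e > 0" "normal_F_finite_integral TYPE('q \<times> 't) p X"
  shows "frobenius_loc X p e"
proof -
  have X: "excellent_scheme TYPE('t) X" "integral_scheme X" "normal_scheme X" "has_characteristic p X" "F_finite_scheme p X"
    using assms(3) unfolding normal_F_finite_integral_def by auto
  have "ringed_space X" using X(2) unfolding integral_scheme_def scheme_def locally_ringed_space_def by blast
  moreover have "noetherian_ring (sec X U)" if "affine_open X U" for U
    using X(1) that unfolding excellent_scheme_def excellent_ring_def by blast
  moreover have "integrally_closed_domain (stalk X x)" if "x \<in> points X" for x
    using X(3) that unfolding normal_scheme_def by blast
  ultimately show ?thesis using assms(1,2) X
    by (intro frobenius_loc.intro frobenius_loc_axioms.intro normal_loc.intro normal_loc_axioms.intro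
        integral_loc.intro integral_loc_axioms.intro ringed_space_loc.intro)
qed

text \<open>That the divisor is canonically determined is expressed by its uniqueness among the
  divisors of \<open>\<phi>\<^sub>W\<close>. \<open>Q_Cartier_pullback\<close> includes the
  assertion that \<open>K\<^sub>W + \<Delta>\<^sub>W\<close> is Q-Cartier, which is why the pullback
  appears as a divisor \<open>D\<close> whose existence is part of the claim.\<close>

theorem corollary5p4:
  fixes p e :: nat
    and E :: "('x, 'a) ringed_space" and W :: "('w, 'b) ringed_space"
    and \<pi> :: "('x, 'a, 'w, 'b) morphism"
    and L :: "('w, 'b, 'l) module_sheaf"
    and K\<^sub>E \<Delta>\<^sub>E :: "'x \<Rightarrow> rat" and K\<^sub>W :: "'w \<Rightarrow> rat"
    and u :: "'w set \<Rightarrow> 'l \<Rightarrow> ('x set \<times> 'a) set"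
    and \<phi>\<^sub>E :: "'x set \<Rightarrow> ('x set \<times> 'a) set \<Rightarrow> ('x set \<times> 'a) set"
  defines "N \<equiv> divisor_sheaf E (\<lambda>x. (1 - of_nat p ^ e) * (K\<^sub>E x + \<Delta>\<^sub>E x))"
    and "\<phi>\<^sub>W \<equiv> induced_map E W \<pi> u \<phi>\<^sub>E"
  assumes "Factorial_Ring.prime p" and "e > 0"
    and "normal_F_finite_integral TYPE('q \<times> 't) p E"
    and "normal_F_finite_integral TYPE('q \<times> 't) p W"
    and "proper_morphism TYPE('q \<times> 't) E W \<pi>" and "dominant_morphism E W \<pi>"
    and "\<And>V. open_in W V \<Longrightarrow>
           bij_betw (comor \<pi> V) (carrier (sec W V)) (carrier (sec E (preim E \<pi> V)))"
    and "canonical_divisor p E K\<^sub>E" and "canonical_divisor p W K\<^sub>W"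
    and "Q_divisor E \<Delta>\<^sub>E"
    and "line_bundle W L" and "pullback_iso E W \<pi> L N u"
    and "map_divisor E p e N \<phi>\<^sub>E \<Delta>\<^sub>E"
    and "\<And>U. open_in E U \<Longrightarrow>
           \<phi>\<^sub>E U ` inverse_image_sections E W \<pi> L N u U
             \<subseteq> fun_field_pullback E \<pi> ` carrier (fun_field W)"
    and "\<exists>V l. open_in W V \<and> l \<in> carrier (msec L V) \<and> \<phi>\<^sub>W V l \<noteq> \<zero>\<^bsub>fun_field W\<^esub>"
  shows "\<exists>\<Delta>\<^sub>W. map_divisor W p e L \<phi>\<^sub>W \<Delta>\<^sub>W \<and>
           (\<forall>\<Delta>. map_divisor W p e L \<phi>\<^sub>W \<Delta> \<longrightarrow> \<Delta> = \<Delta>\<^sub>W) \<and>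
           (\<exists>D. Q_Cartier_pullback E W \<pi> (\<lambda>w. K\<^sub>W w + \<Delta>\<^sub>W w) D \<and>
                Q_linearly_equivalent E (\<lambda>x. K\<^sub>E x + \<Delta>\<^sub>E x) D)"
proof -
  note N = assms(1) and \<phi>W = assms(2)
  define B where "B x = 1 * K\<^sub>E x + 1 * \<Delta>\<^sub>E x" for x
  define M where "M x = (1 - rat_of_nat p ^ e) * B x" for x
  have NM: "N = divisor_sheaf E M" unfolding N M_def B_def by simp
  have FW: "frobenius_loc W p e" by (rule normal_F_finite_integral_frobenius_loc[OF assms(3,4,6)])
  interpret E: frobenius_loc E p e by (rule normal_F_finite_integral_frobenius_loc[OF assms(3,4,5)])
  interpret W: frobenius_loc W p e by (rule FW)
  have mor: "ringed_morphism E W \<pi>" using assms(7) unfolding proper_morphism_def scheme_morphism_def by blast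
  interpret dominant_loc E W \<pi>
    by (intro dominant_loc.intro dominant_loc_axioms.intro mor assms(8) E.normal_loc_axioms W.normal_loc_axioms)
  obtain h where h: "duality_loc W p e K\<^sub>W h" by (rule canonical_divisor_duality[OF FW assms(11)])
  have KE: "Weil_divisor E K\<^sub>E" using assms(10) unfolding canonical_divisor_def by blast
  have BQ: "Q_divisor E B" unfolding B_def
    by (rule E.Q_divisor_comb[OF _ assms(12)]) (use KE in \<open>simp add: Weil_divisor_def\<close>)
  have MQ: "Q_divisor E M" using E.Q_divisor_comb[OF BQ BQ, of "1 - of_nat p ^ e" 0] unfolding M_def by simp
  \<comment> \<open>Although \<open>\<Delta>\<^sub>E\<close> has rational coefficients,
    \<open>(p^e - 1) \<Delta>\<^sub>E\<close> is integral: by the definition of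
    \<open>map_divisor\<close> it is a vanishing order minus \<open>p^e - 1\<close> times the order
    of \<open>g\<close>.\<close>
  have Mint: "M y \<in> \<int>" if y: "codim_one E y" for y
  proof -
    have md: "map_divisor E p e N \<phi>\<^sub>E \<Delta>\<^sub>E" by fact
    obtain U g where Ug: "y \<in> U" "\<forall>y \<in> U. codim_one E y \<longrightarrow>
           (\<exists>n. vanishing_order E p e N y
                 ((\<lambda>l. (germ E y U g [^]\<^bsub>stalk E y\<^esub> (p ^ e - 1)) \<odot>\<^bsub>mstalk E N y\<^esub> l) ` carrier (mstalk E N y))
                 (map_at_stalk \<phi>\<^sub>E) n \<and>
              \<Delta>\<^sub>E y = of_nat n / (of_nat p ^ e - 1) - of_int (order_at E y (to_fun_field E U g)))"
      using md[unfolded map_divisor_def, THEN conjunct2, THEN conjunct2, THEN conjunct2, rule_format, OF E.codim_point[OF y]]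
      by (elim exE conjE) (rule that)
    obtain n :: nat where n: "\<Delta>\<^sub>E y = of_nat n / (of_nat p ^ e - 1) - of_int (order_at E y (to_fun_field E U g))"
      using Ug(2)[rule_format, OF Ug(1) y] by (elim exE conjE) (rule that)
    have "rat_of_nat p ^ e - 1 \<noteq> 0"
      using E.q_ge_2 by (metis eq_iff_diff_eq_0 numeral_le_one_iff of_nat_1_eq_iff of_nat_power semiring_norm(69))
    then have "M y = (1 - of_nat p ^ e) * K\<^sub>E y - of_nat n + (of_nat p ^ e - 1) * of_int (order_at E y (to_fun_field E U g))"
      unfolding M_def B_def n by (simp add: field_simps)
    moreover have "K\<^sub>E y \<in> \<int>" using KE unfolding Weil_divisor_def by blast
    ultimately show ?thesis by simp
  qed
  interpret pullback_loc E W \<pi> L M u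
  proof (intro pullback_loc.intro pullback_loc_axioms.intro dominant_loc_axioms MQ Mint)
    show "module_presheaf W L" using sheaf_of_modules_presheaf[OF W.ringed] assms(13) unfolding line_bundle_def by blast
    show "pullback_iso E W \<pi> L (divisor_sheaf E M) u" using assms(14) unfolding NM .
  qed
  have \<phi>E: "module_sheaf_hom E (points E) (frobenius_push E p e (divisor_sheaf E M)) (constant_sheaf E) \<phi>\<^sub>E"
    using assms(15) unfolding map_divisor_def NM by (rule conjunct1)
  have \<phi>Wh: "module_sheaf_hom W (points W) (frobenius_push W p e L) (constant_sheaf W) \<phi>\<^sub>W"
    unfolding \<phi>W by (rule induced_map_hom[OF \<phi>E]) (rule assms(16)[unfolded NM])
  interpret map_loc W p e K\<^sub>W h L \<phi>\<^sub>W
    by (intro map_loc.intro map_loc_axioms.intro h assms(13) \<phi>Wh assms(17))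
  interpret descent_loc E W \<pi> L M u p e K\<^sub>W h \<phi>\<^sub>W B
    by (intro descent_loc.intro descent_loc_axioms.intro pullback_loc_axioms map_loc_axioms BQ) (simp add: M_def fun_eq_iff)
  have eq: "B = (\<lambda>x. K\<^sub>E x + \<Delta>\<^sub>E x)" unfolding B_def by simp
  show ?thesis
    by (intro exI[of _ divisor] conjI allI impI map_divisor_exists map_divisor_unique descent[unfolded eq])
qed

end
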